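(* Let $X$ be an irreducible locally finite $\mathrm{CAT}(0)$ polyhedral complex such that $A=\mathrm{Aut}(X)$ acts cocompactly and minimally on $X$. Let $n\ge 0$ be an integer and let $\Gamma$ be a uniform lattice in $\mathrm{Isom}(\mathbb{E}^n)\times A$. If $\Gamma$ is irreducible, then $H^1(\Gamma;\mathbb{Z})\cong H^1(X/\Gamma;\mathbb{Z})$.
   Context: A $\mathrm{CAT}(0)$ space $X$ is irreducible if it does not split as a direct product of two subspaces. A group acts minimally on $X$ if there is no invariant closed convex non-empty proper subspace of $X$. $\mathrm{Aut}(X)$ has the topology of uniform convergence on compacta, which makes it a locally compact group. $\mathbb{E}^n$ is Euclidean $n$-space. A lattice in a locally compact group $G$ is a discrete subgroup $\Gamma$ such that $G/\Gamma$ has finite Haar measure; it is uniform if $G/\Gamma$ is compact. $\Gamma$ acts on $X$ via its projection to $A$, and $X/\Gamma$ is the quotient space. Irreducibility of lattices: $\Gamma$ is (algebraically) irreducible if it has no finite index subgroup which splits as a direct product of two infinite groups; when $n=1$, $\Gamma$ is by convention never irreducible. *)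

theory Defs
  imports "HOL-Analysis.Analysis" "HOL-Homology.Homology" "HOL-Algebra.Group_Action" "HOL-Algebra.Left_Coset"
begin

section \<open>Metric geometry\<close>

definition geodesic_path :: "'a set \<Rightarrow> ('a \<Rightarrow> 'a \<Rightarrow> real) \<Rightarrow> (real \<Rightarrow> 'a) \<Rightarrow> 'a \<Rightarrow> 'a \<Rightarrow> bool" where
  "geodesic_path M d c x y \<longleftrightarrow>
     c ` {0..d x y} \<subseteq> M \<and> c 0 = x \<and> c (d x y) = y \<and>
     (\<forall>s\<in>{0..d x y}. \<forall>t\<in>{0..d x y}. d (c s) (c t) = \<bar>s - t\<bar>)"

definition geodesically_convex :: "'a set \<Rightarrow> ('a \<Rightarrow> 'a \<Rightarrow> real) \<Rightarrow> 'a set \<Rightarrow> bool" where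
  "geodesically_convex M d C \<longleftrightarrow>
     C \<subseteq> M \<and>
     (\<forall>x\<in>C. \<forall>y\<in>C. (\<exists>c. geodesic_path M d c x y) \<and>
        (\<forall>c. geodesic_path M d c x y \<longrightarrow> c ` {0..d x y} \<subseteq> C))"

text \<open>In the \<open>CAT(0)\<close> inequality, \<open>x\<close> is an arbitrary vertex of a geodesic triangle with
  comparison triangle \<open>x' y' z'\<close>, and the two points compared lie on the sides \<open>[x,y]\<close>, \<open>[x,z]\<close>.
  Permuting the vertices covers all pairs of sides; the third side does not enter.\<close>

definition cat0_space :: "'a set \<Rightarrow> ('a \<Rightarrow> 'a \<Rightarrow> real) \<Rightarrow> bool" where
  "cat0_space M d \<longleftrightarrow>
     Metric_space M d \<and> M \<noteq> {} \<and>
     (\<forall>x\<in>M. \<forall>y\<in>M. \<exists>c. geodesic_path M d c x y) \<and>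
     (\<forall>x\<in>M. \<forall>y\<in>M. \<forall>z\<in>M. \<forall>b c. \<forall>x' y' z' p' q' :: real^2. \<forall>s\<in>{0..d x y}. \<forall>t\<in>{0..d x z}.
        geodesic_path M d b x y \<longrightarrow> geodesic_path M d c x z \<longrightarrow>
        dist x' y' = d x y \<longrightarrow> dist x' z' = d x z \<longrightarrow> dist y' z' = d y z \<longrightarrow>
        p' \<in> closed_segment x' y' \<longrightarrow> dist x' p' = s \<longrightarrow>
        q' \<in> closed_segment x' z' \<longrightarrow> dist x' q' = t \<longrightarrow>
        d (b s) (c t) \<le> dist p' q')"

text \<open>\<open>prod_dist\<close> is the $\ell^2$ product metric; a factor consisting of one point is trivial.\<close>

definition irreducible_space :: "'a set \<Rightarrow> ('a \<Rightarrow> 'a \<Rightarrow> real) \<Rightarrow> bool" where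
  "irreducible_space M d \<longleftrightarrow>
     \<not> (\<exists>Y Z f. Y \<subseteq> M \<and> Z \<subseteq> M \<and> (\<nexists>y. Y \<subseteq> {y}) \<and> (\<nexists>z. Z \<subseteq> {z}) \<and>
          bij_betw f (Y \<times> Z) M \<and>
          (\<forall>p\<in>Y \<times> Z. \<forall>q\<in>Y \<times> Z. d (f p) (f q) = prod_dist d d p q))"

definition isometry_group :: "'a set \<Rightarrow> ('a \<Rightarrow> 'a \<Rightarrow> real) \<Rightarrow> ('a \<Rightarrow> 'a) monoid" where
  "isometry_group M d =
     (BijGroup M)\<lparr>carrier := {f \<in> Bij M. \<forall>x\<in>M. \<forall>y\<in>M. d (f x) (f y) = d x y}\<rparr>"

definition acts_cocompactly :: "('a \<Rightarrow> 'a) monoid \<Rightarrow> 'a set \<Rightarrow> ('a \<Rightarrow> 'a \<Rightarrow> real) \<Rightarrow> bool" where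
  "acts_cocompactly A M d \<longleftrightarrow>
     (\<exists>C. compactin (Metric_space.mtopology M d) C \<and> (\<Union>a\<in>carrier A. a ` C) = M)"

definition acts_minimally :: "('a \<Rightarrow> 'a) monoid \<Rightarrow> 'a set \<Rightarrow> ('a \<Rightarrow> 'a \<Rightarrow> real) \<Rightarrow> bool" where
  "acts_minimally A M d \<longleftrightarrow>
     \<not> (\<exists>C. closedin (Metric_space.mtopology M d) C \<and> geodesically_convex M d C \<and>
          C \<noteq> {} \<and> C \<noteq> M \<and> (\<forall>a\<in>carrier A. a ` C \<subseteq> C))"


section \<open>Polyhedral complexes\<close>

text \<open>The model space $M_\kappa^n$ of constant curvature $\kappa$ (Bridson and Haefliger,
  Chapter I.2), realised in finitely supported real sequences: Euclidean space has coordinates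
  \<open>0..<n\<close>, the sphere and the hyperboloid have coordinates \<open>0..n\<close>, and coordinate \<open>0\<close> is the
  timelike one of the hyperboloid.\<close>

definition model_space :: "real \<Rightarrow> nat \<Rightarrow> (nat \<Rightarrow> real) set" where
  "model_space \<kappa> n =
     (if \<kappa> = 0 then {x. \<forall>i\<ge>n. x i = 0}
      else if \<kappa> > 0 then {x. (\<forall>i>n. x i = 0) \<and> (\<Sum>i\<le>n. (x i)\<^sup>2) = 1}
      else {x. (\<forall>i>n. x i = 0) \<and> (\<Sum>i=1..n. (x i)\<^sup>2) - (x 0)\<^sup>2 = -1 \<and> x 0 > 0})"

definition model_dist :: "real \<Rightarrow> nat \<Rightarrow> (nat \<Rightarrow> real) \<Rightarrow> (nat \<Rightarrow> real) \<Rightarrow> real" where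
  "model_dist \<kappa> n x y =
     (if \<kappa> = 0 then sqrt (\<Sum>i<n. (x i - y i)\<^sup>2)
      else if \<kappa> > 0 then arccos (\<Sum>i\<le>n. x i * y i) / sqrt \<kappa>
      else arcosh (x 0 * y 0 - (\<Sum>i=1..n. x i * y i)) / sqrt (- \<kappa>))"

definition convex_cell :: "real \<Rightarrow> nat \<Rightarrow> (nat \<Rightarrow> real) set \<Rightarrow> bool" where
  "convex_cell \<kappa> n C \<longleftrightarrow>
     (\<exists>P. finite P \<and> P \<noteq> {} \<and> P \<subseteq> model_space \<kappa> n \<and>
        (\<kappa> > 0 \<longrightarrow> (\<exists>z\<in>model_space \<kappa> n. \<forall>x\<in>P. model_dist \<kappa> n z x < pi / sqrt \<kappa> / 2)) \<and>
        C = \<Inter>{D. geodesically_convex (model_space \<kappa> n) (model_dist \<kappa> n) D \<and> P \<subseteq> D})"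

text \<open>Hyperplanes of $M_\kappa^n$ are cut out by one equation \<open>(\<Sum>i\<le>n. b i * x i) = a\<close>, affine if
  $\kappa = 0$ and linear otherwise.  The degenerate equation \<open>0 = 0\<close> is allowed, so that a cell is
  a face of itself, and a plane (an intersection of hyperplanes) may be the whole space.\<close>

definition face_of_cell :: "real \<Rightarrow> nat \<Rightarrow> (nat \<Rightarrow> real) set \<Rightarrow> (nat \<Rightarrow> real) set \<Rightarrow> bool" where
  "face_of_cell \<kappa> n F C \<longleftrightarrow>
     F \<noteq> {} \<and>
     (\<exists>b a. (\<kappa> \<noteq> 0 \<longrightarrow> a = 0) \<and> (\<forall>x\<in>C. (\<Sum>i\<le>n. b i * x i) \<ge> a) \<and>
        F = {x\<in>C. (\<Sum>i\<le>n. b i * x i) = a})"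

definition plane_span :: "real \<Rightarrow> nat \<Rightarrow> (nat \<Rightarrow> real) set \<Rightarrow> (nat \<Rightarrow> real) set" where
  "plane_span \<kappa> n F =
     {y \<in> model_space \<kappa> n. \<forall>b a. (\<kappa> \<noteq> 0 \<longrightarrow> a = 0) \<longrightarrow>
        (\<forall>x\<in>F. (\<Sum>i\<le>n. b i * x i) = a) \<longrightarrow> (\<Sum>i\<le>n. b i * y i) = a}"

definition cell_interior :: "real \<Rightarrow> nat \<Rightarrow> (nat \<Rightarrow> real) set \<Rightarrow> (nat \<Rightarrow> real) set" where
  "cell_interior \<kappa> n F =
     {x\<in>F. \<exists>e>0. \<forall>y\<in>plane_span \<kappa> n F. model_dist \<kappa> n x y < e \<longrightarrow> y \<in> F}"

text \<open>Cells \<open>cell K l\<close> in $M_\kappa^{n_l}$ and their maps \<open>attach K l\<close> to the quotient of the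
  disjoint union of the cells; the equivalence relation is the one induced by these maps.\<close>

record ('i, 'a) cell_complex =
  curvature :: real
  cell_index :: "'i set"
  cell_dim :: "'i \<Rightarrow> nat"
  cell :: "'i \<Rightarrow> (nat \<Rightarrow> real) set"
  attach :: "'i \<Rightarrow> (nat \<Rightarrow> real) \<Rightarrow> 'a"

definition points :: "('i, 'a) cell_complex \<Rightarrow> 'a set" where
  "points K = (\<Union>l\<in>cell_index K. attach K l ` cell K l)"

abbreviation cell_dist :: "('i, 'a) cell_complex \<Rightarrow> 'i \<Rightarrow> (nat \<Rightarrow> real) \<Rightarrow> (nat \<Rightarrow> real) \<Rightarrow> real" where
  "cell_dist K l \<equiv> model_dist (curvature K) (cell_dim K l)"

abbreviation cell_face :: "('i, 'a) cell_complex \<Rightarrow> 'i \<Rightarrow> (nat \<Rightarrow> real) set \<Rightarrow> bool" where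
  "cell_face K l F \<equiv> face_of_cell (curvature K) (cell_dim K l) F (cell K l)"

abbreviation face_interior :: "('i, 'a) cell_complex \<Rightarrow> 'i \<Rightarrow> (nat \<Rightarrow> real) set \<Rightarrow> (nat \<Rightarrow> real) set" where
  "face_interior K l F \<equiv> cell_interior (curvature K) (cell_dim K l) F"

definition cells :: "('i, 'a) cell_complex \<Rightarrow> 'a set set" where
  "cells K = {attach K l ` F | l F. l \<in> cell_index K \<and> cell_face K l F}"

text \<open>\<open>piecewise_geodesic K x y r\<close>: some concatenation of finitely many geodesic segments, each in a
  cell, leads from \<open>x\<close> to \<open>y\<close> and has length \<open>r\<close>.\<close>

inductive piecewise_geodesic :: "('i, 'a) cell_complex \<Rightarrow> 'a \<Rightarrow> 'a \<Rightarrow> real \<Rightarrow> bool" for K where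
  refl: "x \<in> points K \<Longrightarrow> piecewise_geodesic K x x 0"
| step: "l \<in> cell_index K \<Longrightarrow> u \<in> cell K l \<Longrightarrow> v \<in> cell K l \<Longrightarrow>
    piecewise_geodesic K (attach K l v) y r \<Longrightarrow>
    piecewise_geodesic K (attach K l u) y (cell_dist K l u v + r)"

text \<open>The value \<open>0\<close> off the complex is needed because \<open>Metric_space\<close> asks for a function that is
  symmetric and nonnegative on the whole type.\<close>

definition path_dist :: "('i, 'a) cell_complex \<Rightarrow> 'a \<Rightarrow> 'a \<Rightarrow> real" where
  "path_dist K x y =
     (if x \<in> points K \<and> y \<in> points K then Inf {r. piecewise_geodesic K x y r} else 0)"

text \<open>$M_\kappa$-polyhedral complexes (Bridson and Haefliger, Definition I.7.37).  The last clause,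
  connectedness, makes \<open>path_dist\<close> finite.\<close>

definition polyhedral_complex :: "('i, 'a) cell_complex \<Rightarrow> bool" where
  "polyhedral_complex K \<longleftrightarrow>
     (\<forall>l\<in>cell_index K. convex_cell (curvature K) (cell_dim K l) (cell K l)) \<and>
     (\<forall>l\<in>cell_index K. \<forall>F. cell_face K l F \<longrightarrow> inj_on (attach K l) (face_interior K l F)) \<and>
     (\<forall>l\<in>cell_index K. \<forall>m\<in>cell_index K. \<forall>E F. \<forall>x\<in>face_interior K l E. \<forall>y\<in>face_interior K m F.
        cell_face K l E \<longrightarrow> cell_face K m F \<longrightarrow> attach K l x = attach K m y \<longrightarrow>
        (\<exists>h. bij_betw h E F \<and>
           (\<forall>u\<in>E. \<forall>v\<in>E. cell_dist K m (h u) (h v) = cell_dist K l u v) \<and>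
           (\<forall>u\<in>E. attach K l u = attach K m (h u)))) \<and>
     (\<forall>x\<in>points K. \<forall>y\<in>points K. \<exists>r. piecewise_geodesic K x y r)"

abbreviation complex_topology :: "('i, 'a) cell_complex \<Rightarrow> 'a topology" where
  "complex_topology K \<equiv> Metric_space.mtopology (points K) (path_dist K)"

definition locally_finite_complex :: "('i, 'a) cell_complex \<Rightarrow> bool" where
  "locally_finite_complex K \<longleftrightarrow>
     (\<forall>x\<in>points K. \<exists>U. openin (complex_topology K) U \<and> x \<in> U \<and> finite {c \<in> cells K. c \<inter> U \<noteq> {}})"

text \<open>The automorphisms are the isometries that permute the cells.\<close>

definition complex_aut :: "('i, 'a) cell_complex \<Rightarrow> ('a \<Rightarrow> 'a) monoid" where
  "complex_aut K =
     (isometry_group (points K) (path_dist K))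
       \<lparr>carrier := {f \<in> carrier (isometry_group (points K) (path_dist K)). (`) f ` cells K = cells K}\<rparr>"


section \<open>Lattices\<close>

definition uniform_compacta_topology ::
    "'a set \<Rightarrow> ('a \<Rightarrow> 'a \<Rightarrow> real) \<Rightarrow> ('a \<Rightarrow> 'a) set \<Rightarrow> ('a \<Rightarrow> 'a) topology" where
  "uniform_compacta_topology M d A =
     topology (\<lambda>U. U \<subseteq> A \<and>
       (\<forall>f\<in>U. \<exists>C e. compactin (Metric_space.mtopology M d) C \<and> e > 0 \<and>
          {g\<in>A. \<forall>x\<in>C. d (f x) (g x) < e} \<subseteq> U))"

lemma openin_uniform_compacta_topology:
  "openin (uniform_compacta_topology M d A) U \<longleftrightarrow>
     U \<subseteq> A \<and>
     (\<forall>f\<in>U. \<exists>C e. compactin (Metric_space.mtopology M d) C \<and> e > 0 \<and>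
        {g\<in>A. \<forall>x\<in>C. d (f x) (g x) < e} \<subseteq> U)"
proof -
  let ?N = "\<lambda>f C e. {g\<in>A. \<forall>x\<in>C. d (f x) (g x) < e}"
  let ?P = "\<lambda>U f. \<exists>C e. compactin (Metric_space.mtopology M d) C \<and> e > 0 \<and> ?N f C e \<subseteq> U"
  have "istopology (\<lambda>U. U \<subseteq> A \<and> (\<forall>f\<in>U. ?P U f))"
    unfolding istopology_def
  proof (intro conjI allI impI)
    fix S T assume S: "S \<subseteq> A \<and> (\<forall>f\<in>S. ?P S f)" and T: "T \<subseteq> A \<and> (\<forall>f\<in>T. ?P T f)"
    show "S \<inter> T \<subseteq> A" using S by blast
    show "\<forall>f\<in>S \<inter> T. ?P (S \<inter> T) f"
    proof
      fix f assume "f \<in> S \<inter> T"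
      then have "f \<in> S" "f \<in> T" by simp_all
      then have "?P S f" "?P T f" using S T by (simp_all only:)
      then obtain C e D k where
        "compactin (Metric_space.mtopology M d) C" "e > 0" "?N f C e \<subseteq> S"
        "compactin (Metric_space.mtopology M d) D" "k > 0" "?N f D k \<subseteq> T"
        by (elim exE conjE)
      moreover have "?N f (C \<union> D) (min e k) \<subseteq> ?N f C e \<inter> ?N f D k" by auto
      ultimately have "compactin (Metric_space.mtopology M d) (C \<union> D) \<and> min e k > 0 \<and>
          ?N f (C \<union> D) (min e k) \<subseteq> S \<inter> T"
        by (simp add: compactin_Un subset_iff)
      then show "?P (S \<inter> T) f" by (intro exI)
    qed
  next
    fix \<K> assume K: "\<forall>U\<in>\<K>. U \<subseteq> A \<and> (\<forall>f\<in>U. ?P U f)"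
    show "\<Union>\<K> \<subseteq> A" using K by blast
    show "\<forall>f\<in>\<Union>\<K>. ?P (\<Union>\<K>) f"
    proof
      fix f assume "f \<in> \<Union>\<K>"
      then obtain U where U: "U \<in> \<K>" "f \<in> U" by blast
      then have "?P U f" using K by (simp only:)
      then obtain C e where
        "compactin (Metric_space.mtopology M d) C" "e > 0" "?N f C e \<subseteq> U"
        by (elim exE conjE)
      moreover have "U \<subseteq> \<Union>\<K>" using U(1) by blast
      ultimately have "compactin (Metric_space.mtopology M d) C \<and> e > 0 \<and> ?N f C e \<subseteq> \<Union>\<K>"
        by (simp add: subset_iff)
      then show "?P (\<Union>\<K>) f" by (intro exI)
    qed
  qed
  then show ?thesis unfolding uniform_compacta_topology_def by (simp only: topology_inverse')
qed

definition quotient_topology :: "'a topology \<Rightarrow> ('a \<Rightarrow> 'b) \<Rightarrow> 'b topology" where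
  "quotient_topology T f = topology (\<lambda>U. U \<subseteq> f ` topspace T \<and> openin T {x \<in> topspace T. f x \<in> U})"

lemma openin_quotient_topology:
  "openin (quotient_topology T f) U \<longleftrightarrow>
     U \<subseteq> f ` topspace T \<and> openin T {x \<in> topspace T. f x \<in> U}"
proof -
  have "istopology (\<lambda>U. U \<subseteq> f ` topspace T \<and> openin T {x \<in> topspace T. f x \<in> U})"
    unfolding istopology_def
  proof (intro conjI allI impI)
    fix S R
    assume "S \<subseteq> f ` topspace T \<and> openin T {x \<in> topspace T. f x \<in> S}"
      and "R \<subseteq> f ` topspace T \<and> openin T {x \<in> topspace T. f x \<in> R}"
    moreover have "{x \<in> topspace T. f x \<in> S \<inter> R} =
        {x \<in> topspace T. f x \<in> S} \<inter> {x \<in> topspace T. f x \<in> R}" by auto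
    ultimately show "S \<inter> R \<subseteq> f ` topspace T" "openin T {x \<in> topspace T. f x \<in> S \<inter> R}" by auto
  next
    fix \<K> assume K: "\<forall>U\<in>\<K>. U \<subseteq> f ` topspace T \<and> openin T {x \<in> topspace T. f x \<in> U}"
    have "{x \<in> topspace T. f x \<in> \<Union>\<K>} = (\<Union>U\<in>\<K>. {x \<in> topspace T. f x \<in> U})" by auto
    then show "openin T {x \<in> topspace T. f x \<in> \<Union>\<K>}" using K by (simp add: openin_clauses)
    show "\<Union>\<K> \<subseteq> f ` topspace T" using K by blast
  qed
  then show ?thesis unfolding quotient_topology_def by (subst topology_inverse') auto
qed

lemma quotient_map_quotient_topology: "quotient_map T (quotient_topology T f) f"
proof -
  have "{x \<in> topspace T. f x \<in> f ` topspace T} = topspace T" by blast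
  then have "openin (quotient_topology T f) (f ` topspace T)"
    by (simp add: openin_quotient_topology)
  moreover have "topspace (quotient_topology T f) \<subseteq> f ` topspace T"
    using openin_quotient_topology[of T f] openin_topspace by blast
  ultimately have "topspace (quotient_topology T f) = f ` topspace T"
    by (simp add: openin_subset subset_antisym)
  then show ?thesis by (simp add: quotient_map_def openin_quotient_topology)
qed

definition coset_topology :: "('g, 'b) monoid_scheme \<Rightarrow> 'g topology \<Rightarrow> 'g set \<Rightarrow> 'g set topology" where
  "coset_topology G T \<Gamma> = quotient_topology T (\<lambda>g. g <#\<^bsub>G\<^esub> \<Gamma>)"

text \<open>Haar measure on \<open>G/\<Gamma>\<close>: a nonzero \<open>G\<close>-invariant Radon measure, unique up to scaling.\<close>

definition coset_haar_measure ::
    "('g, 'b) monoid_scheme \<Rightarrow> 'g topology \<Rightarrow> 'g set \<Rightarrow> 'g set measure \<Rightarrow> bool" where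
  "coset_haar_measure G T \<Gamma> \<mu> \<longleftrightarrow>
     (let Q = coset_topology G T \<Gamma> in
        space \<mu> = topspace Q \<and>
        sets \<mu> = sigma_sets (topspace Q) {U. openin Q U} \<and>
        emeasure \<mu> (space \<mu>) \<noteq> 0 \<and>
        (\<forall>g\<in>carrier G. \<forall>B\<in>sets \<mu>. emeasure \<mu> ((\<lambda>c. g <#\<^bsub>G\<^esub> c) ` B) = emeasure \<mu> B) \<and>
        (\<forall>C. compactin Q C \<longrightarrow> emeasure \<mu> C < \<infinity>) \<and>
        (\<forall>B\<in>sets \<mu>. emeasure \<mu> B = (INF U\<in>{U. openin Q U \<and> B \<subseteq> U}. emeasure \<mu> U)) \<and>
        (\<forall>U. openin Q U \<longrightarrow> emeasure \<mu> U = (SUP C\<in>{C. compactin Q C \<and> C \<subseteq> U}. emeasure \<mu> C)))"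

definition lattice_in :: "('g, 'b) monoid_scheme \<Rightarrow> 'g topology \<Rightarrow> 'g set \<Rightarrow> bool" where
  "lattice_in G T \<Gamma> \<longleftrightarrow>
     subgroup \<Gamma> G \<and> subtopology T \<Gamma> = discrete_topology \<Gamma> \<and>
     (\<exists>\<mu>. coset_haar_measure G T \<Gamma> \<mu> \<and> emeasure \<mu> (space \<mu>) < \<infinity>)"

definition uniform_lattice_in :: "('g, 'b) monoid_scheme \<Rightarrow> 'g topology \<Rightarrow> 'g set \<Rightarrow> bool" where
  "uniform_lattice_in G T \<Gamma> \<longleftrightarrow> lattice_in G T \<Gamma> \<and> compact_space (coset_topology G T \<Gamma>)"

definition virtually_splits :: "('g, 'b) monoid_scheme \<Rightarrow> bool" where
  "virtually_splits L \<longleftrightarrow>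
     (\<exists>H N P. subgroup H L \<and> finite (rcosets\<^bsub>L\<^esub> H) \<and>
        subgroup N L \<and> subgroup P L \<and> infinite N \<and> infinite P \<and>
        (\<lambda>(x, y). x \<otimes>\<^bsub>L\<^esub> y) \<in> iso (L\<lparr>carrier := N\<rparr> \<times>\<times> L\<lparr>carrier := P\<rparr>) (L\<lparr>carrier := H\<rparr>))"

text \<open>\<open>n\<close> is the dimension of the Euclidean factor; lattices with \<open>n = 1\<close> are reducible by
  convention.\<close>

definition irreducible_lattice :: "nat \<Rightarrow> ('g, 'b) monoid_scheme \<Rightarrow> bool" where
  "irreducible_lattice n L \<longleftrightarrow> n \<noteq> 1 \<and> \<not> virtually_splits L"

abbreviation euclidean_isometries :: "nat \<Rightarrow> ((nat \<Rightarrow> real) \<Rightarrow> nat \<Rightarrow> real) monoid" where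
  "euclidean_isometries n \<equiv> isometry_group (model_space 0 n) (model_dist 0 n)"

definition ambient_group ::
    "nat \<Rightarrow> ('i, 'a) cell_complex \<Rightarrow> (((nat \<Rightarrow> real) \<Rightarrow> nat \<Rightarrow> real) \<times> ('a \<Rightarrow> 'a)) monoid" where
  "ambient_group n K = euclidean_isometries n \<times>\<times> complex_aut K"

definition ambient_topology ::
    "nat \<Rightarrow> ('i, 'a) cell_complex \<Rightarrow> (((nat \<Rightarrow> real) \<Rightarrow> nat \<Rightarrow> real) \<times> ('a \<Rightarrow> 'a)) topology" where
  "ambient_topology n K =
     prod_topology
       (uniform_compacta_topology (model_space 0 n) (model_dist 0 n) (carrier (euclidean_isometries n)))
       (uniform_compacta_topology (points K) (path_dist K) (carrier (complex_aut K)))"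

text \<open>\<open>X/\<Gamma>\<close> as a space of orbits, with \<open>\<Gamma>\<close> acting through the second factor.\<close>

definition orbit_space ::
    "('i, 'a) cell_complex \<Rightarrow> ('c \<times> ('a \<Rightarrow> 'a), 'b) monoid_scheme \<Rightarrow> 'a set topology" where
  "orbit_space K L = quotient_topology (complex_topology K) (orbit L snd)"


section \<open>Cohomology with integer coefficients\<close>

definition cohomology_group ::
    "(nat \<Rightarrow> 'c monoid) \<Rightarrow> (nat \<Rightarrow> 'c \<Rightarrow> 'c) \<Rightarrow> nat \<Rightarrow> 'c set monoid" where
  "cohomology_group C \<delta> p =
     (C p)\<lparr>carrier := kernel (C p) (C (Suc p)) (\<delta> p)\<rparr>
       Mod (if p = 0 then {\<one>\<^bsub>C p\<^esub>} else \<delta> (p - 1) ` carrier (C (p - 1)))"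

definition singular_cochains :: "'a topology \<Rightarrow> nat \<Rightarrow> ('a chain \<Rightarrow> int) monoid" where
  "singular_cochains X p =
     (product_group (carrier (chain_group p X)) (\<lambda>_. integer_group))
       \<lparr>carrier := hom (chain_group p X) integer_group \<inter> extensional (carrier (chain_group p X))\<rparr>"

definition singular_coboundary :: "'a topology \<Rightarrow> nat \<Rightarrow> ('a chain \<Rightarrow> int) \<Rightarrow> 'a chain \<Rightarrow> int" where
  "singular_coboundary X p \<phi> =
     (\<lambda>c\<in>carrier (chain_group (Suc p) X). \<phi> (chain_boundary (Suc p) c))"

definition singular_cohomology :: "nat \<Rightarrow> 'a topology \<Rightarrow> ('a chain \<Rightarrow> int) set monoid" where
  "singular_cohomology p X = cohomology_group (singular_cochains X) (singular_coboundary X) p"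

text \<open>Group cohomology with trivial coefficients, by inhomogeneous cochains of the bar resolution.\<close>

definition bar_cochains :: "('g, 'b) monoid_scheme \<Rightarrow> nat \<Rightarrow> ('g list \<Rightarrow> int) monoid" where
  "bar_cochains L p =
     product_group {gs. length gs = p \<and> set gs \<subseteq> carrier L} (\<lambda>_. integer_group)"

definition bar_coboundary ::
    "('g, 'b) monoid_scheme \<Rightarrow> nat \<Rightarrow> ('g list \<Rightarrow> int) \<Rightarrow> 'g list \<Rightarrow> int" where
  "bar_coboundary L p f =
     (\<lambda>gs\<in>{gs. length gs = Suc p \<and> set gs \<subseteq> carrier L}.
        f (tl gs)
        + (\<Sum>i=1..p. (-1) ^ i * f (take (i - 1) gs @ [gs ! (i - 1) \<otimes>\<^bsub>L\<^esub> gs ! i] @ drop (i + 1) gs))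
        + (-1) ^ (p + 1) * f (butlast gs))"

definition group_cohomology :: "nat \<Rightarrow> ('g, 'b) monoid_scheme \<Rightarrow> ('g list \<Rightarrow> int) set monoid" where
  "group_cohomology p L = cohomology_group (bar_cochains L) (bar_coboundary L) p"

end

theory Submission
  imports Defs
begin

text \<open>Both cohomology groups are identified with $\mathrm{Hom}(\Gamma, \mathbb{Z})$.

  An automorphism that preserves a cell permutes its finitely many extreme points, so by local
  finiteness every orbit of $A$ in $X$ is discrete.  A singular 1-cocycle on $X/\Gamma$ becomes a
  coboundary on the contractible space $X$, and the periods of a potential form a homomorphism
  $\Gamma \to \mathbb{Z}$.  If the periods vanish, the potential descends and bounds the cocycle: a path
  in $X/\Gamma$ need not lift to $X$, but discreteness of orbits makes it a concatenation of paths in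
  contractible images of balls.
  Conversely $\varphi$ is the period homomorphism of a cocycle as soon as some continuous
  $g : X \to \mathbb{R}$ satisfies $g(\gamma x) = g(x) + \varphi(\gamma)$: lift $e^{2 \pi i g}$, which
  lives on $X/\Gamma$, along simplices and subtract a fixed choice of logarithm at the vertices.

  Irreducibility provides $g$.  Cocompactness yields a Lipschitz function on $\mathbb{E}^n \times X$
  that is equivariant for $\varphi$.  The Lasry--Lions regularisation commutes with isometries, and at
  growing scales it converges to an equivariant function of the form $w \cdot p + g(x)$.  If
  $w \neq 0$, then $n \ge 2$, all of $\Gamma$ commutes with the translations along $w$, and a
  pigeonhole argument turns them into a central element $c$ of $\Gamma$ with $\varphi(c) \neq 0$.  Then
  $\ker \varphi \times \langle c \rangle$ has finite index and infinite factors, a contradiction.\<close>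

section \<open>Convexity in the model spaces\<close>

text \<open>The action of \<Gamma> on the complex need not be proper: point stabilisers may be
  infinite and the orbit map need not be a covering. What survives is discreteness of orbits, which
  makes the contraction of a small ball along geodesics compatible with the orbit relation. An
  equivariant function on the product with Euclidean space is easy to write down as an infimum over
  the group. The difficulty is to remove its dependence on the Euclidean variable by operations that
  commute with arbitrary isometries. Second differences that tend to 0 under a fixed Lipschitz
  constant force a limit that is affine in that variable, and the Lipschitz bound also makes its
  linear part the same at all points of the complex. Equivariance then says that every element of
  \<Gamma> preserves the gradient w, hence commutes with the translations along w. The product
  decomposition needs an infinite kernel; it is produced by moving perpendicularly to w, which
  requires dimension at least 2. In dimension 1 the kernel may be finite, as for the integers acting
  on a line.\<close>

definition comb :: "real \<Rightarrow> (nat \<Rightarrow> real) \<Rightarrow> real \<Rightarrow> (nat \<Rightarrow> real) \<Rightarrow> nat \<Rightarrow> real" where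
  "comb a x b y = (\<lambda>i. a * x i + b * y i)"

lemma nonneg_eq_if_square_eq: "(a::real) * a = b * b \<Longrightarrow> a \<ge> 0 \<Longrightarrow> b \<ge> 0 \<Longrightarrow> a = b"
  using power2_eq_iff_nonneg[of a b] by (simp add: power2_eq_square)

text \<open>The minimum over \<open>t\<close> is attained at \<open>- B / D\<close>; for
  \<open>D = 0\<close> a nonzero \<open>B\<close> would make the affine polynomial negative
  somewhere.\<close>

lemma discriminant_le:
  fixes A B D :: real
  assumes "\<And>t. A + 2 * t * B + t * t * D \<ge> 0" "D \<ge> 0"
  shows "B\<^sup>2 \<le> A * D"
proof (cases "D = 0")
  case True
  have "B = 0"
  proof (rule ccontr)
    assume "B \<noteq> 0"
    then show False using assms(1)[of "- (A + 1) / (2 * B)"] True by (simp add: field_simps)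
  qed
  then show ?thesis using True by simp
next
  case False
  then have g: "D > 0" using assms(2) by simp
  have "A + 2 * (- B / D) * B + (- B / D) * (- B / D) * D \<ge> 0" by (rule assms(1))
  then have "A - B * B / D \<ge> 0" using g by (simp add: field_simps)
  then show ?thesis using g by (simp add: field_simps power2_eq_square)
qed

text \<open>Spherical geometry (\<open>\<sigma> = 1\<close>, \<open>C = cos\<close>, \<open>S = sin\<close>) and hyperbolic geometry (\<open>\<sigma> = -1\<close>,
  \<open>C = cosh\<close>, \<open>S = sinh\<close>) at once; \<open>I\<close> is the range of distances, and geodesics are unique for
  distances in \<open>I'\<close>.\<close>

locale curved_geometry =
  fixes F :: "(nat \<Rightarrow> real) \<Rightarrow> (nat \<Rightarrow> real) \<Rightarrow> real" and M :: "(nat \<Rightarrow> real) set"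
    and \<sigma> :: real and C S :: "real \<Rightarrow> real" and I I' :: "real set"
    and \<theta> :: "(nat \<Rightarrow> real) \<Rightarrow> (nat \<Rightarrow> real) \<Rightarrow> real"
  assumes sigma: "\<sigma> * \<sigma> = 1"
    and F_sym: "F x y = F y x"
    and F_lin: "F (comb a x b y) z = a * F x z + b * F y z"
    and F_one: "x \<in> M \<Longrightarrow> F x x = 1"
    and F_perp: "x \<in> M \<Longrightarrow> F u x = 0 \<Longrightarrow> \<sigma> * F u u \<ge> 0"
    and F_perp0: "x \<in> M \<Longrightarrow> y \<in> M \<Longrightarrow> z \<in> M \<Longrightarrow> u = comb a x 1 (comb b y c z) \<Longrightarrow> F u z = 0 \<Longrightarrow> F u u = 0 \<Longrightarrow> u = (\<lambda>_. 0)"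
    and M_cone: "x \<in> M \<Longrightarrow> y \<in> M \<Longrightarrow> a \<ge> 0 \<Longrightarrow> b \<ge> 0 \<Longrightarrow> F (comb a x b y) (comb a x b y) = 1 \<Longrightarrow> comb a x b y \<in> M"
    and C_add: "C (s + t) = C s * C t - \<sigma> * S s * S t"
    and S_add: "S (s + t) = S s * C t + C s * S t"
    and C_0: "C 0 = 1" and S_0: "S 0 = 0"
    and C_minus: "C (- s) = C s" and S_minus: "S (- s) = - S s"
    and I_nonneg: "s \<in> I \<Longrightarrow> s \<ge> 0 \<and> S s \<ge> 0"
    and I'_zero: "0 \<in> I'" and I'_sub: "I' \<subseteq> I" and I'_down: "t \<in> I' \<Longrightarrow> 0 \<le> s \<Longrightarrow> s \<le> t \<Longrightarrow> s \<in> I'"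
    and I'_pos: "s \<in> I' \<Longrightarrow> 0 < s \<Longrightarrow> S s > 0"
    and I_le: "s \<in> I \<Longrightarrow> t \<in> I \<Longrightarrow> r \<in> I \<Longrightarrow> \<sigma> * C r \<ge> \<sigma> * C (s + t) \<Longrightarrow> r \<le> s + t"
    and I_inj: "s \<in> I \<Longrightarrow> t \<in> I \<Longrightarrow> C s = C t \<Longrightarrow> s = t"
    and I'_eq: "s \<in> I \<Longrightarrow> t \<in> I \<Longrightarrow> D \<in> I' \<Longrightarrow> D > 0 \<Longrightarrow> C (s + t) = C D \<Longrightarrow> S (s + t) = S D \<Longrightarrow> s + t = D"
    and \<theta>_I: "x \<in> M \<Longrightarrow> y \<in> M \<Longrightarrow> \<theta> x y \<in> I"
    and \<theta>_C: "x \<in> M \<Longrightarrow> y \<in> M \<Longrightarrow> C (\<theta> x y) = F x y"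
begin

lemma F_lin2: "F z (comb a x b y) = a * F z x + b * F z y"
  using F_lin F_sym by metis

lemma CS: "C s * C s + \<sigma> * (S s * S s) = 1"
  using C_add[of s "- s"] by (simp add: C_minus S_minus C_0 algebra_simps)

text \<open>The equality case of Cauchy--Schwarz: the difference of the two vectors is orthogonal to
  \<open>z\<close> and isotropic. Writing the first vector as a combination of \<open>x\<close> and
  \<open>y\<close> keeps this difference in the span of three model points, where
  \<open>F_perp0\<close> applies.\<close>

lemma eq_if_F: assumes "x \<in> M" "z \<in> M" "y \<in> M" "F (comb a x b y) (comb a x b y) = 1" "F (comb a x b y) z = 1"
  shows "comb a x b y = z"
proof -
  let ?w = "comb a x b y"
  let ?u = "comb a x 1 (comb b y (-1) z)"
  have u: "?u = comb 1 ?w (-1) z" by (auto simp: comb_def algebra_simps)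
  have "F ?u z = 0" unfolding u F_lin[of 1] using assms(2,5) F_one by simp
  moreover have "F ?u ?u = 0" unfolding u F_lin[of 1] F_lin2[of _ 1] using assms(2,4,5) F_one F_sym[of z ?w] by simp
  ultimately have "?u = (\<lambda>_. 0)" using F_perp0[OF assms(1,3,2) HOL.refl] by blast
  then have "1 * comb a x b y i + (- 1) * z i = 0" for i unfolding u comb_def[of 1] by (rule fun_cong)
  then show ?thesis by (simp add: fun_eq_iff)
qed

lemma \<theta>_self: assumes "x \<in> M" shows "\<theta> x x = 0"
  using I_inj[OF \<theta>_I[OF assms assms], of 0] I'_zero I'_sub \<theta>_C[OF assms assms] F_one[OF assms] C_0 by auto

lemma \<theta>_zero: assumes "x \<in> M" "y \<in> M" "\<theta> x y = 0" shows "x = y"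
proof -
  have "F x y = 1" using \<theta>_C assms C_0 by metis
  then have "comb 1 x 0 x = y" using assms F_one F_lin F_lin2 by (intro eq_if_F[of x y x]) simp_all
  then show ?thesis by (simp add: comb_def)
qed

text \<open>On the orthogonal complement of \<open>y\<close> the form is semidefinite up to the sign
  \<open>\<sigma>\<close>, so the discriminant argument applies; the two factors
  \<open>\<sigma>\<close> cancel in the conclusion.\<close>

lemma perp_CS: assumes "y \<in> M" "F u y = 0" "F v y = 0" shows "(F u v)\<^sup>2 \<le> F u u * F v v"
proof -
  have pos: "\<sigma> * F u u + 2 * t * (\<sigma> * F u v) + t * t * (\<sigma> * F v v) \<ge> 0" for t
  proof -
    have "F (comb 1 u t v) y = 0" using F_lin assms by simp
    then have "\<sigma> * F (comb 1 u t v) (comb 1 u t v) \<ge> 0" using F_perp assms by blast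
    then show ?thesis unfolding F_lin F_lin2 by (simp add: F_sym[of v u] algebra_simps)
  qed
  have *: "(\<sigma> * F u v)\<^sup>2 \<le> (\<sigma> * F u u) * (\<sigma> * F v v)"
    using pos F_perp[OF assms(1,3)] by (rule discriminant_le)
  then show ?thesis
  proof -
    have "(\<sigma> * F u v)\<^sup>2 = (\<sigma> * \<sigma>) * (F u v)\<^sup>2" "(\<sigma> * F u u) * (\<sigma> * F v v) = (\<sigma> * \<sigma>) * (F u u * F v v)"
      by (simp_all add: power2_eq_square)
    with * show ?thesis unfolding sigma by simp
  qed
qed

lemma one_minus_C2: "1 - C s * C s = \<sigma> * (S s * S s)" using CS[of s] by simp

text \<open>Split off from \<open>x\<close> and \<open>z\<close> the components orthogonal to
  \<open>y\<close>. Their pairing is \<open>F x z - C a * C b\<close>, Cauchy--Schwarz bounds it by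
  \<open>S a * S b\<close>, and the addition formula for \<open>C (a + b)\<close> turns this into
  the claim.\<close>

lemma \<theta>_triangle: assumes "x \<in> M" "y \<in> M" "z \<in> M" shows "\<theta> x z \<le> \<theta> x y + \<theta> y z"
proof -
  define a b where "a = \<theta> x y" and "b = \<theta> y z"
  have xy: "F x y = C a" "F y x = C a" and yz: "F z y = C b" "F y z = C b"
    using \<theta>_C assms F_sym by (simp_all add: a_def b_def)
  have one: "F x x = 1" "F y y = 1" "F z z = 1" using F_one assms by auto
  define u v where "u = comb 1 x (- C a) y" and "v = comb 1 z (- C b) y"
  have uv: "F u v = F x z - C a * C b" unfolding u_def v_def F_lin F_lin2 by (simp add: xy yz one algebra_simps)
  have uu: "F u u = \<sigma> * (S a * S a)" unfolding u_def F_lin F_lin2 one_minus_C2[symmetric] by (simp add: xy yz one algebra_simps)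
  have vv: "F v v = \<sigma> * (S b * S b)" unfolding v_def F_lin F_lin2 one_minus_C2[symmetric] by (simp add: xy yz one algebra_simps)
  have "F u y = 0" "F v y = 0" unfolding u_def v_def F_lin by (simp_all add: xy yz one)
  then have "(F u v)\<^sup>2 \<le> F u u * F v v" using perp_CS assms by blast
  also have "\<dots> = (S a * S b)\<^sup>2"
  proof -
    have "F u u * F v v = (\<sigma> * \<sigma>) * (S a * S b)\<^sup>2" unfolding uu vv by (simp add: power2_eq_square)
    then show ?thesis unfolding sigma by simp
  qed
  finally have uv2: "(F u v)\<^sup>2 \<le> (S a * S b)\<^sup>2" .
  have "(\<sigma> * F u v)\<^sup>2 \<le> (S a * S b)\<^sup>2"
  proof -
    have "(\<sigma> * F u v)\<^sup>2 = (\<sigma> * \<sigma>) * (F u v)\<^sup>2" by (simp add: power2_eq_square)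
    with uv2 show ?thesis unfolding sigma by simp
  qed
  moreover have "S a \<ge> 0" "S b \<ge> 0" using I_nonneg \<theta>_I assms by (auto simp: a_def b_def)
  ultimately have "\<bar>\<sigma> * F u v\<bar> \<le> S a * S b" using abs_le_square_iff[of "\<sigma> * F u v" "S a * S b"] by simp
  then have "\<sigma> * (F x z - C a * C b) \<ge> - (S a * S b)" using uv by (simp add: abs_le_iff)
  moreover have "\<sigma> * C (a + b) = \<sigma> * (C a * C b) - S a * S b"
  proof -
    have "\<sigma> * C (a + b) = \<sigma> * (C a * C b) - (\<sigma> * \<sigma>) * (S a * S b)" unfolding C_add by (simp add: algebra_simps)
    then show ?thesis unfolding sigma by simp
  qed
  ultimately have "\<sigma> * C (\<theta> x z) \<ge> \<sigma> * C (a + b)" using \<theta>_C assms by (simp add: right_diff_distrib)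
  then show ?thesis using I_le \<theta>_I assms unfolding a_def b_def by blast
qed

text \<open>The sines of the two partial distances are \<open>b * S D\<close> and
  \<open>a * S D\<close>, and the normalisation of \<open>z\<close> turns the addition theorems into
  \<open>C (s + t) = C D\<close> and \<open>S (s + t) = S D\<close>.\<close>

lemma seg_imp_between:
  assumes "x \<in> M" "y \<in> M" "z \<in> M" "\<theta> x y \<in> I'" "z = comb a x b y" "a \<ge> 0" "b \<ge> 0"
  shows "\<theta> x z + \<theta> z y = \<theta> x y"
proof (cases "\<theta> x y = 0")
  case True
  then have "x = y" using \<theta>_zero assms by blast
  have "F z z = 1" using F_one assms by blast
  moreover have "F (comb a x b x) (comb a x b x) = (a + b) * (a + b)" unfolding F_lin F_lin2 by (simp add: F_one[OF assms(1)] algebra_simps)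
  moreover have "comb a x b x = z" unfolding assms(5) \<open>x = y\<close> ..
  ultimately have "(a + b) * (a + b) = 1" by simp
  then have "a + b = 1" using nonneg_eq_if_square_eq[of "a + b" 1] assms(6,7) by simp
  then have "z = x" using \<open>x = y\<close> assms(5) by (auto simp: comb_def fun_eq_iff simp flip: distrib_right)
  then show ?thesis using \<open>x = y\<close> \<theta>_self assms by simp
next
  case False
  define D where "D = \<theta> x y"
  have D: "D > 0" "D \<in> I'" using False assms I_nonneg I'_sub unfolding D_def by force+
  have xy: "F x y = C D" "F y x = C D" using \<theta>_C assms F_sym by (auto simp: D_def)
  have one: "F x x = 1" "F y y = 1" "F z z = 1" using F_one assms by auto
  have zz: "a * a + b * b + 2 * a * b * C D = 1" using one(3) unfolding assms(5) F_lin F_lin2 by (simp add: xy one algebra_simps)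
  define s t where "s = \<theta> x z" and "t = \<theta> z y"
  have st: "s \<in> I" "t \<in> I" using \<theta>_I assms by (auto simp: s_def t_def)
  have Cs: "C s = a + b * C D" using \<theta>_C[OF assms(1,3)] F_lin2[of x a x b y] unfolding s_def[symmetric] assms(5)[symmetric] by (simp add: xy one)
  have Ct: "C t = a * C D + b" using \<theta>_C[OF assms(3,2)] F_lin[of a x b y y] unfolding t_def[symmetric] assms(5)[symmetric] by (simp add: xy one)
  have sd: "S D > 0" using I'_pos D by auto
  have "\<sigma> * (S s * S s) = \<sigma> * ((b * S D) * (b * S D))"
  proof -
    have "\<sigma> * (S s * S s) = 1 - (a + b * C D) * (a + b * C D)" using one_minus_C2[of s] Cs by simp
    also have "\<dots> = b * b * (1 - C D * C D)" using zz by (simp add: algebra_simps)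
    finally show ?thesis using one_minus_C2[of D] by (simp add: algebra_simps)
  qed
  then have "S s * S s = (b * S D) * (b * S D)" using sigma by (metis mult_cancel_left mult_zero_left zero_neq_one)
  then have Ss: "S s = b * S D" using nonneg_eq_if_square_eq[of "S s" "b * S D"] I_nonneg[OF st(1)] sd assms(7) by simp
  have "\<sigma> * (S t * S t) = \<sigma> * ((a * S D) * (a * S D))"
  proof -
    have "\<sigma> * (S t * S t) = 1 - (a * C D + b) * (a * C D + b)" using one_minus_C2[of t] Ct by simp
    also have "\<dots> = a * a * (1 - C D * C D)" using zz by (simp add: algebra_simps)
    finally show ?thesis using one_minus_C2[of D] by (simp add: algebra_simps)
  qed
  then have "S t * S t = (a * S D) * (a * S D)" using sigma by (metis mult_cancel_left mult_zero_left zero_neq_one)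
  then have St: "S t = a * S D" using nonneg_eq_if_square_eq[of "S t" "a * S D"] I_nonneg[OF st(2)] sd assms(6) by simp
  have "C (s + t) = (a + b * C D) * (a * C D + b) - a * b * (\<sigma> * (S D * S D))"
    unfolding C_add Cs Ct Ss St by (simp add: algebra_simps)
  also have "\<dots> = C D * (a * a + b * b + 2 * a * b * C D)" unfolding one_minus_C2[symmetric] by (simp add: algebra_simps)
  finally have c: "C (s + t) = C D" using zz by simp
  have "S (s + t) = S D * (a * a + b * b + 2 * a * b * C D)" unfolding S_add Cs Ct Ss St by (simp add: algebra_simps)
  then have "S (s + t) = S D" using zz by simp
  then show ?thesis using I'_eq[OF st D(2,1) c] unfolding s_def t_def D_def by simp
qed

text \<open>The Gram computation behind \<open>F_geo\<close>: with \<open>C D\<close> the pairing of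
  the end points, the left side is the unnormalised pairing of the points at parameters
  \<open>s\<close> and \<open>t\<close> of the candidate geodesic.\<close>

lemma sin_sum_identity:
  "S (D - s) * S (D - t) + S s * S t + (S (D - s) * S t + S s * S (D - t)) * C D = S D * S D * C (s - t)"
proof -
  have m: "S (D - r) = S D * C r - C D * S r" for r using S_add[of D "- r"] by (simp add: C_minus S_minus)
  have c: "C (s - t) = C s * C t + \<sigma> * S s * S t" using C_add[of s "- t"] by (simp add: C_minus S_minus)
  have e: "\<sigma> * (S D * S D) = 1 - C D * C D" by (simp add: one_minus_C2)
  have "S D * S D * C (s - t) = S D * S D * (C s * C t) + (\<sigma> * (S D * S D)) * (S s * S t)" unfolding c by (simp add: algebra_simps)
  also have "\<dots> = S (D - s) * S (D - t) + S s * S t + (S (D - s) * S t + S s * S (D - t)) * C D"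
    unfolding e m by (simp add: algebra_simps)
  finally show ?thesis by simp
qed

text \<open>Spherical linear interpolation and its hyperbolic analogue.\<close>

definition geo :: "(nat \<Rightarrow> real) \<Rightarrow> (nat \<Rightarrow> real) \<Rightarrow> real \<Rightarrow> nat \<Rightarrow> real" where
  "geo x y t = comb (S (\<theta> x y - t) / S (\<theta> x y)) x (S t / S (\<theta> x y)) y"

lemma F_geo: assumes "x \<in> M" "y \<in> M" "\<theta> x y \<in> I'" "\<theta> x y > 0"
  shows "F (geo x y s) (geo x y t) = C (s - t)"
proof -
  define D where "D = \<theta> x y"
  have xy: "F x y = C D" "F y x = C D" using \<theta>_C assms F_sym by (auto simp: D_def)
  have one: "F x x = 1" "F y y = 1" using F_one assms by auto
  have sd: "S D > 0" using I'_pos assms by (auto simp: D_def)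
  have "F (geo x y s) (geo x y t) = (S (D - s) * S (D - t) + S s * S t + (S (D - s) * S t + S s * S (D - t)) * C D) / (S D * S D)"
    unfolding geo_def D_def[symmetric] F_lin F_lin2 using sd by (simp add: xy one field_simps)
  then show ?thesis unfolding sin_sum_identity using sd by simp
qed

lemma geo_coeff: assumes "x \<in> M" "y \<in> M" "\<theta> x y \<in> I'" "\<theta> x y > 0" "t \<in> {0..\<theta> x y}"
  shows "S (\<theta> x y - t) / S (\<theta> x y) \<ge> 0" "S t / S (\<theta> x y) \<ge> 0"
proof -
  have "t \<in> I" "\<theta> x y - t \<in> I" using I'_sub I'_down[OF assms(3), of t] I'_down[OF assms(3), of "\<theta> x y - t"] assms(5) by auto
  then show "S (\<theta> x y - t) / S (\<theta> x y) \<ge> 0" "S t / S (\<theta> x y) \<ge> 0"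
    using I'_pos[OF assms(3,4)] I_nonneg by (auto intro!: divide_nonneg_pos)
qed

lemma geo_M: assumes "x \<in> M" "y \<in> M" "\<theta> x y \<in> I'" "\<theta> x y > 0" "t \<in> {0..\<theta> x y}" shows "geo x y t \<in> M"
proof -
  have "F (geo x y t) (geo x y t) = 1" using F_geo[OF assms(1-4)] C_0 by simp
  then show ?thesis using M_cone[OF assms(1,2) geo_coeff[OF assms]] unfolding geo_def by blast
qed

lemma geo_dist: assumes "x \<in> M" "y \<in> M" "\<theta> x y \<in> I'" "\<theta> x y > 0" "s \<in> {0..\<theta> x y}" "t \<in> {0..\<theta> x y}"
  shows "\<theta> (geo x y s) (geo x y t) = \<bar>s - t\<bar>"
proof -
  have m: "geo x y s \<in> M" "geo x y t \<in> M" using geo_M assms by auto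
  have "C (\<theta> (geo x y s) (geo x y t)) = C (s - t)" using \<theta>_C[OF m] F_geo[OF assms(1-4)] by simp
  also have "\<dots> = C \<bar>s - t\<bar>" using C_minus[of "s - t"] by (auto simp: abs_if)
  finally have c: "C (\<theta> (geo x y s) (geo x y t)) = C \<bar>s - t\<bar>" .
  have "\<bar>s - t\<bar> \<le> \<theta> x y" using assms(5,6) by auto
  then have "\<bar>s - t\<bar> \<in> I" using I'_sub I'_down[OF assms(3), of "\<bar>s - t\<bar>"] by auto
  then show ?thesis using I_inj[OF \<theta>_I[OF m] _ c] by blast
qed

lemma geo_ends: assumes "x \<in> M" "y \<in> M" "\<theta> x y \<in> I'" "\<theta> x y > 0"
  shows "geo x y 0 = x" "geo x y (\<theta> x y) = y"
  using I'_pos[OF assms(3,4)] by (auto simp: geo_def comb_def S_0)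

text \<open>The addition formula for \<open>S\<close> makes the pairing of \<open>z\<close> with the
  point at parameter \<open>\<theta> x z\<close> equal to 1, which is the equality case treated in
  \<open>eq_if_F\<close>.\<close>

lemma between_imp_geo:
  assumes "x \<in> M" "y \<in> M" "z \<in> M" "\<theta> x y \<in> I'" "\<theta> x y > 0" "\<theta> x z + \<theta> z y = \<theta> x y"
  shows "z = geo x y (\<theta> x z)"
proof -
  define D t where "D = \<theta> x y" and "t = \<theta> x z"
  have sd: "S D > 0" using I'_pos assms by (auto simp: D_def)
  have "D - t = \<theta> z y" using assms(6) by (simp add: D_def t_def)
  then have xz: "F x z = C t" and yz: "F y z = C (D - t)" using \<theta>_C[OF assms(1,3)] \<theta>_C[OF assms(3,2)] F_sym[of y z]
    by (simp_all add: t_def)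
  have "F (geo x y t) z = (S (D - t) * C t + S t * C (D - t)) / S D"
    unfolding geo_def D_def[symmetric] F_lin xz yz by (simp add: add_divide_distrib)
  also have "\<dots> = 1" using S_add[of "D - t" t] sd by (simp add: mult.commute)
  finally have "F (geo x y t) z = 1" .
  moreover have "F (geo x y t) (geo x y t) = 1" using F_geo[OF assms(1,2,4,5)] C_0 by simp
  ultimately show ?thesis using eq_if_F[OF assms(1,3,2)] unfolding geo_def t_def by metis
qed

lemma between_comb:
  assumes "x \<in> M" "y \<in> M" "z \<in> M" "\<theta> x y \<in> I'" "\<theta> x z + \<theta> z y = \<theta> x y"
  shows "\<exists>a b. a \<ge> 0 \<and> b \<ge> 0 \<and> z = comb a x b y"
proof (cases "\<theta> x y = 0")
  case True
  then have "\<theta> x z = 0" using I_nonneg[OF \<theta>_I[OF assms(1,3)]] I_nonneg[OF \<theta>_I[OF assms(3,2)]] assms(5) by linarith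
  then have "z = comb 1 x 0 y" using \<theta>_zero assms by (auto simp: comb_def)
  then show ?thesis by (intro exI[of _ 1] exI[of _ 0]) simp
next
  case False
  then have p: "\<theta> x y > 0" using I_nonneg[OF \<theta>_I[OF assms(1,2)]] by linarith
  have t: "\<theta> x z \<in> {0..\<theta> x y}" using I_nonneg[OF \<theta>_I[OF assms(1,3)]] I_nonneg[OF \<theta>_I[OF assms(3,2)]] assms(5) by auto
  show ?thesis using geo_coeff[OF assms(1,2,4) p t] between_imp_geo[OF assms(1-4) p assms(5)] unfolding geo_def by blast
qed

lemma between_unique:
  assumes "x \<in> M" "y \<in> M" "z \<in> M" "z' \<in> M" "\<theta> x y \<in> I'" "\<theta> x z + \<theta> z y = \<theta> x y" "\<theta> x z' + \<theta> z' y = \<theta> x y" "\<theta> x z = \<theta> x z'"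
  shows "z = z'"
proof (cases "\<theta> x y = 0")
  case True
  then have "\<theta> x z = 0" using I_nonneg[OF \<theta>_I[OF assms(1,3)]] I_nonneg[OF \<theta>_I[OF assms(3,2)]] assms(6) by linarith
  then show ?thesis using \<theta>_zero assms by metis
next
  case False
  then have p: "\<theta> x y > 0" using I_nonneg[OF \<theta>_I[OF assms(1,2)]] by linarith
  show ?thesis using between_imp_geo[OF assms(1,2,3,5) p assms(6)] between_imp_geo[OF assms(1,2,4,5) p assms(7)] assms(8) by metis
qed

text \<open>The metric of curvature \<kappa> is the angle divided by \<open>k\<close>, so unit speed
  in \<open>d\<close> means speed \<open>k\<close> in the angle.\<close>

lemma scaled_geodesic:
  assumes "k > 0" "\<And>x y. d x y = \<theta> x y / k" "x \<in> M" "y \<in> M" "\<theta> x y \<in> I'"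
  shows "\<exists>c. geodesic_path M d c x y"
proof (cases "\<theta> x y = 0")
  case True
  then have "geodesic_path M d (\<lambda>_. x) x y" using \<theta>_zero[OF assms(3,4)] \<theta>_self assms by (auto simp: geodesic_path_def)
  then show ?thesis by blast
next
  case False
  then have p: "\<theta> x y > 0" using I_nonneg[OF \<theta>_I[OF assms(3,4)]] by linarith
  have r: "k * t \<in> {0..\<theta> x y}" if "t \<in> {0..d x y}" for t
    using that assms(1) unfolding assms(2) by (auto simp: field_simps)
  have "geodesic_path M d (\<lambda>t. geo x y (k * t)) x y"
    unfolding geodesic_path_def
  proof (intro conjI ballI)
    show "(\<lambda>t. geo x y (k * t)) ` {0..d x y} \<subseteq> M" using r geo_M[OF assms(3-5) p] by blast
    show "geo x y (k * 0) = x" "geo x y (k * d x y) = y" using geo_ends[OF assms(3-5) p] assms(1) unfolding assms(2) by simp_all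
    show "d (geo x y (k * s)) (geo x y (k * t)) = \<bar>s - t\<bar>" if "s \<in> {0..d x y}" "t \<in> {0..d x y}" for s t
    proof -
      have "k * s - k * t = k * (s - t)" by (simp add: right_diff_distrib)
      then show ?thesis using geo_dist[OF assms(3-5) p r[OF that(1)] r[OF that(2)]] assms(1) unfolding assms(2) by (simp add: abs_mult)
    qed
  qed
  then show ?thesis by blast
qed

end

section \<open>Homogeneous coordinates for all three kinds of curvature\<close>

text \<open>Euclidean space becomes the affine hyperplane where coordinate \<open>n\<close> is 1. In
  every curvature, hyperplanes are then zero sets of linear functionals \<open>lin n b\<close>, and
  geodesic hulls become cones.\<close>

definition lift :: "real \<Rightarrow> nat \<Rightarrow> (nat \<Rightarrow> real) \<Rightarrow> nat \<Rightarrow> real" where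
  "lift \<kappa> n x = (if \<kappa> = 0 then x(n := 1) else x)"

definition lin :: "nat \<Rightarrow> (nat \<Rightarrow> real) \<Rightarrow> (nat \<Rightarrow> real) \<Rightarrow> real" where
  "lin n b x = (\<Sum>i\<le>n. b i * x i)"

definition hyp :: "nat \<Rightarrow> (nat \<Rightarrow> real) \<Rightarrow> (nat \<Rightarrow> real) \<Rightarrow> real" where
  "hyp n x y = x 0 * y 0 - (\<Sum>i=1..n. x i * y i)"

text \<open>The lifted model space is the level 1 of this function, up to the conditions on support
  and on the sign of coordinate 0; it is linear in the flat case and quadratic otherwise.\<close>

definition qf :: "real \<Rightarrow> nat \<Rightarrow> (nat \<Rightarrow> real) \<Rightarrow> real" where
  "qf \<kappa> n w = (if \<kappa> = 0 then w n else if \<kappa> > 0 then lin n w w else hyp n w w)"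

lemma lin_comb: "lin n h (comb a x b y) = a * lin n h x + b * lin n h y"
  by (simp add: lin_def comb_def sum_distrib_left sum.distrib algebra_simps)

lemma lin_sym: "lin n x y = lin n y x"
  by (simp add: lin_def mult.commute)

lemma hyp_comb: "hyp n (comb a x b y) z = a * hyp n x z + b * hyp n y z"
  by (simp add: hyp_def comb_def sum_distrib_left sum.distrib algebra_simps)

lemma hyp_sym: "hyp n x y = hyp n y x"
  by (simp add: hyp_def mult.commute)

lemma lin_self_nonneg: "lin n u u \<ge> 0"
  by (simp add: lin_def sum_nonneg)

lemma lin_self_zero: "lin n u u = 0 \<Longrightarrow> i \<le> n \<Longrightarrow> u i = 0"
  unfolding lin_def by (subst (asm) sum_nonneg_eq_0_iff) auto

lemma model_pos: "\<kappa> > 0 \<Longrightarrow> x \<in> model_space \<kappa> n \<longleftrightarrow> (\<forall>i>n. x i = 0) \<and> lin n x x = 1"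
  by (simp add: model_space_def lin_def power2_eq_square)

lemma model_neg: "\<kappa> < 0 \<Longrightarrow> x \<in> model_space \<kappa> n \<longleftrightarrow> (\<forall>i>n. x i = 0) \<and> hyp n x x = 1 \<and> x 0 > 0"
  by (auto simp: model_space_def hyp_def power2_eq_square)

lemma model_zero: "x \<in> model_space 0 n \<longleftrightarrow> (\<forall>i\<ge>n. x i = 0)"
  by (simp add: model_space_def)

lemma hyp_CS: "(\<Sum>i=1..n. x i * y i)\<^sup>2 \<le> (x 0 * x 0 - hyp n x x) * (y 0 * y 0 - hyp n y y)"
  using Cauchy_Schwarz_ineq_sum[of x y "{1..n}"] by (simp add: hyp_def power2_eq_square)

lemma model_neg_ge1: assumes "\<kappa> < 0" "x \<in> model_space \<kappa> n" shows "x 0 \<ge> 1"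
proof -
  have "x 0 * x 0 = 1 + (\<Sum>i=1..n. x i * x i)" "x 0 > 0" using assms by (auto simp: model_neg hyp_def)
  then have "1 * 1 \<le> x 0 * x 0" by (simp add: sum_nonneg)
  then show ?thesis using \<open>x 0 > 0\<close> by (metis abs_1 abs_le_square_iff abs_of_pos power2_eq_square)
qed

text \<open>Reverse Cauchy--Schwarz: the spatial parts have squared lengths \<open>a * a - 1\<close>
  and \<open>b * b - 1\<close>, whose product is the square of \<open>a * b - 1\<close> minus the
  square of \<open>a - b\<close>.\<close>

lemma hyp_ge1: assumes "\<kappa> < 0" "x \<in> model_space \<kappa> n" "y \<in> model_space \<kappa> n" shows "hyp n x y \<ge> 1"
proof -
  define a b where "a = x 0" and "b = y 0"
  have ab: "a \<ge> 1" "b \<ge> 1" using model_neg_ge1 assms by (auto simp: a_def b_def)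
  then have "a * b \<ge> 1" using mult_mono[of 1 a 1 b] by simp
  have "(\<Sum>i=1..n. x i * y i)\<^sup>2 \<le> (a * a - 1) * (b * b - 1)" using hyp_CS[of x y n] assms by (simp add: model_neg a_def b_def)
  also have "\<dots> = (a * b - 1)\<^sup>2 - (a - b)\<^sup>2" by (simp add: power2_eq_square algebra_simps)
  also have "\<dots> \<le> (a * b - 1)\<^sup>2" by simp
  finally have "\<bar>\<Sum>i=1..n. x i * y i\<bar> \<le> \<bar>a * b - 1\<bar>" by (simp add: abs_le_square_iff)
  then show ?thesis using \<open>a * b \<ge> 1\<close> by (simp add: hyp_def a_def b_def)
qed

text \<open>A vector orthogonal to a timelike one is spacelike. The bound is quantitative, so that
  the Euclidean size of \<open>u\<close> is controlled by the form and by the time coordinate of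
  \<open>y\<close>.\<close>

lemma hyp_perp: assumes "\<kappa> < 0" "y \<in> model_space \<kappa> n" "hyp n u y = 0"
  shows "(\<Sum>i=1..n. u i * u i) \<le> - hyp n u u * (y 0 * y 0)"
proof -
  define A where "A = (\<Sum>i=1..n. u i * u i)"
  have "(\<Sum>i=1..n. u i * y i)\<^sup>2 \<le> A * (y 0 * y 0 - 1)"
  proof -
    have "A = u 0 * u 0 - hyp n u u" "y 0 * y 0 - 1 = y 0 * y 0 - hyp n y y" using assms by (simp_all add: model_neg A_def hyp_def)
    then show ?thesis using hyp_CS[of u y n] by metis
  qed
  moreover have "(\<Sum>i=1..n. u i * y i) = u 0 * y 0" using assms(3) by (simp add: hyp_def)
  ultimately have "u 0 * u 0 * (y 0 * y 0) \<le> A * (y 0 * y 0 - 1)" by (simp add: power2_eq_square algebra_simps)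
  then have "A \<le> - (u 0 * u 0 - A) * (y 0 * y 0)" by (simp add: algebra_simps)
  then show ?thesis by (simp add: hyp_def A_def)
qed

text \<open>The range of unique geodesics omits \<open>pi\<close>: antipodal points are joined by
  many geodesics, and \<open>sin\<close> vanishes there.\<close>

lemma spherical_geometry: assumes "\<kappa> > 0"
  shows "curved_geometry (lin n) (model_space \<kappa> n) 1 cos sin {0..pi} {0..<pi} (\<lambda>x y. arccos (lin n x y))"
proof
  have ab1: "\<bar>lin n x y\<bar> \<le> 1" if "x \<in> model_space \<kappa> n" "y \<in> model_space \<kappa> n" for x y
    using Cauchy_Schwarz_ineq_sum[of x y "{..n}"] that assms by (simp add: model_pos lin_def power2_eq_square[symmetric] abs_square_le_1)
  fix x y z u :: "nat \<Rightarrow> real" and a b c s t r D :: real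
  show "lin n x y = lin n y x" by (rule lin_sym)
  show "lin n (comb a x b y) z = a * lin n x z + b * lin n y z" by (metis lin_comb lin_sym)
  show "x \<in> model_space \<kappa> n \<Longrightarrow> lin n x x = 1" using assms by (simp add: model_pos)
  show "1 * lin n u u \<ge> 0" by (simp add: lin_self_nonneg)
  show "u = (\<lambda>_. 0)" if "x \<in> model_space \<kappa> n" "y \<in> model_space \<kappa> n" "z \<in> model_space \<kappa> n"
    "u = comb a x 1 (comb b y c z)" "lin n u u = 0"
  proof
    fix i show "u i = 0" using lin_self_zero[OF that(5), of i] that assms by (cases "i \<le> n") (auto simp: model_pos comb_def)
  qed
  show "comb a x b y \<in> model_space \<kappa> n" if "x \<in> model_space \<kappa> n" "y \<in> model_space \<kappa> n" "lin n (comb a x b y) (comb a x b y) = 1"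
    using that assms by (simp add: model_pos) (simp add: comb_def)
  show "cos (s + t) = cos s * cos t - 1 * sin s * sin t" by (simp add: cos_add)
  show "sin (s + t) = sin s * cos t + cos s * sin t" by (rule sin_add)
  show "s \<in> {0..pi} \<Longrightarrow> 0 \<le> s \<and> 0 \<le> sin s" by (simp add: sin_ge_zero)
  show "s \<in> {0..<pi} \<Longrightarrow> 0 < s \<Longrightarrow> 0 < sin s" by (simp add: sin_gt_zero)
  show "r \<le> s + t" if "s \<in> {0..pi}" "t \<in> {0..pi}" "r \<in> {0..pi}" "1 * cos (s + t) \<le> 1 * cos r"
    using that cos_monotone_0_pi[of "s + t" r] by (cases "s + t < r") auto
  show "s \<in> {0..pi} \<Longrightarrow> t \<in> {0..pi} \<Longrightarrow> cos s = cos t \<Longrightarrow> s = t" using cos_inj_pi by auto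
  show "s + t = D" if "s \<in> {0..pi}" "t \<in> {0..pi}" "D \<in> {0..<pi}" "0 < D" "cos (s + t) = cos D" "sin (s + t) = sin D"
  proof -
    have "sin D > 0" using that sin_gt_zero by auto
    then have "s + t \<le> pi" using sin_le_zero[of "s + t"] that by (cases "s + t = 2 * pi") force+
    then show ?thesis using that cos_inj_pi by auto
  qed
  show "arccos (lin n x y) \<in> {0..pi}" if "x \<in> model_space \<kappa> n" "y \<in> model_space \<kappa> n"
    using ab1[OF that] by (auto simp: abs_le_iff intro: arccos_lbound arccos_ubound)
  show "cos (arccos (lin n x y)) = lin n x y" if "x \<in> model_space \<kappa> n" "y \<in> model_space \<kappa> n"
    using ab1[OF that] by (simp add: cos_arccos_abs)
qed auto

lemma hyperbolic_geometry: assumes "\<kappa> < 0"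
  shows "curved_geometry (hyp n) (model_space \<kappa> n) (-1) cosh sinh {0..} {0..} (\<lambda>x y. arcosh (hyp n x y))"
proof
  fix x y z u :: "nat \<Rightarrow> real" and a b c s t r D :: real
  show "hyp n x y = hyp n y x" by (rule hyp_sym)
  show "hyp n (comb a x b y) z = a * hyp n x z + b * hyp n y z" by (rule hyp_comb)
  show "x \<in> model_space \<kappa> n \<Longrightarrow> hyp n x x = 1" using assms by (simp add: model_neg)
  have nn: "(\<Sum>i=1..n. v i * v i) \<ge> 0" for v :: "nat \<Rightarrow> real" by (simp add: sum_nonneg)
  show "- 1 * hyp n u u \<ge> 0" if x: "x \<in> model_space \<kappa> n" and "hyp n u x = 0"
  proof -
    have "- hyp n u u * (x 0 * x 0) \<ge> 0" using hyp_perp[OF assms that] nn[of u] by linarith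
    moreover have "x 0 * x 0 > 0" using x assms by (simp add: model_neg)
    ultimately have "- hyp n u u \<ge> 0" by (simp only: zero_le_mult_iff) linarith
    then show ?thesis by simp
  qed
  show "u = (\<lambda>_. 0)" if "x \<in> model_space \<kappa> n" "y \<in> model_space \<kappa> n" "z \<in> model_space \<kappa> n"
    "u = comb a x 1 (comb b y c z)" "hyp n u z = 0" "hyp n u u = 0"
  proof
    have A: "(\<Sum>i=1..n. u i * u i) = 0" using hyp_perp[OF assms that(3,5)] nn[of u] that(6) by simp
    then have u0: "u 0 = 0" using that(6) by (simp add: hyp_def)
    have "\<forall>i\<in>{1..n}. u i * u i = 0" using A by (subst (asm) sum_nonneg_eq_0_iff) auto
    then have ui: "u i = 0" if "i \<in> {1..n}" for i using that by simp
    fix i show "u i = 0"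
    proof (cases "i > n")
      case True then show ?thesis using that(1-4) assms by (simp add: model_neg comb_def)
    next
      case False then show ?thesis using u0 ui by (cases "i = 0") auto
    qed
  qed
  show "comb a x b y \<in> model_space \<kappa> n" if xy: "x \<in> model_space \<kappa> n" "y \<in> model_space \<kappa> n" and ab: "a \<ge> 0" "b \<ge> 0"
    and one: "hyp n (comb a x b y) (comb a x b y) = 1"
  proof -
    have "(comb a x b y) 0 * (comb a x b y) 0 = 1 + (\<Sum>i=1..n. (comb a x b y) i * (comb a x b y) i)" using one by (simp add: hyp_def)
    then have "(comb a x b y) 0 \<noteq> 0" using nn[of "comb a x b y"] by force
    moreover have "(comb a x b y) 0 \<ge> 0" using xy ab assms by (simp add: comb_def model_neg)
    ultimately show ?thesis using xy one assms by (simp add: model_neg) (simp add: comb_def)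
  qed
  show "cosh (s + t) = cosh s * cosh t - - 1 * sinh s * sinh t" by (simp add: cosh_add)
  show "sinh (s + t) = sinh s * cosh t + cosh s * sinh t" by (rule sinh_add)
  show "r \<le> s + t" if "s \<in> {0..}" "t \<in> {0..}" "r \<in> {0..}" "- 1 * cosh (s + t) \<le> - 1 * cosh r"
    using that by (simp add: cosh_real_nonneg_le_iff)
  show "arcosh (hyp n x y) \<in> {0..}" if "x \<in> model_space \<kappa> n" "y \<in> model_space \<kappa> n"
    using hyp_ge1[OF assms that] by simp
  show "cosh (arcosh (hyp n x y)) = hyp n x y" if "x \<in> model_space \<kappa> n" "y \<in> model_space \<kappa> n"
    using hyp_ge1[OF assms that] by simp
qed auto

section \<open>The metric of the model spaces and betweenness\<close>

lemma model_dist_pos: "\<kappa> > 0 \<Longrightarrow> model_dist \<kappa> n x y = arccos (lin n x y) / sqrt \<kappa>"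
  by (simp add: model_dist_def lin_def)

lemma model_dist_neg: "\<kappa> < 0 \<Longrightarrow> model_dist \<kappa> n x y = arcosh (hyp n x y) / sqrt (- \<kappa>)"
  by (simp add: model_dist_def hyp_def)

lemma model_dist_zero: "model_dist 0 n x y = L2_set (\<lambda>i. x i - y i) {..<n}"
  by (simp add: model_dist_def L2_set_def)

text \<open>At distance \<open>pi\<close> the point \<open>y\<close> would be the antipode of
  \<open>x\<close>, and no linear functional is positive on both.\<close>

lemma arccos_side: assumes "\<kappa> > 0" "x \<in> model_space \<kappa> n" "y \<in> model_space \<kappa> n" "lin n h x > 0" "lin n h y > 0"
  shows "arccos (lin n x y) \<in> {0..<pi}"
proof -
  interpret curved_geometry "lin n" "model_space \<kappa> n" 1 cos sin "{0..pi}" "{0..<pi}" "\<lambda>x y. arccos (lin n x y)"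
    by (rule spherical_geometry[OF assms(1)])
  have "arccos (lin n x y) \<noteq> pi"
  proof
    assume "arccos (lin n x y) = pi"
    then have e: "lin n x y = -1" using \<theta>_C[OF assms(2,3)] by simp
    have "comb (-1) x 0 x = y"
      by (rule eq_if_F[OF assms(2,3,2)]) (simp_all add: F_lin F_lin2 F_one[OF assms(2)] e)
    then have "lin n h y = - lin n h x" using lin_comb[of n h "-1" x 0 x] by simp
    then show False using assms(4,5) by linarith
  qed
  then show ?thesis using \<theta>_I[OF assms(2,3)] by auto
qed

lemma model_dist_sym: "x \<in> model_space \<kappa> n \<Longrightarrow> y \<in> model_space \<kappa> n \<Longrightarrow> model_dist \<kappa> n x y = model_dist \<kappa> n y x"
  by (cases "\<kappa> = 0"; cases "\<kappa> > 0")
    (simp_all add: model_dist_pos model_dist_neg model_dist_zero lin_sym[of n x] hyp_sym[of n x] L2_set_def power2_commute)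

lemma model_dist_nonneg: assumes "x \<in> model_space \<kappa> n" "y \<in> model_space \<kappa> n" shows "model_dist \<kappa> n x y \<ge> 0"
proof -
  consider "\<kappa> = 0" | "\<kappa> > 0" | "\<kappa> < 0" by linarith
  then show ?thesis
  proof cases
    case 2
    interpret curved_geometry "lin n" "model_space \<kappa> n" 1 cos sin "{0..pi}" "{0..<pi}" "\<lambda>x y. arccos (lin n x y)"
      by (rule spherical_geometry[OF 2])
    show ?thesis using \<theta>_I[OF assms] 2 by (simp add: model_dist_pos)
  next
    case 3 then show ?thesis using hyp_ge1[OF 3 assms] by (simp add: model_dist_neg)
  qed (simp add: model_dist_zero)
qed

lemma model_dist_self: assumes "x \<in> model_space \<kappa> n" shows "model_dist \<kappa> n x x = 0"
proof -
  consider "\<kappa> = 0" | "\<kappa> > 0" | "\<kappa> < 0" by linarith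
  then show ?thesis
    by cases (use assms in \<open>simp_all add: model_dist_pos model_dist_neg model_dist_zero L2_set_def model_pos model_neg\<close>)
qed

lemma model_dist_zero_imp: assumes "x \<in> model_space \<kappa> n" "y \<in> model_space \<kappa> n" "model_dist \<kappa> n x y = 0" shows "x = y"
proof -
  consider "\<kappa> = 0" | "\<kappa> > 0" | "\<kappa> < 0" by linarith
  then show ?thesis
  proof cases
    case 1
    have "x i = y i" for i using assms 1 by (cases "i < n") (auto simp: model_dist_zero L2_set_eq_0_iff model_zero)
    then show ?thesis by blast
  next
    case 2
    interpret curved_geometry "lin n" "model_space \<kappa> n" 1 cos sin "{0..pi}" "{0..<pi}" "\<lambda>x y. arccos (lin n x y)"
      by (rule spherical_geometry[OF 2])
    show ?thesis using \<theta>_zero[OF assms(1,2)] assms(3) 2 by (simp add: model_dist_pos)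
  next
    case 3
    interpret curved_geometry "hyp n" "model_space \<kappa> n" "-1" cosh sinh "{0..}" "{0..}" "\<lambda>x y. arcosh (hyp n x y)"
      by (rule hyperbolic_geometry[OF 3])
    show ?thesis using \<theta>_zero[OF assms(1,2)] assms(3) 3 by (simp add: model_dist_neg)
  qed
qed

lemma model_dist_triangle: assumes "x \<in> model_space \<kappa> n" "y \<in> model_space \<kappa> n" "z \<in> model_space \<kappa> n"
  shows "model_dist \<kappa> n x z \<le> model_dist \<kappa> n x y + model_dist \<kappa> n y z"
proof -
  consider "\<kappa> = 0" | "\<kappa> > 0" | "\<kappa> < 0" by linarith
  then show ?thesis
  proof cases
    case 1
    show ?thesis using L2_set_triangle_ineq[of "\<lambda>i. x i - y i" "\<lambda>i. y i - z i" "{..<n}"] unfolding 1 model_dist_zero by simp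
  next
    case 2
    interpret curved_geometry "lin n" "model_space \<kappa> n" 1 cos sin "{0..pi}" "{0..<pi}" "\<lambda>x y. arccos (lin n x y)"
      by (rule spherical_geometry[OF 2])
    show ?thesis using \<theta>_triangle[OF assms] 2 by (simp add: model_dist_pos divide_right_mono flip: add_divide_distrib)
  next
    case 3
    interpret curved_geometry "hyp n" "model_space \<kappa> n" "-1" cosh sinh "{0..}" "{0..}" "\<lambda>x y. arcosh (hyp n x y)"
      by (rule hyperbolic_geometry[OF 3])
    show ?thesis using \<theta>_triangle[OF assms] 3 by (simp add: model_dist_neg divide_right_mono flip: add_divide_distrib)
  qed
qed

text \<open>The value 0 off the model space is needed because \<open>Metric_space\<close> demands
  symmetry and nonnegativity on the whole type.\<close>

lemma model_Metric_space: "Metric_space (model_space \<kappa> n) (\<lambda>x y. if x \<in> model_space \<kappa> n \<and> y \<in> model_space \<kappa> n then model_dist \<kappa> n x y else 0)"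
  by unfold_locales (auto simp: model_dist_nonneg model_dist_self model_dist_triangle dest: model_dist_zero_imp model_dist_sym)

lemma L2_set_sq: "(L2_set f A)\<^sup>2 = (\<Sum>i\<in>A. (f i)\<^sup>2)"
  by (simp add: L2_set_def sum_nonneg)

text \<open>Equality in the triangle inequality: with \<open>p = z - x\<close> and
  \<open>q = y - x\<close>, the squared length of \<open>p - t * q\<close> vanishes when
  \<open>t\<close> is the ratio of the distances.\<close>

lemma euclid_between:
  assumes "model_dist 0 n x z + model_dist 0 n z y = model_dist 0 n x y" "i < n"
  shows "z i = x i + model_dist 0 n x z / model_dist 0 n x y * (y i - x i)"
proof -
  define D e where "D = model_dist 0 n x y" and "e = model_dist 0 n x z"
  define p q where "p i = z i - x i" and "q i = y i - x i" for i
  have zy: "model_dist 0 n z y = D - e" using assms by (simp add: D_def e_def)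
  have pp: "(\<Sum>i<n. (p i)\<^sup>2) = e\<^sup>2" unfolding e_def model_dist_zero L2_set_sq p_def by (simp add: power2_commute)
  have qq: "(\<Sum>i<n. (q i)\<^sup>2) = D\<^sup>2" unfolding D_def model_dist_zero L2_set_sq q_def by (simp add: power2_commute)
  have "(\<Sum>i<n. (p i - q i)\<^sup>2) = (D - e)\<^sup>2" unfolding zy[symmetric] model_dist_zero L2_set_sq p_def q_def by simp
  moreover have "(\<Sum>i<n. (p i - q i)\<^sup>2) = (\<Sum>i<n. (p i)\<^sup>2) - 2 * (\<Sum>i<n. p i * q i) + (\<Sum>i<n. (q i)\<^sup>2)"
    by (simp add: power2_diff sum.distrib sum_subtractf sum_distrib_left mult.assoc)
  ultimately have "e\<^sup>2 - 2 * (\<Sum>i<n. p i * q i) + D\<^sup>2 = (D - e)\<^sup>2" using pp qq by simp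
  also have "\<dots> = D\<^sup>2 - 2 * (e * D) + e\<^sup>2" by (simp add: power2_diff)
  finally have pq: "(\<Sum>i<n. p i * q i) = e * D" by simp
  define t where "t = e / D"
  have "(\<Sum>i<n. (p i - t * q i)\<^sup>2) = (\<Sum>i<n. (p i)\<^sup>2) - 2 * t * (\<Sum>i<n. p i * q i) + t\<^sup>2 * (\<Sum>i<n. (q i)\<^sup>2)"
    by (simp add: power2_diff sum.distrib sum_subtractf sum_distrib_left mult.assoc mult.left_commute power_mult_distrib)
  also have "\<dots> = 0"
  proof (cases "D = 0")
    case True
    have "e \<ge> 0" "model_dist 0 n z y \<ge> 0" by (simp_all add: e_def model_dist_zero)
    then have "e = 0" using zy True by simp
    then show ?thesis unfolding pp pq qq by (simp add: t_def)
  next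
    case False then show ?thesis unfolding pp pq qq t_def by (simp add: power2_eq_square field_simps)
  qed
  finally have "\<forall>i\<in>{..<n}. (p i - t * q i)\<^sup>2 = 0" by (subst (asm) sum_nonneg_eq_0_iff) auto
  then have "p i - t * q i = 0" using assms(2) by simp
  then show ?thesis by (simp add: p_def q_def t_def e_def D_def)
qed

lemma lift_supp: "x \<in> model_space \<kappa> n \<Longrightarrow> i > n \<Longrightarrow> lift \<kappa> n x i = 0"
  by (cases "\<kappa> = 0"; cases "\<kappa> > 0") (auto simp: lift_def model_zero model_pos model_neg)

lemma qf_lift: "x \<in> model_space \<kappa> n \<Longrightarrow> qf \<kappa> n (lift \<kappa> n x) = 1"
  by (cases "\<kappa> = 0"; cases "\<kappa> > 0") (auto simp: lift_def qf_def model_zero model_pos model_neg)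

lemma lift_0_pos: "x \<in> model_space \<kappa> n \<Longrightarrow> \<kappa> < 0 \<Longrightarrow> lift \<kappa> n x 0 > 0"
  by (auto simp: lift_def model_neg)

lemma unlift: assumes "\<And>i. i > n \<Longrightarrow> w i = 0" "qf \<kappa> n w = 1" "\<kappa> < 0 \<Longrightarrow> w 0 > 0"
  shows "\<exists>z\<in>model_space \<kappa> n. lift \<kappa> n z = w"
proof -
  consider "\<kappa> = 0" | "\<kappa> > 0" | "\<kappa> < 0" by linarith
  then show ?thesis
  proof cases
    case 1 then show ?thesis using assms(1,2) by (intro bexI[of _ "w(n := 0)"]) (auto simp: lift_def qf_def model_zero fun_eq_iff)
  next
    case 2 then show ?thesis using assms(1,2) by (intro bexI[of _ w]) (auto simp: lift_def qf_def model_pos)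
  next
    case 3 then show ?thesis using assms by (intro bexI[of _ w]) (auto simp: lift_def qf_def model_neg)
  qed
qed

lemma qf_scale: "qf \<kappa> n (\<lambda>i. r * w i) = (if \<kappa> = 0 then r else r\<^sup>2) * qf \<kappa> n w"
  by (simp add: qf_def lin_def hyp_def sum_distrib_left right_diff_distrib power2_eq_square mult_ac)

text \<open>The factor that brings a vector with positive \<open>qf\<close> to level 1; its form
  follows the degree of homogeneity of \<open>qf\<close>.\<close>

definition qnorm :: "real \<Rightarrow> nat \<Rightarrow> (nat \<Rightarrow> real) \<Rightarrow> real" where
  "qnorm \<kappa> n w = (if \<kappa> = 0 then 1 / qf \<kappa> n w else 1 / sqrt (qf \<kappa> n w))"

lemma normalize: assumes "\<And>i. i > n \<Longrightarrow> w i = 0" "qf \<kappa> n w > 0" "\<kappa> < 0 \<Longrightarrow> w 0 > 0"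
  shows "qnorm \<kappa> n w > 0 \<and> (\<exists>z\<in>model_space \<kappa> n. lift \<kappa> n z = (\<lambda>i. qnorm \<kappa> n w * w i))"
proof
  have "1 / qf \<kappa> n w > 0" "1 / sqrt (qf \<kappa> n w) > 0" using assms(2) by simp_all
  then show p: "qnorm \<kappa> n w > 0" unfolding qnorm_def by presburger
  show "\<exists>z\<in>model_space \<kappa> n. lift \<kappa> n z = (\<lambda>i. qnorm \<kappa> n w * w i)"
  proof (rule unlift)
    show "qf \<kappa> n (\<lambda>i. qnorm \<kappa> n w * w i) = 1"
    proof -
      have "1 / qf \<kappa> n w * qf \<kappa> n w = 1" "(1 / sqrt (qf \<kappa> n w))\<^sup>2 * qf \<kappa> n w = 1" using assms(2) by (simp_all add: power_divide)
      then show ?thesis unfolding qf_scale qnorm_def by (cases "\<kappa> = 0") (simp_all only: if_True if_False simp_thms)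
    qed
  qed (use assms p in auto)
qed

text \<open>The functional \<open>h\<close> witnesses that both points lie in one open half-space,
  which keeps the combination away from 0 on the sphere. On the hyperboloid the mixed term is
  nonnegative by \<open>hyp_ge1\<close>.\<close>

lemma cone_pos: assumes "x \<in> model_space \<kappa> n" "y \<in> model_space \<kappa> n" "lin n h (lift \<kappa> n x) > 0" "lin n h (lift \<kappa> n y) > 0"
    "a \<ge> 0" "b \<ge> 0" "a + b > 0"
  defines "w \<equiv> comb a (lift \<kappa> n x) b (lift \<kappa> n y)"
  shows "qf \<kappa> n w > 0" "\<kappa> < 0 \<Longrightarrow> w 0 > 0" "lin n h w > 0"
proof -
  have ab: "a > 0 \<or> b > 0" using assms(5-7) by linarith
  have pos: "a * r + b * s > 0" if "r > 0" "s > 0" for r s using ab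
  proof
    assume "a > 0" then show ?thesis using that assms(6) by (intro add_pos_nonneg) simp_all
  next
    assume "b > 0" then show ?thesis using that assms(5) by (intro add_nonneg_pos) simp_all
  qed
  show l: "lin n h w > 0" unfolding w_def lin_comb using pos[OF assms(3,4)] .
  show "\<kappa> < 0 \<Longrightarrow> w 0 > 0" unfolding w_def comb_def using pos lift_0_pos assms(1,2) by blast
  consider "\<kappa> = 0" | "\<kappa> > 0" | "\<kappa> < 0" by linarith
  then show "qf \<kappa> n w > 0"
  proof cases
    case 1 then show ?thesis using assms(7) by (simp add: qf_def w_def comb_def lift_def)
  next
    case 2
    have "lin n w w \<noteq> 0"
    proof
      assume "lin n w w = 0"
      then have "lin n h w = 0" unfolding lin_def[of n h] by (intro sum.neutral) (auto dest: lin_self_zero)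
      then show False using l by simp
    qed
    then show ?thesis using lin_self_nonneg[of n w] 2 by (simp add: qf_def)
  next
    case 3
    have e: "hyp n x x = 1" "hyp n y y = 1" "hyp n x y \<ge> 1" using assms(1,2) 3 hyp_ge1 by (auto simp: model_neg)
    have "hyp n w w = a * a + b * b + 2 * (a * b) * hyp n x y" using 3
      unfolding w_def lift_def by (simp add: hyp_comb hyp_sym[of n _ "comb _ _ _ _"] e hyp_sym[of n y x] algebra_simps)
    moreover have "2 * (a * b) * hyp n x y \<ge> 0" using assms(5,6) e(3) by simp
    moreover have "a * a + b * b > 0" using ab by (auto intro: add_pos_nonneg add_nonneg_pos)
    ultimately show ?thesis using 3 by (simp add: qf_def)
  qed
qed

lemma model_dist_geodesic:
  assumes "x \<in> model_space \<kappa> n" "y \<in> model_space \<kappa> n" "lin n h (lift \<kappa> n x) > 0" "lin n h (lift \<kappa> n y) > 0"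
  shows "\<exists>c. geodesic_path (model_space \<kappa> n) (model_dist \<kappa> n) c x y"
proof -
  consider "\<kappa> = 0" | "\<kappa> > 0" | "\<kappa> < 0" by linarith
  then show ?thesis
  proof cases
    case 1
    define D where "D = model_dist 0 n x y"
    \<comment> \<open>For \<open>D = 0\<close> the quotient is 0 and \<open>c\<close> is the
      constant path at \<open>x\<close>.\<close>
    define c where "c t = (\<lambda>i. x i + t / D * (y i - x i))" for t
    have D0: "D \<ge> 0" by (simp add: D_def model_dist_zero)
    have "geodesic_path (model_space 0 n) (model_dist 0 n) c x y" unfolding geodesic_path_def D_def[symmetric]
    proof (intro conjI ballI)
      show "c ` {0..D} \<subseteq> model_space 0 n" using assms(1,2) 1 by (auto simp: c_def model_zero)
      show "c 0 = x" by (simp add: c_def)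
      show "c D = y"
      proof (cases "D = 0")
        case True then show ?thesis using model_dist_zero_imp[of x 0 n y] assms(1,2) 1 by (simp add: c_def D_def)
      qed (simp add: c_def)
      fix s t assume st: "s \<in> {0..D}" "t \<in> {0..D}"
      have "model_dist 0 n (c s) (c t) = L2_set (\<lambda>i. \<bar>s - t\<bar> / D * \<bar>x i - y i\<bar>) {..<n}"
        unfolding model_dist_zero L2_set_def
        by (intro arg_cong[of _ _ sqrt] sum.cong) (simp_all add: c_def power_mult_distrib power_divide diff_divide_distrib flip: left_diff_distrib diff_divide_distrib,
          simp add: power2_commute[of "x _"])
      also have "\<dots> = \<bar>s - t\<bar> / D * L2_set (\<lambda>i. \<bar>x i - y i\<bar>) {..<n}" by (rule L2_set_right_distrib[symmetric]) (use D0 in simp)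
      also have "L2_set (\<lambda>i. \<bar>x i - y i\<bar>) {..<n} = D" by (simp add: D_def model_dist_zero L2_set_def)
      finally show "model_dist 0 n (c s) (c t) = \<bar>s - t\<bar>" using st by (cases "D = 0") auto
    qed
    then show ?thesis using 1 by blast
  next
    case 2
    interpret curved_geometry "lin n" "model_space \<kappa> n" 1 cos sin "{0..pi}" "{0..<pi}" "\<lambda>x y. arccos (lin n x y)"
      by (rule spherical_geometry[OF 2])
    show ?thesis using scaled_geodesic[of "sqrt \<kappa>" "model_dist \<kappa> n" x y] 2 assms(1,2) arccos_side[OF 2 assms(1,2)] assms(3,4)
      by (simp add: model_dist_pos lift_def)
  next
    case 3
    interpret curved_geometry "hyp n" "model_space \<kappa> n" "-1" cosh sinh "{0..}" "{0..}" "\<lambda>x y. arcosh (hyp n x y)"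
      by (rule hyperbolic_geometry[OF 3])
    show ?thesis using scaled_geodesic[of "sqrt (- \<kappa>)" "model_dist \<kappa> n" x y] 3 assms(1,2) \<theta>_I[OF assms(1,2)]
      by (simp add: model_dist_neg)
  qed
qed

lemma model_dist_seg:
  assumes "x \<in> model_space \<kappa> n" "y \<in> model_space \<kappa> n" "lin n h (lift \<kappa> n x) > 0" "lin n h (lift \<kappa> n y) > 0"
    and z: "z \<in> model_space \<kappa> n" "lift \<kappa> n z = comb a (lift \<kappa> n x) b (lift \<kappa> n y)" "a \<ge> 0" "b \<ge> 0"
  shows "model_dist \<kappa> n x z + model_dist \<kappa> n z y = model_dist \<kappa> n x y"
proof -
  consider "\<kappa> = 0" | "\<kappa> > 0" | "\<kappa> < 0" by linarith
  then show ?thesis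
  proof cases
    case 1
    have ab: "a + b = 1" using z(2) 1 by (auto simp: lift_def comb_def fun_eq_iff split: if_splits)
    have zi: "z i = a * x i + b * y i" if "i < n" for i
      using fun_cong[OF z(2), of i] 1 that by (simp add: lift_def comb_def)
    have e1: "x i - z i = b * (x i - y i)" "z i - y i = a * (x i - y i)" if "i < n" for i

    proof -
      have a: "a = 1 - b" using ab by simp
      show "x i - z i = b * (x i - y i)" "z i - y i = a * (x i - y i)" unfolding zi[OF that] a by (simp_all add: algebra_simps)
    qed
    have e2: "model_dist 0 n x z = L2_set (\<lambda>i. b * (x i - y i)) {..<n}" "model_dist 0 n z y = L2_set (\<lambda>i. a * (x i - y i)) {..<n}"
      unfolding model_dist_zero by (rule L2_set_cong, simp, simp add: e1)+
    then show ?thesis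
    proof -
      define L where "L = L2_set (\<lambda>i. x i - y i) {..<n}"
      have "model_dist 0 n x z = b * L" "model_dist 0 n z y = a * L"
        unfolding e2 L_def by (simp_all only: L2_set_right_distrib[OF z(3)] L2_set_right_distrib[OF z(4)])
      then have "model_dist 0 n x z + model_dist 0 n z y = (a + b) * L" by (simp add: algebra_simps)
      then show ?thesis unfolding ab 1 by (simp add: L_def model_dist_zero)
    qed
  next
    case 2
    interpret curved_geometry "lin n" "model_space \<kappa> n" 1 cos sin "{0..pi}" "{0..<pi}" "\<lambda>x y. arccos (lin n x y)"
      by (rule spherical_geometry[OF 2])
    show ?thesis using seg_imp_between[OF assms(1,2) z(1) arccos_side[OF 2 assms(1,2), of h] _ z(3,4)] 2 assms(3,4) z(2)
      by (simp add: model_dist_pos lift_def flip: add_divide_distrib)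
  next
    case 3
    interpret curved_geometry "hyp n" "model_space \<kappa> n" "-1" cosh sinh "{0..}" "{0..}" "\<lambda>x y. arcosh (hyp n x y)"
      by (rule hyperbolic_geometry[OF 3])
    show ?thesis using seg_imp_between[OF assms(1,2) z(1) \<theta>_I[OF assms(1,2)] _ z(3,4)] 3 z(2)
      by (simp add: model_dist_neg lift_def flip: add_divide_distrib)
  qed
qed

text \<open>Together with \<open>model_dist_seg\<close> this translates betweenness in the metric
  into positive combinations of lifts, which reduces geodesic convexity to linear algebra.\<close>

lemma model_dist_between:
  assumes "x \<in> model_space \<kappa> n" "y \<in> model_space \<kappa> n" "lin n h (lift \<kappa> n x) > 0" "lin n h (lift \<kappa> n y) > 0"
    and z: "z \<in> model_space \<kappa> n" "model_dist \<kappa> n x z + model_dist \<kappa> n z y = model_dist \<kappa> n x y"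
  shows "\<exists>a b. a \<ge> 0 \<and> b \<ge> 0 \<and> lift \<kappa> n z = comb a (lift \<kappa> n x) b (lift \<kappa> n y)"
proof -
  consider "\<kappa> = 0" | "\<kappa> > 0" | "\<kappa> < 0" by linarith
  then show ?thesis
  proof cases
    case 1
    define t where "t = model_dist 0 n x z / model_dist 0 n x y"
    have nn: "model_dist 0 n x z \<ge> 0" "model_dist 0 n z y \<ge> 0" by (simp_all add: model_dist_zero)
    then have "t \<ge> 0" "t \<le> 1" using z(2) unfolding t_def 1 by (auto simp: divide_le_eq_1)
    moreover have "lift 0 n z = comb (1 - t) (lift 0 n x) t (lift 0 n y)"
    proof
      fix i
      consider "i < n" | "i = n" | "i > n" by linarith
      then show "lift 0 n z i = comb (1 - t) (lift 0 n x) t (lift 0 n y) i"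
      proof cases
        case 1
        then have "z i = x i + t * (y i - x i)" using euclid_between[of n x z y i] z(2) \<open>\<kappa> = 0\<close> unfolding t_def by blast
        then show ?thesis using 1 by (simp add: lift_def comb_def algebra_simps)
      next
        case 2 then show ?thesis by (simp add: lift_def comb_def)
      next
        case 3 then show ?thesis using assms(1,2) z(1) \<open>\<kappa> = 0\<close> by (simp add: lift_def comb_def model_zero)
      qed
    qed
    ultimately show ?thesis unfolding 1 by (intro exI[of _ "1 - t"] exI[of _ t]) simp
  next
    case 2
    interpret curved_geometry "lin n" "model_space \<kappa> n" 1 cos sin "{0..pi}" "{0..<pi}" "\<lambda>x y. arccos (lin n x y)"
      by (rule spherical_geometry[OF 2])
    show ?thesis using between_comb[OF assms(1,2) z(1) arccos_side[OF 2 assms(1,2), of h]] 2 assms(3,4) z(2)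
      by (simp add: model_dist_pos lift_def flip: add_divide_distrib)
  next
    case 3
    interpret curved_geometry "hyp n" "model_space \<kappa> n" "-1" cosh sinh "{0..}" "{0..}" "\<lambda>x y. arcosh (hyp n x y)"
      by (rule hyperbolic_geometry[OF 3])
    show ?thesis using between_comb[OF assms(1,2) z(1) \<theta>_I[OF assms(1,2)]] 3 z(2)
      by (simp add: model_dist_neg lift_def flip: add_divide_distrib)
  qed
qed

lemma model_dist_between_unique:
  assumes "x \<in> model_space \<kappa> n" "y \<in> model_space \<kappa> n" "lin n h (lift \<kappa> n x) > 0" "lin n h (lift \<kappa> n y) > 0"
    and z: "z \<in> model_space \<kappa> n" "model_dist \<kappa> n x z + model_dist \<kappa> n z y = model_dist \<kappa> n x y"
    and z': "z' \<in> model_space \<kappa> n" "model_dist \<kappa> n x z' + model_dist \<kappa> n z' y = model_dist \<kappa> n x y"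
    and e: "model_dist \<kappa> n x z = model_dist \<kappa> n x z'"
  shows "z = z'"
proof -
  consider "\<kappa> = 0" | "\<kappa> > 0" | "\<kappa> < 0" by linarith
  then show ?thesis
  proof cases
    case 1
    show ?thesis
    proof
      fix i show "z i = z' i"
      proof (cases "i < n")
        case True then show ?thesis using euclid_between[of n x z y i] euclid_between[of n x z' y i] z z' e 1 by simp
      next
        case False then show ?thesis using z(1) z'(1) 1 by (simp add: model_zero)
      qed
    qed
  next
    case 2
    interpret curved_geometry "lin n" "model_space \<kappa> n" 1 cos sin "{0..pi}" "{0..<pi}" "\<lambda>x y. arccos (lin n x y)"
      by (rule spherical_geometry[OF 2])
    show ?thesis using between_unique[OF assms(1,2) z(1) z'(1) arccos_side[OF 2 assms(1,2), of h]] 2 assms(3,4) z(2) z'(2) e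
      by (simp add: model_dist_pos lift_def flip: add_divide_distrib)
  next
    case 3
    interpret curved_geometry "hyp n" "model_space \<kappa> n" "-1" cosh sinh "{0..}" "{0..}" "\<lambda>x y. arcosh (hyp n x y)"
      by (rule hyperbolic_geometry[OF 3])
    show ?thesis using between_unique[OF assms(1,2) z(1) z'(1) \<theta>_I[OF assms(1,2)]] 3 z(2) z'(2) e
      by (simp add: model_dist_neg lift_def flip: add_divide_distrib)
  qed
qed

section \<open>Comparison of the metric with coordinates\<close>

lemma cos_near_1: "e > 0 \<Longrightarrow> \<exists>d>0. \<forall>t. \<bar>t\<bar> < d \<longrightarrow> \<bar>cos t - 1\<bar> < (e::real)"
  using isCont_cos[of "0::real"] unfolding continuous_at_eps_delta by (auto simp: dist_real_def)

lemma coord_le_lin_self: "i \<le> n \<Longrightarrow> (u i)\<^sup>2 \<le> lin n u u"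
  unfolding lin_def by (subst power2_eq_square, rule member_le_sum) auto

text \<open>In the hyperbolic case the tangential part of \<open>y\<close> at \<open>v\<close> is a spacelike vector of length
  \<open>sinh \<theta>\<close>, whose Euclidean length is at most \<open>v 0 * sinh \<theta>\<close> by \<open>hyp_perp\<close>.\<close>

lemma model_dist_imp_coord:
  assumes v: "v \<in> model_space \<kappa> n" and "e > 0"
  shows "\<exists>d>0. \<forall>y\<in>model_space \<kappa> n. model_dist \<kappa> n v y < d \<longrightarrow> (\<forall>i\<le>n. \<bar>lift \<kappa> n y i - lift \<kappa> n v i\<bar> < e)"
proof -
  consider "\<kappa> = 0" | "\<kappa> > 0" | "\<kappa> < 0" by linarith
  then show ?thesis
  proof cases
    case 1
    have "\<bar>lift \<kappa> n y i - lift \<kappa> n v i\<bar> < e" if "model_dist \<kappa> n v y < e" "i \<le> n" for y i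
    proof (cases "i = n")
      case False
      then have "\<bar>v i - y i\<bar> \<le> L2_set (\<lambda>i. \<bar>v i - y i\<bar>) {..<n}" using that by (intro member_le_L2_set) auto
      also have "\<dots> = model_dist 0 n v y" by (simp add: model_dist_zero L2_set_def)
      finally show ?thesis using that False 1 by (simp add: lift_def)
    qed (use \<open>e > 0\<close> 1 in \<open>simp add: lift_def\<close>)
    then show ?thesis using \<open>e > 0\<close> by blast
  next
    case 2
    interpret curved_geometry "lin n" "model_space \<kappa> n" 1 cos sin "{0..pi}" "{0..<pi}" "\<lambda>x y. arccos (lin n x y)"
      by (rule spherical_geometry[OF 2])
    obtain d where d: "d > 0" "\<And>t. \<bar>t\<bar> < d \<Longrightarrow> \<bar>cos t - 1\<bar> < e\<^sup>2 / 2" using cos_near_1[of "e\<^sup>2 / 2"] \<open>e > 0\<close> by auto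
    have "\<bar>lift \<kappa> n y i - lift \<kappa> n v i\<bar> < e" if y: "y \<in> model_space \<kappa> n" "model_dist \<kappa> n v y < d / sqrt \<kappa>" "i \<le> n" for y i
    proof -
      have "arccos (lin n v y) < d" using y(2) 2 by (simp add: model_dist_pos divide_less_cancel)
      then have "\<bar>lin n v y - 1\<bar> < e\<^sup>2 / 2" using d(2)[of "arccos (lin n v y)"] \<theta>_C[OF v y(1)] \<theta>_I[OF v y(1)] by simp
      moreover have "lin n (comb 1 y (-1) v) (comb 1 y (-1) v) = 2 - 2 * lin n v y"
        using F_one[OF v] F_one[OF y(1)] by (simp add: F_lin F_lin2 F_sym[of y v])
      ultimately have "lin n (comb 1 y (-1) v) (comb 1 y (-1) v) < e\<^sup>2" by linarith
      then have "(y i - v i)\<^sup>2 < e\<^sup>2" using coord_le_lin_self[OF y(3), of "comb 1 y (-1) v"] by (simp add: comb_def)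
      then show ?thesis using 2 \<open>e > 0\<close> abs_le_square_iff[of e "y i - v i"] by (simp add: lift_def not_le[symmetric])
    qed
    moreover have "d / sqrt \<kappa> > 0" using d 2 by simp
    ultimately show ?thesis by blast
  next
    case 3
    interpret curved_geometry "hyp n" "model_space \<kappa> n" "-1" cosh sinh "{0..}" "{0..}" "\<lambda>x y. arcosh (hyp n x y)"
      by (rule hyperbolic_geometry[OF 3])
    define A where "A = (\<Sum>i\<le>n. \<bar>v i\<bar>)"
    \<comment> \<open>\<open>f\<close> bounds the change of a coordinate: its first term is for the
      part of \<open>y\<close> orthogonal to \<open>v\<close>, its second for the change of the
      component along \<open>v\<close>.\<close>
    define f where "f t = v 0 * sinh t + (cosh t - 1) * A" for t :: real
    have "isCont f 0" unfolding f_def by (intro continuous_intros)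
    moreover have "f 0 = 0" by (simp add: f_def)
    ultimately obtain d where d: "d > 0" "\<And>t. \<bar>t\<bar> < d \<Longrightarrow> \<bar>f t\<bar> < e" using \<open>e > 0\<close> unfolding continuous_at_eps_delta by (auto simp: dist_real_def)
    have v0: "v 0 > 0" using v 3 by (simp add: model_neg)
    have "\<bar>lift \<kappa> n y i - lift \<kappa> n v i\<bar> < e" if y: "y \<in> model_space \<kappa> n" "model_dist \<kappa> n v y < d / sqrt (- \<kappa>)" "i \<le> n" for y i
    proof -
      define t where "t = arcosh (hyp n v y)"
      have t: "t < d" "t \<ge> 0" "cosh t = hyp n v y" using y(2) 3 \<theta>_I[OF v y(1)] \<theta>_C[OF v y(1)] by (simp_all add: model_dist_neg divide_less_cancel t_def)
      define w where "w = comb 1 y (- cosh t) v"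
      have "hyp n w v = 0" unfolding w_def hyp_comb using F_one[OF v] t(3) hyp_sym[of n y v] by simp
      then have W: "(\<Sum>i=1..n. w i * w i) \<le> - hyp n w w * (v 0 * v 0)" by (rule hyp_perp[OF 3 v])
      have "hyp n w w = 1 - (cosh t)\<^sup>2" using F_one[OF v] F_one[OF y(1)] t(3) unfolding w_def F_lin F_lin2 by (simp add: hyp_sym[of n y v] power2_eq_square)
      then have hw: "hyp n w w = - (sinh t)\<^sup>2" by (simp add: cosh_square_eq)
      have le: "(w i)\<^sup>2 \<le> (v 0 * sinh t)\<^sup>2"
      proof (cases "i = 0")
        case True
        have "w 0 * w 0 \<le> (\<Sum>i=1..n. w i * w i)" using hw by (simp add: hyp_def) (smt (verit) zero_le_power2)
        then show ?thesis using W hw True by (simp add: power2_eq_square mult_ac)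
      next
        case False
        then have "w i * w i \<le> (\<Sum>i=1..n. w i * w i)" using y(3) by (intro member_le_sum[of i "{1..n}" "\<lambda>i. w i * w i"]) auto
        then show ?thesis using W hw by (simp add: power2_eq_square mult_ac)
      qed
      have wi: "\<bar>w i\<bar> \<le> v 0 * sinh t" using abs_le_square_iff[of "w i" "v 0 * sinh t"] le v0 t(2) by (simp add: abs_mult)
      have "y i - v i = w i + (cosh t - 1) * v i" by (simp add: w_def comb_def algebra_simps)
      then have "\<bar>y i - v i\<bar> \<le> \<bar>w i\<bar> + (cosh t - 1) * \<bar>v i\<bar>" using abs_triangle_ineq[of "w i" "(cosh t - 1) * v i"] cosh_real_ge_1[of t] by (simp add: abs_mult)
      also have "\<dots> \<le> f t" unfolding f_def A_def using wi y(3) cosh_real_ge_1[of t]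
        by (intro add_mono mult_left_mono member_le_sum[of i "{..n}" "\<lambda>i. \<bar>v i\<bar>"]) auto
      finally show ?thesis using d(2)[of t] t 3 by (simp add: lift_def)
    qed
    moreover have "d / sqrt (- \<kappa>) > 0" using d 3 by simp
    ultimately show ?thesis by blast
  qed
qed

text \<open>On the curved models the form at \<open>v\<close> and \<open>y\<close> is 1 plus its
  value at \<open>v\<close> and \<open>y - v\<close>, which is small with the coordinates;
  monotonicity of \<open>cos\<close> or \<open>cosh\<close> turns this into a bound on the
  distance.\<close>

lemma coord_imp_model_dist:
  assumes v: "v \<in> model_space \<kappa> n" and "e > 0"
  shows "\<exists>d>0. \<forall>y\<in>model_space \<kappa> n. (\<forall>i\<le>n. \<bar>lift \<kappa> n y i - lift \<kappa> n v i\<bar> < d) \<longrightarrow> model_dist \<kappa> n v y < e"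
proof -
  define A where "A = (\<Sum>i\<le>n. \<bar>v i\<bar>) + 1"
  have A: "A > 0" by (simp add: A_def sum_nonneg add_nonneg_pos)
  have dot: "\<bar>\<Sum>i\<in>I. v i * (y i - v i)\<bar> \<le> A * d" if "\<And>i. i \<le> n \<Longrightarrow> \<bar>y i - v i\<bar> < d" "I \<subseteq> {..n}" for y d I
  proof -
    have "d > 0" using that(1)[of 0] by linarith
    have "\<bar>\<Sum>i\<in>I. v i * (y i - v i)\<bar> \<le> (\<Sum>i\<in>I. \<bar>v i\<bar> * d)"
      using that by (intro order_trans[OF sum_abs] sum_mono) (auto simp: abs_mult subset_iff intro!: mult_left_mono intro: less_imp_le)
    also have "\<dots> \<le> (\<Sum>i\<le>n. \<bar>v i\<bar> * d)" using that \<open>d > 0\<close> by (intro sum_mono2) auto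
    also have "\<dots> \<le> A * d" using \<open>d > 0\<close> by (simp add: A_def distrib_right flip: sum_distrib_right)
    finally show ?thesis .
  qed
  consider "\<kappa> = 0" | "\<kappa> > 0" | "\<kappa> < 0" by linarith
  then show ?thesis
  proof cases
    case 1
    have "model_dist \<kappa> n v y < e" if "\<forall>i\<le>n. \<bar>lift \<kappa> n y i - lift \<kappa> n v i\<bar> < e / (real n + 1)" for y
    proof -
      have "model_dist \<kappa> n v y \<le> (\<Sum>i<n. \<bar>v i - y i\<bar>)" unfolding 1 model_dist_zero by (rule L2_set_le_sum_abs)
      also have "\<dots> \<le> (\<Sum>i<n. e / (real n + 1))"
      proof (rule sum_mono)
        fix i assume "i \<in> {..<n}"
        then show "\<bar>v i - y i\<bar> \<le> e / (real n + 1)" using that[rule_format, of i] 1 by (simp add: lift_def abs_minus_commute)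
      qed
      also have "\<dots> < e" using \<open>e > 0\<close> by (simp add: field_simps)
      finally show ?thesis .
    qed
    moreover have "e / (real n + 1) > 0" using \<open>e > 0\<close> by (simp add: add_nonneg_pos)
    ultimately show ?thesis by blast
  next
    case 2
    interpret curved_geometry "lin n" "model_space \<kappa> n" 1 cos sin "{0..pi}" "{0..<pi}" "\<lambda>x y. arccos (lin n x y)"
      by (rule spherical_geometry[OF 2])
    \<comment> \<open>The cap at \<open>pi\<close> keeps \<open>e'\<close> in the range where
      \<open>cos\<close> is monotone.\<close>
    define e' where "e' = min (e * sqrt \<kappa>) pi"
    have e': "0 < e'" "e' \<le> pi" "e' \<le> e * sqrt \<kappa>" using \<open>e > 0\<close> 2 by (auto simp: e'_def)
    have c: "cos e' < 1" using cos_monotone_0_pi[of 0 e'] e' by simp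
    define d where "d = (1 - cos e') / (2 * A)"
    have "model_dist \<kappa> n v y < e" if y: "y \<in> model_space \<kappa> n" "\<forall>i\<le>n. \<bar>lift \<kappa> n y i - lift \<kappa> n v i\<bar> < d" for y
    proof -
      have "\<bar>\<Sum>i\<le>n. v i * (y i - v i)\<bar> \<le> A * d" using y(2) 2 by (intro dot) (auto simp: lift_def)
      also have "\<dots> < 1 - cos e'" using A c by (simp add: d_def)
      finally have "\<bar>lin n v y - 1\<bar> < 1 - cos e'" using F_one[OF v] by (simp add: lin_def right_diff_distrib sum_subtractf)
      then have "cos e' < lin n v y" by linarith
      then have "cos e' < cos (arccos (lin n v y))" using \<theta>_C[OF v y(1)] by simp
      then have "arccos (lin n v y) < e'" using cos_monotone_0_pi_le[of e' "arccos (lin n v y)"] \<theta>_I[OF v y(1)] e' by (cases "e' \<le> arccos (lin n v y)") auto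
      then show ?thesis using e'(3) 2 by (simp add: model_dist_pos divide_less_eq)
    qed
    moreover have "d > 0" using A c by (simp add: d_def)
    ultimately show ?thesis by blast
  next
    case 3
    interpret curved_geometry "hyp n" "model_space \<kappa> n" "-1" cosh sinh "{0..}" "{0..}" "\<lambda>x y. arcosh (hyp n x y)"
      by (rule hyperbolic_geometry[OF 3])
    define e' where "e' = e * sqrt (- \<kappa>)"
    have e': "0 < e'" using \<open>e > 0\<close> 3 by (auto simp: e'_def)
    have c: "cosh e' > 1" using cosh_real_nonneg_less_iff[of 0 e'] e' by simp
    define d where "d = (cosh e' - 1) / (4 * A)"
    have "model_dist \<kappa> n v y < e" if y: "y \<in> model_space \<kappa> n" "\<forall>i\<le>n. \<bar>lift \<kappa> n y i - lift \<kappa> n v i\<bar> < d" for y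
    proof -
      have yd: "\<bar>y i - v i\<bar> < d" if "i \<le> n" for i using y(2) 3 that by (auto simp: lift_def)
      have "\<bar>\<Sum>i=1..n. v i * (y i - v i)\<bar> \<le> A * d" by (intro dot yd) auto
      moreover have "\<bar>\<Sum>i\<in>{0}. v i * (y i - v i)\<bar> \<le> A * d" by (intro dot yd) auto
      moreover have "2 * (A * d) < cosh e' - 1" using A c by (simp add: d_def)
      moreover have "hyp n v y = 1 + (\<Sum>i\<in>{0}. v i * (y i - v i)) - (\<Sum>i=1..n. v i * (y i - v i))"
        using F_one[OF v] by (simp add: hyp_def right_diff_distrib sum_subtractf)
      ultimately have "hyp n v y < cosh e'" by linarith
      then have "cosh (arcosh (hyp n v y)) < cosh e'" using \<theta>_C[OF v y(1)] by simp
      then have "arcosh (hyp n v y) < e'" using cosh_real_nonneg_less_iff[of "arcosh (hyp n v y)" e'] \<theta>_I[OF v y(1)] e' by simp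
      then show ?thesis using 3 by (simp add: model_dist_neg divide_less_eq e'_def)
    qed
    moreover have "d > 0" using A c by (simp add: d_def)
    ultimately show ?thesis by blast
  qed
qed

text \<open>At \<open>v\<close> the value of \<open>qf\<close> is 1, so the normalising factor tends
  to 1 and renormalised perturbations of the lift of \<open>v\<close> stay close to
  \<open>v\<close>.\<close>

lemma normalize_near:
  assumes v: "v \<in> model_space \<kappa> n" and "e > 0"
    and w: "\<And>i. i \<le> n \<Longrightarrow> ((\<lambda>s. w s i) \<longlongrightarrow> lift \<kappa> n v i) G" and supp: "\<And>s i. i > n \<Longrightarrow> w s i = 0"
  shows "\<forall>\<^sub>F s in G. \<exists>r>0. \<exists>z\<in>model_space \<kappa> n. lift \<kappa> n z = (\<lambda>i. r * w s i) \<and> model_dist \<kappa> n v z < e"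
proof -
  have q: "((\<lambda>s. qf \<kappa> n (w s)) \<longlongrightarrow> qf \<kappa> n (lift \<kappa> n v)) G"
    unfolding qf_def lin_def hyp_def using w by (auto intro!: tendsto_intros)
  then have q1: "((\<lambda>s. qf \<kappa> n (w s)) \<longlongrightarrow> 1) G" using qf_lift[OF v] by simp
  have r: "((\<lambda>s. qnorm \<kappa> n (w s)) \<longlongrightarrow> 1) G"
    using tendsto_divide[OF tendsto_const q1, of 1] tendsto_divide[OF tendsto_const tendsto_real_sqrt[OF q1], of 1]
    unfolding qnorm_def by (cases "\<kappa> = 0") simp_all
  obtain d where d: "d > 0" "\<And>y. y \<in> model_space \<kappa> n \<Longrightarrow> (\<forall>i\<le>n. \<bar>lift \<kappa> n y i - lift \<kappa> n v i\<bar> < d) \<Longrightarrow> model_dist \<kappa> n v y < e"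
    using coord_imp_model_dist[OF v \<open>e > 0\<close>] by blast
  have "((\<lambda>s. qnorm \<kappa> n (w s) * w s i) \<longlongrightarrow> 1 * lift \<kappa> n v i) G" if "i \<le> n" for i
    by (intro tendsto_intros r w that)
  then have "\<forall>\<^sub>F s in G. \<bar>qnorm \<kappa> n (w s) * w s i - lift \<kappa> n v i\<bar> < d" if "i \<le> n" for i
    using that d(1) by (auto simp: tendsto_iff dist_real_def)
  then have "\<forall>\<^sub>F s in G. \<forall>i\<in>{..n}. \<bar>qnorm \<kappa> n (w s) * w s i - lift \<kappa> n v i\<bar> < d"
    by (intro eventually_ball_finite) auto
  moreover have "\<forall>\<^sub>F s in G. qf \<kappa> n (w s) > 0" using order_tendstoD(1)[OF q1, of 0] by simp
  moreover have "\<forall>\<^sub>F s in G. \<kappa> < 0 \<longrightarrow> w s 0 > 0"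
    using order_tendstoD(1)[OF w[of 0], of 0] lift_0_pos[OF v] by (cases "\<kappa> < 0") auto
  ultimately show ?thesis
  proof eventually_elim
    case (elim s)
    then obtain z where "z \<in> model_space \<kappa> n" "lift \<kappa> n z = (\<lambda>i. qnorm \<kappa> n (w s) * w s i)" "qnorm \<kappa> n (w s) > 0"
      using normalize[of n "w s" \<kappa>] supp by auto
    then show ?case using d(2)[of z] elim by (intro exI[of _ "qnorm \<kappa> n (w s)"]) auto
  qed
qed

section \<open>Cells and their faces\<close>

lemma lin_uminus_left: "lin n (\<lambda>i. - b i) x = - lin n b x"
  by (simp add: lin_def sum_negf)

lemma lin_comb_left: "lin n (comb a b c d) x = a * lin n b x + c * lin n d x"
  by (simp add: lin_sym[of n _ x] lin_comb)

lemma lin_sum: "lin n b (\<lambda>i. \<Sum>j\<in>I. c j * v j i) = (\<Sum>j\<in>I. c j * lin n b (v j))"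
  unfolding lin_def sum_distrib_left by (subst sum.swap) (simp add: mult.left_commute)

text \<open>If the functional found for the old generators is negative on the new one, project along
  the new generator to the kernel of that functional and apply the induction hypothesis to the
  projections.\<close>

lemma farkas:
  assumes "finite I" "\<nexists>c. (\<forall>j\<in>I. c j \<ge> (0::real)) \<and> (\<forall>i\<le>n. y i = (\<Sum>j\<in>I. c j * v j i))"
  shows "\<exists>b. (\<forall>j\<in>I. lin n b (v j) \<ge> 0) \<and> lin n b y < 0"
  using assms
proof (induction I arbitrary: v y rule: finite_induct)
  case empty
  then obtain i where "i \<le> n" "y i \<noteq> 0" by auto
  then have "lin n y y > 0" using coord_le_lin_self[of i n y] by (smt (verit) zero_less_power2)
  then show ?case by (intro exI[of _ "\<lambda>i. - y i"]) (simp add: lin_uminus_left)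
next
  case (insert r I)
  have "\<nexists>c. (\<forall>j\<in>I. c j \<ge> 0) \<and> (\<forall>i\<le>n. y i = (\<Sum>j\<in>I. c j * v j i))"
  proof
    assume "\<exists>c. (\<forall>j\<in>I. c j \<ge> 0) \<and> (\<forall>i\<le>n. y i = (\<Sum>j\<in>I. c j * v j i))"
    then obtain c where c: "\<forall>j\<in>I. c j \<ge> 0" "\<forall>i\<le>n. y i = (\<Sum>j\<in>I. c j * v j i)" by blast
    have e: "(\<Sum>j\<in>insert r I. (c(r := 0)) j * v j i) = (\<Sum>j\<in>I. c j * v j i)" for i
      using insert(1,2) by (auto intro!: sum.cong)
    have "(\<forall>j\<in>insert r I. (c(r := 0)) j \<ge> 0) \<and> (\<forall>i\<le>n. y i = (\<Sum>j\<in>insert r I. (c(r := 0)) j * v j i))"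
      unfolding e using c by simp
    then show False using insert(4) by blast
  qed
  then obtain b where b: "\<And>j. j \<in> I \<Longrightarrow> lin n b (v j) \<ge> 0" "lin n b y < 0" using insert(3) by blast
  show ?case
  proof (cases "lin n b (v r) \<ge> 0")
    case True then show ?thesis using b by auto
  next
    case False
    define \<beta> where "\<beta> = - lin n b (v r)"
    have \<beta>: "\<beta> > 0" using False by (simp add: \<beta>_def)
    define proj where "proj x = comb \<beta> x (lin n b x) (v r)" for x
    have "\<nexists>c. (\<forall>j\<in>I. c j \<ge> 0) \<and> (\<forall>i\<le>n. proj y i = (\<Sum>j\<in>I. c j * proj (v j) i))"
    proof
      assume "\<exists>c. (\<forall>j\<in>I. c j \<ge> 0) \<and> (\<forall>i\<le>n. proj y i = (\<Sum>j\<in>I. c j * proj (v j) i))"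
      then obtain c where c: "\<And>j. j \<in> I \<Longrightarrow> c j \<ge> 0" "\<And>i. i \<le> n \<Longrightarrow> proj y i = (\<Sum>j\<in>I. c j * proj (v j) i)" by blast
      \<comment> \<open>The coefficient of the new generator, read off by \<open>b\<close>; it is
        nonnegative because \<open>b\<close> is nonnegative on the old generators and negative on
        \<open>y\<close>.\<close>
      define s where "s = ((\<Sum>j\<in>I. c j * lin n b (v j)) - lin n b y) / \<beta>"
      have "s \<ge> 0" unfolding s_def using \<beta> b c by (intro divide_nonneg_pos) (auto simp: sum_nonneg intro: order_trans[OF less_imp_le[of _ 0]])
      have "y i = (\<Sum>j\<in>insert r I. (c(r := s)) j * v j i)" if "i \<le> n" for i
      proof -
        have "\<beta> * y i + lin n b y * v r i = \<beta> * (\<Sum>j\<in>I. c j * v j i) + (\<Sum>j\<in>I. c j * lin n b (v j)) * v r i"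

        proof -
          have "(\<Sum>j\<in>I. c j * proj (v j) i) = (\<Sum>j\<in>I. \<beta> * (c j * v j i) + c j * lin n b (v j) * v r i)"
            by (simp add: proj_def comb_def algebra_simps)
          also have "\<dots> = \<beta> * (\<Sum>j\<in>I. c j * v j i) + (\<Sum>j\<in>I. c j * lin n b (v j)) * v r i"
            by (simp only: sum.distrib sum_distrib_left sum_distrib_right)
          finally show ?thesis using c(2)[OF that] by (simp add: proj_def comb_def)
        qed
        moreover have "\<beta> * s = (\<Sum>j\<in>I. c j * lin n b (v j)) - lin n b y" using \<beta> by (simp add: s_def)
        then have "\<beta> * (s * v r i) = (\<Sum>j\<in>I. c j * lin n b (v j)) * v r i - lin n b y * v r i"
          by (metis left_diff_distrib mult.assoc)
        ultimately have "\<beta> * y i = \<beta> * ((\<Sum>j\<in>I. c j * v j i) + s * v r i)" by (simp add: distrib_left)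
        then have "y i = (\<Sum>j\<in>I. c j * v j i) + s * v r i" using \<beta> by simp
        moreover have "(\<Sum>j\<in>I. c j * v j i) = (\<Sum>j\<in>I. (c(r := s)) j * v j i)" using insert(2) by (auto intro!: sum.cong)
        ultimately show ?thesis using insert(1,2) by simp
      qed
      moreover have "\<forall>j\<in>insert r I. (c(r := s)) j \<ge> 0" using c(1) \<open>s \<ge> 0\<close> by auto
      ultimately have "\<exists>c. (\<forall>j\<in>insert r I. c j \<ge> 0) \<and> (\<forall>i\<le>n. y i = (\<Sum>j\<in>insert r I. c j * v j i))"
        by (intro exI[of _ "c(r := s)"] conjI allI impI) simp_all
      then show False using insert(4) by contradiction
    qed
    from insert(3)[OF this] obtain b' where b': "\<And>j. j \<in> I \<Longrightarrow> lin n b' (proj (v j)) \<ge> 0" "lin n b' (proj y) < 0" by blast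
    \<comment> \<open>\<open>b''\<close> is \<open>b'\<close> composed with \<open>proj\<close>, so
      it vanishes on the new generator.\<close>
    define b'' where "b'' = comb \<beta> b' (lin n b' (v r)) b"
    have "lin n b'' x = lin n b' (proj x)" for x by (simp add: b''_def proj_def lin_comb_left lin_comb mult.commute)
    moreover have "proj (v r) = (\<lambda>_. 0)" by (simp add: proj_def comb_def \<beta>_def)
    ultimately show ?thesis using b' by (intro exI[of _ b'']) (auto simp: lin_def[of n b' "\<lambda>_. 0"])
  qed
qed

text \<open>A generator independent of the earlier ones has a functional that is 0 on them and 1 on
  it, and this functional reads off its coefficient with a bound; a dependent generator gets
  coefficient 0.\<close>

lemma span_bounded_coeffs:
  assumes "finite I"
  shows "\<exists>K\<ge>0. \<forall>y. (\<forall>b. (\<forall>j\<in>I. lin n b (v j) = 0) \<longrightarrow> lin n b y = 0) \<longrightarrow>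
    (\<exists>d. (\<forall>i\<le>n. y i = (\<Sum>j\<in>I. d j * v j i)) \<and> (\<forall>j\<in>I. \<bar>d j\<bar> \<le> K * (\<Sum>i\<le>n. \<bar>y i\<bar>)))"
  using assms
proof (induction I rule: finite_induct)
  case empty
  have "y i = 0" if "\<forall>b. lin n b y = 0" "i \<le> n" for y i using lin_self_zero[of n y i] that by blast
  then show ?case by (intro exI[of _ 0]) simp
next
  case (insert r I)
  then obtain K where K: "K \<ge> 0" "\<And>y. (\<And>b. (\<forall>j\<in>I. lin n b (v j) = 0) \<Longrightarrow> lin n b y = 0) \<Longrightarrow>
    \<exists>d. (\<forall>i\<le>n. y i = (\<Sum>j\<in>I. d j * v j i)) \<and> (\<forall>j\<in>I. \<bar>d j\<bar> \<le> K * (\<Sum>i\<le>n. \<bar>y i\<bar>))" by blast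
  have upd: "(\<Sum>j\<in>insert r I. (d(r := s)) j * v j i) = (\<Sum>j\<in>I. d j * v j i) + s * v r i" for d s i
    using insert(1,2) by (auto intro!: sum.cong)
  show ?case
  proof (cases "\<forall>b. (\<forall>j\<in>I. lin n b (v j) = 0) \<longrightarrow> lin n b (v r) = 0")
    case True
    show ?thesis
    proof (intro exI[of _ K] conjI allI impI)
      fix y assume "\<forall>b. (\<forall>j\<in>insert r I. lin n b (v j) = 0) \<longrightarrow> lin n b y = 0"
      then have "lin n b y = 0" if "\<forall>j\<in>I. lin n b (v j) = 0" for b using True that by blast
      from K(2)[OF this] obtain d where d: "\<forall>i\<le>n. y i = (\<Sum>j\<in>I. d j * v j i)" "\<forall>j\<in>I. \<bar>d j\<bar> \<le> K * (\<Sum>i\<le>n. \<bar>y i\<bar>)" by blast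
      then show "\<exists>d. (\<forall>i\<le>n. y i = (\<Sum>j\<in>insert r I. d j * v j i)) \<and> (\<forall>j\<in>insert r I. \<bar>d j\<bar> \<le> K * (\<Sum>i\<le>n. \<bar>y i\<bar>))"
        using K(1) upd[of d 0] by (intro exI[of _ "d(r := 0)"]) (auto simp: sum_nonneg)
    qed (rule K(1))
  next
    case False
    then obtain b0 where b0: "\<forall>j\<in>I. lin n b0 (v j) = 0" "lin n b0 (v r) \<noteq> 0" by blast
    define b where "b = comb (1 / lin n b0 (v r)) b0 0 b0"
    have b: "lin n b (v j) = 0" if "j \<in> I" for j using b0 that by (simp add: b_def lin_comb_left)
    have br: "lin n b (v r) = 1" using b0 by (simp add: b_def lin_comb_left)
    define B where "B = (\<Sum>i\<le>n. \<bar>b i\<bar>)"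
    define V where "V = (\<Sum>i\<le>n. \<bar>v r i\<bar>)"
    have BV: "B \<ge> 0" "V \<ge> 0" by (simp_all add: B_def V_def sum_nonneg)
    show ?thesis
    \<comment> \<open>\<open>B\<close> bounds the coefficient of the new generator, and
      \<open>1 + B * V\<close> bounds the growth of the vector when the share of that generator is
      subtracted.\<close>
    proof (intro exI[of _ "K * (1 + B * V) + B"] conjI allI impI)
      show "K * (1 + B * V) + B \<ge> 0" using K(1) BV by simp
      fix y assume y: "\<forall>b. (\<forall>j\<in>insert r I. lin n b (v j) = 0) \<longrightarrow> lin n b y = 0"
      define Y where "Y = (\<Sum>i\<le>n. \<bar>y i\<bar>)"
      have Y: "Y \<ge> 0" by (simp add: Y_def sum_nonneg)
      define s where "s = lin n b y"
      have "\<bar>s\<bar> \<le> (\<Sum>i\<le>n. \<bar>b i\<bar> * \<bar>y i\<bar>)" unfolding s_def lin_def by (rule order_trans[OF sum_abs]) (simp add: abs_mult)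
      also have "\<dots> \<le> (\<Sum>i\<le>n. \<bar>b i\<bar> * Y)" unfolding Y_def by (intro sum_mono mult_left_mono member_le_sum[of _ _ "\<lambda>i. \<bar>y i\<bar>"]) auto
      finally have s: "\<bar>s\<bar> \<le> B * Y" by (simp add: B_def sum_distrib_right)
      define y' where "y' = comb 1 y (- s) (v r)"
      have "lin n b' y' = 0" if b': "\<forall>j\<in>I. lin n b' (v j) = 0" for b'
      proof -
        have "\<forall>j\<in>insert r I. lin n (comb 1 b' (- lin n b' (v r)) b) (v j) = 0" using b b' br by (auto simp: lin_comb_left)
        then have "lin n (comb 1 b' (- lin n b' (v r)) b) y = 0" using y by blast
        then show ?thesis by (simp add: y'_def lin_comb lin_comb_left s_def)
      qed
      from K(2)[OF this] obtain d where d: "\<forall>i\<le>n. y' i = (\<Sum>j\<in>I. d j * v j i)" "\<forall>j\<in>I. \<bar>d j\<bar> \<le> K * (\<Sum>i\<le>n. \<bar>y' i\<bar>)" by blast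
      have "(\<Sum>i\<le>n. \<bar>y' i\<bar>) \<le> (\<Sum>i\<le>n. \<bar>y i\<bar> + \<bar>s\<bar> * \<bar>v r i\<bar>)" unfolding y'_def comb_def
        by (intro sum_mono) (simp add: abs_triangle_ineq4[of "y _" "s * v r _", unfolded abs_mult])
      also have "\<dots> = Y + \<bar>s\<bar> * V" by (simp add: sum.distrib Y_def V_def sum_distrib_left)
      also have "\<dots> \<le> Y + B * Y * V" using s BV by (intro add_left_mono mult_right_mono) auto
      finally have le: "K * (\<Sum>i\<le>n. \<bar>y' i\<bar>) \<le> K * (Y + B * Y * V)" using K(1) by (intro mult_left_mono) auto
      have 1: "K * (Y + B * Y * V) \<le> (K * (1 + B * V) + B) * Y" using K(1) BV Y by (simp add: algebra_simps)
      have 2: "B * Y \<le> (K * (1 + B * V) + B) * Y" using K(1) BV Y by (simp add: algebra_simps)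
      show "\<exists>d. (\<forall>i\<le>n. y i = (\<Sum>j\<in>insert r I. d j * v j i)) \<and> (\<forall>j\<in>insert r I. \<bar>d j\<bar> \<le> (K * (1 + B * V) + B) * (\<Sum>i\<le>n. \<bar>y i\<bar>))"
        unfolding Y_def[symmetric]
      proof (intro exI[of _ "d(r := s)"] conjI allI impI ballI)
        fix i assume "i \<le> n"
        then show "y i = (\<Sum>j\<in>insert r I. (d(r := s)) j * v j i)" using d(1) unfolding upd by (auto simp: y'_def comb_def algebra_simps)
      next
        fix j assume "j \<in> insert r I"
        then show "\<bar>(d(r := s)) j\<bar> \<le> (K * (1 + B * V) + B) * Y" using s d(2) le 1 2 by (cases "j = r") (auto intro: order_trans)
      qed
    qed
  qed
qed

section \<open>Cells as cones on finitely many points\<close>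

definition model_hull :: "real \<Rightarrow> nat \<Rightarrow> (nat \<Rightarrow> real) set \<Rightarrow> (nat \<Rightarrow> real) set" where
  "model_hull \<kappa> n P = {x \<in> model_space \<kappa> n. \<exists>c. (\<forall>p\<in>P. c p \<ge> 0) \<and> lift \<kappa> n x = (\<lambda>i. \<Sum>p\<in>P. c p * lift \<kappa> n p i)}"

lemma model_hullE: assumes "x \<in> model_hull \<kappa> n P"
  obtains c where "\<And>p. p \<in> P \<Longrightarrow> c p \<ge> 0" "lift \<kappa> n x = (\<lambda>i. \<Sum>p\<in>P. c p * lift \<kappa> n p i)"
  using assms unfolding model_hull_def by auto

lemma model_hullI: "x \<in> model_space \<kappa> n \<Longrightarrow> (\<And>p. p \<in> P \<Longrightarrow> c p \<ge> 0) \<Longrightarrow> (\<And>i. i \<le> n \<Longrightarrow> lift \<kappa> n x i = (\<Sum>p\<in>P. c p * lift \<kappa> n p i))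
   \<Longrightarrow> P \<subseteq> model_space \<kappa> n \<Longrightarrow> x \<in> model_hull \<kappa> n P"
  unfolding model_hull_def
proof safe
  assume a: "x \<in> model_space \<kappa> n" "\<And>p. p \<in> P \<Longrightarrow> c p \<ge> 0" "\<And>i. i \<le> n \<Longrightarrow> lift \<kappa> n x i = (\<Sum>p\<in>P. c p * lift \<kappa> n p i)" "P \<subseteq> model_space \<kappa> n"
  have "lift \<kappa> n x i = (\<Sum>p\<in>P. c p * lift \<kappa> n p i)" for i
  proof (cases "i \<le> n")
    case False
    then show ?thesis using lift_supp[OF a(1), of i] lift_supp[of _ \<kappa> n i] a(4) by (simp add: subset_iff)
  qed (use a in auto)
  then show "\<exists>c. (\<forall>p\<in>P. c p \<ge> 0) \<and> lift \<kappa> n x = (\<lambda>i. \<Sum>p\<in>P. c p * lift \<kappa> n p i)" using a(2) by blast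
qed

text \<open>The half-space given by \<open>h\<close> replaces the spherical condition on a ball in
  \<open>convex_cell\<close> by a condition that has the same form in all curvatures.\<close>

locale polytope =
  fixes \<kappa> :: real and n :: nat and P :: "(nat \<Rightarrow> real) set" and h :: "nat \<Rightarrow> real"
  assumes fin: "finite P" and PM: "P \<subseteq> model_space \<kappa> n" and side: "p \<in> P \<Longrightarrow> lin n h (lift \<kappa> n p) > 0"
begin

abbreviation "M \<equiv> model_space \<kappa> n"
abbreviation "L \<equiv> lift \<kappa> n"
abbreviation "T \<equiv> model_hull \<kappa> n P"
abbreviation "d \<equiv> model_dist \<kappa> n"

lemma sub: "Q \<subseteq> P \<Longrightarrow> polytope \<kappa> n Q h"
  using fin PM side by unfold_locales (auto intro: finite_subset)

lemma T_sub: "T \<subseteq> M" by (auto simp: model_hull_def)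

lemma hull_mono: assumes "Q \<subseteq> P" shows "model_hull \<kappa> n Q \<subseteq> T"
proof
  fix x assume x: "x \<in> model_hull \<kappa> n Q"
  then obtain c where c: "\<And>p. p \<in> Q \<Longrightarrow> c p \<ge> 0" "L x = (\<lambda>i. \<Sum>p\<in>Q. c p * L p i)" by (rule model_hullE) blast
  have "(\<Sum>p\<in>Q. c p * L p i) = (\<Sum>p\<in>P. (if p \<in> Q then c p else 0) * L p i)" for i
    using fin assms by (intro sum.mono_neutral_cong_left) auto
  then show "x \<in> T" using c x PM by (intro model_hullI[where c="\<lambda>p. if p \<in> Q then c p else 0"]) (auto simp: model_hull_def)
qed

lemma P_sub_T: "P \<subseteq> T"
proof
  fix p assume p: "p \<in> P"
  have "(\<Sum>q\<in>P. (if q = p then 1 else 0) * L q i) = L p i" for i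
    using fin p by (subst sum.remove[of P p]) auto
  then show "p \<in> T" using p PM by (intro model_hullI[where c="\<lambda>q. if q = p then 1 else 0"]) auto
qed

lemma sideT: assumes "x \<in> T" shows "lin n h (L x) > 0"
proof -
  obtain c where c: "\<And>p. p \<in> P \<Longrightarrow> c p \<ge> 0" "L x = (\<lambda>i. \<Sum>p\<in>P. c p * L p i)" using assms by (rule model_hullE) blast
  have "lin n h (L x) = (\<Sum>p\<in>P. c p * lin n h (L p))" unfolding c(2) lin_sum ..
  moreover have "\<exists>p\<in>P. c p > 0"
  proof (rule ccontr)
    assume "\<not> ?thesis"
    then have "c p = 0" if "p \<in> P" for p using c(1)[OF that] that \<open>\<not> (\<exists>p\<in>P. 0 < c p)\<close> by force
    then have "L x = (\<lambda>_. 0)" unfolding c(2) by simp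
    then have "qf \<kappa> n (L x) = 0" by (simp add: qf_def lin_def hyp_def)
    then show False using qf_lift[of x \<kappa> n] assms T_sub by auto
  qed
  then obtain p where "p \<in> P" "c p > 0" by blast
  then have "(\<Sum>p\<in>P. c p * lin n h (L p)) > 0" using c(1) side fin
    by (intro sum_pos2[of P p]) (auto intro: less_imp_le mult_nonneg_nonneg)
  ultimately show ?thesis by simp
qed

text \<open>Points are added one at a time, with renormalisation after each, because positivity of
  \<open>qf\<close> is known for combinations of two model points.\<close>

lemma cone_normalize:
  assumes "\<And>p. p \<in> P \<Longrightarrow> c p \<ge> 0" "p \<in> P" "c p > 0"
  shows "\<exists>r>0. \<exists>z\<in>T. L z = (\<lambda>i. r * (\<Sum>p\<in>P. c p * L p i))"
proof -
  have "Q \<subseteq> P \<Longrightarrow> (\<exists>p\<in>Q. c p > 0) \<Longrightarrow> \<exists>r>0. \<exists>z\<in>M. lin n h (L z) > 0 \<and> L z = (\<lambda>i. r * (\<Sum>p\<in>Q. c p * L p i))" if "finite Q" for Q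
    using that
  proof (induction Q rule: finite_induct)
    case (insert q Q)
    have q: "q \<in> P" "q \<in> M" "lin n h (L q) > 0" "c q \<ge> 0" using insert.prems PM side assms by auto
    show ?case
    proof (cases "\<exists>p\<in>Q. c p > 0")
      case False
      then have "c p = 0" if "p \<in> Q" for p using assms(1)[of p] that insert.prems False by force
      moreover have "c q > 0" using False insert.prems by auto
      ultimately show ?thesis using insert(1,2) q by (intro exI[of _ "1 / c q"] conjI bexI[of _ q]) auto
    next
      case True
      then obtain r z where rz: "r > 0" "z \<in> M" "lin n h (L z) > 0" "L z = (\<lambda>i. r * (\<Sum>p\<in>Q. c p * L p i))" using insert by auto
      define w where "w = comb (c q) (L q) (1 / r) (L z)"
      have "c q + 1 / r > 0" "1 / r \<ge> 0" using q rz by (simp_all add: add_nonneg_pos)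
      note pos = cone_pos[OF q(2) rz(2) q(3) rz(3) q(4) this(2,1), folded w_def]
      have we: "w = (\<lambda>i. \<Sum>p\<in>insert q Q. c p * L p i)" using rz(1) insert(1,2) by (simp add: w_def comb_def rz(4))
      have supp: "w i = 0" if "i > n" for i using that lift_supp q(2) rz(2) by (simp add: w_def comb_def)
      obtain z' where z': "z' \<in> M" "L z' = (\<lambda>i. qnorm \<kappa> n w * w i)" "qnorm \<kappa> n w > 0"
        using normalize[of n w \<kappa>] supp pos by blast
      have "lin n h (L z') = qnorm \<kappa> n w * lin n h w" unfolding z'(2) by (simp add: lin_def sum_distrib_left mult.left_commute)
      then show ?thesis using z' pos(3) we by (intro exI[of _ "qnorm \<kappa> n w"] conjI bexI[of _ z']) auto
    qed
  qed simp
  from this[OF fin] assms obtain r z where rz: "r > 0" "z \<in> M" "L z = (\<lambda>i. r * (\<Sum>p\<in>P. c p * L p i))" by blast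
  have "z \<in> T" using rz assms(1) PM by (intro model_hullI[where c="\<lambda>p. r * c p"]) (auto simp: sum_distrib_left mult_ac)
  then show ?thesis using rz by blast
qed

lemma T_comb: assumes "x \<in> T" "y \<in> T" "z \<in> M" "a \<ge> 0" "b \<ge> 0" "L z = comb a (L x) b (L y)" shows "z \<in> T"
proof -
  obtain c where c: "\<And>p. p \<in> P \<Longrightarrow> c p \<ge> 0" "L x = (\<lambda>i. \<Sum>p\<in>P. c p * L p i)" using assms(1) by (rule model_hullE) blast
  obtain e where e: "\<And>p. p \<in> P \<Longrightarrow> e p \<ge> 0" "L y = (\<lambda>i. \<Sum>p\<in>P. e p * L p i)" using assms(2) by (rule model_hullE) blast
  show ?thesis using c e assms PM
    by (intro model_hullI[where c="\<lambda>p. a * c p + b * e p"]) (auto simp: comb_def sum_distrib_left sum.distrib algebra_simps)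
qed

text \<open>Peel off one generator at a time: the rest of the combination, renormalised, is a hull
  point of fewer generators, unless all its coefficients vanish.\<close>

lemma pair_induct:
  assumes "x \<in> T" "P \<subseteq> W" "\<And>x y z a b. x \<in> W \<Longrightarrow> y \<in> W \<Longrightarrow> x \<in> T \<Longrightarrow> y \<in> T \<Longrightarrow> z \<in> T \<Longrightarrow> a \<ge> 0 \<Longrightarrow> b \<ge> 0 \<Longrightarrow> L z = comb a (L x) b (L y) \<Longrightarrow> z \<in> W"
  shows "x \<in> W"
proof -
  have "Q \<subseteq> P \<Longrightarrow> x \<in> model_hull \<kappa> n Q \<Longrightarrow> x \<in> W" if "finite Q" for Q x
    using that
  proof (induction Q arbitrary: x rule: finite_induct)
    case empty
    interpret E: polytope \<kappa> n "{}" h using sub[of "{}"] by simp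
    have "lin n h (L x) > 0" by (rule E.sideT[OF empty(2)])
    moreover have "L x = (\<lambda>_. 0)" using empty(2) by (auto simp: model_hull_def)
    ultimately show ?case by (simp add: lin_def)
  next
    case (insert q Q)
    interpret Q: polytope \<kappa> n Q h using insert.prems by (intro sub) auto
    have QT: "model_hull \<kappa> n Q \<subseteq> T" using insert.prems by (intro hull_mono) auto
    obtain c where c: "\<And>p. p \<in> insert q Q \<Longrightarrow> c p \<ge> 0" "L x = (\<lambda>i. \<Sum>p\<in>insert q Q. c p * L p i)" using insert.prems(2) by (rule model_hullE) blast
    have xT: "x \<in> T" using hull_mono[OF insert.prems(1)] insert.prems(2) by auto
    have q: "q \<in> W" "q \<in> T" using insert.prems assms(2) P_sub_T by auto
    show ?case
    proof (cases "\<exists>p\<in>Q. c p > 0")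
      case True
      then obtain r z where rz: "r > 0" "z \<in> model_hull \<kappa> n Q" "L z = (\<lambda>i. r * (\<Sum>p\<in>Q. c p * L p i))" using Q.cone_normalize[of c] c(1) by blast
      then have "z \<in> W" "z \<in> T" using insert QT by auto
      moreover have "L x = comb (c q) (L q) (1 / r) (L z)" using insert(1,2) rz(1) unfolding c(2) rz(3) comb_def by simp
      ultimately show ?thesis using assms(3)[of q z x "c q" "1 / r"] q xT c(1) rz(1) by simp
    next
      case False
      then have "c p = 0" if "p \<in> Q" for p using c(1)[of p] that False by force
      then have "L x = comb (c q) (L q) 0 (L q)" using insert(1,2) unfolding c(2) comb_def by simp
      then show ?thesis using assms(3)[of q q x "c q" 0] q xT c(1) by simp
    qed
  qed
  then show ?thesis using assms(1) fin by blast
qed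

lemma T_between: assumes "x \<in> T" "y \<in> T" "z \<in> M" "d x z + d z y = d x y" shows "z \<in> T"
  using model_dist_between[of x \<kappa> n y h z] T_comb[OF assms(1-3)] assms sideT T_sub by blast

lemma T_geodesically_convex: "geodesically_convex M d T"
  unfolding geodesically_convex_def
proof (intro conjI ballI allI impI)
  show "T \<subseteq> M" by (rule T_sub)
  fix x y assume xy: "x \<in> T" "y \<in> T"
  then show "\<exists>c. geodesic_path M d c x y" using model_dist_geodesic[of x \<kappa> n y h] sideT T_sub by blast
  fix c assume c: "geodesic_path M d c x y"
  show "c ` {0..d x y} \<subseteq> T"
  proof
    fix z assume "z \<in> c ` {0..d x y}"
    then obtain t where t: "t \<in> {0..d x y}" "z = c t" by blast
    have M: "x \<in> M" "y \<in> M" using xy T_sub by auto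
    have 0: "0 \<in> {0..d x y}" "d x y \<in> {0..d x y}" using model_dist_nonneg[OF M] by auto
    have "d (c 0) (c t) = \<bar>0 - t\<bar>" "d (c t) (c (d x y)) = \<bar>t - d x y\<bar>" using c t(1) 0 unfolding geodesic_path_def by blast+
    then have "d x z + d z y = d x y" using c t by (auto simp: geodesic_path_def)
    moreover have "z \<in> M" using c t by (auto simp: geodesic_path_def)
    ultimately show "z \<in> T" using T_between xy by blast
  qed
qed

text \<open>A point between two points of \<open>D\<close> is, by uniqueness, the point at the right
  distance on a geodesic contained in \<open>D\<close>.\<close>

lemma T_subset_convex: assumes "geodesically_convex M d D" "P \<subseteq> D" shows "T \<subseteq> D"
proof
  fix x assume "x \<in> T"
  then show "x \<in> D"
  proof (rule pair_induct[OF _ assms(2)])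
    fix x y z a b assume *: "x \<in> D" "y \<in> D" "x \<in> T" "y \<in> T" "z \<in> T" "a \<ge> 0" "b \<ge> 0" "L z = comb a (L x) b (L y)"
    then have M: "x \<in> M" "y \<in> M" "z \<in> M" using T_sub by auto
    obtain c where c: "geodesic_path M d c x y" "c ` {0..d x y} \<subseteq> D" using assms(1) *(1,2) unfolding geodesically_convex_def by blast
    have e: "d x z + d z y = d x y" using model_dist_seg[OF M(1,2) sideT[OF *(3)] sideT[OF *(4)] M(3) *(8,6,7)] .
    have t: "d x z \<in> {0..d x y}" using model_dist_nonneg[OF M(1,3)] model_dist_nonneg[OF M(3,2)] e by auto
    have 0: "0 \<in> {0..d x y}" "d x y \<in> {0..d x y}" using t by auto
    have "d (c 0) (c (d x z)) = \<bar>0 - d x z\<bar>" "d (c (d x z)) (c (d x y)) = \<bar>d x z - d x y\<bar>" using c(1) t 0 unfolding geodesic_path_def by blast+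
    then have "d x (c (d x z)) = d x z" "d (c (d x z)) y = d x y - d x z" using c(1) t by (auto simp: geodesic_path_def)
    moreover have "c (d x z) \<in> M" using c(1) t by (auto simp: geodesic_path_def)
    ultimately have "z = c (d x z)" using model_dist_between_unique[OF M(1,2) sideT[OF *(3)] sideT[OF *(4)] M(3) e, of "c (d x z)"] by simp
    then show "z \<in> D" using c(2) t by auto
  qed
qed

end

text \<open>A half-space functional exists in each curvature: coordinate \<open>n\<close> of the
  lift in the flat case, the pairing with the centre of the open hemisphere on the sphere, and the
  time coordinate on the hyperboloid.\<close>

lemma convex_cell_polytope: assumes "convex_cell \<kappa> n C"
  shows "\<exists>P h. polytope \<kappa> n P h \<and> P \<noteq> {} \<and> C = model_hull \<kappa> n P"
proof -
  obtain P where P: "finite P" "P \<noteq> {}" "P \<subseteq> model_space \<kappa> n"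
      "\<kappa> > 0 \<Longrightarrow> \<exists>z\<in>model_space \<kappa> n. \<forall>x\<in>P. model_dist \<kappa> n z x < pi / sqrt \<kappa> / 2"
      "C = \<Inter>{D. geodesically_convex (model_space \<kappa> n) (model_dist \<kappa> n) D \<and> P \<subseteq> D}"
    using assms unfolding convex_cell_def by blast
  have "\<exists>h. \<forall>p\<in>P. lin n h (lift \<kappa> n p) > 0"
  proof -
    have single: "lin n (\<lambda>i. if i = k then 1 else 0) x = x k" if "k \<le> n" for k and x :: "nat \<Rightarrow> real"
      unfolding lin_def using that by (subst sum.remove[of _ k]) auto
    consider "\<kappa> = 0" | "\<kappa> > 0" | "\<kappa> < 0" by linarith
    then show ?thesis
    proof cases
      case 1
      then show ?thesis by (intro exI[of _ "\<lambda>i. if i = n then 1 else 0"]) (simp add: single lift_def)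
    next
      case 2
      then obtain z where z: "z \<in> model_space \<kappa> n" "\<forall>x\<in>P. model_dist \<kappa> n z x < pi / sqrt \<kappa> / 2" using P(4) by blast
      interpret curved_geometry "lin n" "model_space \<kappa> n" 1 cos sin "{0..pi}" "{0..<pi}" "\<lambda>x y. arccos (lin n x y)"
        by (rule spherical_geometry[OF 2])
      have "lin n z (lift \<kappa> n p) > 0" if p: "p \<in> P" for p
      proof -
        have "p \<in> model_space \<kappa> n" using p P(3) by auto
        note th = \<theta>_I[OF z(1) this] \<theta>_C[OF z(1) this]
        have "arccos (lin n z p) / sqrt \<kappa> < pi / sqrt \<kappa> / 2" using z(2) p 2 by (simp add: model_dist_pos)
        then have "arccos (lin n z p) < pi / 2" using 2 by (simp only: pos_divide_less_eq real_sqrt_gt_zero) (simp add: field_simps)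
        then have "cos (arccos (lin n z p)) > 0" using th(1) by (intro cos_gt_zero_pi) auto
        then show ?thesis using th(2) 2 by (simp add: lift_def)
      qed
      then show ?thesis by blast
    next
      case 3
      have "p 0 > 0" if "p \<in> P" for p using P(3) that 3 by (auto simp: model_neg)
      then show ?thesis using 3 by (intro exI[of _ "\<lambda>i. if i = 0 then 1 else 0"]) (simp add: single lift_def)
    qed
  qed
  then obtain h where h: "\<forall>p\<in>P. lin n h (lift \<kappa> n p) > 0" by blast
  interpret polytope \<kappa> n P h using P h by unfold_locales auto
  have "C = T" using P(5) T_geodesically_convex P_sub_T T_subset_convex by blast
  then show ?thesis using polytope_axioms P(2) by blast
qed

section \<open>Faces, compactness and interiors of cells\<close>

lemma lin_lift: assumes "x \<in> model_space \<kappa> n"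
  shows "lin n b (lift \<kappa> n x) = (\<Sum>i\<le>n. b i * x i) + (if \<kappa> = 0 then b n else 0)"
proof (cases "\<kappa> = 0")
  case True
  have "(\<Sum>i\<le>n. b i * (x(n := 1)) i) = (\<Sum>i\<le>n. b i * x i + (if i = n then b n else 0))"
    using assms True by (intro sum.cong) (auto simp: model_zero)
  then show ?thesis using True by (simp add: lin_def lift_def sum.distrib)
qed (simp add: lin_def lift_def)

text \<open>In the flat case coordinate \<open>n\<close> is free, being 0 on model points and 1 on
  their lifts, and absorbs the constant \<open>a\<close>.\<close>

lemma affine_as_linear: assumes "\<kappa> \<noteq> 0 \<longrightarrow> a = 0"
  obtains b' where "\<And>x. x \<in> model_space \<kappa> n \<Longrightarrow> lin n b' (lift \<kappa> n x) = (\<Sum>i\<le>n. b i * x i) - a"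
proof (cases "\<kappa> = 0")
  case True
  have "lin n (b(n := - a)) (lift \<kappa> n x) = (\<Sum>i\<le>n. b i * x i) - a" if "x \<in> model_space \<kappa> n" for x
  proof -
    have "(\<Sum>i\<le>n. (b(n := - a)) i * x i) = (\<Sum>i\<le>n. b i * x i)" using that True by (intro sum.cong) (auto simp: model_zero)
    then show ?thesis using lin_lift[OF that, of "b(n := - a)"] True by simp
  qed
  then show ?thesis by (rule that)
next
  case False
  then show ?thesis using assms lin_lift by (intro that[of b]) auto
qed

lemma face_iff: assumes "C \<subseteq> model_space \<kappa> n"
  shows "face_of_cell \<kappa> n F C \<longleftrightarrow> F \<noteq> {} \<and> (\<exists>b. (\<forall>x\<in>C. lin n b (lift \<kappa> n x) \<ge> 0) \<and> F = {x\<in>C. lin n b (lift \<kappa> n x) = 0})"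
proof
  assume "face_of_cell \<kappa> n F C"
  then obtain b a where F: "F \<noteq> {}" and b: "\<kappa> \<noteq> 0 \<longrightarrow> a = 0" "\<forall>x\<in>C. (\<Sum>i\<le>n. b i * x i) \<ge> a" "F = {x\<in>C. (\<Sum>i\<le>n. b i * x i) = a}"
    unfolding face_of_cell_def by blast
  obtain b' where b': "\<And>x. x \<in> model_space \<kappa> n \<Longrightarrow> lin n b' (lift \<kappa> n x) = (\<Sum>i\<le>n. b i * x i) - a"
    using affine_as_linear[OF b(1)] by blast
  have "\<forall>x\<in>C. lin n b' (lift \<kappa> n x) \<ge> 0" "F = {x\<in>C. lin n b' (lift \<kappa> n x) = 0}" using b b' assms by (auto simp: subset_iff)
  then show "F \<noteq> {} \<and> (\<exists>b. (\<forall>x\<in>C. lin n b (lift \<kappa> n x) \<ge> 0) \<and> F = {x\<in>C. lin n b (lift \<kappa> n x) = 0})" using F by blast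
next
  assume "F \<noteq> {} \<and> (\<exists>b. (\<forall>x\<in>C. lin n b (lift \<kappa> n x) \<ge> 0) \<and> F = {x\<in>C. lin n b (lift \<kappa> n x) = 0})"
  then obtain b where F: "F \<noteq> {}" and b: "\<forall>x\<in>C. lin n b (lift \<kappa> n x) \<ge> 0" "F = {x\<in>C. lin n b (lift \<kappa> n x) = 0}" by blast
  define a where "a = - (if \<kappa> = 0 then b n else 0)"
  have "lin n b (lift \<kappa> n x) = (\<Sum>i\<le>n. b i * x i) - a" if "x \<in> C" for x using lin_lift[of x \<kappa> n b] that assms by (auto simp: a_def)
  then have "(\<forall>x\<in>C. (\<Sum>i\<le>n. b i * x i) \<ge> a) \<and> F = {x\<in>C. (\<Sum>i\<le>n. b i * x i) = a}" "\<kappa> \<noteq> 0 \<longrightarrow> a = 0" using b by (auto simp: a_def)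
  then show "face_of_cell \<kappa> n F C" unfolding face_of_cell_def using F by blast
qed

lemma plane_span_lin: assumes "F \<subseteq> model_space \<kappa> n" "y \<in> plane_span \<kappa> n F" "\<And>x. x \<in> F \<Longrightarrow> lin n b (lift \<kappa> n x) = 0"
  shows "lin n b (lift \<kappa> n y) = 0"
proof -
  define a where "a = - (if \<kappa> = 0 then b n else 0)"
  have e: "lin n b (lift \<kappa> n x) = (\<Sum>i\<le>n. b i * x i) - a" if "x \<in> model_space \<kappa> n" for x using lin_lift[OF that, of b] by (simp add: a_def)
  have y: "y \<in> model_space \<kappa> n" using assms(2) by (simp add: plane_span_def)
  have "\<forall>x\<in>F. (\<Sum>i\<le>n. b i * x i) = a" using e assms(1,3) by force
  moreover have "\<kappa> \<noteq> 0 \<longrightarrow> a = 0" by (simp add: a_def)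
  ultimately have "(\<Sum>i\<le>n. b i * y i) = a" using assms(2) by (simp add: plane_span_def)
  then show ?thesis using e[OF y] by simp
qed

lemma plane_spanI: assumes "F \<subseteq> model_space \<kappa> n" "y \<in> model_space \<kappa> n"
  "\<And>b. (\<And>x. x \<in> F \<Longrightarrow> lin n b (lift \<kappa> n x) = 0) \<Longrightarrow> lin n b (lift \<kappa> n y) = 0"
  shows "y \<in> plane_span \<kappa> n F"
  unfolding plane_span_def
proof (intro CollectI conjI allI impI)
  fix b a assume a: "\<kappa> \<noteq> 0 \<longrightarrow> a = 0" and b: "\<forall>x\<in>F. (\<Sum>i\<le>n. b i * x i) = a"
  obtain b' where b': "\<And>x. x \<in> model_space \<kappa> n \<Longrightarrow> lin n b' (lift \<kappa> n x) = (\<Sum>i\<le>n. b i * x i) - a"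
    using affine_as_linear[OF a] by blast
  have "lin n b' (lift \<kappa> n y) = 0" using assms(1) b b' by (intro assms(3)) force
  then show "(\<Sum>i\<le>n. b i * y i) = a" using b' assms(2) by simp
qed (rule assms(2))

lemma bounded_coeffs_subseq:
  fixes c :: "nat \<Rightarrow> 'p \<Rightarrow> real"
  assumes "finite P" "\<And>k p. p \<in> P \<Longrightarrow> c k p \<in> {0..K}"
  shows "\<exists>r l. strict_mono (r :: nat \<Rightarrow> nat) \<and> (\<forall>p\<in>P. l p \<in> {0..K} \<and> (\<lambda>k. c (r k) p) \<longlonglongrightarrow> l p)"
  using assms
proof (induction P rule: finite_induct)
  case empty then show ?case by (intro exI[of _ id]) (auto simp: strict_mono_def)
next
  case (insert q P)
  then obtain r l where r: "strict_mono r" "\<forall>p\<in>P. l p \<in> {0..K} \<and> (\<lambda>k. c (r k) p) \<longlonglongrightarrow> l p" by auto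
  have "seq_compact {0..K}" by (simp add: compact_imp_seq_compact)
  moreover have "\<forall>k. c (r k) q \<in> {0..K}" using insert.prems by blast
  ultimately obtain m s where s: "m \<in> {0..K}" "strict_mono s" "((\<lambda>k. c (r k) q) \<circ> s) \<longlonglongrightarrow> m"
    unfolding seq_compact_def by (metis (no_types, lifting))
  have "(\<lambda>k. c (r (s k)) p) \<longlonglongrightarrow> l p" if "p \<in> P" for p
    using LIMSEQ_subseq_LIMSEQ[OF _ s(2), of "\<lambda>k. c (r k) p" "l p"] r(2) that by (simp add: o_def)
  then show ?case using s r insert(2)
    by (intro exI[of _ "r \<circ> s"] exI[of _ "l(q := m)"]) (auto simp: o_def strict_mono_o[unfolded o_def])
qed

text \<open>A point missed by the image has positive distance \<open>e\<close> from it. Its iterates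
  are then pairwise at least \<open>e\<close> apart, against sequential compactness.\<close>

lemma (in Metric_space) isometric_self_embedding_onto:
  assumes S: "compactin mtopology S" and f: "f ` S \<subseteq> S" "\<And>x y. x \<in> S \<Longrightarrow> y \<in> S \<Longrightarrow> d (f x) (f y) = d x y"
  shows "f ` S = S"
proof (rule ccontr)
  assume "f ` S \<noteq> S"
  then obtain x where x: "x \<in> S" "x \<notin> f ` S" using f(1) by blast
  have SM: "S \<subseteq> M" using compactin_subset_topspace[OF S] by simp
  have seq: "\<exists>l r. l \<in> S \<and> strict_mono r \<and> limitin mtopology (\<sigma> \<circ> r) l sequentially" if "range \<sigma> \<subseteq> S" for \<sigma> :: "nat \<Rightarrow> 'a"
    using S that unfolding compactin_sequentially by blast
  have "\<exists>e>0. \<forall>y\<in>S. d x (f y) \<ge> e"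
  proof (rule ccontr)
    assume "\<not> ?thesis"
    then have ex: "\<exists>y\<in>S. d x (f y) < e" if "e > 0" for e using that by force
    have "\<exists>y\<in>S. d x (f y) < 1 / (real k + 1)" for k by (rule ex) (simp add: add_nonneg_pos)
    then obtain y where y: "\<And>k. y k \<in> S" "\<And>k. d x (f (y k)) < 1 / (real k + 1)" by metis
    obtain l r where l: "l \<in> S" "strict_mono r" "limitin mtopology (y \<circ> r) l sequentially" using seq[of y] y by blast
    have "d x (f l) \<le> 0"
    proof (rule field_le_epsilon)
      fix e :: real assume "e > 0"
      have "\<forall>\<^sub>F k in sequentially. (y \<circ> r) k \<in> M \<and> d ((y \<circ> r) k) l < e / 2"
        using l(3) \<open>e > 0\<close> unfolding limit_metric_sequentially eventually_sequentially by (metis half_gt_zero)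
      moreover have "\<forall>\<^sub>F k in sequentially. 1 / (real (r k) + 1) < e / 2"
      proof -
        have "(\<lambda>k. 1 / (real k + 1)) \<longlonglongrightarrow> 0" using LIMSEQ_inverse_real_of_nat by (simp add: inverse_eq_divide add.commute)
        then have "(\<lambda>k. 1 / (real (r k) + 1)) \<longlonglongrightarrow> 0" using LIMSEQ_subseq_LIMSEQ[OF _ l(2)] by (fastforce simp: o_def)
        then show ?thesis using \<open>e > 0\<close> by (intro order_tendstoD(2)) auto
      qed
      ultimately have "\<forall>\<^sub>F k in sequentially. d x (f l) < e"
      proof eventually_elim
        case (elim k)
        have "d x (f l) \<le> d x (f (y (r k))) + d (f (y (r k))) (f l)"
          using f(1) y(1) l(1) x(1) SM by (intro triangle) auto
        also have "d (f (y (r k))) (f l) = d (y (r k)) l" using f(2) y(1) l(1) by blast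
        finally show ?case using elim y(2)[of "r k"] by (simp add: o_def)
      qed
      then show "d x (f l) \<le> 0 + e" by (auto dest: eventually_happens)
    qed
    moreover have "f l \<in> M" "x \<in> M" using f(1) l(1) x(1) SM by auto
    ultimately have "x = f l" by (metis nonneg order_antisym zero)
    then show False using x l by blast
  qed
  then obtain e where e: "e > 0" "\<And>y. y \<in> S \<Longrightarrow> d x (f y) \<ge> e" by blast
  have it: "(f ^^ k) y \<in> S" if "y \<in> S" for k y using that f(1) by (induction k) auto
  have apart: "d ((f ^^ i) x) ((f ^^ (i + Suc k)) x) \<ge> e" for i k
  proof (induction i)
    case 0 show ?case using e(2)[OF it[OF x(1), of k]] by simp
  next
    case (Suc i)
    have "d ((f ^^ Suc i) x) ((f ^^ (Suc i + Suc k)) x) = d ((f ^^ i) x) ((f ^^ (i + Suc k)) x)"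
      using f(2)[OF it[OF x(1)] it[OF x(1)], of i "i + Suc k"] by simp
    then show ?case using Suc by simp
  qed
  have "range (\<lambda>k. (f ^^ k) x) \<subseteq> S" using it[OF x(1)] by auto
  from seq[OF this] obtain l r where l: "l \<in> S" "strict_mono r" "limitin mtopology ((\<lambda>k. (f ^^ k) x) \<circ> r) l sequentially"
    by blast
  obtain N where N: "\<And>k. k \<ge> N \<Longrightarrow> d ((f ^^ (r k)) x) l < e / 2"

  proof -
    have "\<exists>N. \<forall>k\<ge>N. ((\<lambda>k. (f ^^ k) x) \<circ> r) k \<in> M \<and> d (((\<lambda>k. (f ^^ k) x) \<circ> r) k) l < e / 2"
      using l(3) half_gt_zero[OF e(1)] unfolding limit_metric_sequentially by blast
    then show ?thesis using that by (auto simp: o_def)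
  qed
  have "r N < r (Suc N)" using l(2) by (simp add: strict_mono_def)
  then obtain k where k: "r (Suc N) = r N + Suc k" using less_iff_Suc_add by auto
  have "e \<le> d ((f ^^ (r N)) x) ((f ^^ (r (Suc N))) x)" using apart[of "r N" k] k by simp
  also have "\<dots> \<le> d ((f ^^ (r N)) x) l + d ((f ^^ (r (Suc N))) x) l"
    using it[OF x(1)] l(1) SM by (intro triangle') auto
  also have "\<dots> < e" using N[of N] N[of "Suc N"] by simp
  finally show False by simp
qed

definition mdist :: "real \<Rightarrow> nat \<Rightarrow> (nat \<Rightarrow> real) \<Rightarrow> (nat \<Rightarrow> real) \<Rightarrow> real" where
  "mdist \<kappa> n x y = (if x \<in> model_space \<kappa> n \<and> y \<in> model_space \<kappa> n then model_dist \<kappa> n x y else 0)"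

global_interpretation model: Metric_space "model_space \<kappa> n" "mdist \<kappa> n" for \<kappa> n
  unfolding mdist_def by (rule model_Metric_space)

context polytope
begin

text \<open>The bound comes from coordinate \<open>n\<close> in the flat case, from the functional
  \<open>h\<close> on the sphere, and on the hyperboloid from expanding
  \<open>hyp n x x = 1\<close>, where every \<open>hyp n p x\<close> is at least 1.\<close>

lemma coeffs_bounded:
  "\<exists>K. \<forall>x\<in>T. \<forall>c. (\<forall>p\<in>P. c p \<ge> 0) \<longrightarrow> L x = (\<lambda>i. \<Sum>p\<in>P. c p * L p i) \<longrightarrow> (\<forall>p\<in>P. c p \<le> K)"
proof -
  consider "\<kappa> = 0" | "\<kappa> > 0" | "\<kappa> < 0" by linarith
  then show ?thesis
  proof cases
    case 1
    have "c p \<le> 1" if "\<forall>p\<in>P. c p \<ge> 0" "L x = (\<lambda>i. \<Sum>p\<in>P. c p * L p i)" "p \<in> P" for x c p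
    proof -
      have "1 = (\<Sum>p\<in>P. c p)" using fun_cong[OF that(2), of n] 1 by (simp add: lift_def)
      then show ?thesis using member_le_sum[of p P c] fin that by auto
    qed
    then show ?thesis by blast
  next
    case 2
    define H where "H = (\<Sum>i\<le>n. \<bar>h i\<bar>)"
    have "c p \<le> Max ((\<lambda>p. H / lin n h (L p)) ` P)" if x: "x \<in> T" "\<forall>p\<in>P. c p \<ge> 0" "L x = (\<lambda>i. \<Sum>p\<in>P. c p * L p i)" "p \<in> P" for x c p
    proof -
      have "lin n x x = 1" using x(1) 2 T_sub by (auto simp: model_pos)
      then have "\<bar>x i\<bar> \<le> 1" if "i \<le> n" for i using coord_le_lin_self[OF that, of x] by (simp add: abs_square_le_1)
      then have "\<bar>h i * x i\<bar> \<le> \<bar>h i\<bar>" if "i \<le> n" for i using that mult_left_le[of "\<bar>x i\<bar>" "\<bar>h i\<bar>"] by (simp add: abs_mult)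
      then have "(\<Sum>i\<le>n. h i * x i) \<le> H" unfolding H_def by (intro sum_mono) (use abs_le_D1 in blast)
      then have "lin n h (L x) \<le> H" using 2 by (simp add: lin_def lift_def)
      then have "(\<Sum>p\<in>P. c p * lin n h (L p)) \<le> H" unfolding x(3) lin_sum .
      moreover have "c p * lin n h (L p) \<le> (\<Sum>p\<in>P. c p * lin n h (L p))"
        using x(2,4) side fin by (intro member_le_sum[of p P "\<lambda>p. c p * lin n h (L p)"]) (auto simp: less_imp_le)
      ultimately have "c p \<le> H / lin n h (L p)" using side[OF x(4)] by (simp add: pos_le_divide_eq)
      also have "\<dots> \<le> Max ((\<lambda>p. H / lin n h (L p)) ` P)" using fin x(4) by (intro Max_ge) auto
      finally show ?thesis .
    qed
    then show ?thesis by blast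
  next
    case 3
    have "c p \<le> 1" if x: "x \<in> T" "\<forall>p\<in>P. c p \<ge> 0" "L x = (\<lambda>i. \<Sum>p\<in>P. c p * L p i)" "p \<in> P" for x c p
    proof -
      have xM: "x \<in> M" using x(1) T_sub by auto
      have lx: "x = (\<lambda>i. \<Sum>p\<in>P. c p * p i)" using x(3) 3 by (simp add: lift_def)
      have "1 = hyp n x x" using xM 3 by (simp add: model_neg)
      also have "\<dots> = (\<Sum>p\<in>P. c p * hyp n p x)"
        unfolding hyp_def by (subst (1 3) lx) (simp add: sum_distrib_right sum_distrib_left right_diff_distrib sum_subtractf sum.swap[of _ P] mult_ac)
      also have "\<dots> \<ge> (\<Sum>p\<in>P. c p * 1)" using x(2) PM hyp_ge1[OF 3 _ xM] by (intro sum_mono mult_left_mono) auto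
      finally have "(\<Sum>p\<in>P. c p) \<le> 1" by simp
      then show ?thesis using member_le_sum[of p P c] fin x by auto
    qed
    then show ?thesis by blast
  qed
qed

text \<open>Bounded coefficients converge along a subsequence. The limiting combination still has
  \<open>qf\<close> equal to 1, so it is the lift of a point of the hull.\<close>

lemma T_compact: "compactin (model.mtopology \<kappa> n) T"
  unfolding model.compactin_sequentially
proof (intro conjI allI impI)
  show "T \<subseteq> M" by (rule T_sub)
  fix \<sigma> :: "nat \<Rightarrow> nat \<Rightarrow> real" assume "range \<sigma> \<subseteq> T"
  then have sT: "\<sigma> k \<in> T" for k by auto
  obtain K where K: "\<And>x c p. x \<in> T \<Longrightarrow> \<forall>p\<in>P. c p \<ge> 0 \<Longrightarrow> L x = (\<lambda>i. \<Sum>p\<in>P. c p * L p i) \<Longrightarrow> p \<in> P \<Longrightarrow> c p \<le> K"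
    using coeffs_bounded by blast
  have "\<forall>k. \<exists>c. (\<forall>p\<in>P. c p \<ge> 0) \<and> L (\<sigma> k) = (\<lambda>i. \<Sum>p\<in>P. c p * L p i)" using sT unfolding model_hull_def by blast
  then obtain c where c: "\<And>k. \<forall>p\<in>P. c k p \<ge> 0" "\<And>k. L (\<sigma> k) = (\<lambda>i. \<Sum>p\<in>P. c k p * L p i)" by metis
  have bd: "c k p \<in> {0..K}" if "p \<in> P" for k p using c(1)[of k] K[OF sT c(1) c(2) that] that by auto
  from bounded_coeffs_subseq[of P c K, OF fin bd] obtain r l where r: "strict_mono r" "\<And>p. p \<in> P \<Longrightarrow> l p \<in> {0..K}" "\<And>p. p \<in> P \<Longrightarrow> (\<lambda>k. c (r k) p) \<longlonglongrightarrow> l p"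
    by blast
  define w where "w = (\<lambda>i. \<Sum>p\<in>P. l p * L p i)"
  have lim: "(\<lambda>k. L (\<sigma> (r k)) i) \<longlonglongrightarrow> w i" for i unfolding c(2) w_def using r by (intro tendsto_intros) auto
  have "(\<lambda>k. qf \<kappa> n (L (\<sigma> (r k)))) \<longlonglongrightarrow> qf \<kappa> n w" unfolding qf_def lin_def hyp_def using lim by (auto intro!: tendsto_intros)
  moreover have "qf \<kappa> n (L (\<sigma> (r k))) = 1" for k using qf_lift sT T_sub by blast
  ultimately have "qf \<kappa> n w = 1" by (simp add: LIMSEQ_const_iff)
  moreover have "w i = 0" if "i > n" for i
  proof -
    have "L (\<sigma> (r k)) i = 0" for k using lift_supp that sT T_sub by blast
    then show ?thesis using lim[of i] by (simp add: LIMSEQ_const_iff)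
  qed
  \<comment> \<open>A strict inequality could be lost in the limit; the uniform lower bound 1
    preserves it.\<close>
  moreover have "w 0 > 0" if "\<kappa> < 0"
  proof -
    have "L (\<sigma> (r k)) 0 \<ge> 1" for k using model_neg_ge1[OF that, of "\<sigma> (r k)" n] sT T_sub that by (auto simp: lift_def)
    then have "w 0 \<ge> 1" using lim[of 0] by (intro LIMSEQ_le_const) auto
    then show ?thesis by simp
  qed
  ultimately obtain z where z: "z \<in> M" "L z = w" using unlift[of n w \<kappa>] by blast
  have "z \<in> T" using z r(2) PM by (intro model_hullI[where c=l]) (auto simp: w_def)
  moreover have "limitin (model.mtopology \<kappa> n) (\<sigma> \<circ> r) z sequentially"
    unfolding model.limit_metric_sequentially
  proof (intro conjI allI impI)
    fix e :: real assume "e > 0"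
    obtain \<delta> where \<delta>: "\<delta> > 0" "\<And>y. y \<in> M \<Longrightarrow> (\<forall>i\<le>n. \<bar>L y i - L z i\<bar> < \<delta>) \<Longrightarrow> d z y < e" using coord_imp_model_dist[OF z(1) \<open>e > 0\<close>] by blast
    have "\<forall>\<^sub>F k in sequentially. \<bar>L (\<sigma> (r k)) i - L z i\<bar> < \<delta>" for i
      using lim[of i] \<delta>(1) unfolding tendsto_iff dist_real_def z(2) by blast
    then have "\<forall>\<^sub>F k in sequentially. \<forall>i\<in>{..n}. \<bar>L (\<sigma> (r k)) i - L z i\<bar> < \<delta>" by (intro eventually_ball_finite) auto
    then obtain N where N: "\<And>k. k \<ge> N \<Longrightarrow> \<forall>i\<in>{..n}. \<bar>L (\<sigma> (r k)) i - L z i\<bar> < \<delta>" unfolding eventually_sequentially by blast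
    show "\<exists>N. \<forall>k\<ge>N. (\<sigma> \<circ> r) k \<in> M \<and> mdist \<kappa> n ((\<sigma> \<circ> r) k) z < e"
    proof (intro exI[of _ N] allI impI conjI)
      fix k assume "k \<ge> N"
      show m: "(\<sigma> \<circ> r) k \<in> M" using sT T_sub by auto
      then show "mdist \<kappa> n ((\<sigma> \<circ> r) k) z < e" using \<delta>(2)[OF m] N[OF \<open>k \<ge> N\<close>] z(1) model_dist_sym[OF m z(1)] by (simp add: mdist_def)
    qed
  qed (rule z(1))
  ultimately show "\<exists>l r. l \<in> T \<and> strict_mono r \<and> limitin (model.mtopology \<kappa> n) (\<sigma> \<circ> r) l sequentially" using r(1) by blast
qed

lemma T_nonneg: assumes "x \<in> T" "\<And>p. p \<in> P \<Longrightarrow> lin n b (L p) \<ge> 0" shows "lin n b (L x) \<ge> 0"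
proof -
  obtain c where c: "\<And>p. p \<in> P \<Longrightarrow> c p \<ge> 0" "L x = (\<lambda>i. \<Sum>p\<in>P. c p * L p i)" using assms(1) by (rule model_hullE) blast
  show ?thesis unfolding c(2) lin_sum using c(1) assms(2) by (intro sum_nonneg) auto
qed

text \<open>A functional that is nonnegative on \<open>P\<close> vanishes on a combination only if
  it vanishes at every point with positive coefficient.\<close>

lemma face_hull: assumes "\<And>p. p \<in> P \<Longrightarrow> lin n b (L p) \<ge> 0"
  shows "{x\<in>T. lin n b (L x) = 0} = model_hull \<kappa> n {p\<in>P. lin n b (L p) = 0}"
proof
  interpret Q: polytope \<kappa> n "{p\<in>P. lin n b (L p) = 0}" h by (rule sub) auto
  show "model_hull \<kappa> n {p\<in>P. lin n b (L p) = 0} \<subseteq> {x\<in>T. lin n b (L x) = 0}"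
  proof
    fix x assume x: "x \<in> model_hull \<kappa> n {p\<in>P. lin n b (L p) = 0}"
    have "lin n b (L x) \<ge> 0" using Q.T_nonneg[OF x, of b] by auto
    moreover have "lin n (\<lambda>i. - b i) (L x) \<ge> 0" using Q.T_nonneg[OF x, of "\<lambda>i. - b i"] by (auto simp: lin_uminus_left)
    ultimately show "x \<in> {x\<in>T. lin n b (L x) = 0}" using x hull_mono[of "{p\<in>P. lin n b (L p) = 0}"] by (auto simp: lin_uminus_left)
  qed
  show "{x\<in>T. lin n b (L x) = 0} \<subseteq> model_hull \<kappa> n {p\<in>P. lin n b (L p) = 0}"
  proof safe
    fix x assume x: "x \<in> T" "lin n b (L x) = 0"
    obtain c where c: "\<And>p. p \<in> P \<Longrightarrow> c p \<ge> 0" "L x = (\<lambda>i. \<Sum>p\<in>P. c p * L p i)" using x(1) by (rule model_hullE) blast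
    have "(\<Sum>p\<in>P. c p * lin n b (L p)) = 0" using x(2) unfolding c(2) lin_sum .
    then have z: "\<forall>p\<in>P. c p * lin n b (L p) = 0" using c(1) assms fin by (subst (asm) sum_nonneg_eq_0_iff) auto
    have "(\<Sum>p\<in>P. c p * L p i) = (\<Sum>p\<in>{p\<in>P. lin n b (L p) = 0}. c p * L p i)" for i
      using fin z by (intro sum.mono_neutral_right) auto
    then show "x \<in> model_hull \<kappa> n {p\<in>P. lin n b (L p) = 0}" using c x T_sub PM by (intro model_hullI[where c=c]) auto
  qed
qed

lemma faceE: assumes "face_of_cell \<kappa> n F T"
  obtains b where "\<And>x. x \<in> T \<Longrightarrow> lin n b (L x) \<ge> 0" "F = {x\<in>T. lin n b (L x) = 0}" "F \<noteq> {}"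
  using assms unfolding face_iff[OF T_sub] by blast

lemma face_compact: assumes "face_of_cell \<kappa> n F T" shows "compactin (model.mtopology \<kappa> n) F"
proof -
  obtain b where b: "\<And>x. x \<in> T \<Longrightarrow> lin n b (L x) \<ge> 0" "F = {x\<in>T. lin n b (L x) = 0}" "F \<noteq> {}" using assms by (rule faceE) blast
  have "F = model_hull \<kappa> n {p\<in>P. lin n b (L p) = 0}" unfolding b(2) using b(1) P_sub_T by (intro face_hull) auto
  moreover have "polytope \<kappa> n {p\<in>P. lin n b (L p) = 0} h" by (rule sub) auto
  ultimately show ?thesis using polytope.T_compact by metis
qed

lemma face_self: "T \<noteq> {} \<Longrightarrow> face_of_cell \<kappa> n T T"
  unfolding face_iff[OF T_sub] by (intro conjI exI[of _ "\<lambda>_. 0"]) (auto simp: lin_def)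

text \<open>Average the representations that are positive at the individual points of
  \<open>Q\<close>.\<close>

lemma positive_coeffs:
  assumes x: "x \<in> T"
  defines "Q \<equiv> {q\<in>P. \<exists>c. (\<forall>p\<in>P. c p \<ge> 0) \<and> L x = (\<lambda>i. \<Sum>p\<in>P. c p * L p i) \<and> c q > 0}"
  shows "\<exists>c. (\<forall>p\<in>P. c p \<ge> 0) \<and> L x = (\<lambda>i. \<Sum>p\<in>P. c p * L p i) \<and> (\<forall>q\<in>Q. c q > 0)"
proof -
  have finQ: "finite Q" using fin by (simp add: Q_def)
  show ?thesis
  proof (cases "Q = {}")
    case True then show ?thesis using x by (auto simp: model_hull_def)
  next
    case False
    have "\<forall>q\<in>Q. \<exists>c. (\<forall>p\<in>P. c p \<ge> 0) \<and> L x = (\<lambda>i. \<Sum>p\<in>P. c p * L p i) \<and> c q > 0" by (simp add: Q_def)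
    then obtain c where c: "\<And>q. q \<in> Q \<Longrightarrow> \<forall>p\<in>P. c q p \<ge> 0" "\<And>q. q \<in> Q \<Longrightarrow> L x = (\<lambda>i. \<Sum>p\<in>P. c q p * L p i)" "\<And>q. q \<in> Q \<Longrightarrow> c q q > 0" by metis
    define m where "m = real (card Q)"
    have m: "m > 0" using False finQ by (simp add: m_def card_gt_0_iff)
    define e where "e p = (\<Sum>q\<in>Q. c q p) / m" for p
    have "e p \<ge> 0" if "p \<in> P" for p unfolding e_def using c(1) that m by (intro divide_nonneg_pos sum_nonneg) auto
    moreover have "e q > 0" if "q \<in> Q" for q unfolding e_def using c(1,3) that m finQ by (intro divide_pos_pos sum_pos2[of Q q]) (auto simp: Q_def)
    moreover have "L x i = (\<Sum>p\<in>P. e p * L p i)" for i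
    proof -
      have "(\<Sum>p\<in>P. e p * L p i) = (\<Sum>q\<in>Q. \<Sum>p\<in>P. c q p * L p i) / m"
        unfolding e_def by (subst sum.swap) (simp add: sum_distrib_right sum_divide_distrib)
      also have "(\<Sum>q\<in>Q. \<Sum>p\<in>P. c q p * L p i) = (\<Sum>q\<in>Q. L x i)" using c(2) by (intro sum.cong) (auto dest: fun_cong[of _ _ i])
      finally show ?thesis using m by (simp add: m_def)
    qed
    ultimately show ?thesis by (intro exI[of _ e]) auto
  qed
qed

end

lemma sum_times_singleton: "(\<Sum>j\<in>A \<times> {b}. f j) = (\<Sum>p\<in>A. f (p, b))"
proof -
  have "A \<times> {b} = (\<lambda>p. (p, b)) ` A" by auto
  then show ?thesis by (simp add: sum.reindex inj_on_def)
qed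

context polytope
begin

text \<open>The functional found here cuts out the face whose interior contains \<open>x\<close>.\<close>

lemma support_functional:
  assumes x: "x \<in> T" and c: "\<And>p. p \<in> P \<Longrightarrow> c p \<ge> 0" "L x = (\<lambda>i. \<Sum>p\<in>P. c p * L p i)" "\<And>q. q \<in> Q \<Longrightarrow> c q > 0"
    and Q: "Q = {q\<in>P. \<exists>c. (\<forall>p\<in>P. c p \<ge> 0) \<and> L x = (\<lambda>i. \<Sum>p\<in>P. c p * L p i) \<and> c q > 0}"
  shows "\<exists>b. (\<forall>p\<in>P. lin n b (L p) \<ge> 0) \<and> (\<forall>p\<in>P. lin n b (L p) = 0 \<longleftrightarrow> p \<in> Q)"
proof -
  have QP: "Q \<subseteq> P" and finQ: "finite Q" using fin by (auto simp: Q)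
  have one: "\<exists>b. (\<forall>p\<in>P. lin n b (L p) \<ge> 0) \<and> (\<forall>p\<in>Q. lin n b (L p) = 0) \<and> lin n b (L p0) > 0" if p0: "p0 \<in> P - Q" for p0
  proof -
    \<comment> \<open>The tag distinguishes \<open>P\<close> from the negatives of \<open>Q\<close>:
      a functional nonnegative on all these vectors is nonnegative on \<open>P\<close> and zero on
      \<open>Q\<close>.\<close>
    define I where "I = P \<times> {True} \<union> Q \<times> {False}"
    define v where "v j = (\<lambda>i. (if snd j then 1 else -1) * L (fst j) i)" for j :: "(nat \<Rightarrow> real) \<times> bool"
    have "finite I" using fin finQ by (simp add: I_def)
    moreover have "\<nexists>e. (\<forall>j\<in>I. e j \<ge> (0::real)) \<and> (\<forall>i\<le>n. - L p0 i = (\<Sum>j\<in>I. e j * v j i))"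
    proof
      assume "\<exists>e. (\<forall>j\<in>I. e j \<ge> (0::real)) \<and> (\<forall>i\<le>n. - L p0 i = (\<Sum>j\<in>I. e j * v j i))"
      then obtain e where e: "\<And>j. j \<in> I \<Longrightarrow> e j \<ge> 0" "\<And>i. i \<le> n \<Longrightarrow> - L p0 i = (\<Sum>j\<in>I. e j * v j i)" by blast
      define f where "f p = e (p, True) + (if p = p0 then 1 else 0) - (if p \<in> Q then e (p, False) else 0)" for p
      have zero: "(\<Sum>p\<in>P. f p * L p i) = 0" if "i \<le> n" for i
      proof -
        have "(\<Sum>j\<in>I. e j * v j i) = (\<Sum>j\<in>P \<times> {True}. e j * v j i) + (\<Sum>j\<in>Q \<times> {False}. e j * v j i)"
          unfolding I_def using fin finQ by (intro sum.union_disjoint) auto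
        also have "(\<Sum>j\<in>P \<times> {True}. e j * v j i) = (\<Sum>p\<in>P. e (p, True) * L p i)"
          by (simp add: sum_times_singleton v_def)
        also have "(\<Sum>j\<in>Q \<times> {False}. e j * v j i) = (\<Sum>p\<in>Q. - (e (p, False) * L p i))"
          by (simp add: sum_times_singleton v_def)
        also have "\<dots> = (\<Sum>p\<in>P. - ((if p \<in> Q then e (p, False) else 0) * L p i))"
          using fin QP by (intro sum.mono_neutral_cong_left) auto
        finally have "- L p0 i = (\<Sum>p\<in>P. e (p, True) * L p i) + (\<Sum>p\<in>P. - ((if p \<in> Q then e (p, False) else 0) * L p i))"
          using e(2)[OF that] by simp
        moreover have "(\<Sum>p\<in>P. (if p = p0 then 1 else 0) * L p i) = L p0 i"
          using fin p0 by (subst sum.remove[of P p0]) auto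
        ultimately show ?thesis unfolding f_def by (simp add: left_diff_distrib distrib_right sum.distrib sum_subtractf sum_negf)
      qed
      \<comment> \<open>The step \<open>s\<close> is so small that adding \<open>s * f\<close>
        cannot make the positive coefficients on \<open>Q\<close> negative.\<close>
      define s where "s = Min (insert 1 ((\<lambda>q. c q / (1 + \<bar>f q\<bar>)) ` Q))"
      have s0: "s > 0" unfolding s_def using finQ c(3) by (auto intro!: divide_pos_pos)
      have sq: "s * \<bar>f q\<bar> \<le> c q" if "q \<in> Q" for q
      proof -
        have "s \<le> c q / (1 + \<bar>f q\<bar>)" unfolding s_def using finQ that by (intro Min_le) auto
        then have "s * (1 + \<bar>f q\<bar>) \<le> c q" by (simp add: pos_le_divide_eq)
        then show ?thesis using s0 by (simp add: distrib_left)
      qed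
      have "c p + s * f p \<ge> 0" if p: "p \<in> P" for p
      proof (cases "p \<in> Q")
        case True
        have "- (s * f p) \<le> s * \<bar>f p\<bar>" using s0 mult_left_mono[of "- f p" "\<bar>f p\<bar>" s] by auto
        then show ?thesis using sq[OF True] by linarith
      next
        case False
        then have "f p \<ge> 0" using e(1)[of "(p, True)"] p by (auto simp: f_def I_def)
        then show ?thesis using c(1)[OF p] s0 by simp
      qed
      moreover have "c p0 + s * f p0 > 0"
      proof -
        have "f p0 \<ge> 1" using e(1)[of "(p0, True)"] p0 by (auto simp: f_def I_def)
        then have "s * f p0 > 0" using s0 by simp
        then show ?thesis using c(1)[of p0] p0 by simp
      qed
      moreover have "L x i = (\<Sum>p\<in>P. (c p + s * f p) * L p i)" for i
      proof (cases "i \<le> n")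
        case True
        have "(\<Sum>p\<in>P. (c p + s * f p) * L p i) = (\<Sum>p\<in>P. c p * L p i) + s * (\<Sum>p\<in>P. f p * L p i)"
          by (simp add: distrib_right sum.distrib sum_distrib_left mult.assoc)
        then show ?thesis using zero[OF True] c(2) by simp
      next
        case False
        then have "L x i = 0" "\<And>p. p \<in> P \<Longrightarrow> L p i = 0" using lift_supp x T_sub PM by auto
        then show ?thesis by simp
      qed
      ultimately have "\<exists>c. (\<forall>p\<in>P. c p \<ge> 0) \<and> L x = (\<lambda>i. \<Sum>p\<in>P. c p * L p i) \<and> c p0 > 0"
        by (intro exI[of _ "\<lambda>p. c p + s * f p"]) auto
      then show False using p0 by (simp add: Q)
    qed
    ultimately obtain b where b: "\<And>j. j \<in> I \<Longrightarrow> lin n b (v j) \<ge> 0" "lin n b (\<lambda>i. - L p0 i) < 0" using farkas[of I n "\<lambda>i. - L p0 i" v] by blast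
    have neg: "lin n b (\<lambda>i. - L p i) = - lin n b (L p)" for p by (simp add: lin_def sum_negf)
    have pos: "lin n b (L p) \<ge> 0" if "p \<in> P" for p using b(1)[of "(p, True)"] that by (simp add: I_def v_def)
    moreover have "lin n b (L p) = 0" if "p \<in> Q" for p using b(1)[of "(p, False)"] that neg pos[of p] QP by (auto simp: I_def v_def)
    ultimately show ?thesis using b(2) neg by (intro exI[of _ b]) auto
  qed
  then obtain B where B: "\<And>p0 p. p0 \<in> P - Q \<Longrightarrow> p \<in> P \<Longrightarrow> lin n (B p0) (L p) \<ge> 0" "\<And>p0 p. p0 \<in> P - Q \<Longrightarrow> p \<in> Q \<Longrightarrow> lin n (B p0) (L p) = 0"
    "\<And>p0. p0 \<in> P - Q \<Longrightarrow> lin n (B p0) (L p0) > 0" by metis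
  define b where "b = (\<lambda>i. \<Sum>p\<in>P - Q. B p i)"
  have b: "lin n b x = (\<Sum>p\<in>P - Q. lin n (B p) x)" for x
    using lin_sum[where b=x and I="P - Q" and c="\<lambda>_. 1" and v=B] by (simp add: b_def lin_sym[of n _ x])
  have "lin n b (L p) \<ge> 0" if "p \<in> P" for p unfolding b using B(1) that by (intro sum_nonneg) auto
  moreover have "lin n b (L p) = 0" if "p \<in> Q" for p unfolding b using B(2) that by (intro sum.neutral) auto
  moreover have "lin n b (L p) > 0" if "p \<in> P" "p \<notin> Q" for p unfolding b using B(1,3) that fin by (intro sum_pos2[of _ p]) auto
  ultimately show ?thesis by (intro exI[of _ b]) force
qed

text \<open>The face is spanned by the points that can occur with positive coefficient. Positive
  coefficients tolerate small changes, and by \<open>span_bounded_coeffs\<close> such changes reach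
  all nearby points of the plane.\<close>

lemma interior_face_exists:
  assumes x: "x \<in> T"
  shows "\<exists>F. face_of_cell \<kappa> n F T \<and> x \<in> cell_interior \<kappa> n F"
proof -
  define Q where "Q = {q\<in>P. \<exists>c. (\<forall>p\<in>P. c p \<ge> 0) \<and> L x = (\<lambda>i. \<Sum>p\<in>P. c p * L p i) \<and> c q > 0}"
  obtain c where c: "\<And>p. p \<in> P \<Longrightarrow> c p \<ge> 0" "L x = (\<lambda>i. \<Sum>p\<in>P. c p * L p i)" "\<And>q. q \<in> Q \<Longrightarrow> c q > 0"
    using positive_coeffs[OF x] unfolding Q_def by blast
  have finQ: "finite Q" and QP: "Q \<subseteq> P" using fin by (auto simp: Q_def)
  obtain b where b: "\<And>p. p \<in> P \<Longrightarrow> lin n b (L p) \<ge> 0" "\<And>p. p \<in> P \<Longrightarrow> lin n b (L p) = 0 \<longleftrightarrow> p \<in> Q"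
    using support_functional[OF x c Q_def] by blast
  define F where "F = {y\<in>T. lin n b (L y) = 0}"
  have c0: "c p = 0" if "p \<in> P" "p \<notin> Q" for p
  proof (rule ccontr)
    assume "c p \<noteq> 0"
    then have "c p > 0" using c(1)[OF that(1)] by linarith
    then have "p \<in> Q" using c(1,2) that(1) unfolding Q_def by blast
    then show False using that(2) by contradiction
  qed
  have FQ: "F = model_hull \<kappa> n Q"
  proof -
    have "{p\<in>P. lin n b (L p) = 0} = Q" using b(2) QP by auto
    then show ?thesis unfolding F_def using face_hull[OF b(1)] by simp
  qed
  have LQ: "L x i = (\<Sum>p\<in>Q. c p * L p i)" for i
    unfolding c(2) using fin QP c0 by (intro sum.mono_neutral_right) auto
  have xF: "x \<in> F" unfolding FQ using x T_sub QP PM c(1) LQ by (intro model_hullI[where c=c]) auto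
  have face: "face_of_cell \<kappa> n F T" unfolding face_iff[OF T_sub] using xF b(1) T_nonneg by (intro conjI exI[of _ b]) (auto simp: F_def)
  obtain K where K: "K \<ge> 0" "\<And>y. (\<And>b. (\<forall>q\<in>Q. lin n b (L q) = 0) \<Longrightarrow> lin n b y = 0) \<Longrightarrow>
    \<exists>d. (\<forall>i\<le>n. y i = (\<Sum>q\<in>Q. d q * L q i)) \<and> (\<forall>q\<in>Q. \<bar>d q\<bar> \<le> K * (\<Sum>i\<le>n. \<bar>y i\<bar>))"
    using span_bounded_coeffs[OF finQ, of n L] by blast
  define m where "m = Min (insert 1 (c ` Q))"
  have m: "m > 0" "\<And>q. q \<in> Q \<Longrightarrow> m \<le> c q" unfolding m_def using finQ c(3) by auto
  \<comment> \<open>With \<open>n + 1\<close> coordinate differences below \<open>\<delta>\<close>,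
    each coefficient changes by at most \<open>m\<close>; \<open>K + 1\<close> instead of
    \<open>K\<close> avoids a division by zero.\<close>
  define \<delta> where "\<delta> = m / ((K + 1) * (real n + 1))"
  have \<delta>: "\<delta> > 0" using m K by (simp add: \<delta>_def)
  obtain e where e: "e > 0" "\<And>y. y \<in> M \<Longrightarrow> d x y < e \<Longrightarrow> \<forall>i\<le>n. \<bar>L y i - L x i\<bar> < \<delta>"
    using model_dist_imp_coord[of x \<kappa> n \<delta>] x T_sub \<delta> by blast
  have "y \<in> F" if y: "y \<in> plane_span \<kappa> n F" "d x y < e" for y
  proof -
    have yM: "y \<in> M" using y by (simp add: plane_span_def)
    have FM: "F \<subseteq> M" using T_sub by (auto simp: F_def)
    have "lin n b' (comb 1 (L y) (-1) (L x)) = 0" if b': "\<forall>q\<in>Q. lin n b' (L q) = 0" for b'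
    proof -
      have van: "lin n b' (L z) = 0" if z: "z \<in> F" for z
      proof -
        obtain c' where "L z = (\<lambda>i. \<Sum>p\<in>Q. c' p * L p i)" using z unfolding FQ by (rule model_hullE) blast
        then show ?thesis using b' by (simp add: lin_sum)
      qed
      then show ?thesis using plane_span_lin[OF FM y(1) van] van[OF xF] by (simp add: lin_comb)
    qed
    from K(2)[OF this] obtain g where g: "\<And>i. i \<le> n \<Longrightarrow> comb 1 (L y) (-1) (L x) i = (\<Sum>q\<in>Q. g q * L q i)"
      "\<And>q. q \<in> Q \<Longrightarrow> \<bar>g q\<bar> \<le> K * (\<Sum>i\<le>n. \<bar>comb 1 (L y) (-1) (L x) i\<bar>)" by blast
    have "(\<Sum>i\<le>n. \<bar>comb 1 (L y) (-1) (L x) i\<bar>) \<le> (\<Sum>i\<le>n. \<delta>)"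
      using e(2)[OF yM y(2)] by (intro sum_mono) (auto simp: comb_def less_imp_le)
    also have "\<dots> = (real n + 1) * \<delta>" by simp
    finally have le: "(\<Sum>i\<le>n. \<bar>comb 1 (L y) (-1) (L x) i\<bar>) \<le> (real n + 1) * \<delta>" .
    have gm: "\<bar>g q\<bar> \<le> m" if "q \<in> Q" for q
    proof -
      have "\<bar>g q\<bar> \<le> K * ((real n + 1) * \<delta>)" using g(2)[OF that] mult_left_mono[OF le K(1)] by linarith
      also have "\<dots> \<le> (K + 1) * ((real n + 1) * \<delta>)" using \<delta> by (intro mult_right_mono) auto
      also have "\<dots> = m" using K(1) by (simp add: \<delta>_def)
      finally show ?thesis .
    qed
    have "L y i = (\<Sum>q\<in>Q. (c q + g q) * L q i)" if "i \<le> n" for i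
      using g(1)[OF that] LQ[of i] by (simp add: comb_def distrib_right sum.distrib)
    moreover have "c q + g q \<ge> 0" if "q \<in> Q" for q using gm[OF that] m(2)[OF that] by linarith
    ultimately show "y \<in> F" unfolding FQ using yM QP PM by (intro model_hullI[where c="\<lambda>q. c q + g q"]) auto
  qed
  then have "x \<in> cell_interior \<kappa> n F" unfolding cell_interior_def using xF e(1) by blast
  then show ?thesis using face by blast
qed

text \<open>An interior point of \<open>G\<close> allows a small move beyond \<open>x\<close>, away
  from \<open>g\<close>, within \<open>G\<close>. The functional of \<open>F\<close> is 0 at
  \<open>x\<close> and nonnegative at the new point, hence nonpositive at \<open>g\<close>.\<close>

lemma face_contains:
  assumes F: "face_of_cell \<kappa> n F T" and G: "face_of_cell \<kappa> n G T" and x: "x \<in> F" "x \<in> cell_interior \<kappa> n G"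
  shows "G \<subseteq> F"
proof
  fix g assume g: "g \<in> G"
  obtain b where b: "\<And>x. x \<in> T \<Longrightarrow> lin n b (L x) \<ge> 0" "F = {x\<in>T. lin n b (L x) = 0}" "F \<noteq> {}" using F by (rule faceE) blast
  have GT: "G \<subseteq> T" using G by (auto elim: faceE)
  have GM: "G \<subseteq> M" using GT T_sub by blast
  obtain e where e: "e > 0" "\<And>y. y \<in> plane_span \<kappa> n G \<Longrightarrow> d x y < e \<Longrightarrow> y \<in> G" and xG: "x \<in> G" using x(2) by (auto simp: cell_interior_def)
  have xM: "x \<in> M" and gM: "g \<in> M" using xG g GM by auto
  \<comment> \<open>The point slightly beyond \<open>x\<close> on the line from \<open>g\<close>,
    before renormalisation.\<close>
  define w where "w s = comb (1 + s) (L x) (- s) (L g)" for s :: real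
  have "\<forall>\<^sub>F s in at_right 0. \<exists>r>0. \<exists>z\<in>M. L z = (\<lambda>i. r * w s i) \<and> d x z < e"
  proof (rule normalize_near[OF xM e(1)])
    fix i show "((\<lambda>s. w s i) \<longlongrightarrow> L x i) (at_right 0)"
    proof -
      have "((\<lambda>s. (1 + s) * L x i + - s * L g i) \<longlongrightarrow> (1 + 0) * L x i + - 0 * L g i) (at_right 0)" by (intro tendsto_intros)
      then show ?thesis by (simp add: w_def comb_def)
    qed
  qed (use lift_supp xM gM in \<open>simp add: w_def comb_def\<close>)
  moreover have "\<forall>\<^sub>F s in at_right (0::real). s > 0" by (simp add: eventually_at_right_less)
  ultimately have "\<forall>\<^sub>F s in at_right 0. s > 0 \<and> (\<exists>r>0. \<exists>z\<in>M. L z = (\<lambda>i. r * w s i) \<and> d x z < e)" by eventually_elim auto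
  from eventually_happens'[OF trivial_limit_at_right_real this]
  obtain s r z where s: "s > 0" "r > 0" "z \<in> M" "L z = (\<lambda>i. r * w s i)" "d x z < e" by blast
  have linz: "lin n b' (L z) = r * ((1 + s) * lin n b' (L x) - s * lin n b' (L g))" for b'
  proof -
    have "L z = comb r (w s) 0 (w s)" unfolding s(4) by (simp add: comb_def)
    then show ?thesis by (simp add: lin_comb w_def)
  qed
  have "z \<in> plane_span \<kappa> n G" using linz xG g by (intro plane_spanI[OF GM s(3)]) simp
  then have "z \<in> T" using e(2) s(5) GT by blast
  then have "r * ((1 + s) * lin n b (L x) - s * lin n b (L g)) \<ge> 0" using b(1) linz by metis
  moreover have "lin n b (L x) = 0" using x(1) b(2) by simp
  ultimately have "r * (s * lin n b (L g)) \<le> 0" by simp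
  then have "lin n b (L g) \<le> 0" using s(1,2) by (simp add: mult_le_0_iff)
  then show "g \<in> F" using b(1)[of g] b(2) g GT by auto
qed

text \<open>Take the renormalised sum of all generators: a face through it contains every generator
  and is therefore the whole cell.\<close>

lemma interior_nonempty: assumes "P \<noteq> {}" shows "cell_interior \<kappa> n T \<noteq> {}"
proof -
  obtain p where p: "p \<in> P" using assms by blast
  obtain r z where z: "r > 0" "z \<in> T" "L z = (\<lambda>i. r * (\<Sum>p\<in>P. 1 * L p i))" using cone_normalize[of "\<lambda>_. 1" p] p by auto
  obtain F where F: "face_of_cell \<kappa> n F T" "z \<in> cell_interior \<kappa> n F" using interior_face_exists[OF z(2)] by blast
  obtain b where b: "\<And>x. x \<in> T \<Longrightarrow> lin n b (L x) \<ge> 0" "F = {x\<in>T. lin n b (L x) = 0}" "F \<noteq> {}" using F(1) by (rule faceE) blast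
  have "z \<in> F" using F(2) by (simp add: cell_interior_def)
  then have "lin n b (L z) = 0" using b(2) by simp
  moreover have "L z = (\<lambda>i. \<Sum>p\<in>P. r * L p i)" using z(3) by (simp add: sum_distrib_left)
  ultimately have "(\<Sum>p\<in>P. r * lin n b (L p)) = 0" by (simp add: lin_sum)
  then have "\<forall>p\<in>P. r * lin n b (L p) = 0" using z(1) b(1) P_sub_T fin by (subst (asm) sum_nonneg_eq_0_iff) auto
  then have p0: "lin n b (L p) = 0" if "p \<in> P" for p using z(1) that by simp
  have "T \<subseteq> F"
  proof
    fix x assume x: "x \<in> T"
    then obtain c where "L x = (\<lambda>i. \<Sum>p\<in>P. c p * L p i)" by (rule model_hullE) blast
    then have "lin n b (L x) = 0" using p0 by (simp add: lin_sum)
    then show "x \<in> F" using x b(2) by simp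
  qed
  then have "F = T" using b(2) by auto
  then show ?thesis using F(2) by auto
qed

text \<open>The face with \<open>z\<close> in its interior contains \<open>w\<close>, because its
  functional is nonnegative on both summands and \<open>w\<close> has positive weight; a face
  through an interior point is the whole cell.\<close>

lemma interior_cone: assumes w: "w \<in> cell_interior \<kappa> n T" and x: "x \<in> T" and z: "z \<in> T" "L z = comb a (L x) b (L w)" "a \<ge> 0" "b > 0"
  shows "z \<in> cell_interior \<kappa> n T"
proof -
  obtain F where F: "face_of_cell \<kappa> n F T" "z \<in> cell_interior \<kappa> n F" using interior_face_exists[OF z(1)] by blast
  obtain f where f: "\<And>x. x \<in> T \<Longrightarrow> lin n f (L x) \<ge> 0" "F = {x\<in>T. lin n f (L x) = 0}" "F \<noteq> {}" using F(1) by (rule faceE) blast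
  have wT: "w \<in> T" using w by (simp add: cell_interior_def)
  have "z \<in> F" using F(2) by (simp add: cell_interior_def)
  then have "a * lin n f (L x) + b * lin n f (L w) = 0" using f(2) z(2) by (simp add: lin_comb)
  moreover have "a * lin n f (L x) \<ge> 0" "b * lin n f (L w) \<ge> 0" using z(3,4) f(1) x wT by auto
  ultimately have "lin n f (L w) = 0" using z(4) by (auto simp: add_nonneg_eq_0_iff)
  then have "w \<in> F" using wT f(2) by simp
  then have "T \<subseteq> F" using face_contains[OF F(1) face_self] w wT by blast
  then have "F = T" using f(2) by auto
  then show ?thesis using F(2) by simp
qed

lemma interior_segment: assumes "w \<in> cell_interior \<kappa> n T" "x \<in> T" "z \<in> M" "d x z + d z w = d x w" "z \<noteq> x"
  shows "z \<in> cell_interior \<kappa> n T"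
proof -
  have wT: "w \<in> T" using assms(1) by (simp add: cell_interior_def)
  have M: "x \<in> M" "w \<in> M" using assms(2) wT T_sub by auto
  have zT: "z \<in> T" using T_between[OF assms(2) wT assms(3,4)] .
  obtain a b where ab: "a \<ge> 0" "b \<ge> 0" "L z = comb a (L x) b (L w)"
    using model_dist_between[OF M sideT[OF assms(2)] sideT[OF wT] assms(3,4)] by blast
  show ?thesis
  proof (cases "b = 0")
    case True
    have lz: "L z = comb a (L x) 0 (L x)" using ab(3) True by (simp add: comb_def)
    have "d x z + d z x = d x x" using model_dist_seg[OF M(1) M(1) sideT[OF assms(2)] sideT[OF assms(2)] assms(3) lz ab(1)] by simp
    then have "d x z = 0" using model_dist_self[OF M(1)] model_dist_nonneg[OF M(1) assms(3)] model_dist_nonneg[OF assms(3) M(1)] by simp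
    then show ?thesis using model_dist_zero_imp[OF M(1) assms(3)] assms(5) by simp
  next
    case False
    then show ?thesis using interior_cone[OF assms(1,2) zT ab(3,1)] ab(2) by simp
  qed
qed

text \<open>Move from \<open>x\<close> by \<open>e / 2\<close> along the geodesic to some interior
  point.\<close>

lemma interior_dense: assumes "P \<noteq> {}" "x \<in> T" "e > 0" shows "\<exists>z\<in>cell_interior \<kappa> n T. d x z < e"
proof -
  obtain w where w: "w \<in> cell_interior \<kappa> n T" using interior_nonempty[OF assms(1)] by blast
  have wT: "w \<in> T" using w by (simp add: cell_interior_def)
  have M: "x \<in> M" "w \<in> M" using assms(2) wT T_sub by auto
  show ?thesis
  proof (cases "d x w < e")
    case True then show ?thesis using w by blast
  next
    case False
    obtain c where c: "geodesic_path M d c x w" using model_dist_geodesic[OF M sideT[OF assms(2)] sideT[OF wT]] by blast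
    have t: "e / 2 \<in> {0..d x w}" "0 \<in> {0..d x w}" "d x w \<in> {0..d x w}" using False assms(3) by auto
    have "d (c 0) (c (e / 2)) = \<bar>0 - e / 2\<bar>" "d (c (e / 2)) (c (d x w)) = \<bar>e / 2 - d x w\<bar>" using c t unfolding geodesic_path_def by blast+
    then have *: "d x (c (e / 2)) = e / 2" "d (c (e / 2)) w = d x w - e / 2" using c t assms(3) by (auto simp: geodesic_path_def)
    have "c (e / 2) \<in> M" using c t by (auto simp: geodesic_path_def)
    moreover have "c (e / 2) \<noteq> x" using * assms(3) model_dist_self[OF M(1)] by auto
    ultimately have "c (e / 2) \<in> cell_interior \<kappa> n T" using interior_segment[OF w assms(2)] * by simp
    then show ?thesis using * assms(3) by (intro bexI[of _ "c (e / 2)"]) auto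
  qed
qed

section \<open>Extreme points and isometries of a cell\<close>

text \<open>The condition is phrased by distances only, so isometries of the cell preserve
  it.\<close>

definition extreme :: "(nat \<Rightarrow> real) \<Rightarrow> bool" where
  "extreme p \<longleftrightarrow> p \<in> T \<and> (\<forall>y\<in>T. \<forall>z\<in>T. d y p + d p z = d y z \<longrightarrow> p = y \<or> p = z)"

lemma pair_comb: assumes "x \<in> T" "y \<in> T" "z \<in> T" "a \<ge> 0" "b \<ge> 0" "L z = comb a (L x) b (L y)" shows "d x z + d z y = d x y"
  using model_dist_seg[of x \<kappa> n y h z a b] assms sideT T_sub by blast

lemma extreme_in_P: assumes "extreme p" shows "p \<in> P"
proof -
  have "p \<in> P \<or> p \<in> T - {p}"
  proof (rule ccontr)
    assume "\<not> ?thesis"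
    then have pP: "p \<notin> P" by simp
    have "p \<in> T - {p}"
    proof (rule pair_induct[of p "T - {p}"])
      show "p \<in> T" using assms by (simp add: extreme_def)
      show "P \<subseteq> T - {p}" using P_sub_T pP by blast
      fix x y z a b
      assume a: "x \<in> T - {p}" "y \<in> T - {p}" "x \<in> T" "y \<in> T" "z \<in> T" "0 \<le> a" "0 \<le> b" "L z = comb a (L x) b (L y)"
      then have "d x z + d z y = d x y" using pair_comb by blast
      then have "z \<noteq> p" using assms a unfolding extreme_def by auto
      then show "z \<in> T - {p}" using a by simp
    qed
    then show False by simp
  qed
  then show ?thesis by simp
qed

text \<open>Expanding \<open>y\<close> and \<open>z\<close> expresses \<open>p\<close> by the
  generators with coefficients \<open>g\<close>. If \<open>g p < 1\<close>, the equation solves for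
  \<open>p\<close> in terms of the others, against minimality; otherwise the half-space functional
  forces the other coefficients to vanish, and \<open>y\<close> or \<open>z\<close> coincides with
  \<open>p\<close>.\<close>

lemma minimal_extreme:
  assumes min: "\<And>p. p \<in> P \<Longrightarrow> p \<notin> model_hull \<kappa> n (P - {p})" and p: "p \<in> P"
  shows "extreme p"
  unfolding extreme_def
proof (intro conjI ballI impI)
  show pT: "p \<in> T" using p P_sub_T by auto
  have pM: "p \<in> M" using p PM by auto
  fix y z assume yz: "y \<in> T" "z \<in> T" "d y p + d p z = d y z"
  obtain a b where ab: "a \<ge> 0" "b \<ge> 0" "L p = comb a (L y) b (L z)"
    using model_dist_between[of y \<kappa> n z h p] yz T_sub sideT pM by blast
  obtain c where c: "\<And>p. p \<in> P \<Longrightarrow> c p \<ge> 0" "L y = (\<lambda>i. \<Sum>p\<in>P. c p * L p i)" using yz(1) by (rule model_hullE) blast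
  obtain e where e: "\<And>p. p \<in> P \<Longrightarrow> e p \<ge> 0" "L z = (\<lambda>i. \<Sum>p\<in>P. e p * L p i)" using yz(2) by (rule model_hullE) blast
  define g where "g q = a * c q + b * e q" for q
  have g: "g q \<ge> 0" if "q \<in> P" for q using ab c e that by (simp add: g_def)
  have "L p i = (\<Sum>q\<in>P. g q * L q i)" for i
    unfolding ab(3) c(2) e(2) comb_def g_def by (simp add: distrib_right sum.distrib sum_distrib_left mult.assoc)
  then have Lp: "(1 - g p) * L p i = (\<Sum>q\<in>P - {p}. g q * L q i)" for i
    using sum.remove[OF fin p, of "\<lambda>q. g q * L q i"] by (simp add: left_diff_distrib)
  have "(\<lambda>i. (1 - g p) * L p i) = (\<lambda>i. \<Sum>q\<in>P - {p}. g q * L q i)" using Lp by blast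
  then have "lin n h (\<lambda>i. (1 - g p) * L p i) = (\<Sum>q\<in>P - {p}. g q * lin n h (L q))" by (simp add: lin_sum)
  moreover have "lin n h (\<lambda>i. (1 - g p) * L p i) = (1 - g p) * lin n h (L p)" by (simp add: lin_def sum_distrib_left mult.left_commute)
  ultimately have H: "(1 - g p) * lin n h (L p) = (\<Sum>q\<in>P - {p}. g q * lin n h (L q))" by simp
  have "\<not> 1 - g p > 0"
  proof
    assume pos: "1 - g p > 0"
    have "L p i = (\<Sum>q\<in>P - {p}. (g q / (1 - g p)) * L q i)" for i
    proof -
      have "L p i = ((1 - g p) * L p i) / (1 - g p)" using pos by simp
      also have "\<dots> = (\<Sum>q\<in>P - {p}. (g q / (1 - g p)) * L q i)" unfolding Lp by (simp add: sum_divide_distrib)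
      finally show ?thesis .
    qed
    then have "p \<in> model_hull \<kappa> n (P - {p})" using g pos pM PM by (intro model_hullI[where c="\<lambda>q. g q / (1 - g p)"]) auto
    then show False using min[OF p] by contradiction
  qed
  then have "(\<Sum>q\<in>P - {p}. g q * lin n h (L q)) \<le> 0" using H side[OF p] mult_nonpos_nonneg[of "1 - g p" "lin n h (L p)"] by linarith
  moreover have nn: "\<And>q. q \<in> P - {p} \<Longrightarrow> g q * lin n h (L q) \<ge> 0" using g side by (simp add: less_imp_le)
  ultimately have "(\<Sum>q\<in>P - {p}. g q * lin n h (L q)) = 0" using sum_nonneg[of "P - {p}" "\<lambda>q. g q * lin n h (L q)"] by (meson order_antisym)
  then have "\<forall>q\<in>P - {p}. g q * lin n h (L q) = 0" using nn fin by (subst (asm) sum_nonneg_eq_0_iff) auto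
  then have g0: "g q = 0" if "q \<in> P - {p}" for q using side that by force
  show "p = y \<or> p = z"
  proof (cases "a > 0")
    case True
    have "c q = 0" if "q \<in> P - {p}" for q
    proof -
      have "a * c q + b * e q = 0" "a * c q \<ge> 0" "b * e q \<ge> 0" using g0[OF that] ab c(1)[of q] e(1)[of q] that by (auto simp: g_def)
      then show ?thesis using True by (auto simp: add_nonneg_eq_0_iff)
    qed
    then have "L y = comb (c p) (L p) 0 (L p)" unfolding c(2) using fin p by (auto simp: comb_def sum.remove[of P p])
    then have "d p y + d y p = d p p" using pair_comb[OF pT pT yz(1), of "c p" 0] c(1)[OF p] by simp
    then have "d p y = 0" using model_dist_self[OF pM] model_dist_nonneg[OF pM, of y] model_dist_nonneg[of y \<kappa> n p] pM yz(1) T_sub by auto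
    then show ?thesis using model_dist_zero_imp[OF pM, of y] yz(1) T_sub by auto
  next
    case False
    then have "L p = comb b (L z) 0 (L z)" using ab by (simp add: comb_def)
    then have "d z p + d p z = d z z" using pair_comb[OF yz(2) yz(2) pT, of b 0] ab by simp
    then have "d z p = 0" using model_dist_self[of z] model_dist_nonneg[OF pM, of z] model_dist_nonneg[of z \<kappa> n p] pM yz(2) T_sub by auto
    then show ?thesis using model_dist_zero_imp[of z \<kappa> n p] pM yz(2) T_sub by auto
  qed
qed

lemma minimal_generators: "\<exists>Q\<subseteq>P. model_hull \<kappa> n Q = T \<and> (\<forall>q\<in>Q. q \<notin> model_hull \<kappa> n (Q - {q}))"
proof -
  define m where "m = (LEAST k. \<exists>Q\<subseteq>P. model_hull \<kappa> n Q = T \<and> card Q = k)"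
  have "\<exists>k. \<exists>Q\<subseteq>P. model_hull \<kappa> n Q = T \<and> card Q = k" by blast
  then have "\<exists>Q\<subseteq>P. model_hull \<kappa> n Q = T \<and> card Q = m" unfolding m_def by (rule LeastI_ex)
  then obtain Q where Q: "Q \<subseteq> P" "model_hull \<kappa> n Q = T" "card Q = m" by blast
  interpret Q: polytope \<kappa> n Q h using Q(1) by (rule sub)
  have "q \<notin> model_hull \<kappa> n (Q - {q})" if q: "q \<in> Q" for q
  proof
    assume qh: "q \<in> model_hull \<kappa> n (Q - {q})"
    interpret R: polytope \<kappa> n "Q - {q}" h by (rule Q.sub) auto
    have "Q \<subseteq> model_hull \<kappa> n (Q - {q})" using qh R.P_sub_T by blast
    then have "model_hull \<kappa> n Q \<subseteq> model_hull \<kappa> n (Q - {q})" using Q.T_subset_convex[OF R.T_geodesically_convex] by blast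
    then have "model_hull \<kappa> n (Q - {q}) = T" using Q.hull_mono[of "Q - {q}"] Q(2) by auto
    then have "m \<le> card (Q - {q})" unfolding m_def using Q(1) by (intro Least_le) blast
    then show False using Q(3) card_Diff1_less[OF Q.fin q] by simp
  qed
  then show ?thesis using Q by blast
qed

lemma isometries_agree:
  assumes f: "f ` T \<subseteq> T" "\<And>x y. x \<in> T \<Longrightarrow> y \<in> T \<Longrightarrow> d (f x) (f y) = d x y"
    and g: "g ` T \<subseteq> T" "\<And>x y. x \<in> T \<Longrightarrow> y \<in> T \<Longrightarrow> d (g x) (g y) = d x y"
    and e: "\<And>p. p \<in> P \<Longrightarrow> f p = g p" and x: "x \<in> T"
  shows "f x = g x"
proof -
  have "x \<in> {x\<in>T. f x = g x}"
  proof (rule pair_induct[OF x])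
    show "P \<subseteq> {x\<in>T. f x = g x}" using e P_sub_T by auto
    fix x y z a b
    assume a: "x \<in> {x\<in>T. f x = g x}" "y \<in> {x\<in>T. f x = g x}" "x \<in> T" "y \<in> T" "z \<in> T" "0 \<le> a" "0 \<le> b" "L z = comb a (L x) b (L y)"
    have s: "d x z + d z y = d x y" using pair_comb a by blast
    have T: "f x \<in> T" "f y \<in> T" "f z \<in> T" "g z \<in> T" using f(1) g(1) a by auto
    have eq: "g x = f x" "g y = f y" using a(1,2) by auto
    have "f z = g z"
    proof (rule model_dist_between_unique[of "f x" \<kappa> n "f y" h])
      show "d (f x) (f z) + d (f z) (f y) = d (f x) (f y)" using f(2) a(3-5) s by simp
      show "d (f x) (g z) + d (g z) (f y) = d (f x) (f y)" using f(2) g(2)[OF a(3,5)] g(2)[OF a(5,4)] a(3-5) s unfolding eq by simp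
      show "d (f x) (f z) = d (f x) (g z)" using f(2)[OF a(3,5)] g(2)[OF a(3,5)] unfolding eq by simp
    qed (use T T_sub sideT in auto)
    then show "z \<in> {x\<in>T. f x = g x}" using a by simp
  qed
  then show ?thesis by simp
qed

text \<open>An isometry permutes the extreme points, which are the minimal generators, and is
  determined by its values there.\<close>

lemma finite_isometries:
  "finite {restrict f T | f. f ` T = T \<and> (\<forall>x\<in>T. \<forall>y\<in>T. d (f x) (f y) = d x y)}" (is "finite ?A")
proof -
  obtain Q where Q: "Q \<subseteq> P" "model_hull \<kappa> n Q = T" "\<And>q. q \<in> Q \<Longrightarrow> q \<notin> model_hull \<kappa> n (Q - {q})" using minimal_generators by blast
  interpret Q: polytope \<kappa> n Q h using Q(1) by (rule sub)
  have ext: "Q.extreme p \<longleftrightarrow> p \<in> Q" for p using Q.extreme_in_P Q.minimal_extreme[OF Q(3)] by blast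
  have perm: "f q \<in> Q" if f: "f ` T = T" "\<forall>x\<in>T. \<forall>y\<in>T. d (f x) (f y) = d x y" and q: "q \<in> Q" for f q
  proof -
    have qT: "q \<in> T" using q Q.P_sub_T Q(2) by auto
    have "Q.extreme (f q)" unfolding Q.extreme_def Q(2)
    proof (intro conjI ballI impI)
      show "f q \<in> T" using f(1) qT by blast
      fix y z assume yz: "y \<in> T" "z \<in> T" "d y (f q) + d (f q) z = d y z"
      obtain y' z' where y': "y' \<in> T" "y = f y'" "z' \<in> T" "z = f z'" using yz(1,2) f(1) by (metis imageE)
      have "d y' q + d q z' = d y' z'" using yz(3) f(2) y' qT by simp
      then have "q = y' \<or> q = z'" using q y' ext[of q] unfolding Q.extreme_def Q(2) by blast
      then show "f q = y \<or> f q = z" using y' by auto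
    qed
    then show ?thesis using ext by blast
  qed
  have "inj_on (\<lambda>f. restrict f Q) ?A"
  proof (rule inj_onI)
    fix f g assume "f \<in> ?A" "g \<in> ?A" and r: "restrict f Q = restrict g Q"
    then obtain f' g' where f': "f = restrict f' T" "f' ` T = T" "\<forall>x\<in>T. \<forall>y\<in>T. d (f' x) (f' y) = d x y"
      and g': "g = restrict g' T" "g' ` T = T" "\<forall>x\<in>T. \<forall>y\<in>T. d (g' x) (g' y) = d x y" by blast
    have "f' q = g' q" if "q \<in> Q" for q
      using fun_cong[OF r, of q] that Q.P_sub_T unfolding Q(2) f'(1) g'(1) by auto
    then have "f' x = g' x" if "x \<in> T" for x
      using Q.isometries_agree[of f' g' x] f' g' that unfolding Q(2) by auto
    then show "f = g" unfolding f'(1) g'(1) by (auto simp: restrict_def)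
  qed
  moreover have "(\<lambda>f. restrict f Q) ` ?A \<subseteq> Q \<rightarrow>\<^sub>E Q"
  proof
    fix f0 assume "f0 \<in> (\<lambda>f. restrict f Q) ` ?A"
    then obtain f where f: "f ` T = T" "\<forall>x\<in>T. \<forall>y\<in>T. d (f x) (f y) = d x y" "f0 = restrict (restrict f T) Q" by blast
    then show "f0 \<in> Q \<rightarrow>\<^sub>E Q" using perm[OF f(1,2)] Q.P_sub_T Q(2) by auto
  qed
  moreover have "finite (Q \<rightarrow>\<^sub>E Q)" by (intro finite_PiE Q.fin)
  ultimately show ?thesis using finite_imageD finite_subset by blast
qed

end

section \<open>Automorphisms of polyhedral complexes\<close>

text \<open>Elements of \<open>complex_aut\<close> are moreover extensional; leaving this out frees
  compositions and inverses from restrictions.\<close>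

definition complex_automorphism :: "('i, 'a) cell_complex \<Rightarrow> ('a \<Rightarrow> 'a) \<Rightarrow> bool" where
  "complex_automorphism K a \<longleftrightarrow> bij_betw a (points K) (points K) \<and>
     (\<forall>x\<in>points K. \<forall>y\<in>points K. path_dist K (a x) (a y) = path_dist K x y) \<and> (`) a ` cells K = cells K"

section \<open>Cells and carriers of points in a complex\<close>

locale metric_complex = X: Metric_space "points K" "path_dist K" for K :: "('i, 'a) cell_complex" +
  assumes poly: "polyhedral_complex K" and lf: "locally_finite_complex K"
begin

abbreviation "X \<equiv> points K"
abbreviation "D \<equiv> path_dist K"
abbreviation "idx \<equiv> cell_index K"
abbreviation "att \<equiv> attach K"
abbreviation "cel \<equiv> cell K"
abbreviation "\<kappa> \<equiv> curvature K"
abbreviation "cdim \<equiv> cell_dim K"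
abbreviation "cd \<equiv> cell_dist K"

lemma cell_polytope: assumes "l \<in> idx" obtains P h where "polytope \<kappa> (cdim l) P h" "P \<noteq> {}" "cel l = model_hull \<kappa> (cdim l) P"
proof -
  have "convex_cell \<kappa> (cdim l) (cel l)" using poly[unfolded polyhedral_complex_def, THEN conjunct1] assms by (rule bspec)
  from convex_cell_polytope[OF this] show ?thesis using that by metis
qed

lemma cell_sub: "l \<in> idx \<Longrightarrow> cel l \<subseteq> model_space \<kappa> (cdim l)"
  by (elim cell_polytope) (simp add: polytope.T_sub)

lemma cell_ne: "l \<in> idx \<Longrightarrow> cel l \<noteq> {}"
  by (elim cell_polytope) (use polytope.P_sub_T in fastforce)

lemma cell_self_face: assumes "l \<in> idx" shows "cell_face K l (cel l)"
proof -
  obtain P h where "polytope \<kappa> (cdim l) P h" "cel l = model_hull \<kappa> (cdim l) P" using cell_polytope[OF assms] by metis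
  then show ?thesis using polytope.face_self cell_ne[OF assms] by fastforce
qed

lemma face_sub: "cell_face K l F \<Longrightarrow> F \<subseteq> cel l"
  by (auto simp: face_of_cell_def)

lemma cell_in_cells: "l \<in> idx \<Longrightarrow> att l ` cel l \<in> cells K"
  unfolding cells_def using cell_self_face by blast

lemma cells_sub: "c \<in> cells K \<Longrightarrow> c \<subseteq> X"
  unfolding cells_def points_def using face_sub by blast

lemma att_X: "l \<in> idx \<Longrightarrow> u \<in> cel l \<Longrightarrow> att l u \<in> X"
  by (auto simp: points_def)

lemma cd_nonneg: "l \<in> idx \<Longrightarrow> u \<in> cel l \<Longrightarrow> v \<in> cel l \<Longrightarrow> cd l u v \<ge> 0"
  using cell_sub model_dist_nonneg by blast

lemma cd_sym: "l \<in> idx \<Longrightarrow> u \<in> cel l \<Longrightarrow> v \<in> cel l \<Longrightarrow> cd l u v = cd l v u"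
  using cell_sub model_dist_sym by blast

lemma cd_self: "l \<in> idx \<Longrightarrow> u \<in> cel l \<Longrightarrow> cd l u u = 0"
  using cell_sub model_dist_self by blast

lemma cd_triangle: "l \<in> idx \<Longrightarrow> u \<in> cel l \<Longrightarrow> v \<in> cel l \<Longrightarrow> w \<in> cel l \<Longrightarrow> cd l u w \<le> cd l u v + cd l v w"
  using cell_sub model_dist_triangle by blast

lemma cell_seq_compact: assumes "l \<in> idx" "cell_face K l F" "range \<sigma> \<subseteq> F"
  shows "\<exists>u r. u \<in> F \<and> strict_mono (r :: nat \<Rightarrow> nat) \<and> (\<forall>e>0. \<exists>N. \<forall>k\<ge>N. cd l (\<sigma> (r k)) u < e)"
proof -
  obtain P h where P: "polytope \<kappa> (cdim l) P h" "cel l = model_hull \<kappa> (cdim l) P" using cell_polytope[OF assms(1)] by metis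
  have "compactin (model.mtopology \<kappa> (cdim l)) F" using polytope.face_compact[OF P(1)] assms(2) P(2) by simp
  then obtain u r where u: "u \<in> F" "strict_mono r" "limitin (model.mtopology \<kappa> (cdim l)) (\<sigma> \<circ> r) u sequentially"
    using assms(3) unfolding model.compactin_sequentially by blast
  have FM: "F \<subseteq> model_space \<kappa> (cdim l)" using face_sub[OF assms(2)] cell_sub[OF assms(1)] by blast
  have "\<exists>N. \<forall>k\<ge>N. cd l (\<sigma> (r k)) u < e" if e: "e > 0" for e
  proof -
    obtain N where "\<forall>k\<ge>N. (\<sigma> \<circ> r) k \<in> model_space \<kappa> (cdim l) \<and> mdist \<kappa> (cdim l) ((\<sigma> \<circ> r) k) u < e"
      using u(3)[unfolded model.limit_metric_sequentially, THEN conjunct2, rule_format, OF e] by blast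
    then show ?thesis using FM u(1) by (intro exI[of _ N]) (auto simp: mdist_def subset_iff)
  qed
  then show ?thesis using u by blast
qed

lemma piecewise_nonneg: "piecewise_geodesic K x y r \<Longrightarrow> r \<ge> 0 \<and> x \<in> X \<and> y \<in> X"
  by (induction rule: piecewise_geodesic.induct) (auto intro: att_X cd_nonneg add_nonneg_nonneg)

lemma D_le: assumes "piecewise_geodesic K x y r" shows "D x y \<le> r"
proof -
  have "bdd_below {r. piecewise_geodesic K x y r}" using piecewise_nonneg by (intro bdd_belowI[of _ 0]) blast
  then show ?thesis using assms piecewise_nonneg[OF assms] unfolding path_dist_def by (simp add: cInf_lower)
qed

lemma att_Lipschitz: assumes "l \<in> idx" "u \<in> cel l" "v \<in> cel l" shows "D (att l u) (att l v) \<le> cd l u v"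
  using D_le[OF piecewise_geodesic.step[OF assms piecewise_geodesic.refl[OF att_X[OF assms(1,3)]]]] by simp

lemma D_approx: assumes "x \<in> X" "y \<in> X" "D x y < e" obtains r where "piecewise_geodesic K x y r" "r < e"
proof -
  have "{r. piecewise_geodesic K x y r} \<noteq> {}" using poly[unfolded polyhedral_complex_def, THEN conjunct2, THEN conjunct2, THEN conjunct2] assms(1,2) by blast
  then show ?thesis using assms that cInf_lessD[of "{r. piecewise_geodesic K x y r}" e] by (auto simp: path_dist_def)
qed

text \<open>A sequence is lifted to the compact face, and the attaching map does not increase
  distances, so the limit passes down.\<close>

lemma cells_compact: assumes "c \<in> cells K" shows "compactin X.mtopology c"
proof -
  obtain l F where l: "l \<in> idx" "cell_face K l F" "c = att l ` F" using assms unfolding cells_def by blast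
  have FC: "F \<subseteq> cel l" using face_sub[OF l(2)] .
  show ?thesis unfolding X.compactin_sequentially
  proof (intro conjI allI impI)
    show "c \<subseteq> X" using cells_sub assms by blast
    fix \<sigma> :: "nat \<Rightarrow> 'a" assume "range \<sigma> \<subseteq> c"
    then have "\<forall>k. \<exists>u\<in>F. \<sigma> k = att l u" unfolding l(3) by blast
    then obtain s where s: "\<And>k. s k \<in> F" "\<And>k. \<sigma> k = att l (s k)" by metis
    obtain u and r :: "nat \<Rightarrow> nat" where u: "u \<in> F" "strict_mono r" "\<And>e. e > 0 \<Longrightarrow> \<exists>N. \<forall>k\<ge>N. cd l (s (r k)) u < e"
      using cell_seq_compact[OF l(1,2), of s] s(1) by (metis image_subset_iff)
    have "limitin X.mtopology (\<sigma> \<circ> r) (att l u) sequentially" unfolding X.limit_metric_sequentially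
    proof (intro conjI allI impI)
      show "att l u \<in> X" using u(1) FC l(1) att_X by blast
      fix e :: real assume "e > 0"
      then obtain N where N: "\<forall>k\<ge>N. cd l (s (r k)) u < e" using u(3) by blast
      show "\<exists>N. \<forall>k\<ge>N. (\<sigma> \<circ> r) k \<in> X \<and> D ((\<sigma> \<circ> r) k) (att l u) < e"
      proof (intro exI[of _ N] allI impI conjI)
        fix k assume "N \<le> k"
        have su: "s (r k) \<in> cel l" "u \<in> cel l" using s(1) u(1) FC by blast+
        then show "(\<sigma> \<circ> r) k \<in> X" using s(2) att_X[OF l(1)] by simp
        show "D ((\<sigma> \<circ> r) k) (att l u) < e" using att_Lipschitz[OF l(1) su] N \<open>N \<le> k\<close> s(2) by (simp add: le_less_trans)
      qed
    qed
    then show "\<exists>la r. la \<in> c \<and> strict_mono r \<and> limitin X.mtopology (\<sigma> \<circ> r) la sequentially" using u l(3) by blast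
  qed
qed

lemma gluing:
  assumes "l \<in> idx" "m \<in> idx" "cell_face K l E" "cell_face K m F" "x \<in> face_interior K l E" "y \<in> face_interior K m F" "att l x = att m y"
  shows "\<exists>h. bij_betw h E F \<and> (\<forall>u\<in>E. \<forall>v\<in>E. cd m (h u) (h v) = cd l u v) \<and> (\<forall>u\<in>E. att l u = att m (h u))"
  using poly[unfolded polyhedral_complex_def, THEN conjunct2, THEN conjunct2, THEN conjunct1, rule_format, OF assms(1,2,5,6,3,4,7)] .

lemma interior_inj: "l \<in> idx \<Longrightarrow> cell_face K l F \<Longrightarrow> inj_on (att l) (face_interior K l F)"
  using poly[unfolded polyhedral_complex_def, THEN conjunct2, THEN conjunct1] by simp

lemma interior_exists: assumes "l \<in> idx" "u \<in> cel l" shows "\<exists>E. cell_face K l E \<and> u \<in> face_interior K l E"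
proof -
  obtain P h where P: "polytope \<kappa> (cdim l) P h" "cel l = model_hull \<kappa> (cdim l) P" using cell_polytope[OF assms(1)] by metis
  show ?thesis using polytope.interior_face_exists[OF P(1)] assms(2) unfolding P(2) by blast
qed

lemma interior_ne: assumes "l \<in> idx" shows "face_interior K l (cel l) \<noteq> {}"
proof -
  obtain P h where P: "polytope \<kappa> (cdim l) P h" "P \<noteq> {}" "cel l = model_hull \<kappa> (cdim l) P" using cell_polytope[OF assms(1)] by metis
  show ?thesis using polytope.interior_nonempty[OF P(1,2)] unfolding P(3) .
qed

lemma faces_contain: assumes "l \<in> idx" "cell_face K l F" "cell_face K l G" "x \<in> F" "x \<in> face_interior K l G" shows "G \<subseteq> F"
proof -
  obtain P h where "polytope \<kappa> (cdim l) P h" "cel l = model_hull \<kappa> (cdim l) P" using cell_polytope[OF assms(1)] by metis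
  then show ?thesis using polytope.face_contains[of \<kappa> "cdim l" P h F G x] assms(2-5) by simp
qed

text \<open>The carrier of a point, the smallest closed cell that contains it.\<close>

definition supp :: "'a \<Rightarrow> 'a set" where
  "supp y = \<Inter>{c\<in>cells K. y \<in> c}"

text \<open>In any cell through the point, gluing provides a face with the same image as
  \<open>E\<close>, and \<open>faces_contain\<close> places this face inside the given cell.\<close>

lemma supp_eq: assumes "l \<in> idx" "cell_face K l E" "u \<in> face_interior K l E" shows "supp (att l u) = att l ` E"
proof -
  have uE: "u \<in> E" using assms(3) by (simp add: cell_interior_def)
  have "att l ` E \<subseteq> c" if c: "c \<in> cells K" "att l u \<in> c" for c
  proof -
    obtain m F where m: "m \<in> idx" "cell_face K m F" "c = att m ` F" using c(1) unfolding cells_def by blast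
    obtain v where v: "v \<in> F" "att l u = att m v" using c(2) m(3) by auto
    obtain G where G: "cell_face K m G" "v \<in> face_interior K m G" using interior_exists[OF m(1)] v(1) face_sub[OF m(2)] by blast
    have "G \<subseteq> F" using faces_contain[OF m(1,2) G(1) v(1) G(2)] .
    obtain h where h: "bij_betw h E G" "\<forall>u\<in>E. att l u = att m (h u)" using gluing[OF assms(1) m(1) assms(2) G(1) assms(3) G(2) v(2)] by blast
    then show ?thesis using \<open>G \<subseteq> F\<close> m(3) unfolding bij_betw_def by force
  qed
  moreover have "att l ` E \<in> cells K" using assms(1,2) unfolding cells_def by blast
  ultimately show ?thesis using uE unfolding supp_def by blast
qed

lemma self_embedding_onto:
  assumes "l \<in> idx" "f ` cel l \<subseteq> cel l" "\<And>x y. x \<in> cel l \<Longrightarrow> y \<in> cel l \<Longrightarrow> cd l (f x) (f y) = cd l x y"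
  shows "f ` cel l = cel l"
proof -
  obtain P h where P: "polytope \<kappa> (cdim l) P h" "cel l = model_hull \<kappa> (cdim l) P" using cell_polytope[OF assms(1)] by metis
  have c: "compactin (model.mtopology \<kappa> (cdim l)) (cel l)" using polytope.T_compact[OF P(1)] P(2) by simp
  have M: "x \<in> model_space \<kappa> (cdim l)" if "x \<in> cel l" for x using cell_sub[OF assms(1)] that by blast
  have fx: "f x \<in> cel l" if "x \<in> cel l" for x using assms(2) that by blast
  show ?thesis
  proof (rule model.isometric_self_embedding_onto[OF c assms(2)])
    fix x y assume "x \<in> cel l" "y \<in> cel l"
    then show "mdist \<kappa> (cdim l) (f x) (f y) = mdist \<kappa> (cdim l) x y" using M fx assms(3) by (simp add: mdist_def)
  qed
qed

text \<open>Finitely many cells meet some neighbourhood of \<open>y\<close>; those that miss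
  \<open>y\<close> are compact, hence closed, and can be removed from it.\<close>

lemma supp_local: assumes "y \<in> X"
  shows "finite {c\<in>cells K. y \<in> c}" "\<exists>e>0. \<forall>c\<in>cells K. c \<inter> X.mball y e \<noteq> {} \<longrightarrow> y \<in> c"
proof -
  obtain U where U: "openin X.mtopology U" "y \<in> U" "finite {c \<in> cells K. c \<inter> U \<noteq> {}}"
    using lf assms unfolding locally_finite_complex_def by blast
  have "{c\<in>cells K. y \<in> c} \<subseteq> {c \<in> cells K. c \<inter> U \<noteq> {}}" using U(2) by blast
  then show "finite {c\<in>cells K. y \<in> c}" using U(3) finite_subset by blast
  define B where "B = {c \<in> cells K. c \<inter> U \<noteq> {} \<and> y \<notin> c}"
  have "finite B" unfolding B_def using U(3) by (rule rev_finite_subset) blast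
  moreover have "closedin X.mtopology c" if "c \<in> B" for c
    using that cells_compact unfolding B_def by (auto intro: compactin_imp_closedin X.Hausdorff_space_mtopology)
  ultimately have "closedin X.mtopology (\<Union>B)" by (intro closedin_Union) auto
  then have "openin X.mtopology (U - \<Union>B)" using U(1) by (rule openin_diff[rotated])
  moreover have "y \<in> U - \<Union>B" using U(2) by (auto simp: B_def)
  ultimately obtain e where e: "e > 0" "X.mball y e \<subseteq> U - \<Union>B" unfolding X.openin_mtopology by blast
  have "y \<in> c" if "c \<in> cells K" "c \<inter> X.mball y e \<noteq> {}" for c
  proof (rule ccontr)
    assume "y \<notin> c"
    have "c \<inter> U \<noteq> {}" using that(2) e(2) by blast
    then have "c \<in> B" using that(1) \<open>y \<notin> c\<close> by (simp add: B_def)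
    then show False using that(2) e(2) by blast
  qed
  then show "\<exists>e>0. \<forall>c\<in>cells K. c \<inter> X.mball y e \<noteq> {} \<longrightarrow> y \<in> c" using e(1) by blast
qed

section \<open>Maximal cells and their charts\<close>

definition maximal :: "'a set \<Rightarrow> bool" where
  "maximal c \<longleftrightarrow> c \<in> cells K \<and> (\<forall>c'\<in>cells K. c \<subseteq> c' \<longrightarrow> c' = c)"

lemma maximal_exists: assumes "x \<in> X" shows "\<exists>c. maximal c \<and> x \<in> c"
proof -
  have "{c\<in>cells K. x \<in> c} \<noteq> {}" using assms cell_in_cells unfolding points_def by blast
  then obtain c where c: "c \<in> {c\<in>cells K. x \<in> c}" "\<forall>c'\<in>{c\<in>cells K. x \<in> c}. c \<subseteq> c' \<longrightarrow> c' = c"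
    using finite_has_maximal[OF supp_local(1)[OF assms]] by metis
  then have "maximal c" unfolding maximal_def by blast
  then show ?thesis using c(1) by blast
qed

text \<open>The attaching map of the whole cell serves as a parametrisation of \<open>c\<close>; it
  is known to be injective only on interiors of faces.\<close>

definition chart :: "'i \<Rightarrow> 'a set \<Rightarrow> bool" where
  "chart l c \<longleftrightarrow> l \<in> idx \<and> att l ` cel l = c \<and> maximal c"

lemma chart_exists: assumes "maximal c" shows "\<exists>l. chart l c"
proof -
  obtain l F where l: "l \<in> idx" "cell_face K l F" "c = att l ` F" using assms unfolding maximal_def cells_def by blast
  then have "c \<subseteq> att l ` cel l" using face_sub by blast
  then have "att l ` cel l = c" using assms cell_in_cells[OF l(1)] unfolding maximal_def by blast
  then show ?thesis using l(1) assms unfolding chart_def by blast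
qed

text \<open>For the converse, a proper face with image \<open>c\<close> is excluded: gluing would
  embed the cell isometrically into that face, and a compact space is not isometric to a proper part
  of itself.\<close>

lemma chart_interior: assumes "chart l c" "u \<in> cel l"
  shows "u \<in> face_interior K l (cel l) \<longleftrightarrow> supp (att l u) = c"
proof
  have l: "l \<in> idx" "att l ` cel l = c" using assms by (auto simp: chart_def)
  show "u \<in> face_interior K l (cel l) \<Longrightarrow> supp (att l u) = c" using supp_eq[OF l(1) cell_self_face[OF l(1)]] l(2) by blast
  assume s: "supp (att l u) = c"
  obtain G where G: "cell_face K l G" "u \<in> face_interior K l G" using interior_exists[OF l(1) assms(2)] by blast
  have cG: "att l ` G = c" using supp_eq[OF l(1) G] s by simp
  obtain w where w: "w \<in> face_interior K l (cel l)" using interior_ne[OF l(1)] by blast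
  then have "att l w \<in> att l ` G" using cG l(2) by (auto simp: cell_interior_def)
  then obtain g where g: "g \<in> G" "att l w = att l g" by auto
  obtain G' where G': "cell_face K l G'" "g \<in> face_interior K l G'" using interior_exists[OF l(1)] g(1) face_sub[OF G(1)] by blast
  have "G' \<subseteq> G" using faces_contain[OF l(1) G(1) G'(1) g(1) G'(2)] .
  obtain h where h: "bij_betw h (cel l) G'" "\<And>u v. u \<in> cel l \<Longrightarrow> v \<in> cel l \<Longrightarrow> cd l (h u) (h v) = cd l u v"
    using gluing[OF l(1) l(1) cell_self_face[OF l(1)] G'(1) w G'(2) g(2)] by blast
  have hG: "h ` cel l = G'" using h(1) by (simp add: bij_betw_def)
  then have "h ` cel l = cel l" using self_embedding_onto[OF l(1) _ h(2)] face_sub[OF G'(1)] by blast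
  then have "G = cel l" using hG \<open>G' \<subseteq> G\<close> face_sub[OF G(1)] by blast
  then show "u \<in> face_interior K l (cel l)" using G(2) by simp
qed

text \<open>Gluing at an interior point embeds each cell isometrically into the other. The composite
  self-embedding is onto by compactness, hence so is the second factor.\<close>

lemma chart_change: assumes "chart m c" "chart l c"
  shows "\<exists>h. h ` cel m = cel l \<and> (\<forall>u\<in>cel m. \<forall>v\<in>cel m. cd l (h u) (h v) = cd m u v) \<and> (\<forall>u\<in>cel m. att m u = att l (h u))"
proof -
  have half: "\<exists>h. h ` cel m \<subseteq> cel l \<and> (\<forall>u\<in>cel m. \<forall>v\<in>cel m. cd l (h u) (h v) = cd m u v) \<and> (\<forall>u\<in>cel m. att m u = att l (h u))"
    if "chart m c" "chart l c" for l m
  proof -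
    have lm: "l \<in> idx" "m \<in> idx" "att l ` cel l = c" "att m ` cel m = c" using that by (auto simp: chart_def)
    obtain w where w: "w \<in> face_interior K m (cel m)" using interior_ne[OF lm(2)] by blast
    then have "att m w \<in> att l ` cel l" using lm by (auto simp: cell_interior_def)
    then obtain w' where w': "w' \<in> cel l" "att m w = att l w'" by auto
    obtain G where G: "cell_face K l G" "w' \<in> face_interior K l G" using interior_exists[OF lm(1) w'(1)] by blast
    obtain h where "bij_betw h (cel m) G" "\<forall>u\<in>cel m. \<forall>v\<in>cel m. cd l (h u) (h v) = cd m u v" "\<forall>u\<in>cel m. att m u = att l (h u)"
      using gluing[OF lm(2,1) cell_self_face[OF lm(2)] G(1) w G(2) w'(2)] by blast
    then show ?thesis using face_sub[OF G(1)] unfolding bij_betw_def by blast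
  qed
  obtain h where h: "h ` cel m \<subseteq> cel l" "\<And>u v. u \<in> cel m \<Longrightarrow> v \<in> cel m \<Longrightarrow> cd l (h u) (h v) = cd m u v" "\<And>u. u \<in> cel m \<Longrightarrow> att m u = att l (h u)"
    using half[OF assms] by blast
  obtain g where g: "g ` cel l \<subseteq> cel m" "\<And>u v. u \<in> cel l \<Longrightarrow> v \<in> cel l \<Longrightarrow> cd m (g u) (g v) = cd l u v"
    using half[OF assms(2,1)] by blast
  have lm: "l \<in> idx" "m \<in> idx" using assms by (auto simp: chart_def)
  have gc: "g v \<in> cel m" if "v \<in> cel l" for v using g(1) that by blast
  have hc: "h v \<in> cel l" if "v \<in> cel m" for v using h(1) that by blast
  have "(h \<circ> g) ` cel l = cel l" by (rule self_embedding_onto[OF lm(1)]) (auto simp: gc hc h(2) g(2))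
  then have "cel l \<subseteq> h ` cel m" using gc by (metis (no_types, lifting) image_comp image_mono image_subset_iff)
  then show ?thesis using h by blast
qed

text \<open>Near \<open>y\<close> every cell in use is a chart of the maximal cell \<open>c\<close>,
  so a short chain of segments can be moved into the chart \<open>l\<close> one segment at a time;
  there the triangle inequality bounds its length from below.\<close>

lemma local_isometry:
  assumes c: "chart l c" and y: "y \<in> X" "supp y = c"
  obtains e where "e > 0" "\<And>z. z \<in> X \<Longrightarrow> D y z < e \<Longrightarrow> supp z = c"
    "\<And>u v. u \<in> cel l \<Longrightarrow> v \<in> cel l \<Longrightarrow> att l u = y \<Longrightarrow> D y (att l v) < e \<Longrightarrow> D y (att l v) = cd l u v"
proof -
  have l: "l \<in> idx" "att l ` cel l = c" and mx: "maximal c" using c by (auto simp: chart_def)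
  obtain e where e: "e > 0" "\<And>c. c \<in> cells K \<Longrightarrow> c \<inter> X.mball y e \<noteq> {} \<Longrightarrow> y \<in> c" using supp_local(2)[OF y(1)] by blast
  have only: "c' = c" if "c' \<in> cells K" "z \<in> c'" "D y z < e" for c' z
  proof -
    have "z \<in> X.mball y e" using that cells_sub y(1) by auto
    then have "y \<in> c'" using e(2) that by blast
    then have "c \<subseteq> c'" using y(2) that(1) unfolding supp_def by blast
    then show ?thesis using mx that(1) unfolding maximal_def by blast
  qed
  have sup: "supp z = c" if z: "z \<in> X" "D y z < e" for z
  proof -
    obtain m v where v: "m \<in> idx" "v \<in> cel m" "z = att m v" using z(1) by (auto simp: points_def)
    obtain E where E: "cell_face K m E" "v \<in> face_interior K m E" using interior_exists[OF v(1,2)] by blast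
    have "supp z = att m ` E" using supp_eq[OF v(1) E] v(3) by simp
    moreover have "att m ` E \<in> cells K" "z \<in> att m ` E" using v E unfolding cells_def by (auto simp: cell_interior_def)
    ultimately show ?thesis using only z(2) by metis
  qed
  have inj: "u = v" if "u \<in> cel l" "v \<in> cel l" "att l u = att l v" "D y (att l u) < e" for u v
  proof -
    have "supp (att l u) = c" using sup that(4) att_X[OF l(1) that(1)] by blast
    then have "u \<in> face_interior K l (cel l)" "v \<in> face_interior K l (cel l)" using chart_interior[OF c] that by auto
    then show ?thesis using interior_inj[OF l(1) cell_self_face[OF l(1)]] that(3) by (auto dest: inj_onD)
  qed
  \<comment> \<open>The condition \<open>D y a + r < e\<close> keeps the whole chain inside the ball
    and passes on to the chain without its first segment.\<close>
  have chain: "cd l u v \<le> r" if "piecewise_geodesic K a b r" "u \<in> cel l" "att l u = a" "D y a + r < e" "v \<in> cel l" "att l v = b" for a b r u v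
    using that
  proof (induction arbitrary: u rule: piecewise_geodesic.induct)
    case (refl x)
    then have "u = v" using inj by simp
    then show ?case using cd_self[OF l(1)] refl by simp
  next
    case (step m u1 v1 b r)
    have r: "r \<ge> 0" using piecewise_nonneg step.hyps(4) by blast
    have X: "att m u1 \<in> X" "att m v1 \<in> X" using att_X step.hyps by auto
    have d0: "cd m u1 v1 \<ge> 0" using cd_nonneg step.hyps by blast
    have Dv: "D y (att m v1) \<le> D y (att m u1) + cd m u1 v1"
      using X.triangle[OF y(1) X] att_Lipschitz[OF step.hyps(1-3)] by linarith
    have ul: "D y (att m u1) < e" using step.prems(3) r d0 by simp
    have "att m ` cel m = c" using only[OF cell_in_cells[OF step.hyps(1)] _ ul] step.hyps(2) by blast
    then have "chart m c" using step.hyps(1) mx by (simp add: chart_def)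
    then obtain h where h: "h ` cel m = cel l" "\<And>u v. u \<in> cel m \<Longrightarrow> v \<in> cel m \<Longrightarrow> cd l (h u) (h v) = cd m u v" "\<And>u. u \<in> cel m \<Longrightarrow> att m u = att l (h u)"
      using chart_change[OF _ c] by blast
    have hc: "h u1 \<in> cel l" "h v1 \<in> cel l" using h(1) step.hyps by auto
    have "u = h u1" using inj[OF step.prems(1) hc(1)] h(3)[OF step.hyps(2)] step.prems(2) ul by simp
    have "cd l (h v1) v \<le> r"
    proof (rule step.IH)
      show "att l (h v1) = att m v1" using h(3) step.hyps by simp
      show "D y (att m v1) + r < e" using Dv step.prems(3) by simp
    qed (use hc step.prems in auto)
    moreover have "cd l u (h v1) = cd m u1 v1" using h(2)[OF step.hyps(2,3)] \<open>u = h u1\<close> by simp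
    ultimately show ?case using cd_triangle[OF l(1) step.prems(1) hc(2) step.prems(4)] by simp
  qed
  have "D y (att l v) = cd l u v" if uv: "u \<in> cel l" "v \<in> cel l" "att l u = y" "D y (att l v) < e" for u v
  proof (rule antisym)
    show "D y (att l v) \<le> cd l u v" using att_Lipschitz[OF l(1) uv(1,2)] uv(3) by simp
    show "cd l u v \<le> D y (att l v)"
    proof (rule ccontr)
      assume "\<not> ?thesis"
      then have "D y (att l v) < min e (cd l u v)" using uv(4) by simp
      then obtain r where r: "piecewise_geodesic K y (att l v) r" "r < min e (cd l u v)" using D_approx[OF y(1) att_X[OF l(1) uv(2)]] by blast
      have "cd l u v \<le> r" using chain[OF r(1) uv(1,3) _ uv(2) HOL.refl] r(2) y(1) by simp
      then show False using r(2) by simp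
    qed
  qed
  then show ?thesis using that e(1) sup by blast
qed

end

section \<open>Automorphisms on cells and discreteness of orbits\<close>

context metric_complex
begin

lemma automorphismD:
  assumes "complex_automorphism K a"
  shows "bij_betw a X X" "inj_on a X" "a ` X = X" "\<And>x. x \<in> X \<Longrightarrow> a x \<in> X"
    "\<And>x y. x \<in> X \<Longrightarrow> y \<in> X \<Longrightarrow> D (a x) (a y) = D x y" "(`) a ` cells K = cells K"
proof -
  show b: "bij_betw a X X" and "\<And>x y. x \<in> X \<Longrightarrow> y \<in> X \<Longrightarrow> D (a x) (a y) = D x y" "(`) a ` cells K = cells K"
    using assms unfolding complex_automorphism_def by blast+
  show "inj_on a X" "a ` X = X" using b by (auto simp: bij_betw_def)
  then show "\<And>x. x \<in> X \<Longrightarrow> a x \<in> X" by blast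
qed

lemma automorphism_inverse: assumes a: "complex_automorphism K a" shows "complex_automorphism K (inv_into X a)"
  unfolding complex_automorphism_def
proof (intro conjI ballI)
  note A = automorphismD[OF a]
  let ?b = "inv_into X a"
  show b: "bij_betw ?b X X" using bij_betw_inv_into[OF A(1)] .
  have ab: "a (?b x) = x" "?b x \<in> X" if "x \<in> X" for x using that A(3) by (auto intro: f_inv_into_f inv_into_into)
  show "D (?b x) (?b y) = D x y" if "x \<in> X" "y \<in> X" for x y using A(5)[OF ab(2)[OF that(1)] ab(2)[OF that(2)]] ab(1) that by simp
  have "?b ` (a ` c) = c" if "c \<in> cells K" for c using A(2) cells_sub[OF that] by (rule inv_into_image_cancel)
  then have "(`) ?b ` ((`) a ` cells K) = cells K" by (auto simp: image_image)
  then show "(`) ?b ` cells K = cells K" using A(6) by simp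
qed

lemma automorphism_comp: assumes a: "complex_automorphism K a" and b: "complex_automorphism K b" shows "complex_automorphism K (a \<circ> b)"
  unfolding complex_automorphism_def
proof (intro conjI ballI)
  note A = automorphismD[OF a] and B = automorphismD[OF b]
  show "bij_betw (a \<circ> b) X X" using B(1) A(1) by (rule bij_betw_trans)
  show "D ((a \<circ> b) x) ((a \<circ> b) y) = D x y" if "x \<in> X" "y \<in> X" for x y using that A(5) B(4,5) by simp
  have "(`) (a \<circ> b) ` cells K = (`) a ` ((`) b ` cells K)" by (auto simp: image_comp image_iff)
  then show "(`) (a \<circ> b) ` cells K = cells K" using A(6) B(6) by simp
qed

lemma cells_containing_automorphism: assumes a: "complex_automorphism K a" and y: "y \<in> X"
  shows "{c\<in>cells K. a y \<in> c} = (`) a ` {c\<in>cells K. y \<in> c}"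
proof
  note A = automorphismD[OF a]
  show "(`) a ` {c\<in>cells K. y \<in> c} \<subseteq> {c\<in>cells K. a y \<in> c}" using A(6) by blast
  show "{c\<in>cells K. a y \<in> c} \<subseteq> (`) a ` {c\<in>cells K. y \<in> c}"
  proof
    fix c assume "c \<in> {c\<in>cells K. a y \<in> c}"
    then have c: "c \<in> cells K" "a y \<in> c" by auto
    then obtain c' where c': "c' \<in> cells K" "c = a ` c'" using A(6) by blast
    then have "y \<in> c'" using c(2) inj_on_image_mem_iff[OF A(2) y cells_sub[OF c'(1)]] by simp
    then show "c \<in> (`) a ` {c\<in>cells K. y \<in> c}" using c' by blast
  qed
qed

lemma supp_automorphism: assumes a: "complex_automorphism K a" and y: "y \<in> X" shows "supp (a y) = a ` supp y"
proof -
  obtain c where c: "c \<in> cells K" "y \<in> c" using maximal_exists[OF y] by (auto simp: maximal_def)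
  have "a ` (\<Inter>c\<in>{c\<in>cells K. y \<in> c}. c) = (\<Inter>c\<in>{c\<in>cells K. y \<in> c}. a ` c)"
    using c cells_sub by (intro image_INT[OF automorphismD(2)[OF a], of _ _ c]) auto
  then show ?thesis unfolding supp_def cells_containing_automorphism[OF assms] by simp
qed

lemma interior_geodesic:
  assumes l: "l \<in> idx" and u: "u \<in> face_interior K l (cel l)" and v: "v \<in> face_interior K l (cel l)"
  obtains \<gamma> where "\<gamma> 0 = u" "\<gamma> (cd l u v) = v" "\<And>t. t \<in> {0..cd l u v} \<Longrightarrow> \<gamma> t \<in> face_interior K l (cel l)"
    "\<And>s t. s \<in> {0..cd l u v} \<Longrightarrow> t \<in> {0..cd l u v} \<Longrightarrow> cd l (\<gamma> s) (\<gamma> t) = \<bar>s - t\<bar>"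
proof -
  obtain P h where P: "polytope \<kappa> (cdim l) P h" "cel l = model_hull \<kappa> (cdim l) P" using cell_polytope[OF l] by metis
  have uv: "u \<in> cel l" "v \<in> cel l" using u v by (auto simp: cell_interior_def)
  then have M: "u \<in> model_space \<kappa> (cdim l)" "v \<in> model_space \<kappa> (cdim l)" using cell_sub[OF l] by auto
  obtain \<gamma> where \<gamma>: "geodesic_path (model_space \<kappa> (cdim l)) (cd l) \<gamma> u v"
    using model_dist_geodesic[OF M polytope.sideT[OF P(1)] polytope.sideT[OF P(1)]] uv P(2) by auto
  have g: "\<gamma> 0 = u" "\<gamma> (cd l u v) = v" "\<And>t. t \<in> {0..cd l u v} \<Longrightarrow> \<gamma> t \<in> model_space \<kappa> (cdim l)"
    "\<And>s t. s \<in> {0..cd l u v} \<Longrightarrow> t \<in> {0..cd l u v} \<Longrightarrow> cd l (\<gamma> s) (\<gamma> t) = \<bar>s - t\<bar>"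
    using \<gamma> unfolding geodesic_path_def by auto
  have "\<gamma> t \<in> face_interior K l (cel l)" if t: "t \<in> {0..cd l u v}" for t
  proof (cases "\<gamma> t = u")
    case False
    have e: "0 \<in> {0..cd l u v}" "cd l u v \<in> {0..cd l u v}" using t by auto
    have "cd l u (\<gamma> t) + cd l (\<gamma> t) v = cd l u v" using g(4)[OF e(1) t] g(4)[OF t e(2)] t unfolding g(1,2) by auto
    then show ?thesis using polytope.interior_segment[OF P(1) v[unfolded P(2)] uv(1)[unfolded P(2)] g(3)[OF t]] False P(2) by simp
  qed (use u in simp)
  then show ?thesis using that g by blast
qed

text \<open>Interior points of the cell are recognised by their carrier, and an automorphism maps
  carriers to carriers, so the image of an interior point lifts to an interior point.\<close>

lemma automorphism_lift:
  assumes c: "chart l c" and a: "complex_automorphism K a" "a ` c = c"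
  obtains g where "\<And>u. u \<in> face_interior K l (cel l) \<Longrightarrow> g u \<in> face_interior K l (cel l) \<and> att l (g u) = a (att l u)"
proof -
  have l: "l \<in> idx" "att l ` cel l = c" using c by (auto simp: chart_def)
  have "\<exists>v. v \<in> face_interior K l (cel l) \<and> att l v = a (att l u)" if u: "u \<in> face_interior K l (cel l)" for u
  proof -
    have uc: "u \<in> cel l" using u by (simp add: cell_interior_def)
    then have "a (att l u) \<in> att l ` cel l" using a(2) l(2) by blast
    then obtain v where v: "v \<in> cel l" "a (att l u) = att l v" by auto
    have "supp (att l v) = a ` supp (att l u)" using supp_automorphism[OF a(1) att_X[OF l(1) uc]] v(2) by simp
    also have "\<dots> = c" using chart_interior[OF c uc] u a(2) by simp
    finally show ?thesis using chart_interior[OF c v(1)] v by auto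
  qed
  then show ?thesis using that by metis
qed

lemma local_isometry_ex:
  assumes "chart l c" "y \<in> X" "supp y = c"
  shows "\<exists>e>0. \<forall>u\<in>cel l. \<forall>v\<in>cel l. att l u = y \<longrightarrow> D y (att l v) < e \<longrightarrow> D y (att l v) = cd l u v"
proof (rule local_isometry[OF assms])
  fix e assume "e > 0" and "\<And>u v. u \<in> cel l \<Longrightarrow> v \<in> cel l \<Longrightarrow> att l u = y \<Longrightarrow> D y (att l v) < e \<Longrightarrow> D y (att l v) = cd l u v"
  then show ?thesis by (intro exI[of _ e]) simp
qed

text \<open>The metrics of the cell and of the complex are compared only locally, so the lift is
  known to be isometric only on short pieces of a geodesic. \<open>Bolzano\<close> adds these pieces
  up, which gives an inequality.\<close>

lemma automorphism_lift_nonexpanding: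
  assumes c: "chart l c" and a: "complex_automorphism K a"
    and g: "\<And>u. u \<in> face_interior K l (cel l) \<Longrightarrow> g u \<in> face_interior K l (cel l) \<and> att l (g u) = a (att l u)"
    and u: "u \<in> face_interior K l (cel l)" and v: "v \<in> face_interior K l (cel l)"
  shows "cd l (g u) (g v) \<le> cd l u v"
proof -
  have l: "l \<in> idx" using c by (simp add: chart_def)
  have ic: "w \<in> cel l" if "w \<in> face_interior K l (cel l)" for w using that by (simp add: cell_interior_def)
  define R where "R = cd l u v"
  obtain \<gamma> where \<gamma>: "\<gamma> 0 = u" "\<gamma> R = v" "\<And>t. t \<in> {0..R} \<Longrightarrow> \<gamma> t \<in> face_interior K l (cel l)"
    "\<And>s t. s \<in> {0..R} \<Longrightarrow> t \<in> {0..R} \<Longrightarrow> cd l (\<gamma> s) (\<gamma> t) = \<bar>s - t\<bar>" using interior_geodesic[OF l u v] unfolding R_def by blast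
  have gc: "g (\<gamma> t) \<in> cel l" if "t \<in> {0..R}" for t using ic g \<gamma>(3)[OF that] by blast
  have R: "0 \<le> R" using cd_nonneg[OF l ic[OF u] ic[OF v]] by (simp add: R_def)
  have loc: "\<exists>\<delta>>0. \<forall>s\<in>{0..R}. \<bar>s - t\<bar> < \<delta> \<longrightarrow> cd l (g (\<gamma> t)) (g (\<gamma> s)) = \<bar>t - s\<bar>" if t: "t \<in> {0..R}" for t
  proof -
    define y where "y = att l (\<gamma> t)"
    have y: "y \<in> X" "supp y = c" using \<gamma>(3)[OF t] chart_interior[OF c ic[OF \<gamma>(3)[OF t]]] att_X[OF l ic[OF \<gamma>(3)[OF t]]] unfolding y_def by simp_all
    have ay: "a y = att l (g (\<gamma> t))" using g[OF \<gamma>(3)[OF t]] by (simp add: y_def)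
    have y': "a y \<in> X" "supp (a y) = c" unfolding ay
      by (rule att_X[OF l gc[OF t]], rule iffD1[OF chart_interior[OF c gc[OF t]] g[OF \<gamma>(3)[OF t], THEN conjunct1]])
    obtain e where e: "e > 0" "\<forall>u\<in>cel l. \<forall>v\<in>cel l. att l u = y \<longrightarrow> D y (att l v) < e \<longrightarrow> D y (att l v) = cd l u v"
      using local_isometry_ex[OF c y] by blast
    obtain e' where e': "e' > 0" "\<forall>u\<in>cel l. \<forall>v\<in>cel l. att l u = a y \<longrightarrow> D (a y) (att l v) < e' \<longrightarrow> D (a y) (att l v) = cd l u v"
      using local_isometry_ex[OF c y'] by blast
    have "cd l (g (\<gamma> t)) (g (\<gamma> s)) = \<bar>t - s\<bar>" if s: "s \<in> {0..R}" "\<bar>s - t\<bar> < min e e'" for s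
    proof -
      have cs: "\<gamma> t \<in> cel l" "\<gamma> s \<in> cel l" using ic \<gamma>(3) t s(1) by auto
      have ts: "cd l (\<gamma> t) (\<gamma> s) = \<bar>t - s\<bar>" by (rule \<gamma>(4)[OF t s(1)])
      have "D y (att l (\<gamma> s)) \<le> \<bar>t - s\<bar>" using att_Lipschitz[OF l cs] ts by (simp add: y_def)
      moreover from this have "D y (att l (\<gamma> s)) = cd l (\<gamma> t) (\<gamma> s)" using e(2)[rule_format, OF cs] s(2) by (simp add: y_def abs_minus_commute)
      ultimately have Dy: "D y (att l (\<gamma> s)) = \<bar>t - s\<bar>" using ts by simp
      have "D (a y) (att l (g (\<gamma> s))) = D y (att l (\<gamma> s))"
        using automorphismD(5)[OF a y(1) att_X[OF l cs(2)]] g[OF \<gamma>(3)[OF s(1)]] by simp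
      then have "D (a y) (att l (g (\<gamma> s))) = \<bar>t - s\<bar>" using Dy by simp
      then show ?thesis using e'(2)[rule_format, OF gc[OF t] gc[OF s(1)] ay[symmetric]] s(2) by (simp add: abs_minus_commute)
    qed
    then show ?thesis using e(1) e'(1) by (intro exI[of _ "min e e'"]) auto
  qed
  have "(0::real) \<le> 0 \<longrightarrow> R \<le> R \<longrightarrow> cd l (g (\<gamma> 0)) (g (\<gamma> R)) \<le> R - 0"
  proof (rule Bolzano[OF R, where P="\<lambda>s t. 0 \<le> s \<longrightarrow> t \<le> R \<longrightarrow> cd l (g (\<gamma> s)) (g (\<gamma> t)) \<le> t - s"])
    fix s t r :: real
    assume "0 \<le> s \<longrightarrow> t \<le> R \<longrightarrow> cd l (g (\<gamma> s)) (g (\<gamma> t)) \<le> t - s" "0 \<le> t \<longrightarrow> r \<le> R \<longrightarrow> cd l (g (\<gamma> t)) (g (\<gamma> r)) \<le> r - t" "s \<le> t" "t \<le> r"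
    then show "0 \<le> s \<longrightarrow> r \<le> R \<longrightarrow> cd l (g (\<gamma> s)) (g (\<gamma> r)) \<le> r - s"
      using cd_triangle[OF l gc gc gc, of s t r] by force
  next
    fix t assume "0 \<le> t" "t \<le> R"
    then have t: "t \<in> {0..R}" by simp
    obtain \<delta> where \<delta>: "\<delta> > 0" "\<And>s. s \<in> {0..R} \<Longrightarrow> \<bar>s - t\<bar> < \<delta> \<Longrightarrow> cd l (g (\<gamma> t)) (g (\<gamma> s)) = \<bar>t - s\<bar>" using loc[OF t] by blast
    show "\<exists>d>0. \<forall>a b. a \<le> t \<and> t \<le> b \<and> b - a < d \<longrightarrow> 0 \<le> a \<longrightarrow> b \<le> R \<longrightarrow> cd l (g (\<gamma> a)) (g (\<gamma> b)) \<le> b - a"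
    proof (intro exI[of _ \<delta>] conjI allI impI)
      fix p q assume pq: "p \<le> t \<and> t \<le> q \<and> q - p < \<delta>" "0 \<le> p" "q \<le> R"
      then have I: "p \<in> {0..R}" "q \<in> {0..R}" using t by auto
      have "cd l (g (\<gamma> p)) (g (\<gamma> t)) = t - p" using \<delta>(2)[OF I(1)] pq cd_sym[OF l gc[OF I(1)] gc[OF t]] by auto
      moreover have "cd l (g (\<gamma> t)) (g (\<gamma> q)) = q - t" using \<delta>(2)[OF I(2)] pq by auto
      ultimately show "cd l (g (\<gamma> p)) (g (\<gamma> q)) \<le> q - p" using cd_triangle[OF l gc[OF I(1)] gc[OF t] gc[OF I(2)]] by simp
    qed (rule \<delta>(1))
  qed
  then show ?thesis using \<gamma>(1,2) R_def by simp
qed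

text \<open>On the interior the lift is isometric because the inverse automorphism has a
  nonexpanding lift as well; density of the interior and compactness extend it to the closed
  cell.\<close>

lemma automorphism_cell_isometry:
  assumes c: "chart l c" and a: "complex_automorphism K a" "a ` c = c"
  shows "\<exists>f. f ` cel l = cel l \<and> (\<forall>u\<in>cel l. \<forall>v\<in>cel l. cd l (f u) (f v) = cd l u v) \<and> (\<forall>u\<in>cel l. att l (f u) = a (att l u))"
proof -
  define I where "I = face_interior K l (cel l)"
  have l: "l \<in> idx" "att l ` cel l = c" using c by (auto simp: chart_def)
  have ic: "w \<in> cel l" if "w \<in> I" for w using that by (simp add: cell_interior_def I_def)
  define b where "b = inv_into X a"
  have b: "complex_automorphism K b" using automorphism_inverse[OF a(1)] by (simp add: b_def)
  have cX: "c \<subseteq> X" using l att_X by blast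
  have ba: "b (a x) = x" if "x \<in> X" for x unfolding b_def using that automorphismD(2)[OF a(1)] by simp
  have "b ` c = b ` a ` c" using a(2) by simp
  also have "\<dots> = c" using ba cX by (force simp: image_image)
  finally have bc: "b ` c = c" .
  obtain g where g: "\<And>u. u \<in> I \<Longrightarrow> g u \<in> I \<and> att l (g u) = a (att l u)" using automorphism_lift[OF c a] unfolding I_def by blast
  obtain k where k: "\<And>u. u \<in> I \<Longrightarrow> k u \<in> I \<and> att l (k u) = b (att l u)" using automorphism_lift[OF c b bc] unfolding I_def by blast
  have kg: "k (g u) = u" if u: "u \<in> I" for u
  proof -
    have "att l (k (g u)) = att l u" using k g u ba att_X[OF l(1) ic] by simp
    moreover have "k (g u) \<in> I" using k g u by blast
    ultimately show ?thesis using inj_onD[OF interior_inj[OF l(1) cell_self_face[OF l(1)]]] u unfolding I_def by blast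
  qed
  have giso: "cd l (g u) (g v) = cd l u v" if uv: "u \<in> I" "v \<in> I" for u v
  proof (rule antisym)
    show "cd l (g u) (g v) \<le> cd l u v" using automorphism_lift_nonexpanding[OF c a(1) g[unfolded I_def]] uv unfolding I_def by blast
    have "cd l (k (g u)) (k (g v)) \<le> cd l (g u) (g v)"
      using automorphism_lift_nonexpanding[OF c b k[unfolded I_def]] g uv unfolding I_def by blast
    then show "cd l u v \<le> cd l (g u) (g v)" using kg uv by simp
  qed
  \<comment> \<open>The value at \<open>u\<close> is a limit of values of \<open>g\<close> along
    interior points that tend to \<open>u\<close>.\<close>
  have "\<exists>s w. w \<in> cel l \<and> (\<forall>i. s i \<in> I) \<and> (\<lambda>i. cd l (s i) u) \<longlonglongrightarrow> 0 \<and> (\<lambda>i. cd l (g (s i)) w) \<longlonglongrightarrow> 0" if u: "u \<in> cel l" for u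
  proof -
    obtain P h where P: "polytope \<kappa> (cdim l) P h" "P \<noteq> {}" "cel l = model_hull \<kappa> (cdim l) P" using cell_polytope[OF l(1)] by metis
    have "\<exists>z. z \<in> I \<and> cd l u z < 1 / (real i + 1)" for i
      using polytope.interior_dense[OF P(1,2) u[unfolded P(3)], of "1 / (real i + 1)"] unfolding I_def P(3) by (auto simp: add_nonneg_pos)
    then obtain s where s: "\<And>i. s i \<in> I" "\<And>i. cd l u (s i) < 1 / (real i + 1)" by metis
    have "range (\<lambda>i. g (s i)) \<subseteq> cel l" using g s(1) ic by blast
    from cell_seq_compact[OF l(1) cell_self_face[OF l(1)] this] obtain w and r :: "nat \<Rightarrow> nat" where
      w: "w \<in> cel l" "strict_mono r" "\<And>e. e > 0 \<Longrightarrow> \<exists>N. \<forall>k\<ge>N. cd l (g (s (r k))) w < e" by blast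
    have lim0: "(\<lambda>i. 1 / (real i + 1)) \<longlonglongrightarrow> 0" using LIMSEQ_inverse_real_of_nat by (simp add: inverse_eq_divide add.commute)
    have "(\<lambda>i. cd l (s i) u) \<longlonglongrightarrow> 0"
    proof (rule tendsto_sandwich[OF _ _ tendsto_const lim0])
      show "\<forall>\<^sub>F i in sequentially. 0 \<le> cd l (s i) u" using cd_nonneg[OF l(1) ic[OF s(1)] u] by simp
      show "\<forall>\<^sub>F i in sequentially. cd l (s i) u \<le> 1 / (real i + 1)" using s(2) cd_sym[OF l(1) ic[OF s(1)] u] by (simp add: less_imp_le)
    qed
    then have "(\<lambda>i. cd l (s (r i)) u) \<longlonglongrightarrow> 0" using LIMSEQ_subseq_LIMSEQ[OF _ w(2)] by (fastforce simp: o_def)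
    moreover have "(\<lambda>i. cd l (g (s (r i))) w) \<longlonglongrightarrow> 0"
      unfolding LIMSEQ_def dist_real_def using w(3) cd_nonneg[OF l(1) ic w(1)] g s(1) by simp
    ultimately show ?thesis using w(1) s(1) by (intro exI[of _ "\<lambda>i. s (r i)"] exI[of _ w]) auto
  qed
  then obtain S f where Sf: "\<And>u. u \<in> cel l \<Longrightarrow> f u \<in> cel l" "\<And>u i. u \<in> cel l \<Longrightarrow> S u i \<in> I"
    "\<And>u. u \<in> cel l \<Longrightarrow> (\<lambda>i. cd l (S u i) u) \<longlonglongrightarrow> 0" "\<And>u. u \<in> cel l \<Longrightarrow> (\<lambda>i. cd l (g (S u i)) (f u)) \<longlonglongrightarrow> 0" by metis
  have gS: "S u i \<in> cel l" "g (S u i) \<in> cel l" if "u \<in> cel l" for u i using Sf(2)[OF that] ic g by blast+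
  have iso: "cd l (f u) (f v) = cd l u v" if uv: "u \<in> cel l" "v \<in> cel l" for u v
  proof -
    have bound: "\<bar>cd l (f u) (f v) - cd l u v\<bar> \<le> cd l (g (S u i)) (f u) + cd l (g (S v i)) (f v) + (cd l (S u i) u + cd l (S v i) v)" for i
    proof -
      have quad: "\<bar>cd l p q - cd l p' q'\<bar> \<le> cd l p' p + cd l q' q" if "p \<in> cel l" "q \<in> cel l" "p' \<in> cel l" "q' \<in> cel l" for p q p' q'
        using cd_triangle[OF l(1) that(1,3,2)] cd_triangle[OF l(1) that(3,4,2)] cd_triangle[OF l(1) that(3,1,4)] cd_triangle[OF l(1) that(1,2,4)]
          cd_sym[OF l(1) that(1,3)] cd_sym[OF l(1) that(2,4)] by linarith
      have 1: "\<bar>cd l (f u) (f v) - cd l (g (S u i)) (g (S v i))\<bar> \<le> cd l (g (S u i)) (f u) + cd l (g (S v i)) (f v)" using quad Sf(1) gS uv by simp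
      have 2: "\<bar>cd l u v - cd l (S u i) (S v i)\<bar> \<le> cd l (S u i) u + cd l (S v i) v" using quad gS uv by simp
      have "cd l (g (S u i)) (g (S v i)) = cd l (S u i) (S v i)" using giso Sf(2) uv by simp
      then show ?thesis using 1 2 by linarith
    qed
    have lim: "(\<lambda>i. cd l (g (S u i)) (f u) + cd l (g (S v i)) (f v) + (cd l (S u i) u + cd l (S v i) v)) \<longlonglongrightarrow> 0 + 0 + (0 + 0)"
      by (intro tendsto_add Sf uv)
    have "\<bar>cd l (f u) (f v) - cd l u v\<bar> \<le> 0 + 0 + (0 + 0)" by (rule LIMSEQ_le_const[OF lim]) (use bound in blast)
    then show ?thesis by simp
  qed
  have att: "att l (f u) = a (att l u)" if u: "u \<in> cel l" for u
  proof -
    have X: "att l (f u) \<in> X" "a (att l u) \<in> X" using att_X[OF l(1)] Sf(1) u automorphismD(4)[OF a(1)] by auto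
    have bound: "D (att l (f u)) (a (att l u)) \<le> cd l (g (S u i)) (f u) + cd l (S u i) u" for i
    proof -
      have gX: "att l (g (S u i)) \<in> X" using att_X[OF l(1)] gS u by simp
      have "D (att l (f u)) (a (att l u)) \<le> D (att l (g (S u i))) (att l (f u)) + D (att l (g (S u i))) (a (att l u))"
        using X.triangle[OF X(1) gX X(2)] X.commute[of "att l (f u)" "att l (g (S u i))"] by simp
      also have "D (att l (g (S u i))) (att l (f u)) \<le> cd l (g (S u i)) (f u)" using att_Lipschitz[OF l(1)] gS Sf(1) u by simp
      also have "D (att l (g (S u i))) (a (att l u)) = D (att l (S u i)) (att l u)"
        using g Sf(2) u automorphismD(5)[OF a(1)] att_X[OF l(1)] gS by simp
      also have "\<dots> \<le> cd l (S u i) u" using att_Lipschitz[OF l(1)] gS u by simp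
      finally show ?thesis by simp
    qed
    have lim: "(\<lambda>i. cd l (g (S u i)) (f u) + cd l (S u i) u) \<longlonglongrightarrow> 0 + 0" by (intro tendsto_add Sf u)
    have "D (att l (f u)) (a (att l u)) \<le> 0 + 0" by (rule LIMSEQ_le_const[OF lim]) (use bound in blast)
    then show ?thesis using X.nonneg[of "att l (f u)" "a (att l u)"] X.zero[OF X] by simp
  qed
  have "f ` cel l = cel l" using Sf(1) iso by (intro self_embedding_onto[OF l(1)]) auto
  then show ?thesis using iso att by blast
qed

text \<open>On \<open>c\<close> an automorphism is determined by the isometry that it induces on the
  cell, and there are finitely many of these.\<close>

lemma finite_stabilizer_orbit:
  assumes c: "maximal c" and x: "x \<in> c"
  shows "finite {a x | a. complex_automorphism K a \<and> a ` c = c}"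
proof -
  obtain l where l: "chart l c" using chart_exists[OF c] by blast
  then have li: "l \<in> idx" "att l ` cel l = c" by (auto simp: chart_def)
  obtain u where u: "u \<in> cel l" "x = att l u" using x li by auto
  obtain P h where P: "polytope \<kappa> (cdim l) P h" "cel l = model_hull \<kappa> (cdim l) P" using cell_polytope[OF li(1)] by metis
  let ?F = "{restrict f (cel l) | f. f ` cel l = cel l \<and> (\<forall>x\<in>cel l. \<forall>y\<in>cel l. cd l (f x) (f y) = cd l x y)}"
  have "finite ?F" using polytope.finite_isometries[OF P(1)] unfolding P(2) .
  moreover have "{a x | a. complex_automorphism K a \<and> a ` c = c} \<subseteq> (\<lambda>f. att l (f u)) ` ?F"
  proof
    fix y assume "y \<in> {a x | a. complex_automorphism K a \<and> a ` c = c}"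
    then obtain a where a: "complex_automorphism K a" "a ` c = c" "y = a x" by blast
    obtain f where f: "f ` cel l = cel l" "\<forall>u\<in>cel l. \<forall>v\<in>cel l. cd l (f u) (f v) = cd l u v" "\<forall>u\<in>cel l. att l (f u) = a (att l u)"
      using automorphism_cell_isometry[OF l a(1,2)] by blast
    then have "restrict f (cel l) \<in> ?F" by blast
    moreover have "y = att l (restrict f (cel l) u)" using f(3) u a(3) by simp
    ultimately show "y \<in> (\<lambda>f. att l (f u)) ` ?F" by blast
  qed
  ultimately show ?thesis using finite_surj by blast
qed

text \<open>If \<open>a\<close> moves \<open>x\<close> by little, then \<open>a\<close> maps
  \<open>c\<close> to one of the finitely many cells through \<open>x\<close>. The automorphisms
  from \<open>c\<close> to a given cell form a coset of the stabiliser of \<open>c\<close>, so they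
  take \<open>x\<close> to finitely many points.\<close>

theorem automorphism_orbit_discrete:
  assumes x: "x \<in> X"
  shows "\<exists>e>0. \<forall>a. complex_automorphism K a \<longrightarrow> D (a x) x < e \<longrightarrow> a x = x"
proof -
  obtain c where c: "maximal c" "x \<in> c" using maximal_exists[OF x] by blast
  obtain e where e: "e > 0" "\<And>c. c \<in> cells K \<Longrightarrow> c \<inter> X.mball x e \<noteq> {} \<Longrightarrow> x \<in> c" using supp_local(2)[OF x] by blast
  define S where "S = {c\<in>cells K. x \<in> c}"
  have finS: "finite S" using supp_local(1)[OF x] by (simp add: S_def)
  have cS: "c \<in> S" "c \<subseteq> X" using c cells_sub by (auto simp: S_def maximal_def)
  define Orb where "Orb c' = {a x | a. complex_automorphism K a \<and> a ` c = c'}" for c'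
  have "finite (Orb c')" for c'
  proof (cases "\<exists>b. complex_automorphism K b \<and> b ` c = c'")
    case True
    then obtain b where b: "complex_automorphism K b" "b ` c = c'" by blast
    note B = automorphismD[OF b(1)]
    have "Orb c' \<subseteq> b ` {a x | a. complex_automorphism K a \<and> a ` c = c}"
    proof
      fix y assume "y \<in> Orb c'"
      then obtain a where a: "complex_automorphism K a" "a ` c = c'" "y = a x" by (auto simp: Orb_def)
      have "(inv_into X b \<circ> a) ` c = inv_into X b ` b ` c" by (simp only: image_comp[symmetric] a(2) b(2))
      also have "\<dots> = c" using B(2) cS(2) by (rule inv_into_image_cancel)
      finally have "(inv_into X b \<circ> a) ` c = c" .
      moreover have "complex_automorphism K (inv_into X b \<circ> a)" by (intro automorphism_comp automorphism_inverse b a)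
      moreover have "y = b ((inv_into X b \<circ> a) x)" using a(3) automorphismD(4)[OF a(1) x] B(3) by (simp add: f_inv_into_f)
      ultimately show "y \<in> b ` {a x | a. complex_automorphism K a \<and> a ` c = c}" by blast
    qed
    then show ?thesis using finite_stabilizer_orbit[OF c] finite_surj by blast
  next
    case False
    then have "Orb c' = {}" by (auto simp: Orb_def)
    then show ?thesis by simp
  qed
  then have finO: "finite (\<Union>c'\<in>S. Orb c')" using finS by blast
  have inO: "a x \<in> (\<Union>c'\<in>S. Orb c')" if a: "complex_automorphism K a" "D (a x) x < e" for a
  proof -
    have "a x \<in> X.mball x e" using a automorphismD(4)[OF a(1) x] x X.commute by simp
    moreover have "a ` c \<in> cells K" "a x \<in> a ` c" using automorphismD(6)[OF a(1)] cS(1) c(2) by (auto simp: S_def)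
    ultimately have "a ` c \<in> cells K" "x \<in> a ` c" using e(2)[of "a ` c"] by blast+
    then have "a ` c \<in> S" by (simp add: S_def)
    moreover have "a x \<in> Orb (a ` c)" using a(1) unfolding Orb_def by blast
    ultimately show ?thesis by blast
  qed
  define \<epsilon> where "\<epsilon> = Min (insert e ((\<lambda>y. D y x) ` ((\<Union>c'\<in>S. Orb c') \<inter> X - {x})))"
  have "\<epsilon> > 0" unfolding \<epsilon>_def using finO e(1) x X.mdist_pos_less by (subst Min_gr_iff) auto
  moreover have "a x = x" if a: "complex_automorphism K a" "D (a x) x < \<epsilon>" for a
  proof (rule ccontr)
    assume n: "a x \<noteq> x"
    have "\<epsilon> \<le> e" unfolding \<epsilon>_def using finO by (intro Min_le) auto
    then have "a x \<in> (\<Union>c'\<in>S. Orb c') \<inter> X - {x}" using inO[OF a(1)] a(2) n automorphismD(4)[OF a(1) x] by simp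
    then have "\<epsilon> \<le> D (a x) x" unfolding \<epsilon>_def using finO by (intro Min_le) auto
    then show False using a(2) by simp
  qed
  ultimately show ?thesis by blast
qed

text \<open>A small ball lies in a union of finitely many compact cells.\<close>

lemma locally_totally_bounded: assumes x: "x \<in> X" shows "\<exists>e>0. X.mtotally_bounded (X.mball x e)"
proof -
  obtain U where U: "openin X.mtopology U" "x \<in> U" "finite {c \<in> cells K. c \<inter> U \<noteq> {}}"
    using lf x unfolding locally_finite_complex_def by blast
  obtain e where e: "e > 0" "X.mball x e \<subseteq> U" using U unfolding X.openin_mtopology by blast
  have "X.mball x e \<subseteq> \<Union>{c \<in> cells K. c \<inter> U \<noteq> {}}"
  proof
    fix z assume z: "z \<in> X.mball x e"
    then have "z \<in> X" by simp
    then obtain c where "maximal c" "z \<in> c" using maximal_exists by blast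
    then show "z \<in> \<Union>{c \<in> cells K. c \<inter> U \<noteq> {}}" using z e(2) unfolding maximal_def by blast
  qed
  moreover have "X.mtotally_bounded (\<Union>{c \<in> cells K. c \<inter> U \<noteq> {}})"
    using U(3) cells_compact by (intro X.mtotally_bounded_Union) (auto intro: X.compactin_imp_mtotally_bounded)
  ultimately show ?thesis using e(1) X.mtotally_bounded_subset by blast
qed

end

section \<open>Geodesics and simplices in CAT(0) spaces\<close>

text \<open>One side is placed on the first axis and the law of cosines gives the first coordinate
  \<open>u\<close> of the remaining vertex; the triangle inequalities say exactly that
  \<open>u\<^sup>2 \<le> b\<^sup>2\<close>.\<close>

lemma comparison_triangle:
  fixes a b e :: real
  assumes "a \<ge> 0" "b \<ge> 0" "e \<ge> 0" "a \<le> b + e" "b \<le> a + e" "e \<le> a + b"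
  shows "\<exists>y z :: real^2. norm y = a \<and> norm z = b \<and> norm (y - z) = e"
proof -
  have nrm: "norm (vector [p, q] :: real^2) = sqrt (p\<^sup>2 + q\<^sup>2)" for p q
    by (simp add: norm_eq_sqrt_inner inner_vec_def sum_2 power2_eq_square)
  have dif: "(vector [p, q] :: real^2) - vector [p', q'] = vector [p - p', q - q']" for p q p' q' :: real
    by (simp add: vec_eq_iff forall_2)
  show ?thesis
  proof (cases "a = 0")
    case True
    then have "e = b" using assms by auto
    show ?thesis using True assms(2) \<open>e = b\<close>
      by (intro exI[of _ "vector [0, 0]"] exI[of _ "vector [b, 0]"]) (simp only: nrm dif, simp)
  next
    case False
    then have a: "a > 0" using assms(1) by simp
    define u where "u = (a\<^sup>2 + b\<^sup>2 - e\<^sup>2) / (2 * a)"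
    have "(a - b)\<^sup>2 \<le> e\<^sup>2" using assms by (intro power2_le_iff_abs_le[THEN iffD2]) auto
    moreover have "e\<^sup>2 \<le> (a + b)\<^sup>2" using assms by (intro power_mono) auto
    ultimately have "\<bar>a\<^sup>2 + b\<^sup>2 - e\<^sup>2\<bar> \<le> 2 * a * b" by (simp add: power2_eq_square algebra_simps abs_le_iff)
    then have "\<bar>u\<bar> \<le> b" using a by (simp add: u_def abs_mult pos_divide_le_eq mult.commute mult.left_commute)
    then have ub: "u\<^sup>2 \<le> b\<^sup>2" by (simp add: abs_le_square_iff[symmetric])
    define v where "v = sqrt (b\<^sup>2 - u\<^sup>2)"
    have v: "v\<^sup>2 = b\<^sup>2 - u\<^sup>2" using ub by (simp add: v_def)
    have au: "2 * a * u = a\<^sup>2 + b\<^sup>2 - e\<^sup>2" using a by (simp add: u_def)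
    have "(a - u)\<^sup>2 + (0 - v)\<^sup>2 = a\<^sup>2 - 2 * a * u + u\<^sup>2 + v\<^sup>2" by (simp add: power2_diff)
    also have "\<dots> = e\<^sup>2" using au v by simp
    finally have "norm ((vector [a, 0] :: real^2) - vector [u, v]) = e" using assms(3) unfolding dif nrm by simp
    moreover have "norm (vector [a, 0] :: real^2) = a" "norm (vector [u, v] :: real^2) = b" using a assms(2) v by (simp_all add: nrm)
    ultimately show ?thesis by blast
  qed
qed

section \<open>Contraction along geodesics\<close>

locale cat0 =
  fixes M :: "'a set" and d :: "'a \<Rightarrow> 'a \<Rightarrow> real"
  assumes cat0: "cat0_space M d"

sublocale cat0 \<subseteq> Metric_space M d
  using cat0 by (simp add: cat0_space_def)

context cat0
begin

text \<open>The comparison points at ratio \<open>s\<close> form a triangle similar to the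
  comparison triangle.\<close>

lemma geodesics_diverge:
  assumes b: "geodesic_path M d b x y" and c: "geodesic_path M d c x z" and M: "x \<in> M" "y \<in> M" "z \<in> M" and s: "s \<in> {0..1}"
  shows "d (b (s * d x y)) (c (s * d x z)) \<le> s * d y z"
proof -
  obtain y' z' :: "real^2" where t: "norm y' = d x y" "norm z' = d x z" "norm (y' - z') = d y z"
    using comparison_triangle[of "d x y" "d x z" "d y z"] triangle[OF M] triangle[OF M(1,3,2)] triangle[OF M(2,1,3)] commute nonneg
    by (metis add.commute)
  have I: "s * d x y \<in> {0..d x y}" "s * d x z \<in> {0..d x z}" using s nonneg by (auto intro: mult_left_le_one_le)
  have seg: "s *\<^sub>R w \<in> closed_segment 0 w" for w :: "real^2" using s by (auto simp: in_segment)
  have "d (b (s * d x y)) (c (s * d x z)) \<le> dist (s *\<^sub>R y') (s *\<^sub>R z')"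
    using cat0[unfolded cat0_space_def, THEN conjunct2, THEN conjunct2, THEN conjunct2, rule_format, OF M I b c, of 0 y' z' "s *\<^sub>R y'" "s *\<^sub>R z'"]
      t seg s by (simp add: dist_norm)
  also have "\<dots> = s * d y z" using t(3) s by (simp add: dist_norm flip: scaleR_diff_right)
  finally show ?thesis .
qed

text \<open>Geodesics are parametrised proportionally to arc length on the unit interval, so that
  the parameter is a homotopy parameter; that the choice is immaterial is
  \<open>geo_unique\<close>.\<close>

definition geo :: "'a \<Rightarrow> 'a \<Rightarrow> real \<Rightarrow> 'a" where
  "geo x y s = (SOME c. geodesic_path M d c x y) (s * d x y)"

lemma geo_path: assumes "x \<in> M" "y \<in> M" shows "geodesic_path M d (SOME c. geodesic_path M d c x y) x y"
  using cat0 assms unfolding cat0_space_def by (metis someI_ex)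

lemma geo_in: assumes "x \<in> M" "y \<in> M" "s \<in> {0..1}" shows "geo x y s \<in> M"
proof -
  have "s * d x y \<in> {0..d x y}" using assms(3) nonneg by (auto intro: mult_left_le_one_le)
  then show ?thesis using geo_path[OF assms(1,2)] unfolding geodesic_path_def geo_def by blast
qed

lemma geo_ends: assumes "x \<in> M" "y \<in> M" shows "geo x y 0 = x" "geo x y 1 = y"
  using geo_path[OF assms] by (simp_all add: geodesic_path_def geo_def)

lemma geo_speed: assumes "x \<in> M" "y \<in> M" "s \<in> {0..1}" "t \<in> {0..1}" shows "d (geo x y s) (geo x y t) = \<bar>s - t\<bar> * d x y"
proof -
  have "s * d x y \<in> {0..d x y}" "t * d x y \<in> {0..d x y}" using assms(3,4) nonneg by (auto intro: mult_left_le_one_le)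
  then have "d (geo x y s) (geo x y t) = \<bar>s * d x y - t * d x y\<bar>" using geo_path[OF assms(1,2)] unfolding geodesic_path_def geo_def by blast
  then show ?thesis by (simp add: abs_mult flip: left_diff_distrib)
qed

lemma geo_dist_start: assumes "x \<in> M" "y \<in> M" "s \<in> {0..1}" shows "d x (geo x y s) = s * d x y"
  using geo_speed[OF assms(1,2), of 0 s] geo_ends[OF assms(1,2)] assms(3) by simp

lemma geo_diverge: assumes "x \<in> M" "y \<in> M" "z \<in> M" "s \<in> {0..1}" shows "d (geo x y s) (geo x z s) \<le> s * d y z"
  unfolding geo_def using geodesics_diverge[OF geo_path geo_path] assms by blast

lemma geo_unique: assumes "x \<in> M" "y \<in> M" "geodesic_path M d c x y" "s \<in> {0..1}" shows "c (s * d x y) = geo x y s"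
proof -
  have "d (c (s * d x y)) (geo x y s) \<le> s * d y y" unfolding geo_def using geodesics_diverge[OF assms(3) geo_path] assms by blast
  moreover have "s * d x y \<in> {0..d x y}" using assms(4) nonneg by (auto intro: mult_left_le_one_le)
  then have "c (s * d x y) \<in> M" using assms(3) unfolding geodesic_path_def by blast
  ultimately show ?thesis using geo_in[OF assms(1,2,4)] assms(2) nonneg zero mdist_zero by (metis mult_zero_right order_antisym)
qed

lemma geo_isometry:
  assumes f: "\<And>x. x \<in> M \<Longrightarrow> f x \<in> M" "\<And>x y. x \<in> M \<Longrightarrow> y \<in> M \<Longrightarrow> d (f x) (f y) = d x y" and M: "x \<in> M" "y \<in> M" "s \<in> {0..1}"
  shows "f (geo x y s) = geo (f x) (f y) s"
proof -
  let ?c = "SOME c. geodesic_path M d c x y"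
  have c: "geodesic_path M d ?c x y" using geo_path M by blast
  have "geodesic_path M d (f \<circ> ?c) (f x) (f y)"
    using c f M unfolding geodesic_path_def by (auto simp: image_subset_iff)
  from geo_unique[OF _ _ this M(3)] show ?thesis using f M by (simp add: geo_def)
qed

text \<open>The estimate first changes \<open>s\<close>, at constant speed, and then
  \<open>y\<close>, where geodesics from \<open>x\<close> diverge at most linearly.\<close>

lemma geo_continuous: assumes x: "x \<in> M"
  shows "continuous_map (prod_topology (top_of_set {0..1::real}) mtopology) mtopology (\<lambda>(s, y). geo x y s)"
  unfolding continuous_map_to_metric
proof (intro ballI allI impI)
  fix p and e :: real assume p: "p \<in> topspace (prod_topology (top_of_set {0..1::real}) mtopology)" and e: "e > 0"
  obtain s y where sy: "p = (s, y)" "s \<in> {0..1}" "y \<in> M" using p by auto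
  \<comment> \<open>The 1 keeps the denominator positive when \<open>x = y\<close>.\<close>
  define \<delta> where "\<delta> = e / (2 * (d x y + 1))"
  have \<delta>: "\<delta> > 0" "\<delta> * d x y < e / 2"
  proof -
    have "d x y + 1 > 0" using nonneg[of x y] by linarith
    then show "\<delta> > 0" using e by (simp add: \<delta>_def)
    show "\<delta> * d x y < e / 2" using \<open>d x y + 1 > 0\<close> e by (simp add: \<delta>_def pos_divide_less_eq)
  qed
  define U where "U = ({0..1::real} \<inter> ball s \<delta>) \<times> mball y (e / 2)"
  have "openin (top_of_set {0..1::real}) ({0..1::real} \<inter> ball s \<delta>)" by (intro openin_open_Int) simp
  then have "openin (prod_topology (top_of_set {0..1::real}) mtopology) U" unfolding U_def by (subst openin_prod_Times_iff) auto
  moreover have "p \<in> U" using sy \<delta> e by (simp add: U_def)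
  moreover have "(case q of (s, y) \<Rightarrow> geo x y s) \<in> mball (case p of (s, y) \<Rightarrow> geo x y s) e" if q: "q \<in> U" for q
  proof -
    obtain t z where tz: "q = (t, z)" "t \<in> {0..1}" "\<bar>s - t\<bar> < \<delta>" "z \<in> M" "d y z < e / 2" using q by (auto simp: U_def dist_real_def)
    have m: "geo x y s \<in> M" "geo x y t \<in> M" "geo x z t \<in> M" using geo_in x sy tz by auto
    have "d (geo x y s) (geo x z t) \<le> d (geo x y s) (geo x y t) + d (geo x y t) (geo x z t)" by (rule triangle[OF m])
    also have "\<dots> \<le> \<bar>s - t\<bar> * d x y + t * d y z"
      using geo_speed[OF x sy(3,2) tz(2)] geo_diverge[OF x sy(3) tz(4,2)] by simp
    also have "\<dots> \<le> \<delta> * d x y + 1 * d y z" using tz nonneg by (intro add_mono mult_right_mono) auto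
    also have "\<dots> < e" using \<delta>(2) tz(5) by simp
    finally show ?thesis using m sy tz by simp
  qed
  ultimately show "\<exists>U. openin (prod_topology (top_of_set {0..1::real}) mtopology) U \<and> p \<in> U \<and>
      (\<forall>q\<in>U. (case q of (s, y) \<Rightarrow> geo x y s) \<in> mball (case p of (s, y) \<Rightarrow> geo x y s) e)" by blast
qed

lemma geo_continuous_sub: assumes x: "x \<in> M" and S: "S \<subseteq> M" "\<And>y s. y \<in> S \<Longrightarrow> s \<in> {0..1} \<Longrightarrow> geo x y s \<in> S"
  shows "continuous_map (prod_topology (top_of_set {0..1::real}) (subtopology mtopology S)) (subtopology mtopology S) (\<lambda>(s, y). geo x y s)"
proof -
  have "prod_topology (top_of_set {0..1::real}) (subtopology mtopology S) = subtopology (prod_topology (top_of_set {0..1::real}) mtopology) ({0..1} \<times> S)"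
    by (simp add: subtopology_Times subtopology_subtopology)
  moreover have "continuous_map (subtopology (prod_topology (top_of_set {0..1::real}) mtopology) ({0..1} \<times> S)) mtopology (\<lambda>(s, y). geo x y s)"
    by (rule continuous_map_from_subtopology[OF geo_continuous[OF x]])
  ultimately show ?thesis using S by (auto simp: continuous_map_in_subtopology)
qed

lemma contractible_sub: assumes x: "x \<in> S" and S: "S \<subseteq> M" "\<And>y s. y \<in> S \<Longrightarrow> s \<in> {0..1} \<Longrightarrow> geo x y s \<in> S"
  shows "contractible_space (subtopology mtopology S)"
proof -
  have xM: "x \<in> M" using x S by blast
  have "homotopic_with (\<lambda>_. True) (subtopology mtopology S) (subtopology mtopology S) (\<lambda>_. x) id"
    using geo_continuous_sub[OF xM S] geo_ends[OF xM] S(1)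
    by (subst homotopic_with) (auto intro!: exI[of _ "\<lambda>(s, y). geo x y s"])
  then show ?thesis unfolding contractible_space_def using homotopic_with_sym by blast
qed

lemma geo_mball: assumes "x \<in> M" "y \<in> mball x e" "s \<in> {0..1}" shows "geo x y s \<in> mball x e"
proof -
  have y: "y \<in> M" "d x y < e" using assms(2) by auto
  have "s * d x y \<le> d x y" using assms(3) nonneg by (auto intro: mult_left_le_one_le)
  then show ?thesis using geo_dist_start[OF assms(1) y(1) assms(3)] geo_in[OF assms(1) y(1) assms(3)] y(2) assms(1) by simp
qed

lemma contractible: "contractible_space mtopology"
proof -
  obtain x where "x \<in> M" using cat0 by (auto simp: cat0_space_def)
  then have "contractible_space (subtopology mtopology M)" using geo_in by (intro contractible_sub) auto
  then show ?thesis by (metis subtopology_topspace topspace_mtopology)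
qed

end

section \<open>Singular simplices of low dimension\<close>

text \<open>Reduced and ordinary homology agree in degree 1, and the reduced homology of a
  contractible space is trivial.\<close>

lemma contractible_cycle_boundary:
  assumes "contractible_space X" "singular_relcycle 1 X {} z"
  shows "\<exists>b. singular_chain 2 X b \<and> chain_boundary 2 b = z"
proof -
  have "trivial_group (homology_group 1 X)" using trivial_reduced_homology_group_contractible_space[OF assms(1), of 1] un_reduced_homology_group[of 1 X] by simp
  then have "carrier (homology_group (int 1) X) = {\<one>\<^bsub>homology_group (int 1) X\<^esub>}" by (simp add: trivial_group_def)
  moreover have "homologous_rel_set 1 X {} z \<in> carrier (homology_group (int 1) X)" unfolding carrier_relative_homology_group using assms(2) by blast
  ultimately have "homologous_rel_set 1 X {} z = singular_relboundary_set 1 X {}" by (metis one_relative_homology_group singletonD)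
  moreover have "z \<in> homologous_rel_set 1 X {} z" by simp
  ultimately have "singular_relboundary 1 X {} z" by blast
  then show ?thesis unfolding singular_boundary by (simp add: numeral_2_eq_2)
qed

text \<open>The standard 1-simplex in barycentric coordinates, parametrised by the unit
  interval.\<close>

definition edge :: "real \<Rightarrow> nat \<Rightarrow> real" where
  "edge t i = (if i = 0 then 1 - t else if i = 1 then t else 0)"

lemma edge_simplex: "t \<in> {0..1} \<Longrightarrow> edge t \<in> standard_simplex 1"
  by (auto simp: standard_simplex_def edge_def)

lemma simplex_1_edge: assumes "x \<in> standard_simplex 1" shows "x = edge (x 1)" "x 1 \<in> {0..1}"
proof
  fix i
  have "x 0 + x 1 = 1" "\<And>i. i > 1 \<Longrightarrow> x i = 0" using assms by (auto simp: standard_simplex_def)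
  then show "x i = edge (x 1) i" by (cases "i = 0"; cases "i = 1") (auto simp: edge_def)
qed (use assms in \<open>auto simp: standard_simplex_def\<close>)

lemma vertex_eq: "edge 0 = (\<lambda>j. if j = 0 then 1 else 0)" "edge 1 = (\<lambda>j. if j = 1 then 1 else 0)"
  by (auto simp: edge_def)

lemma continuous_edge: "continuous_map (top_of_set {0..1}) (subtopology (powertop_real UNIV) (standard_simplex 1)) edge"
  unfolding continuous_map_in_subtopology continuous_map_componentwise_UNIV
proof (intro conjI allI)
  fix i show "continuous_map (top_of_set {0..1}) euclideanreal (\<lambda>t. edge t i)"
    unfolding edge_def by (cases "i = 0"; cases "i = 1") (auto intro!: continuous_intros)
qed (use edge_simplex in auto)

text \<open>A path composed with the affine map of the simplex to the real line that takes vertex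
  \<open>i\<close> to \<open>v i\<close>. Such flattened simplices serve to subdivide paths.\<close>

definition affine_simplex :: "nat \<Rightarrow> (real \<Rightarrow> 'a) \<Rightarrow> (nat \<Rightarrow> real) \<Rightarrow> (nat \<Rightarrow> real) \<Rightarrow> 'a" where
  "affine_simplex p g v = (\<lambda>t\<in>standard_simplex p. g (\<Sum>i\<le>p. v i * t i))"

lemma convex_comb_in: assumes "t \<in> standard_simplex p" "\<And>i. i \<le> p \<Longrightarrow> v i \<in> {a..b::real}" shows "(\<Sum>i\<le>p. v i * t i) \<in> {a..b}"
proof -
  have t: "\<And>i. t i \<ge> 0" "(\<Sum>i\<le>p. t i) = 1" using assms(1) by (auto simp: standard_simplex_def)
  have "(\<Sum>i\<le>p. a * t i) \<le> (\<Sum>i\<le>p. v i * t i)" "(\<Sum>i\<le>p. v i * t i) \<le> (\<Sum>i\<le>p. b * t i)"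
    using assms(2) t(1) by (intro sum_mono mult_right_mono; force)+
  then show ?thesis using t(2) by (simp flip: sum_distrib_left)
qed

lemma singular_affine_simplex:
  assumes g: "continuous_map (top_of_set {a..b}) X g" and v: "\<And>i. i \<le> p \<Longrightarrow> v i \<in> {a..b}"
  shows "singular_simplex p X (affine_simplex p g v)"
proof -
  have "continuous_map (subtopology (powertop_real UNIV) (standard_simplex p)) euclideanreal (\<lambda>t. \<Sum>i\<le>p. v i * t i)"
    using continuous_map_product_projection[of _ UNIV "\<lambda>_. euclideanreal"]
    by (intro continuous_map_sum continuous_map_real_mult continuous_map_from_subtopology) auto
  then have "continuous_map (subtopology (powertop_real UNIV) (standard_simplex p)) (top_of_set {a..b}) (\<lambda>t. \<Sum>i\<le>p. v i * t i)"
    using convex_comb_in[of _ p v a b] v by (auto simp: continuous_map_in_subtopology)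
  from continuous_map_compose[OF this g]
  have "continuous_map (subtopology (powertop_real UNIV) (standard_simplex p)) X (affine_simplex p g v)"
    by (rule continuous_map_eq) (auto simp: affine_simplex_def)
  then show ?thesis by (simp add: singular_simplex_def affine_simplex_def)
qed

lemma singular_face_affine: assumes "k \<le> Suc p"
  shows "singular_face (Suc p) k (affine_simplex (Suc p) g v) = affine_simplex p g (\<lambda>i. v (if i < k then i else Suc i))"
proof
  fix t
  show "singular_face (Suc p) k (affine_simplex (Suc p) g v) t = affine_simplex p g (\<lambda>i. v (if i < k then i else Suc i)) t"
  proof (cases "t \<in> standard_simplex p")
    case True
    have f: "simplical_face k t \<in> standard_simplex (Suc p)" using simplical_face_in_standard_simplex[of "Suc p" k t] assms True by simp
    have "(\<Sum>i\<le>Suc p. v i * simplical_face k t i) = (\<Sum>i\<le>p. v (if i < k then i else Suc i) * t i)"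
    proof -
      have "(\<Sum>i\<le>Suc p. v i * simplical_face k t i) = (\<Sum>i\<in>{..Suc p} - {k}. v i * simplical_face k t i)"
        using assms by (intro sum.mono_neutral_right) (auto simp: simplical_face_def)
      also have "\<dots> = (\<Sum>i\<le>p. v (if i < k then i else Suc i) * simplical_face k t (if i < k then i else Suc i))"
        using assms by (intro sum.reindex_bij_witness[where j="\<lambda>i. if i < k then i else i - 1" and i="\<lambda>i. if i < k then i else Suc i"]) auto
      also have "\<dots> = (\<Sum>i\<le>p. v (if i < k then i else Suc i) * t i)" by (intro sum.cong) (auto simp: simplical_face_def)
      finally show ?thesis .
    qed
    then show ?thesis using True f by (simp add: singular_face_def affine_simplex_def)
  qed (simp add: singular_face_def affine_simplex_def)
qed

lemma chain_boundary_2: "chain_boundary 2 (frag_of f) = frag_of (singular_face 2 0 f) - frag_of (singular_face 2 1 f) + frag_of (singular_face 2 2 f)"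
  by (simp add: chain_boundary_of numeral_2_eq_2)

lemma chain_boundary_1: "chain_boundary 1 (frag_of f) = frag_of (singular_face 1 0 f) - frag_of (singular_face 1 1 f)"
  by (simp add: chain_boundary_of)

definition interval_simplex :: "(real \<Rightarrow> 'a) \<Rightarrow> real \<Rightarrow> real \<Rightarrow> (nat \<Rightarrow> real) \<Rightarrow> 'a" where
  "interval_simplex g a b = affine_simplex 1 g (\<lambda>i. if i = 0 then a else b)"

lemma affine_cong: "(\<And>i. i \<le> p \<Longrightarrow> v i = w i) \<Longrightarrow> affine_simplex p g v = affine_simplex p g w"
  unfolding affine_simplex_def by (intro restrict_ext arg_cong[of _ _ g] sum.cong) auto

text \<open>A triangle flattened onto a parameter interval makes cocycles additive under subdivision
  of a path.\<close>

lemma triangle_boundary: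
  "chain_boundary 2 (frag_of (affine_simplex 2 g (\<lambda>i. if i = 0 then a else if i = 1 then b else c))) =
     frag_of (interval_simplex g b c) - frag_of (interval_simplex g a c) + frag_of (interval_simplex g a b)"
proof -
  have "singular_face 2 k (affine_simplex 2 g v) = affine_simplex 1 g (\<lambda>i. v (if i < k then i else Suc i))" if "k \<le> 2" for k v
    using singular_face_affine[of k 1 g v] that by (simp add: numeral_2_eq_2)
  then show ?thesis unfolding chain_boundary_2 interval_simplex_def
    by (auto intro!: arg_cong2[of _ _ _ _ "(+)"] arg_cong2[of _ _ _ _ "(-)"] arg_cong[of _ _ frag_of] affine_cong)
qed

lemma simplex_as_interval: assumes "singular_simplex 1 X f"
  shows "f = interval_simplex (\<lambda>t. f (edge t)) 0 1" "continuous_map (top_of_set {0..1}) X (\<lambda>t. f (edge t))"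
proof -
  have c: "continuous_map (subtopology (powertop_real UNIV) (standard_simplex 1)) X f" and e: "f \<in> extensional (standard_simplex 1)"
    using assms by (auto simp: singular_simplex_def)
  show "continuous_map (top_of_set {0..1}) X (\<lambda>t. f (edge t))" using continuous_map_compose[OF continuous_edge c] by (simp add: o_def)
  show "f = interval_simplex (\<lambda>t. f (edge t)) 0 1"
  proof
    fix t show "f t = interval_simplex (\<lambda>t. f (edge t)) 0 1 t"
    proof (cases "t \<in> standard_simplex 1")
      case True
      then show ?thesis using simplex_1_edge(1)[OF True] by (simp add: interval_simplex_def affine_simplex_def)
    next
      case False
      then show ?thesis using e by (simp add: interval_simplex_def affine_simplex_def extensional_def)
    qed
  qed
qed

lemma interval_simplex_edge: "t \<in> {0..1} \<Longrightarrow> interval_simplex g a b (edge t) = g (a + t * (b - a))"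
proof -
  assume t: "t \<in> {0..1}"
  have "(\<Sum>i\<le>1. (if i = 0 then a else b) * edge t i) = a + t * (b - a)" by (simp add: edge_def algebra_simps)
  then show ?thesis using edge_simplex[OF t] by (simp add: interval_simplex_def affine_simplex_def)
qed

lemma standard_simplex_0': "t \<in> standard_simplex 0 \<Longrightarrow> t = edge 0"
  by (simp add: standard_simplex_0 vertex_eq)

lemma face_1: "singular_face 1 0 f = (\<lambda>t\<in>standard_simplex 0. f (edge 1))" "singular_face 1 1 f = (\<lambda>t\<in>standard_simplex 0. f (edge 0))"
proof -
  have "simplical_face 0 (edge 0) = edge 1" "simplical_face 1 (edge 0) = edge 0" by (auto simp: simplical_face_def edge_def fun_eq_iff)
  then show "singular_face 1 0 f = (\<lambda>t\<in>standard_simplex 0. f (edge 1))" "singular_face 1 1 f = (\<lambda>t\<in>standard_simplex 0. f (edge 0))"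
    unfolding singular_face_def by (auto intro!: restrict_ext dest!: standard_simplex_0')
qed

section \<open>First cohomology of an orbit space\<close>

text \<open>Linear extension of \<open>v\<close> to chains. Since \<open>frag_extend\<close> takes
  values in free abelian groups, an integer is encoded as a multiple of a single generator.\<close>

definition chain_extend :: "('b \<Rightarrow> int) \<Rightarrow> ('b \<Rightarrow>\<^sub>0 int) \<Rightarrow> int" where
  "chain_extend v x = poly_mapping.lookup (frag_extend (\<lambda>\<sigma>. frag_cmul (v \<sigma>) (frag_of ())) x) ()"

lemma chain_extend_of [simp]: "chain_extend v (frag_of \<sigma>) = v \<sigma>"
  by (simp add: chain_extend_def)

lemma chain_extend_diff: "chain_extend v (a - b) = chain_extend v a - chain_extend v b"
  by (simp add: chain_extend_def frag_extend_diff lookup_minus)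

lemma chain_extend_add: "chain_extend v (a + b) = chain_extend v a + chain_extend v b"
  by (simp add: chain_extend_def frag_extend_add lookup_add)

lemma chain_extend_zero: "chain_extend v 0 = 0"
  using chain_extend_diff[of v 0 0] by simp

lemma chain_induct:
  assumes "singular_chain p X c" "P 0" "\<And>f. singular_simplex p X f \<Longrightarrow> P (frag_of f)" "\<And>a b. P a \<Longrightarrow> P b \<Longrightarrow> P (a - b)"
  shows "P c"
  using frag_induction[of c "singular_simplex_set p X" P] assms by (auto simp: singular_chain_def)

text \<open>Integrate \<open>e\<close> along chosen paths from a base point: the defect on a simplex
  is the value of \<open>e\<close> on a cycle, which bounds. The form of \<open>e\<close>, a
  function on chains, covers pullbacks and restrictions to subspaces alike.\<close>

lemma closed_cochain_exact:
  assumes X: "contractible_space X"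
    and e_diff: "\<And>a b. singular_chain 1 X a \<Longrightarrow> singular_chain 1 X b \<Longrightarrow> e (a - b) = e a - (e b :: int)"
    and e_bd: "\<And>b. singular_chain 2 X b \<Longrightarrow> e (chain_boundary 2 b) = 0"
  shows "\<exists>k. \<forall>\<tau>. singular_simplex 1 X \<tau> \<longrightarrow> e (frag_of \<tau>) = k (\<tau> (edge 1)) - k (\<tau> (edge 0))"
proof (cases "topspace X = {}")
  case True
  then have "\<not> singular_simplex 1 X \<tau>" for \<tau> :: "(nat \<Rightarrow> real) \<Rightarrow> 'a"
    using nonempty_standard_simplex[of 1] by (auto simp: singular_simplex_def continuous_map_def)
  then show ?thesis by blast
next
  case False
  then obtain y0 where y0: "y0 \<in> topspace X" by blast
  have "\<exists>\<sigma>. singular_simplex 1 X \<sigma> \<and> \<sigma> (edge 0) = y0 \<and> \<sigma> (edge 1) = y" if y: "y \<in> topspace X" for y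
  proof -
    obtain g where g: "pathin X g" "g 0 = y0" "g 1 = y"
      using contractible_imp_path_connected_space[OF X] y0 y unfolding path_connected_space_def by blast
    have "singular_simplex 1 X (interval_simplex g 0 1)"
      unfolding interval_simplex_def using g(1) by (intro singular_affine_simplex[of 0 1]) (auto simp: pathin_def)
    then show ?thesis using interval_simplex_edge[of 0 g 0 1] interval_simplex_edge[of 1 g 0 1] g(2,3) by auto
  qed
  then obtain \<sigma> where \<sigma>: "\<And>y. y \<in> topspace X \<Longrightarrow> singular_simplex 1 X (\<sigma> y)" "\<And>y. y \<in> topspace X \<Longrightarrow> \<sigma> y (edge 0) = y0"
    "\<And>y. y \<in> topspace X \<Longrightarrow> \<sigma> y (edge 1) = y" by metis
  have "e (frag_of \<tau>) = e (frag_of (\<sigma> (\<tau> (edge 1)))) - e (frag_of (\<sigma> (\<tau> (edge 0))))" if \<tau>: "singular_simplex 1 X \<tau>" for \<tau>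
  proof -
    have c: "continuous_map (subtopology (powertop_real UNIV) (standard_simplex 1)) X \<tau>" using \<tau> by (simp add: singular_simplex_def)
    have in_X: "\<tau> (edge t) \<in> topspace X" if "t \<in> {0..1}" for t
      using continuous_map_image_subset_topspace[OF c] edge_simplex[OF that] by auto
    define a b where "a = \<tau> (edge 0)" and "b = \<tau> (edge 1)"
    have ab: "a \<in> topspace X" "b \<in> topspace X" using in_X by (auto simp: a_def b_def)
    \<comment> \<open>The cycle is written with differences alone, since \<open>e\<close> is assumed
      to respect only these.\<close>
    define z where "z = (frag_of \<tau> - frag_of (\<sigma> b)) - (0 - frag_of (\<sigma> a))"
    have ch: "singular_chain 1 X (frag_of \<tau>)" "singular_chain 1 X (frag_of (\<sigma> a))" "singular_chain 1 X (frag_of (\<sigma> b))"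
      using \<tau> \<sigma>(1) ab by (auto simp: singular_chain_of)
    have z: "singular_chain 1 X z" unfolding z_def by (intro singular_chain_diff ch singular_chain_0)
    have "chain_boundary 1 z = 0"
      unfolding z_def chain_boundary_diff chain_boundary_1 face_1 \<sigma>(2,3)[OF ab(1)] \<sigma>(2,3)[OF ab(2)]
      by (simp add: a_def b_def)
    then obtain w where w: "singular_chain 2 X w" "chain_boundary 2 w = z"
      using contractible_cycle_boundary[OF X, of z] z by (auto simp: singular_cycle)
    have "e z = 0" using e_bd[OF w(1)] w(2) by simp
    moreover have "e 0 = 0" using e_diff[of 0 0] by simp
    moreover have "e z = (e (frag_of \<tau>) - e (frag_of (\<sigma> b))) - (e 0 - e (frag_of (\<sigma> a)))"
      unfolding z_def using e_diff[OF singular_chain_diff[OF ch(1,3)] singular_chain_diff[OF singular_chain_0 ch(2)]]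
        e_diff[OF ch(1,3)] e_diff[OF singular_chain_0 ch(2)] by simp
    ultimately show ?thesis by (simp add: a_def b_def)
  qed
  then show ?thesis by (intro exI[of _ "\<lambda>y. e (frag_of (\<sigma> y))"]) blast
qed

lemma integer_product_subgroup:
  assumes "S \<subseteq> extensional I" "(\<lambda>i\<in>I. 0) \<in> S" "\<And>f g. f \<in> S \<Longrightarrow> g \<in> S \<Longrightarrow> (\<lambda>i\<in>I. f i + g i) \<in> S" "\<And>f. f \<in> S \<Longrightarrow> (\<lambda>i\<in>I. - f i) \<in> S"
  shows "group ((product_group I (\<lambda>_. integer_group))\<lparr>carrier := S\<rparr>)"
proof -
  have g: "group (product_group I (\<lambda>_. integer_group))" by simp
  have "subgroup S (product_group I (\<lambda>_. integer_group))"
  proof (rule group.subgroupI[OF g])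
    show "S \<subseteq> carrier (product_group I (\<lambda>_. integer_group))" using assms(1) by (auto simp: PiE_def)
    show "S \<noteq> {}" using assms(2) by blast
    show "inv\<^bsub>product_group I (\<lambda>_. integer_group)\<^esub> f \<in> S" if "f \<in> S" for f
      using assms(1,4) that by (subst inv_product_group) (auto simp: PiE_def)
    show "f \<otimes>\<^bsub>product_group I (\<lambda>_. integer_group)\<^esub> g \<in> S" if "f \<in> S" "g \<in> S" for f g
      using assms(3)[OF that] by simp
  qed
  then show ?thesis using g by (rule subgroup.subgroup_is_group)
qed

section \<open>Logarithms of circle-valued functions\<close>

lemma cis_eq_iff: "cis (2 * pi * a) = cis (2 * pi * b) \<longleftrightarrow> a - b \<in> \<int>"
proof -
  have "cis (2 * pi * a) = cis (2 * pi * b) \<longleftrightarrow> cis (2 * pi * a - 2 * pi * b) = 1"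
    by (simp add: cis_divide[symmetric])
  also have "\<dots> \<longleftrightarrow> (\<exists>n::int. 2 * pi * a - 2 * pi * b = 2 * pi * n)"
    unfolding cis_conv_exp exp_eq_1 by (simp add: mult.commute mult.left_commute)
  also have "\<dots> \<longleftrightarrow> a - b \<in> \<int>"
  proof -
    have "2 * pi * a - 2 * pi * b = 2 * pi * n \<longleftrightarrow> a - b = n" for n :: real
      by (simp add: right_diff_distrib[symmetric])
    then show ?thesis by (auto simp: Ints_def)
  qed
  finally show ?thesis .
qed

text \<open>A nonvanishing function on a contractible set has a continuous logarithm, and on the
  unit circle only its imaginary part matters.\<close>

lemma circle_lift_exists:
  fixes E :: "'v::real_normed_vector \<Rightarrow> complex"
  assumes "continuous_on S E" "convex S" "\<And>x. x \<in> S \<Longrightarrow> cmod (E x) = 1"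
  shows "\<exists>l. continuous_on S l \<and> (\<forall>x\<in>S. E x = cis (2 * pi * l x))"
proof -
  have "\<And>z. z \<in> S \<Longrightarrow> E z \<noteq> 0" using assms(3) by fastforce
  then obtain g where g: "continuous_on S g" "\<And>x. x \<in> S \<Longrightarrow> E x = exp (g x)"
    using continuous_logarithm_on_contractible[OF assms(1) convex_imp_contractible[OF assms(2)]] by blast
  have "E x = cis (2 * pi * (Im (g x) / (2 * pi)))" if "x \<in> S" for x
  proof -
    have "exp (Re (g x)) = 1" using assms(3)[OF that] g(2)[OF that] by (simp add: norm_exp_eq_Re)
    then show ?thesis using g(2)[OF that] by (simp add: exp_eq_polar)
  qed
  moreover have "continuous_on S (\<lambda>x. Im (g x) / (2 * pi))" using g(1) by (intro continuous_intros) auto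
  ultimately show ?thesis by blast
qed

text \<open>Two lifts differ by a continuous integer-valued function, which is constant on a
  connected set.\<close>

lemma circle_lift_unique:
  assumes "connected S" "continuous_on S l" "continuous_on S k" "\<And>x. x \<in> S \<Longrightarrow> cis (2 * pi * l x) = cis (2 * pi * k x)" "x \<in> S" "y \<in> S"
  shows "l x - l y = k x - k y"
proof -
  have "(\<lambda>x. l x - k x) constant_on S"
  proof (rule continuous_discrete_range_constant[OF assms(1)])
    show "continuous_on S (\<lambda>x. l x - k x)" using assms(2,3) by (intro continuous_intros)
    fix x assume x: "x \<in> S"
    have I: "l y - k y \<in> \<int>" if "y \<in> S" for y using assms(4)[OF that] by (simp add: cis_eq_iff)
    have "1 \<le> norm (l y - k y - (l x - k x))" if "y \<in> S" "l y - k y \<noteq> l x - k x" for y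
      using Ints_nonzero_abs_ge1[of "l y - k y - (l x - k x)"] I[OF that(1)] I[OF x] that(2) by simp
    then show "\<exists>e>0. \<forall>y. y \<in> S \<and> l y - k y \<noteq> l x - k x \<longrightarrow> e \<le> norm (l y - k y - (l x - k x))"
      by (intro exI[of _ 1]) auto
  qed
  then have "l x - k x = l y - k y" using assms(5,6) unfolding constant_on_def by metis
  then show ?thesis by simp
qed

section \<open>Isometric actions and their orbit spaces\<close>

text \<open>These assumptions separate the topological comparison of the two cohomology groups from
  the geometry that provides discrete orbits and the functions in
  \<open>equivariant\<close>.\<close>

locale orbit_setting = cat0 M d + group L
  for M :: "'a set" and d :: "'a \<Rightarrow> 'a \<Rightarrow> real" and L :: "('g, 'b) monoid_scheme" +
  fixes act :: "'g \<Rightarrow> 'a \<Rightarrow> 'a"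
  assumes act_in: "g \<in> carrier L \<Longrightarrow> x \<in> M \<Longrightarrow> act g x \<in> M"
    and act_iso: "g \<in> carrier L \<Longrightarrow> x \<in> M \<Longrightarrow> y \<in> M \<Longrightarrow> d (act g x) (act g y) = d x y"
    and act_mult: "g \<in> carrier L \<Longrightarrow> h \<in> carrier L \<Longrightarrow> x \<in> M \<Longrightarrow> act (g \<otimes>\<^bsub>L\<^esub> h) x = act g (act h x)"
    and act_one: "x \<in> M \<Longrightarrow> act \<one>\<^bsub>L\<^esub> x = x"
    and discrete: "x \<in> M \<Longrightarrow> \<exists>e>0. \<forall>g\<in>carrier L. d (act g x) x < e \<longrightarrow> act g x = x"
    and equivariant: "\<phi> \<in> hom L integer_group \<Longrightarrow>
      \<exists>f. continuous_map mtopology euclideanreal f \<and> (\<forall>g\<in>carrier L. \<forall>x\<in>M. f (act g x) = f x + real_of_int (\<phi> g))"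
begin

abbreviation "p \<equiv> orbit L act"
abbreviation "Q \<equiv> quotient_topology mtopology p"

lemma p_eq_iff: assumes "x \<in> M" "y \<in> M" shows "p x = p y \<longleftrightarrow> (\<exists>g\<in>carrier L. y = act g x)"
proof
  assume "p x = p y"
  moreover have "y \<in> p y" using act_one[OF assms(2)] one_closed unfolding orbit_def by force
  ultimately show "\<exists>g\<in>carrier L. y = act g x" unfolding orbit_def by auto
next
  assume "\<exists>g\<in>carrier L. y = act g x"
  then obtain g where g: "g \<in> carrier L" "y = act g x" by blast
  have "act h y = act (h \<otimes>\<^bsub>L\<^esub> g) x" if "h \<in> carrier L" for h using act_mult[OF that g(1) assms(1)] g(2) by simp
  moreover have "act h x = act (h \<otimes>\<^bsub>L\<^esub> inv\<^bsub>L\<^esub> g) y" if "h \<in> carrier L" for h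
  proof -
    have "h = h \<otimes>\<^bsub>L\<^esub> inv\<^bsub>L\<^esub> g \<otimes>\<^bsub>L\<^esub> g" using that g(1) by (simp add: m_assoc)
    then show ?thesis using act_mult[of "h \<otimes>\<^bsub>L\<^esub> inv\<^bsub>L\<^esub> g" g x] that g assms(1) by simp
  qed
  ultimately show "p x = p y" using g(1) unfolding orbit_def by (auto intro: m_closed inv_closed)
      (metis g(1) inv_closed m_closed)+
qed

lemma p_act: "g \<in> carrier L \<Longrightarrow> x \<in> M \<Longrightarrow> p (act g x) = p x"
  using p_eq_iff[of x "act g x"] act_in by auto

lemma quotient_p: "quotient_map mtopology Q p"
  by (rule quotient_map_quotient_topology)

lemma continuous_p: "continuous_map mtopology Q p"
  using quotient_imp_continuous_map quotient_p by blast

lemma topspace_Q: "topspace Q = p ` M"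
  using quotient_imp_surjective_map[OF quotient_p] by simp

text \<open>A section of the orbit map chosen pointwise, without any continuity.\<close>

definition rep :: "'a set \<Rightarrow> 'a" where
  "rep q = (SOME x. x \<in> M \<and> p x = q)"

lemma rep: "q \<in> topspace Q \<Longrightarrow> rep q \<in> M \<and> p (rep q) = q"
  unfolding topspace_Q rep_def by (rule someI_ex) auto

lemma invariant_rep: assumes "\<And>g x. g \<in> carrier L \<Longrightarrow> x \<in> M \<Longrightarrow> F (act g x) = F x" "x \<in> M" shows "F (rep (p x)) = F x"
proof -
  have "rep (p x) \<in> M" "p (rep (p x)) = p x" using rep[of "p x"] assms(2) by (auto simp: topspace_Q)
  then obtain g where "g \<in> carrier L" "x = act g (rep (p x))" using p_eq_iff[of "rep (p x)" x] assms(2) by auto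
  then show ?thesis using assms(1) \<open>rep (p x) \<in> M\<close> by metis
qed

lemma open_p: "open_map mtopology Q p"
  unfolding open_map_def
proof (intro allI impI)
  fix U assume U: "openin mtopology U"
  then have UM: "U \<subseteq> M" using openin_mtopology by blast
  have "openin mtopology {x \<in> M. p x \<in> p ` U}"
    unfolding openin_mtopology
  proof (intro conjI allI impI)
    fix x assume "x \<in> {x \<in> M. p x \<in> p ` U}"
    then obtain u where u: "x \<in> M" "u \<in> U" "p x = p u" by auto
    then obtain g where g: "g \<in> carrier L" "u = act g x" using p_eq_iff[of x u] UM by auto
    obtain r where r: "r > 0" "mball u r \<subseteq> U" using U u(2) unfolding openin_mtopology by blast
    have "y \<in> {x \<in> M. p x \<in> p ` U}" if y: "y \<in> mball x r" for y
    proof -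
      have "act g y \<in> mball u r" using y g act_in act_iso u(1) by auto
      then have "act g y \<in> U" "y \<in> M" "p y = p (act g y)" using r(2) y p_act[OF g(1), of y] by auto
      then show ?thesis by blast
    qed
    then show "\<exists>r>0. mball x r \<subseteq> {x \<in> M. p x \<in> p ` U}" using r(1) by blast
  qed blast
  then show "openin Q (p ` U)" unfolding openin_quotient_topology using UM by auto
qed

lemma continuous_act: assumes "g \<in> carrier L" shows "continuous_map mtopology mtopology (act g)"
  unfolding continuous_map_to_metric
proof (intro ballI allI impI)
  fix x e assume x: "x \<in> topspace mtopology" and "(e::real) > 0"
  then show "\<exists>U. openin mtopology U \<and> x \<in> U \<and> (\<forall>y\<in>U. act g y \<in> mball (act g x) e)"
    using act_in[OF assms] act_iso[OF assms] by (intro exI[of _ "mball x e"]) auto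
qed

text \<open>If two points of the ball lie in one orbit, the element relating them moves
  \<open>x\<close> by less than \<open>2 * e\<close>, hence fixes \<open>x\<close> and carries one
  geodesic from \<open>x\<close> to the other; so the contraction descends. Its continuity is
  checked upstairs, because the product of a quotient map with the compact interval is again a
  quotient map.\<close>

lemma quotient_ball_contractible:
  assumes x: "x \<in> M" and e: "\<And>g. g \<in> carrier L \<Longrightarrow> d (act g x) x < 2 * e \<Longrightarrow> act g x = x" and "e > 0"
  shows "contractible_space (subtopology Q (p ` mball x e))"
proof -
  define U where "U = mball x e"
  define V where "V = p ` U"
  have UM: "U \<subseteq> M" and oU: "openin mtopology U" and xU: "x \<in> U" using x \<open>e > 0\<close> by (auto simp: U_def)
  have VQ: "V \<subseteq> topspace Q" using UM by (auto simp: V_def topspace_Q)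
  have qp: "quotient_map (subtopology mtopology U) (subtopology Q V) p"
  proof (rule continuous_open_imp_quotient_map)
    show "continuous_map (subtopology mtopology U) (subtopology Q V) p"
      using continuous_map_from_subtopology[OF continuous_p] UM by (auto simp: continuous_map_in_subtopology V_def)
    show "open_map (subtopology mtopology U) (subtopology Q V) p"
      using UM by (intro open_map_into_subtopology open_map_from_subtopology[OF open_p oU]) (auto simp: V_def)
    show "p ` topspace (subtopology mtopology U) = topspace (subtopology Q V)" using UM VQ by (auto simp: V_def)
  qed
  have "compact_space (top_of_set {0..1::real})" by (intro compact_space_subtopology) simp
  then have "locally_compact_space (top_of_set {0..1::real})" by (rule compact_imp_locally_compact_space)
  moreover have "Hausdorff_space (top_of_set {0..1::real})" by (intro Hausdorff_space_subtopology) simp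
  ultimately have q: "quotient_map (prod_topology (top_of_set {0..1::real}) (subtopology mtopology U)) (prod_topology (top_of_set {0..1::real}) (subtopology Q V)) (\<lambda>(s, y). (s, p y))"
    by (intro quotient_map_prod_right disjI1 qp)
  define r where "r v = (SOME u. u \<in> U \<and> p u = v)" for v
  have r: "r v \<in> U \<and> p (r v) = v" if "v \<in> V" for v unfolding r_def by (rule someI_ex) (use that in \<open>auto simp: V_def\<close>)
  define H where "H sv = p (geo x (r (snd sv)) (fst sv))" for sv
  have Hp: "H (s, p u) = p (geo x u s)" if u: "u \<in> U" and s: "s \<in> {0..1}" for s u
  proof -
    have ru: "r (p u) \<in> U" "p u = p (r (p u))" using r[of "p u"] u by (auto simp: V_def)
    then obtain g where g: "g \<in> carrier L" "r (p u) = act g u" using p_eq_iff u UM by blast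
    have m: "u \<in> M" "act g u \<in> M" "act g x \<in> M" using u UM g act_in x by auto
    have "d (act g x) x \<le> d (act g x) (act g u) + d (act g u) x" using triangle m x by blast
    also have "\<dots> < 2 * e" using act_iso[OF g(1) x m(1)] u ru(1) g(2) commute[of x "act g u"] by (simp add: U_def)
    finally have "act g x = x" using e g(1) by blast
    then have "act g (geo x u s) = geo x (r (p u)) s"
      using geo_isometry[of "act g" x u s] act_in[OF g(1)] act_iso[OF g(1)] x m(1) s g(2) by simp
    then show ?thesis using p_act[OF g(1) geo_in[OF x m(1) s]] by (simp add: H_def)
  qed
  have "continuous_map (prod_topology (top_of_set {0..1::real}) (subtopology mtopology U)) (subtopology Q V) (H \<circ> (\<lambda>(s, y). (s, p y)))"
  proof -
    have "continuous_map (prod_topology (top_of_set {0..1::real}) (subtopology mtopology U)) (subtopology mtopology U) (\<lambda>(s, y). geo x y s)"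
      using geo_mball[OF x] UM by (intro geo_continuous_sub[OF x]) (auto simp: U_def)
    moreover have "continuous_map (subtopology mtopology U) (subtopology Q V) p"
      using continuous_map_from_subtopology[OF continuous_p] UM by (auto simp: continuous_map_in_subtopology V_def)
    ultimately have "continuous_map (prod_topology (top_of_set {0..1::real}) (subtopology mtopology U)) (subtopology Q V) (p \<circ> (\<lambda>(s, y). geo x y s))"
      by (rule continuous_map_compose)
    then show ?thesis by (rule continuous_map_eq) (auto simp: Hp)
  qed
  then have cH: "continuous_map (prod_topology (top_of_set {0..1::real}) (subtopology Q V)) (subtopology Q V) H"
    using continuous_compose_quotient_map[OF q] by blast
  have "homotopic_with (\<lambda>_. True) (subtopology Q V) (subtopology Q V) (\<lambda>_. p x) id"
  proof (subst homotopic_with)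
    show "\<exists>h. continuous_map (prod_topology (top_of_set {0..1::real}) (subtopology Q V)) (subtopology Q V) h \<and>
        (\<forall>y\<in>topspace (subtopology Q V). h (0, y) = p x) \<and> (\<forall>y\<in>topspace (subtopology Q V). h (1, y) = id y) \<and> (\<forall>t\<in>{0..1::real}. True)"
    proof (intro exI[of _ H] conjI ballI)
      fix v assume v: "v \<in> topspace (subtopology Q V)"
      then have rv: "r v \<in> M" "p (r v) = v" using r[of v] UM by auto
      show "H (0, v) = p x" "H (1, v) = id v" using geo_ends[OF x rv(1)] rv(2) by (simp_all add: H_def)
    qed (use cH in auto)
  qed auto
  then show ?thesis unfolding contractible_space_def V_def U_def using homotopic_with_sym by blast
qed

section \<open>Cocycles, potentials and periods\<close>

abbreviation "C1 \<equiv> singular_cochains Q 1"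

definition cocycle :: "('a set chain \<Rightarrow> int) \<Rightarrow> bool" where
  "cocycle c \<longleftrightarrow> c \<in> extensional (singular_chain_set 1 Q) \<and>
    (\<forall>a b. singular_chain 1 Q a \<longrightarrow> singular_chain 1 Q b \<longrightarrow> c (a + b) = c a + c b) \<and>
    (\<forall>b. singular_chain 2 Q b \<longrightarrow> c (chain_boundary 2 b) = 0)"

lemma carrier_cochains: "c \<in> carrier (singular_cochains X n) \<longleftrightarrow> c \<in> extensional (singular_chain_set n X) \<and>
    (\<forall>a b. singular_chain n X a \<longrightarrow> singular_chain n X b \<longrightarrow> c (a + b) = c a + c b)"
  by (auto simp: singular_cochains_def hom_def)

lemma kernel_cocycles: "kernel C1 (singular_cochains Q (Suc 1)) (singular_coboundary Q 1) = Collect cocycle"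
proof -
  have "\<one>\<^bsub>singular_cochains Q (Suc 1)\<^esub> = (\<lambda>c\<in>singular_chain_set 2 Q. 0)" by (simp add: singular_cochains_def numeral_2_eq_2)
  moreover have "singular_coboundary Q 1 c = (\<lambda>b\<in>singular_chain_set 2 Q. c (chain_boundary 2 b))" for c
    by (simp add: singular_coboundary_def numeral_2_eq_2)
  ultimately show ?thesis unfolding kernel_def cocycle_def carrier_cochains
    by (auto simp: restrict_def fun_eq_iff split: if_splits)
qed

lemma cocycle_diff: assumes "cocycle c" "singular_chain 1 Q a" "singular_chain 1 Q b" shows "c (a - b) = c a - c b"
proof -
  have "c ((a - b) + b) = c (a - b) + c b" using assms singular_chain_diff unfolding cocycle_def by blast
  then show ?thesis by simp
qed

abbreviation push :: "((nat \<Rightarrow> real) \<Rightarrow> 'a) \<Rightarrow> (nat \<Rightarrow> real) \<Rightarrow> 'a set" where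
  "push \<tau> \<equiv> simplex_map 1 p \<tau>"

lemma push_simplex: "singular_simplex 1 mtopology \<tau> \<Longrightarrow> singular_simplex 1 Q (push \<tau>)"
  using singular_simplex_simplex_map continuous_p by blast

text \<open>A primitive of the pulled back cocycle, as a function on points of \<open>M\<close> and
  not on orbits.\<close>

definition potential :: "('a set chain \<Rightarrow> int) \<Rightarrow> ('a \<Rightarrow> int) \<Rightarrow> bool" where
  "potential c F \<longleftrightarrow> (\<forall>\<tau>. singular_simplex 1 mtopology \<tau> \<longrightarrow> c (frag_of (push \<tau>)) = F (\<tau> (edge 1)) - F (\<tau> (edge 0)))"

lemma potentialD: "potential c F \<Longrightarrow> singular_simplex 1 mtopology \<tau> \<Longrightarrow> c (frag_of (push \<tau>)) = F (\<tau> (edge 1)) - F (\<tau> (edge 0))"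
  by (simp add: potential_def)

lemma potential_exists: assumes c: "cocycle c" shows "\<exists>F. potential c F"
proof -
  have "\<exists>F. \<forall>\<tau>. singular_simplex 1 mtopology \<tau> \<longrightarrow> c (chain_map 1 p (frag_of \<tau>)) = F (\<tau> (edge 1)) - F (\<tau> (edge 0))"
  proof (rule closed_cochain_exact[OF contractible])
    fix a b assume "singular_chain 1 mtopology a" "singular_chain 1 mtopology b"
    then show "c (chain_map 1 p (a - b)) = c (chain_map 1 p a) - c (chain_map 1 p b)"
      using cocycle_diff[OF c] singular_chain_chain_map[OF _ continuous_p] by (simp add: chain_map_diff)
  next
    fix b assume b: "singular_chain 2 mtopology b"
    then have "chain_map 1 p (chain_boundary 2 b) = chain_boundary 2 (chain_map 2 p b)"
      using chain_boundary_chain_map[of 2 mtopology b p] by simp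
    moreover have "singular_chain 2 Q (chain_map 2 p b)" using singular_chain_chain_map[OF b continuous_p] .
    ultimately show "c (chain_map 1 p (chain_boundary 2 b)) = 0" using c unfolding cocycle_def by simp
  qed
  then show ?thesis by (simp add: potential_def)
qed

definition segment :: "'a \<Rightarrow> 'a \<Rightarrow> (nat \<Rightarrow> real) \<Rightarrow> 'a" where
  "segment x y = interval_simplex (geo x y) 0 1"

lemma segment: assumes "x \<in> M" "y \<in> M"
  shows "singular_simplex 1 mtopology (segment x y)" "segment x y (edge 0) = x" "segment x y (edge 1) = y"
    "t \<in> standard_simplex 1 \<Longrightarrow> segment x y t = geo x y (t 1)"
proof -
  have "continuous_map (top_of_set {0..1}) (prod_topology (top_of_set {0..1}) mtopology) (\<lambda>s. (s, y))"
    using assms by (intro continuous_map_pairedI) auto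
  from continuous_map_compose[OF this geo_continuous[OF assms(1)]]
  have "continuous_map (top_of_set {0..1}) mtopology (geo x y)" by (simp add: o_def)
  then show "singular_simplex 1 mtopology (segment x y)" unfolding segment_def interval_simplex_def
    by (intro singular_affine_simplex[of 0 1]) auto
  show "segment x y (edge 0) = x" "segment x y (edge 1) = y"
    using interval_simplex_edge[of 0 "geo x y" 0 1] interval_simplex_edge[of 1 "geo x y" 0 1] geo_ends[OF assms] by (simp_all add: segment_def)
  show "t \<in> standard_simplex 1 \<Longrightarrow> segment x y t = geo x y (t 1)" by (simp add: segment_def interval_simplex_def affine_simplex_def)
qed

definition base :: 'a where "base = (SOME x. x \<in> M)"

lemma base: "base \<in> M"
  unfolding base_def by (rule someI_ex) (use cat0 in \<open>auto simp: cat0_space_def\<close>)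

text \<open>By \<open>potential_translate\<close> this is the increment of any potential under
  \<open>g\<close>; the definition by a segment makes it independent of the choice of a
  potential.\<close>

definition period :: "('a set chain \<Rightarrow> int) \<Rightarrow> 'g \<Rightarrow> int" where
  "period c g = c (frag_of (push (segment base (act g base))))"

text \<open>A segment and its translate have the same image in the orbit space, so the potential
  changes by the same amount along both.\<close>

lemma potential_translate:
  assumes F: "potential c F"
    and g: "g \<in> carrier L" and x: "x \<in> M"
  shows "F (act g x) = F x + period c g"
proof -
  let ?\<tau> = "segment base x"
  note s = segment[OF base x]
  have s': "singular_simplex 1 mtopology (simplex_map 1 (act g) ?\<tau>)" using singular_simplex_simplex_map[OF s(1) continuous_act[OF g]] .
  have "push (simplex_map 1 (act g) ?\<tau>) = push ?\<tau>"
  proof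
    fix t show "push (simplex_map 1 (act g) ?\<tau>) t = push ?\<tau> t"
    proof (cases "t \<in> standard_simplex 1")
      case True
      have "?\<tau> t \<in> M" using True s(4)[OF True] geo_in[OF base x] simplex_1_edge(2)[OF True] by simp
      then show ?thesis using True p_act[OF g] by (simp add: simplex_map_def)
    qed (simp add: simplex_map_def)
  qed
  then have "F (simplex_map 1 (act g) ?\<tau> (edge 1)) - F (simplex_map 1 (act g) ?\<tau> (edge 0)) = F x - F base"
    using potentialD[OF F s'] potentialD[OF F s(1)] s(2,3) by simp
  moreover have "simplex_map 1 (act g) ?\<tau> (edge t) = act g (?\<tau> (edge t))" if "t \<in> {0..1}" for t
    using edge_simplex[OF that] by (simp add: simplex_map_def)
  ultimately have "F (act g x) - F (act g base) = F x - F base" using s(2,3) by simp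
  moreover have "period c g = F (act g base) - F base"
    unfolding period_def using potentialD[OF F] segment[OF base act_in[OF g base]] by simp
  ultimately show ?thesis by simp
qed

lemma period_hom: assumes c: "cocycle c" and g: "g \<in> carrier L" and h: "h \<in> carrier L"
  shows "period c (g \<otimes>\<^bsub>L\<^esub> h) = period c g + period c h"
proof -
  obtain F where F: "potential c F"
    using potential_exists[OF c] by blast
  note T = potential_translate[OF F]
  have "F (act (g \<otimes>\<^bsub>L\<^esub> h) base) = F (act g (act h base))" using act_mult[OF g h base] by simp
  then show ?thesis using T[OF _ base] T[OF g act_in[OF h base]] T[OF h base] T[OF m_closed[OF g h] base] by simp
qed

text \<open>On the contractible image of a small ball the cocycle has a primitive \<open>k\<close>.
  Images of segments from \<open>x\<close> show that \<open>k\<close> agrees with the invariant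
  potential up to a constant, and \<open>k\<close> also computes the cocycle on simplices that do
  not lift.\<close>

lemma locally_potential:
  assumes F: "potential c F"
    and c: "cocycle c" and z: "\<forall>g\<in>carrier L. period c g = 0" and x: "x \<in> M"
  shows "\<exists>V. openin Q V \<and> p x \<in> V \<and>
    (\<forall>\<sigma>. singular_simplex 1 (subtopology Q V) \<sigma> \<longrightarrow> c (frag_of \<sigma>) = F (rep (\<sigma> (edge 1))) - F (rep (\<sigma> (edge 0))))"
proof -
  have inv: "F (act g y) = F y" if "g \<in> carrier L" "y \<in> M" for g y using potential_translate[OF F that] z that(1) by simp
  have repF: "F (rep (p y)) = F y" if "y \<in> M" for y by (rule invariant_rep) (use inv that in auto)
  obtain e where e: "e > 0" "\<And>g. g \<in> carrier L \<Longrightarrow> d (act g x) x < e \<Longrightarrow> act g x = x" using discrete[OF x] by blast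
  \<comment> \<open>Half the radius, because \<open>quotient_ball_contractible\<close> looks at
    displacements up to twice the radius.\<close>
  define V where "V = p ` mball x (e / 2)"
  have V: "openin Q V" using open_p unfolding open_map_def V_def by blast
  have xV: "p x \<in> V" using x e(1) by (auto simp: V_def)
  have con: "contractible_space (subtopology Q V)" unfolding V_def using e by (intro quotient_ball_contractible[OF x]) auto
  have sub: "singular_chain n Q b" if "singular_chain n (subtopology Q V) b" for n b using that by (simp add: singular_chain_subtopology)
  have "\<exists>k. \<forall>\<tau>. singular_simplex 1 (subtopology Q V) \<tau> \<longrightarrow> c (frag_of \<tau>) = k (\<tau> (edge 1)) - k (\<tau> (edge 0))"
  proof (rule closed_cochain_exact[OF con])
    fix a b assume "singular_chain 1 (subtopology Q V) a" "singular_chain 1 (subtopology Q V) b"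
    then show "c (a - b) = c a - c b" using cocycle_diff[OF c sub sub] by simp
  next
    fix b assume "singular_chain 2 (subtopology Q V) b"
    then have "singular_chain 2 Q b" by (rule sub)
    then show "c (chain_boundary 2 b) = 0" using c by (simp add: cocycle_def)
  qed
  then obtain k where k: "\<And>\<tau>. singular_simplex 1 (subtopology Q V) \<tau> \<Longrightarrow> c (frag_of \<tau>) = k (\<tau> (edge 1)) - k (\<tau> (edge 0))" by blast
  have ku: "k (p u) - k (p x) = F u - F x" if u: "u \<in> mball x (e / 2)" for u
  proof -
    have uM: "u \<in> M" using u by simp
    note s = segment[OF x uM]
    have "push (segment x u) ` standard_simplex 1 \<subseteq> V"
    proof
      fix q assume "q \<in> push (segment x u) ` standard_simplex 1"
      then obtain t where t: "t \<in> standard_simplex 1" "q = p (segment x u t)" by (auto simp: simplex_map_def)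
      then show "q \<in> V" using s(4)[OF t(1)] geo_mball[OF x u simplex_1_edge(2)[OF t(1)]] by (simp add: V_def)
    qed
    then have "singular_simplex 1 (subtopology Q V) (push (segment x u))"
      using push_simplex[OF s(1)] by (simp add: singular_simplex_subtopology)
    from k[OF this] potentialD[OF F s(1)] show ?thesis using s(2,3) edge_simplex[of 0] edge_simplex[of 1] by (simp add: simplex_map_def)
  qed
  have "c (frag_of \<sigma>) = F (rep (\<sigma> (edge 1))) - F (rep (\<sigma> (edge 0)))" if s: "singular_simplex 1 (subtopology Q V) \<sigma>" for \<sigma>
  proof -
    have "\<sigma> ` standard_simplex 1 \<subseteq> V" using s by (simp add: singular_simplex_subtopology)
    then have "\<sigma> (edge t) \<in> V" if "t \<in> {0..1}" for t using edge_simplex[OF that] by blast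
    then have "\<sigma> (edge 0) \<in> V" "\<sigma> (edge 1) \<in> V" by auto
    then obtain u w where u: "u \<in> mball x (e / 2)" "\<sigma> (edge 0) = p u" and w: "w \<in> mball x (e / 2)" "\<sigma> (edge 1) = p w" by (auto simp: V_def)
    have "u \<in> M" "w \<in> M" using u(1) w(1) by auto
    then show ?thesis using k[OF s] ku[OF u(1)] ku[OF w(1)] repF unfolding u(2) w(2) by simp
  qed
  then show ?thesis using V xV by blast
qed

lemma interval_sub_simplex: assumes "continuous_map (top_of_set {0..1}) X g" "0 \<le> a" "a \<le> b" "b \<le> 1" "g ` {a..b} \<subseteq> V"
  shows "singular_simplex 1 (subtopology X V) (interval_simplex g a b)"
proof -
  have "continuous_map (subtopology (top_of_set {0..1}) {a..b}) X g" using assms(1) by (rule continuous_map_from_subtopology)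
  moreover have "subtopology (top_of_set {0..1}) {a..b} = top_of_set {a..b}" using assms(2-4) by (simp add: subtopology_subtopology Int_absorb1)
  ultimately have "continuous_map (top_of_set {a..b}) (subtopology X V) g" using assms(5) by (auto simp: continuous_map_in_subtopology)
  then show ?thesis unfolding interval_simplex_def using assms(3) by (intro singular_affine_simplex) auto
qed

text \<open>\<open>Bolzano\<close> along the path: on short pieces this is
  \<open>locally_potential\<close>, and flattened triangles make both sides additive under
  concatenation.\<close>

lemma potential_descends:
  assumes F: "potential c F"
    and c: "cocycle c" and z: "\<forall>g\<in>carrier L. period c g = 0" and \<sigma>: "singular_simplex 1 Q \<sigma>"
  shows "c (frag_of \<sigma>) = F (rep (\<sigma> (edge 1))) - F (rep (\<sigma> (edge 0)))"
proof -
  define g where "g = (\<lambda>t. \<sigma> (edge t))"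
  have \<sigma>g: "\<sigma> = interval_simplex g 0 1" and cg: "continuous_map (top_of_set {0..1}) Q g"
    using simplex_as_interval[OF \<sigma>] by (simp_all add: g_def)
  have ends: "interval_simplex g a b (edge 0) = g a" "interval_simplex g a b (edge 1) = g b" for a b
    using interval_simplex_edge[of 0 g a b] interval_simplex_edge[of 1 g a b] by simp_all
  have sing: "singular_simplex 1 Q (interval_simplex g a b)" if "a \<in> {0..1}" "b \<in> {0..1}" for a b
    unfolding interval_simplex_def using that by (intro singular_affine_simplex[OF cg]) auto
  have "(0::real) \<le> 0 \<longrightarrow> (1::real) \<le> 1 \<longrightarrow> c (frag_of (interval_simplex g 0 1)) = F (rep (g 1)) - F (rep (g 0))"
  proof (rule Bolzano[where P="\<lambda>a b. 0 \<le> a \<longrightarrow> b \<le> 1 \<longrightarrow> c (frag_of (interval_simplex g a b)) = F (rep (g b)) - F (rep (g a))"])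
    show "(0::real) \<le> 1" by simp
    fix r s t :: real
    assume 1: "0 \<le> r \<longrightarrow> s \<le> 1 \<longrightarrow> c (frag_of (interval_simplex g r s)) = F (rep (g s)) - F (rep (g r))"
      and 2: "0 \<le> s \<longrightarrow> t \<le> 1 \<longrightarrow> c (frag_of (interval_simplex g s t)) = F (rep (g t)) - F (rep (g s))" and le: "r \<le> s" "s \<le> t"
    show "0 \<le> r \<longrightarrow> t \<le> 1 \<longrightarrow> c (frag_of (interval_simplex g r t)) = F (rep (g t)) - F (rep (g r))"
    proof (intro impI)
      assume b: "0 \<le> r" "t \<le> 1"
      let ?f = "affine_simplex 2 g (\<lambda>i. if i = 0 then r else if i = 1 then s else t)"
      have "singular_simplex 2 Q ?f" using b le by (intro singular_affine_simplex[OF cg]) auto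
      then have "c (chain_boundary 2 (frag_of ?f)) = 0" using c unfolding cocycle_def by (simp add: singular_chain_of)
      then have "c (frag_of (interval_simplex g s t) - frag_of (interval_simplex g r t) + frag_of (interval_simplex g r s)) = 0"
        unfolding triangle_boundary .
      moreover have ch: "singular_chain 1 Q (frag_of (interval_simplex g s t))" "singular_chain 1 Q (frag_of (interval_simplex g r t))"
        "singular_chain 1 Q (frag_of (interval_simplex g r s))" using sing b le by (auto simp: singular_chain_of)
      ultimately have "c (frag_of (interval_simplex g s t)) - c (frag_of (interval_simplex g r t)) + c (frag_of (interval_simplex g r s)) = 0"
        using cocycle_diff[OF c ch(1,2)] singular_chain_diff[OF ch(1,2)] c ch(3) unfolding cocycle_def by metis
      then show "c (frag_of (interval_simplex g r t)) = F (rep (g t)) - F (rep (g r))" using 1 2 b le by simp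
    qed
  next
    fix t :: real assume t: "0 \<le> t" "t \<le> 1"
    have "g t \<in> topspace Q" using continuous_map_image_subset_topspace[OF cg] t by auto
    then have rM: "rep (g t) \<in> M" "p (rep (g t)) = g t" using rep by auto
    obtain V where V: "openin Q V" "g t \<in> V"
      "\<And>\<sigma>. singular_simplex 1 (subtopology Q V) \<sigma> \<Longrightarrow> c (frag_of \<sigma>) = F (rep (\<sigma> (edge 1))) - F (rep (\<sigma> (edge 0)))"
      using locally_potential[OF F c z rM(1)] rM(2) by metis
    have "openin (top_of_set {0..1}) {s \<in> {0..1}. g s \<in> V}" using openin_continuous_map_preimage[OF cg V(1)] by simp
    moreover have "t \<in> {s \<in> {0..1}. g s \<in> V}" using t V(2) by simp
    ultimately obtain \<delta> where "\<delta> > 0" "\<forall>s\<in>{0..1}. dist s t < \<delta> \<longrightarrow> s \<in> {s \<in> {0..1}. g s \<in> V}"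
      unfolding openin_euclidean_subtopology_iff by blast
    then have \<delta>: "\<delta> > 0" "\<And>s. s \<in> {0..1} \<Longrightarrow> dist s t < \<delta> \<Longrightarrow> g s \<in> V" by auto
    show "\<exists>d>0. \<forall>a b. a \<le> t \<and> t \<le> b \<and> b - a < d \<longrightarrow> 0 \<le> a \<longrightarrow> b \<le> 1 \<longrightarrow>
        c (frag_of (interval_simplex g a b)) = F (rep (g b)) - F (rep (g a))"
    proof (intro exI[of _ \<delta>] conjI allI impI)
      fix a b assume ab: "a \<le> t \<and> t \<le> b \<and> b - a < \<delta>" "0 \<le> a" "b \<le> 1"
      have "g ` {a..b} \<subseteq> V" using \<delta>(2) ab by (auto simp: dist_real_def)
      then have "singular_simplex 1 (subtopology Q V) (interval_simplex g a b)" using ab by (intro interval_sub_simplex[OF cg]) auto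
      from V(3)[OF this] show "c (frag_of (interval_simplex g a b)) = F (rep (g b)) - F (rep (g a))" using ends by simp
    qed (rule \<delta>(1))
  qed
  then have "c (frag_of (interval_simplex g 0 1)) = F (rep (g 1)) - F (rep (g 0))" by simp
  then show ?thesis unfolding \<sigma>g[symmetric] unfolding g_def .
qed

end

section \<open>The standard triangle and cocycles of the bar resolution\<close>

text \<open>Singular triangles are pulled back to a convex set in the plane, because
  \<open>circle_lift_exists\<close> speaks of convex subsets of a normed space.\<close>

definition triangle_point :: "real \<times> real \<Rightarrow> nat \<Rightarrow> real" where
  "triangle_point st i = (if i = 0 then 1 - fst st - snd st else if i = 1 then fst st else if i = 2 then snd st else 0)"

definition triangle :: "(real \<times> real) set" where
  "triangle = {st. fst st \<ge> 0 \<and> snd st \<ge> 0 \<and> fst st + snd st \<le> 1}"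

lemma convex_triangle: "convex triangle"
proof (rule convexI)
  fix x y :: "real \<times> real" and u v :: real
  assume a: "x \<in> triangle" "y \<in> triangle" "0 \<le> u" "0 \<le> v" "u + v = 1"
  have "u * (fst x + snd x) + v * (fst y + snd y) \<le> u * 1 + v * 1" using a by (intro add_mono mult_left_mono) (auto simp: triangle_def)
  then show "u *\<^sub>R x + v *\<^sub>R y \<in> triangle" using a by (auto simp: triangle_def algebra_simps)
qed

lemma continuous_triangle_point: "continuous_map (top_of_set triangle) (subtopology (powertop_real UNIV) (standard_simplex 2)) triangle_point"
  unfolding continuous_map_in_subtopology continuous_map_componentwise_UNIV
proof (intro conjI allI)
  fix i
  have "continuous_on triangle (\<lambda>st. triangle_point st i)"
    by (cases "i = 0"; cases "i = 1"; cases "i = 2") (auto simp: triangle_point_def intro!: continuous_intros)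
  then show "continuous_map (top_of_set triangle) euclideanreal (\<lambda>st. triangle_point st i)" by simp
next
  have "triangle_point st \<in> standard_simplex 2" if "st \<in> triangle" for st
    using that by (auto simp: standard_simplex_def triangle_point_def triangle_def numeral_2_eq_2)
  then show "triangle_point \<in> topspace (top_of_set triangle) \<rightarrow> standard_simplex 2" by auto
qed

lemma triangle_faces:
  "simplical_face 0 (edge t) = triangle_point (1 - t, t)"
  "simplical_face 1 (edge t) = triangle_point (0, t)"
  "simplical_face 2 (edge t) = triangle_point (t, 0)"
  by (auto simp: simplical_face_def edge_def triangle_point_def fun_eq_iff)

text \<open>With trivial coefficients the coboundary at \<open>[a, b]\<close> has three terms and no
  action, so a 1-cocycle amounts to a homomorphism.\<close>

lemma bar_cocycle_iff:
  fixes L (structure)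
  assumes "monoid L"
  shows "\<psi> \<in> kernel (bar_cochains L 1) (bar_cochains L (Suc 1)) (bar_coboundary L 1) \<longleftrightarrow>
    \<psi> \<in> extensional {gs. length gs = 1 \<and> set gs \<subseteq> carrier L} \<and>
    (\<forall>a\<in>carrier L. \<forall>b\<in>carrier L. \<psi> [a \<otimes> b] = \<psi> [a] + \<psi> [b])"
proof -
  have two: "gs \<in> {gs. length gs = Suc 1 \<and> set gs \<subseteq> carrier L} \<longleftrightarrow> (\<exists>a\<in>carrier L. \<exists>b\<in>carrier L. gs = [a, b])" for gs
    by (auto simp: length_Suc_conv)
  have v: "bar_coboundary L 1 \<psi> [a, b] = \<psi> [b] - \<psi> [a \<otimes> b] + \<psi> [a]" if "a \<in> carrier L" "b \<in> carrier L" for a b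
    using that by (simp add: bar_coboundary_def)
  have "bar_coboundary L 1 \<psi> = (\<lambda>gs\<in>{gs. length gs = Suc 1 \<and> set gs \<subseteq> carrier L}. 0) \<longleftrightarrow>
      (\<forall>a\<in>carrier L. \<forall>b\<in>carrier L. \<psi> [a \<otimes> b] = \<psi> [a] + \<psi> [b])" (is "?l = ?r \<longleftrightarrow> ?R")
  proof
    assume e: "?l = ?r"
    show ?R
    proof (intro ballI)
      fix a b assume ab: "a \<in> carrier L" "b \<in> carrier L"
      then have "[a, b] \<in> {gs. length gs = Suc 1 \<and> set gs \<subseteq> carrier L}" by simp
      then have "?l [a, b] = 0" unfolding e by simp
      then show "\<psi> [a \<otimes> b] = \<psi> [a] + \<psi> [b]" using v[OF ab] by simp
    qed
  next
    assume R: ?R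
    show "?l = ?r"
    proof
      fix gs show "?l gs = ?r gs"
      proof (cases "gs \<in> {gs. length gs = Suc 1 \<and> set gs \<subseteq> carrier L}")
        case True
        then obtain a b where ab: "a \<in> carrier L" "b \<in> carrier L" "gs = [a, b]" using two by blast
        then show ?thesis using v[OF ab(1,2)] R True by simp
      next
        case False
        then show ?thesis by (simp only: bar_coboundary_def restrict_apply if_False)
      qed
    qed
  qed
  then show ?thesis by (simp add: kernel_def bar_cochains_def PiE_def)
qed

section \<open>Homomorphisms as periods and the isomorphism\<close>

context orbit_setting
begin

text \<open>The values are integers because two logarithms of one point differ by an integer. They
  cancel around a triangle because one logarithm on the whole triangle serves its three edges. Along
  the image of a segment \<open>f\<close> itself is a logarithm, which gives the period.\<close>

lemma cocycle_from_hom: assumes \<phi>: "\<phi> \<in> hom L integer_group"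
  shows "\<exists>c. cocycle c \<and> (\<forall>g\<in>carrier L. period c g = \<phi> g)"
proof -
  obtain f where f: "continuous_map mtopology euclideanreal f" "\<And>g x. g \<in> carrier L \<Longrightarrow> x \<in> M \<Longrightarrow> f (act g x) = f x + real_of_int (\<phi> g)"
    using equivariant[OF \<phi>] by blast
  define E where "E q = cis (2 * pi * f (rep q))" for q
  \<comment> \<open>The fixed logarithm at vertices, a choice without continuity.\<close>
  define \<theta> where "\<theta> q = frac (f (rep q))" for q
  have Ep: "E (p x) = cis (2 * pi * f x)" if "x \<in> M" for x
    unfolding E_def by (rule invariant_rep) (use that f(2) in \<open>auto simp: cis_eq_iff\<close>)
  have \<theta>E: "E q = cis (2 * pi * \<theta> q)" for q unfolding E_def \<theta>_def by (simp add: cis_eq_iff frac_def)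
  have E1: "cmod (E q) = 1" for q by (simp add: E_def)
  have cE: "continuous_map Q euclidean E"
  proof (rule continuous_compose_quotient_map[OF quotient_p])
    have "continuous_map euclideanreal euclidean (\<lambda>r. cis (2 * pi * r))" by (auto intro!: continuous_intros)
    from continuous_map_compose[OF f(1) this] show "continuous_map mtopology euclidean (E \<circ> p)"
      by (rule continuous_map_eq) (auto simp: Ep)
  qed
  \<comment> \<open>The normed space is arbitrary because the statement is applied to the unit
    interval and to the planar triangle.\<close>
  have lift: "\<exists>l. continuous_on S l \<and> (\<forall>x\<in>S. E (g x) = cis (2 * pi * l x))"
    if "continuous_map (top_of_set S) Q g" "convex S" for S and g :: "'v::real_normed_vector \<Rightarrow> 'a set"
  proof -
    have "continuous_on S (\<lambda>x. E (g x))" using continuous_map_compose[OF that(1) cE] by (simp add: o_def)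
    then show ?thesis using circle_lift_exists[of S "\<lambda>x. E (g x)"] that(2) E1 by blast
  qed
  define l where "l \<sigma> = (SOME l. continuous_on {0..1} l \<and> (\<forall>t\<in>{0..1}. E (\<sigma> (edge t)) = cis (2 * pi * l t)))" for \<sigma>
  \<comment> \<open>The floor only converts the type: for singular simplices the real number is an
    integer, and any other lift \<open>k\<close> gives the same one.\<close>
  define v where "v \<sigma> = \<lfloor>(l \<sigma> 1 - l \<sigma> 0) - (\<theta> (\<sigma> (edge 1)) - \<theta> (\<sigma> (edge 0)))\<rfloor>" for \<sigma>
  have v: "real_of_int (v \<sigma>) = (k 1 - k 0) - (\<theta> (\<sigma> (edge 1)) - \<theta> (\<sigma> (edge 0)))"
    if \<sigma>: "singular_simplex 1 Q \<sigma>" and k: "continuous_on {0..1} k" "\<And>t. t \<in> {0..1} \<Longrightarrow> E (\<sigma> (edge t)) = cis (2 * pi * k t)" for \<sigma> k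
  proof -
    have L: "continuous_on {0..1} (l \<sigma>) \<and> (\<forall>t\<in>{0..1}. E (\<sigma> (edge t)) = cis (2 * pi * l \<sigma> t))"
      unfolding l_def by (rule someI_ex[OF lift[OF simplex_as_interval(2)[OF \<sigma>]]]) simp
    have le: "l \<sigma> 1 - l \<sigma> 0 = k 1 - k 0"
    proof (rule circle_lift_unique[of "{0..1}"])
      show "connected {0..1::real}" by simp
      show "cis (2 * pi * l \<sigma> t) = cis (2 * pi * k t)" if "t \<in> {0..1}" for t using L k(2)[OF that] that by simp
    qed (use L k(1) in auto)
    have ki: "k t - \<theta> (\<sigma> (edge t)) \<in> \<int>" if "t \<in> {0..1}" for t
      using k(2)[OF that] \<theta>E[of "\<sigma> (edge t)"] by (simp add: cis_eq_iff[symmetric])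
    have "(k 1 - \<theta> (\<sigma> (edge 1))) - (k 0 - \<theta> (\<sigma> (edge 0))) \<in> \<int>" using Ints_diff[OF ki[of 1] ki[of 0]] by simp
    then have "(k 1 - k 0) - (\<theta> (\<sigma> (edge 1)) - \<theta> (\<sigma> (edge 0))) \<in> \<int>" by (simp add: algebra_simps)
    then show ?thesis unfolding v_def le by (auto elim: Ints_cases)
  qed
  define c where "c = (\<lambda>b\<in>singular_chain_set 1 Q. chain_extend v b)"
  have tri: "chain_extend v (chain_boundary 2 (frag_of F)) = 0" if F: "singular_simplex 2 Q F" for F
  proof -
    have cF: "continuous_map (subtopology (powertop_real UNIV) (standard_simplex 2)) Q F" using F by (simp add: singular_simplex_def)
    have "continuous_map (top_of_set triangle) Q (\<lambda>st. F (triangle_point st))"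
      using continuous_map_compose[OF continuous_triangle_point cF] by (simp add: o_def)
    from lift[OF this convex_triangle] obtain k where k: "continuous_on triangle k" "\<And>st. st \<in> triangle \<Longrightarrow> E (F (triangle_point st)) = cis (2 * pi * k st)" by blast
    have side: "real_of_int (v (singular_face 2 i F)) = (k (h 1) - k (h 0)) - (\<theta> (F (triangle_point (h 1))) - \<theta> (F (triangle_point (h 0))))"
      if "i \<le> 2" "continuous_on {0..1} h" "h ` {0..1} \<subseteq> triangle" "\<And>t. simplical_face i (edge t) = triangle_point (h t)" for i and h :: "real \<Rightarrow> real \<times> real"
    proof -
      have s: "singular_simplex 1 Q (singular_face 2 i F)" using singular_simplex_singular_face[OF F _ that(1)] by simp
      have e: "singular_face 2 i F (edge t) = F (triangle_point (h t))" if "t \<in> {0..1}" for t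
        using edge_simplex[OF that] that(1) \<open>\<And>t. simplical_face i (edge t) = triangle_point (h t)\<close> by (simp add: singular_face_def)
      have "real_of_int (v (singular_face 2 i F)) = (k (h 1) - k (h 0)) - (\<theta> (singular_face 2 i F (edge 1)) - \<theta> (singular_face 2 i F (edge 0)))"
      proof (rule v[OF s])
        show "continuous_on {0..1} (\<lambda>t. k (h t))" using continuous_on_compose2[OF k(1) that(2,3)] .
        show "E (singular_face 2 i F (edge t)) = cis (2 * pi * k (h t))" if "t \<in> {0..1}" for t
        proof -
          have "h t \<in> triangle" using \<open>h ` {0..1} \<subseteq> triangle\<close> that by (rule subsetD[OF _ imageI])
          then show ?thesis using e[OF that] k(2)[of "h t"] by simp
        qed
      qed
      then show ?thesis using e[of 0] e[of 1] by simp
    qed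
    have "real_of_int (v (singular_face 2 0 F)) = (k (0, 1) - k (1, 0)) - (\<theta> (F (triangle_point (0, 1))) - \<theta> (F (triangle_point (1, 0))))"
      using side[of 0 "\<lambda>t. (1 - t, t)", OF _ continuous_on_Pair _ triangle_faces(1)] by (simp add: triangle_def image_subset_iff continuous_intros)
    moreover have "real_of_int (v (singular_face 2 1 F)) = (k (0, 1) - k (0, 0)) - (\<theta> (F (triangle_point (0, 1))) - \<theta> (F (triangle_point (0, 0))))"
      using side[of 1 "\<lambda>t. (0, t)", OF _ continuous_on_Pair _ triangle_faces(2)] by (simp add: triangle_def image_subset_iff continuous_intros)
    moreover have "real_of_int (v (singular_face 2 2 F)) = (k (1, 0) - k (0, 0)) - (\<theta> (F (triangle_point (1, 0))) - \<theta> (F (triangle_point (0, 0))))"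
      using side[of 2 "\<lambda>t. (t, 0)", OF _ continuous_on_Pair _ triangle_faces(3)] by (simp add: triangle_def image_subset_iff continuous_intros)
    ultimately have "real_of_int (v (singular_face 2 0 F)) - real_of_int (v (singular_face 2 1 F)) + real_of_int (v (singular_face 2 2 F)) = 0" by simp
    then have "v (singular_face 2 0 F) - v (singular_face 2 1 F) + v (singular_face 2 2 F) = 0" by linarith
    then show ?thesis unfolding chain_boundary_2 by (simp add: chain_extend_add chain_extend_diff)
  qed
  have "c (chain_boundary 2 b) = 0" if b: "singular_chain 2 Q b" for b
  proof -
    have "chain_extend v (chain_boundary 2 b) = 0"
      by (rule chain_induct[OF b]) (simp_all add: tri chain_boundary_diff chain_extend_diff chain_extend_zero)
    moreover have "singular_chain 1 Q (chain_boundary 2 b)" using singular_chain_boundary[OF b] by simp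
    ultimately show ?thesis by (simp add: c_def)
  qed
  then have cc: "cocycle c" unfolding cocycle_def by (auto simp: c_def chain_extend_add singular_chain_add)
  moreover have "period c g = \<phi> g" if g: "g \<in> carrier L" for g
  proof -
    let ?\<tau> = "segment base (act g base)"
    note s = segment[OF base act_in[OF g base]]
    have ps: "singular_simplex 1 Q (push ?\<tau>)" by (rule push_simplex[OF s(1)])
    have tM: "?\<tau> (edge t) \<in> M" "push ?\<tau> (edge t) = p (?\<tau> (edge t))" if "t \<in> {0..1}" for t
      using s(4)[OF edge_simplex[OF that]] geo_in[OF base act_in[OF g base], of "edge t 1"] simplex_1_edge(2)[OF edge_simplex[OF that]] edge_simplex[OF that]
      by (simp_all add: simplex_map_def)
    have "real_of_int (v (push ?\<tau>)) = (f (?\<tau> (edge 1)) - f (?\<tau> (edge 0))) - (\<theta> (push ?\<tau> (edge 1)) - \<theta> (push ?\<tau> (edge 0)))"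
    proof (rule v[OF ps])
      show "continuous_on {0..1} (\<lambda>t. f (?\<tau> (edge t)))"
        using continuous_map_compose[OF simplex_as_interval(2)[OF s(1)] f(1)] by (simp add: o_def)
      show "E (push ?\<tau> (edge t)) = cis (2 * pi * f (?\<tau> (edge t)))" if "t \<in> {0..1}" for t using tM[OF that] Ep by simp
    qed
    also have "\<dots> = real_of_int (\<phi> g)" using s(2,3) tM(2)[of 0] tM(2)[of 1] f(2)[OF g base] p_act[OF g base] by simp
    finally show ?thesis using ps by (simp add: period_def c_def singular_chain_of)
  qed
  ultimately show ?thesis by blast
qed

lemma cocycle_zero: "cocycle (\<lambda>i\<in>singular_chain_set 1 Q. 0)"
  unfolding cocycle_def using singular_chain_boundary[of 2 Q] by (auto simp: singular_chain_add)

lemma cocycle_add: assumes "cocycle c" "cocycle e" shows "cocycle (\<lambda>i\<in>singular_chain_set 1 Q. c i + e i)"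
  using assms singular_chain_boundary[of 2 Q] unfolding cocycle_def by (auto simp: singular_chain_add)

lemma cocycle_minus: assumes "cocycle c" shows "cocycle (\<lambda>i\<in>singular_chain_set 1 Q. - c i)"
  using assms singular_chain_boundary[of 2 Q] unfolding cocycle_def by (auto simp: singular_chain_add)

lemma period_add: assumes "g \<in> carrier L"
  shows "period (\<lambda>i\<in>singular_chain_set 1 Q. c i + e i) g = period c g + period e g"
  using push_simplex[OF segment(1)[OF base act_in[OF assms base]]] by (simp add: period_def singular_chain_of)

text \<open>A coboundary has no periods because the image of a segment to a translate is a closed
  path. Conversely, without periods the potential is invariant, and read through \<open>rep\<close>
  it is a 0-cochain with the right coboundary.\<close>

lemma coboundary_iff:
  "c \<in> singular_coboundary Q 0 ` carrier (singular_cochains Q 0) \<longleftrightarrow> cocycle c \<and> (\<forall>g\<in>carrier L. period c g = 0)"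
proof
  assume "c \<in> singular_coboundary Q 0 ` carrier (singular_cochains Q 0)"
  then obtain b where b: "b \<in> carrier (singular_cochains Q 0)" "c = singular_coboundary Q 0 b" by blast
  have badd: "b (x + y) = b x + b y" if "singular_chain 0 Q x" "singular_chain 0 Q y" for x y
    using b(1) that unfolding carrier_cochains by blast
  have b0: "b 0 = 0" using badd[of 0 0] by simp
  have c: "c x = b (chain_boundary 1 x)" if "singular_chain 1 Q x" for x using b(2) that by (simp add: singular_coboundary_def)
  have ch: "singular_chain 0 Q (chain_boundary 1 x)" if "singular_chain 1 Q x" for x using singular_chain_boundary[OF that] by simp
  have "cocycle c" unfolding cocycle_def
  proof (intro conjI allI impI)
    show "c \<in> extensional (singular_chain_set 1 Q)" using b(2) by (simp add: singular_coboundary_def)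
    show "c (x + y) = c x + c y" if "singular_chain 1 Q x" "singular_chain 1 Q y" for x y
      using that ch badd by (simp add: c singular_chain_add chain_boundary_add)
    show "c (chain_boundary 2 x) = 0" if x: "singular_chain 2 Q x" for x
    proof -
      have "singular_chain 1 Q (chain_boundary 2 x)" using singular_chain_boundary[OF x] by simp
      moreover have "chain_boundary 1 (chain_boundary 2 x) = 0" using chain_boundary_boundary_alt[of 1 Q x] x by (simp add: numeral_2_eq_2)
      ultimately show ?thesis using c b0 by simp
    qed
  qed
  moreover have "period c g = 0" if g: "g \<in> carrier L" for g
  proof -
    let ?\<sigma> = "push (segment base (act g base))"
    note s = segment[OF base act_in[OF g base]]
    have ps: "singular_simplex 1 Q ?\<sigma>" by (rule push_simplex[OF s(1)])
    have "?\<sigma> (edge 0) = ?\<sigma> (edge 1)" using s(2,3) p_act[OF g base] edge_simplex[of 0] edge_simplex[of 1] by (simp add: simplex_map_def)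
    then have "chain_boundary 1 (frag_of ?\<sigma>) = 0" unfolding chain_boundary_1 face_1 by simp
    then show ?thesis using c[of "frag_of ?\<sigma>"] ps b0 by (simp add: period_def singular_chain_of)
  qed
  ultimately show "cocycle c \<and> (\<forall>g\<in>carrier L. period c g = 0)" by blast
next
  assume a: "cocycle c \<and> (\<forall>g\<in>carrier L. period c g = 0)"
  then have c: "cocycle c" by blast
  obtain F where F: "potential c F" using potential_exists[OF c] by blast
  \<comment> \<open>A singular 0-simplex is evaluated at its only point, which is
    \<open>edge 0\<close>.\<close>
  define b where "b = (\<lambda>x\<in>singular_chain_set 0 Q. chain_extend (\<lambda>f. F (rep (f (edge 0)))) x)"
  have "b \<in> carrier (singular_cochains Q 0)" unfolding carrier_cochains by (auto simp: b_def chain_extend_add singular_chain_add)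
  moreover have "c = singular_coboundary Q 0 b"
  proof
    fix x show "c x = singular_coboundary Q 0 b x"
    proof (cases "singular_chain 1 Q x")
      case True
      have "chain_boundary 1 x \<in> singular_chain_set 0 Q" using singular_chain_boundary[OF True] by simp
      then have "singular_coboundary Q 0 b x = chain_extend (\<lambda>f. F (rep (f (edge 0)))) (chain_boundary 1 x)"
        using True by (simp add: singular_coboundary_def b_def)
      moreover have "singular_chain 1 Q x \<and> c x = chain_extend (\<lambda>f. F (rep (f (edge 0)))) (chain_boundary 1 x)"
      proof (rule chain_induct[OF True, where P="\<lambda>x. singular_chain 1 Q x \<and> c x = chain_extend (\<lambda>f. F (rep (f (edge 0)))) (chain_boundary 1 x)"])
        show "singular_chain 1 Q 0 \<and> c 0 = chain_extend (\<lambda>f. F (rep (f (edge 0)))) (chain_boundary 1 0)"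
          using cocycle_diff[OF c, of 0 0] by (simp add: chain_extend_zero)
      next
        fix \<sigma> assume \<sigma>: "singular_simplex 1 Q \<sigma>"
        have "edge 0 \<in> standard_simplex 0" by (simp add: standard_simplex_0 vertex_eq)
        then show "singular_chain 1 Q (frag_of \<sigma>) \<and> c (frag_of \<sigma>) = chain_extend (\<lambda>f. F (rep (f (edge 0)))) (chain_boundary 1 (frag_of \<sigma>))"
          using potential_descends[OF F c _ \<sigma>] a \<sigma> unfolding chain_boundary_1 face_1 by (simp add: chain_extend_diff singular_chain_of)
      next
        fix x y assume "singular_chain 1 Q x \<and> c x = chain_extend (\<lambda>f. F (rep (f (edge 0)))) (chain_boundary 1 x)"
          "singular_chain 1 Q y \<and> c y = chain_extend (\<lambda>f. F (rep (f (edge 0)))) (chain_boundary 1 y)"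
        then show "singular_chain 1 Q (x - y) \<and> c (x - y) = chain_extend (\<lambda>f. F (rep (f (edge 0)))) (chain_boundary 1 (x - y))"
          using cocycle_diff[OF c, of x y] by (simp add: chain_boundary_diff chain_extend_diff singular_chain_diff)
      qed
      ultimately show ?thesis by simp
    next
      case False
      then show ?thesis using c by (simp add: cocycle_def extensional_def singular_coboundary_def)
    qed
  qed
  ultimately show "c \<in> singular_coboundary Q 0 ` carrier (singular_cochains Q 0)" by blast
qed

text \<open>The period map from singular cocycles to bar cocycles is onto, and its kernel consists
  of the coboundaries.\<close>

theorem cohomology_iso: "group_cohomology 1 L \<cong> singular_cohomology 1 Q"
proof -
  define I where "I = {gs. length gs = 1 \<and> set gs \<subseteq> carrier L}"
  define ZB where "ZB = kernel (bar_cochains L 1) (bar_cochains L (Suc 1)) (bar_coboundary L 1)"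
  define GB where "GB = (bar_cochains L 1)\<lparr>carrier := ZB\<rparr>"
  define GZ where "GZ = C1\<lparr>carrier := Collect cocycle\<rparr>"
  define h where "h c = (\<lambda>gs\<in>I. period c (hd gs))" for c
  have I: "gs \<in> I \<longleftrightarrow> (\<exists>g\<in>carrier L. gs = [g])" for gs by (auto simp: I_def length_Suc_conv)
  have ZB: "\<psi> \<in> ZB \<longleftrightarrow> \<psi> \<in> extensional I \<and> (\<forall>a\<in>carrier L. \<forall>b\<in>carrier L. \<psi> [a \<otimes>\<^bsub>L\<^esub> b] = \<psi> [a] + \<psi> [b])" for \<psi>
    unfolding ZB_def I_def by (rule bar_cocycle_iff[OF monoid_axioms])
  have GB_eq: "GB = (product_group I (\<lambda>_. integer_group))\<lparr>carrier := ZB\<rparr>" by (simp add: GB_def bar_cochains_def I_def)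
  have gB: "group GB" unfolding GB_eq by (rule integer_product_subgroup) (auto simp: ZB I)
  have GZ_eq: "GZ = (product_group (singular_chain_set 1 Q) (\<lambda>_. integer_group))\<lparr>carrier := Collect cocycle\<rparr>"
    by (simp add: GZ_def singular_cochains_def)
  have gZ: "group GZ" unfolding GZ_eq
  proof (rule integer_product_subgroup)
    show "Collect cocycle \<subseteq> extensional (singular_chain_set 1 Q)" by (auto simp: cocycle_def)
  qed (use cocycle_zero cocycle_add cocycle_minus in \<open>simp_all del: One_nat_def\<close>)
  have hB: "h c \<in> ZB" if "cocycle c" for c unfolding ZB using period_hom[OF that] by (auto simp: h_def I)
  have hom: "h \<in> hom GZ GB"
  proof (rule homI)
    show "h c \<in> carrier GB" if "c \<in> carrier GZ" for c using hB that by (simp add: GB_eq GZ_eq)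
    show "h (c \<otimes>\<^bsub>GZ\<^esub> e) = h c \<otimes>\<^bsub>GB\<^esub> h e" if "c \<in> carrier GZ" "e \<in> carrier GZ" for c e
      unfolding GB_eq GZ_eq h_def using period_add by (auto simp: I fun_eq_iff restrict_def)
  qed
  interpret gh: group_hom GZ GB h by (intro group_hom.intro group_hom_axioms.intro gZ gB hom)
  have surj: "h ` carrier GZ = carrier GB"
  proof
    show "h ` carrier GZ \<subseteq> carrier GB" using hB by (auto simp: GB_eq GZ_eq)
    show "carrier GB \<subseteq> h ` carrier GZ"
    proof
      fix \<psi> assume "\<psi> \<in> carrier GB"
      then have \<psi>: "\<psi> \<in> ZB" by (simp add: GB_eq)
      then have "(\<lambda>g. \<psi> [g]) \<in> hom L integer_group" unfolding ZB by (auto simp: hom_def)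
      then obtain c where c: "cocycle c" "\<forall>g\<in>carrier L. period c g = \<psi> [g]" using cocycle_from_hom by blast
      have "h c = \<psi>" using c(2) \<psi> by (auto simp: h_def ZB I extensional_def fun_eq_iff restrict_def)
      then show "\<psi> \<in> h ` carrier GZ" using c(1) by (auto simp: GZ_eq)
    qed
  qed
  have "kernel GZ GB h = singular_coboundary Q 0 ` carrier (singular_cochains Q 0)"
  proof -
    have "h c = (\<lambda>i\<in>I. 0) \<longleftrightarrow> (\<forall>g\<in>carrier L. period c g = 0)" for c
    proof
      assume "h c = (\<lambda>i\<in>I. 0)"
      then have e: "h c [g] = (\<lambda>i\<in>I. 0) [g]" for g by simp
      show "\<forall>g\<in>carrier L. period c g = 0"
      proof
        fix g assume "g \<in> carrier L"
        then show "period c g = 0" using e[of g] by (simp add: h_def I)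
      qed
    qed (auto simp: h_def I fun_eq_iff restrict_def)
    then have "c \<in> kernel GZ GB h \<longleftrightarrow> c \<in> singular_coboundary Q 0 ` carrier (singular_cochains Q 0)" for c
      unfolding coboundary_iff by (simp add: kernel_def GZ_eq GB_eq)
    then show ?thesis by blast
  qed
  then have "singular_cohomology 1 Q = GZ Mod (kernel GZ GB h)"
    by (simp add: singular_cohomology_def cohomology_group_def kernel_cocycles[unfolded One_nat_def] GZ_def)
  then have 1: "singular_cohomology 1 Q \<cong> GB" using gh.FactGroup_iso_set[OF surj] by (auto simp: is_iso_def)
  \<comment> \<open>For trivial coefficients every 0-cochain has coboundary zero, so on the group
    side there is nothing to divide by.\<close>
  have "bar_coboundary L 0 ` carrier (bar_cochains L 0) = {\<one>\<^bsub>GB\<^esub>}"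
  proof -
    have "bar_coboundary L 0 f = \<one>\<^bsub>GB\<^esub>" for f
      by (auto simp: bar_coboundary_def GB_eq I_def fun_eq_iff restrict_def length_Suc_conv)
    moreover have "carrier (bar_cochains L 0) \<noteq> {}" by (simp add: bar_cochains_def PiE_eq_empty_iff)
    ultimately show ?thesis by (simp add: image_constant_conv)
  qed
  then have "group_cohomology 1 L = GB Mod {\<one>\<^bsub>GB\<^esub>}"
    by (simp add: group_cohomology_def cohomology_group_def GB_def ZB_def)
  then have "group_cohomology 1 L \<cong> GB" using group.trivial_factor_iso[OF gB] by (auto simp: is_iso_def)
  moreover have "GB \<cong> singular_cohomology 1 Q"
  proof (rule group.iso_sym[OF _ 1])
    show "group (singular_cohomology 1 Q)" using \<open>singular_cohomology 1 Q = _\<close> normal.factorgroup_is_group[OF gh.normal_kernel] by simp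
  qed
  ultimately show ?thesis using iso_trans by blast
qed

end

section \<open>Equivariant functions on the product with a Euclidean space\<close>

definition nsq :: "nat \<Rightarrow> (nat \<Rightarrow> real) \<Rightarrow> real" where
  "nsq n v = (\<Sum>i<n. (v i)\<^sup>2)"

lemma nsq_nonneg: "nsq n v \<ge> 0" by (simp add: nsq_def sum_nonneg)

lemma nsq_comb: "nsq n (comb a v b w) = a\<^sup>2 * nsq n v + b\<^sup>2 * nsq n w + 2 * a * b * (\<Sum>i<n. v i * w i)"
  by (simp add: nsq_def comb_def power2_sum power_mult_distrib sum.distrib sum_distrib_left algebra_simps)

lemma model_dist_nsq: "model_dist 0 n x y = sqrt (nsq n (comb 1 x (-1) y))"
  by (simp add: model_dist_def nsq_def comb_def)

lemma comb_model_space: "x \<in> model_space 0 n \<Longrightarrow> y \<in> model_space 0 n \<Longrightarrow> comb a x b y \<in> model_space 0 n"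
  by (simp add: model_zero comb_def)

lemma Metric_space_model: "Metric_space (model_space 0 n) (model_dist 0 n)"
proof
  fix x y z :: "nat \<Rightarrow> real"
  show "model_dist 0 n x y = model_dist 0 n y x" by (simp add: model_dist_zero L2_set_def power2_commute)
  show "0 \<le> model_dist 0 n x y" by (simp add: model_dist_zero)
qed (auto simp: model_dist_self dest: model_dist_zero_imp intro: model_dist_triangle)

section \<open>Coarse geometry of the action on the product\<close>

text \<open>\<open>rot\<close> acts by isometries that need not be linear. The lattice is
  represented by \<open>proper\<close> and \<open>cobounded\<close>, both stated for the orbit of
  one base point.\<close>

locale product_action = cat0 M d + group L
  for M :: "'a set" and d :: "'a \<Rightarrow> 'a \<Rightarrow> real" and L :: "('g, 'b) monoid_scheme" +
  fixes n :: nat and rot :: "'g \<Rightarrow> (nat \<Rightarrow> real) \<Rightarrow> nat \<Rightarrow> real" and act :: "'g \<Rightarrow> 'a \<Rightarrow> 'a" and x0 :: 'a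
  assumes base: "x0 \<in> M"
    and rot_in: "g \<in> carrier L \<Longrightarrow> p \<in> model_space 0 n \<Longrightarrow> rot g p \<in> model_space 0 n"
    and rot_iso: "g \<in> carrier L \<Longrightarrow> p \<in> model_space 0 n \<Longrightarrow> q \<in> model_space 0 n \<Longrightarrow> model_dist 0 n (rot g p) (rot g q) = model_dist 0 n p q"
    and rot_mult: "g \<in> carrier L \<Longrightarrow> h \<in> carrier L \<Longrightarrow> p \<in> model_space 0 n \<Longrightarrow> rot (g \<otimes>\<^bsub>L\<^esub> h) p = rot g (rot h p)"
    and rot_one: "p \<in> model_space 0 n \<Longrightarrow> rot \<one>\<^bsub>L\<^esub> p = p"
    and act_in: "g \<in> carrier L \<Longrightarrow> x \<in> M \<Longrightarrow> act g x \<in> M"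
    and act_iso: "g \<in> carrier L \<Longrightarrow> x \<in> M \<Longrightarrow> y \<in> M \<Longrightarrow> d (act g x) (act g y) = d x y"
    and act_mult: "g \<in> carrier L \<Longrightarrow> h \<in> carrier L \<Longrightarrow> x \<in> M \<Longrightarrow> act (g \<otimes>\<^bsub>L\<^esub> h) x = act g (act h x)"
    and act_one: "x \<in> M \<Longrightarrow> act \<one>\<^bsub>L\<^esub> x = x"
    and proper: "finite {g\<in>carrier L. model_dist 0 n (\<lambda>_. 0) (rot g (\<lambda>_. 0)) \<le> R \<and> d x0 (act g x0) \<le> R}"
    and cobounded: "\<exists>R. \<forall>p\<in>model_space 0 n. \<forall>x\<in>M. \<exists>g\<in>carrier L. model_dist 0 n p (rot g (\<lambda>_. 0)) + d x (act g x0) \<le> R"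
begin

abbreviation "V \<equiv> model_space 0 n"
abbreviation "o0 \<equiv> (\<lambda>_. 0) :: nat \<Rightarrow> real"
abbreviation "W \<equiv> V \<times> M"

text \<open>The sum metric in place of the product metric; the two are equivalent for Lipschitz and
  coarse estimates, and sums are easier to estimate.\<close>

definition D :: "(nat \<Rightarrow> real) \<times> 'a \<Rightarrow> (nat \<Rightarrow> real) \<times> 'a \<Rightarrow> real" where
  "D q r = model_dist 0 n (fst q) (fst r) + d (snd q) (snd r)"

definition \<alpha> :: "'g \<Rightarrow> (nat \<Rightarrow> real) \<times> 'a \<Rightarrow> (nat \<Rightarrow> real) \<times> 'a" where
  "\<alpha> g q = (rot g (fst q), act g (snd q))"

definition q0 :: "(nat \<Rightarrow> real) \<times> 'a" where "q0 = (o0, x0)"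

lemma o0_in: "o0 \<in> V" by (simp add: model_zero)

lemma q0_in: "q0 \<in> W" by (simp add: q0_def base o0_in)

lemma \<alpha>_in: "g \<in> carrier L \<Longrightarrow> q \<in> W \<Longrightarrow> \<alpha> g q \<in> W" by (auto simp: \<alpha>_def rot_in act_in)

lemma \<alpha>_iso: "g \<in> carrier L \<Longrightarrow> q \<in> W \<Longrightarrow> r \<in> W \<Longrightarrow> D (\<alpha> g q) (\<alpha> g r) = D q r"
  by (auto simp: \<alpha>_def D_def rot_iso act_iso)

lemma \<alpha>_mult: "g \<in> carrier L \<Longrightarrow> h \<in> carrier L \<Longrightarrow> q \<in> W \<Longrightarrow> \<alpha> (g \<otimes>\<^bsub>L\<^esub> h) q = \<alpha> g (\<alpha> h q)"
  by (auto simp: \<alpha>_def rot_mult act_mult)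

lemma \<alpha>_one: "q \<in> W \<Longrightarrow> \<alpha> \<one>\<^bsub>L\<^esub> q = q" by (auto simp: \<alpha>_def rot_one act_one)

lemma \<alpha>_inv: assumes "g \<in> carrier L" "q \<in> W" shows "\<alpha> (inv\<^bsub>L\<^esub> g) (\<alpha> g q) = q" "\<alpha> g (\<alpha> (inv\<^bsub>L\<^esub> g) q) = q"
  using \<alpha>_mult[of "inv\<^bsub>L\<^esub> g" g q] \<alpha>_mult[of g "inv\<^bsub>L\<^esub> g" q] assms by (simp_all add: \<alpha>_one)

lemma D_triangle: "q \<in> W \<Longrightarrow> r \<in> W \<Longrightarrow> s \<in> W \<Longrightarrow> D q s \<le> D q r + D r s"
  using model_dist_triangle[of "fst q" 0 n "fst r" "fst s"] triangle[of "snd q" "snd r" "snd s"] by (auto simp: D_def)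

lemma D_nonneg: "D q r \<ge> 0" by (simp add: D_def model_dist_zero)

lemma D_sym: "D q r = D r q" using Metric_space.commute[OF Metric_space_model] commute by (simp add: D_def)

lemma D_self: "q \<in> W \<Longrightarrow> D q q = 0" by (auto simp: D_def model_dist_self)

lemma D_move: assumes "g \<in> carrier L" "h \<in> carrier L" shows "D q0 (\<alpha> (inv\<^bsub>L\<^esub> g \<otimes>\<^bsub>L\<^esub> h) q0) = D (\<alpha> g q0) (\<alpha> h q0)"
proof -
  have "D (\<alpha> g q0) (\<alpha> h q0) = D (\<alpha> (inv\<^bsub>L\<^esub> g) (\<alpha> g q0)) (\<alpha> (inv\<^bsub>L\<^esub> g) (\<alpha> h q0))"
    using assms q0_in by (simp add: \<alpha>_iso \<alpha>_in del: mem_Times_iff)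
  then show ?thesis using assms q0_in by (simp add: \<alpha>_inv \<alpha>_mult)
qed

lemma finite_ball: "finite {g\<in>carrier L. D q0 (\<alpha> g q0) \<le> R}"
proof (rule finite_subset[OF _ proper[of R]])
  have "0 \<le> model_dist 0 n a b" for a b by (simp add: model_dist_zero)
  moreover note nonneg
  ultimately show "{g\<in>carrier L. D q0 (\<alpha> g q0) \<le> R} \<subseteq> {g\<in>carrier L. model_dist 0 n o0 (rot g o0) \<le> R \<and> d x0 (act g x0) \<le> R}"
    by (auto simp: D_def \<alpha>_def q0_def intro: order_trans[rotated] add_increasing add_increasing2)
qed

lemma dense: "\<exists>R\<ge>0. \<forall>q\<in>W. \<exists>g\<in>carrier L. D q (\<alpha> g q0) \<le> R"
proof -
  obtain R where R: "\<And>p x. p \<in> V \<Longrightarrow> x \<in> M \<Longrightarrow> \<exists>g\<in>carrier L. model_dist 0 n p (rot g o0) + d x (act g x0) \<le> R"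
    using cobounded by blast
  have "\<exists>g\<in>carrier L. D q (\<alpha> g q0) \<le> max R 0" if "q \<in> W" for q
    using R[of "fst q" "snd q"] that by (force simp: D_def \<alpha>_def q0_def)
  then show ?thesis by (intro exI[of _ "max R 0"]) auto
qed

text \<open>The product is geodesic for the sum metric as soon as both coordinates move
  proportionally.\<close>

lemma halfway: assumes "q \<in> W" "t \<in> {0..1}" shows "\<exists>r\<in>W. D q0 r = t * D q0 q \<and> D r q = (1 - t) * D q0 q"
proof -
  obtain p x where q: "q = (p, x)" "p \<in> V" "x \<in> M" using assms(1) by auto
  define r where "r = (comb t p 0 o0, geo x0 x t)"
  have "model_dist 0 n o0 (comb t p 0 o0) = t * model_dist 0 n o0 p"
    using assms(2) by (simp add: model_dist_zero comb_def L2_set_def power_mult_distrib real_sqrt_mult flip: sum_distrib_left)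
  moreover have "(t * p i - p i)\<^sup>2 = (1 - t)\<^sup>2 * (p i)\<^sup>2" for i by (simp add: power2_eq_square algebra_simps)
  then have "model_dist 0 n (comb t p 0 o0) p = (1 - t) * model_dist 0 n o0 p"
    using assms(2) by (simp add: model_dist_zero comb_def L2_set_def real_sqrt_mult flip: sum_distrib_left)
  moreover have "d x0 (geo x0 x t) = t * d x0 x" using geo_dist_start[OF base q(3) assms(2)] .
  moreover have "d (geo x0 x t) x = (1 - t) * d x0 x"
    using geo_speed[OF base q(3) assms(2), of 1] geo_ends[OF base q(3)] assms(2) by simp
  moreover have "r \<in> W" using q base assms(2) o0_in by (auto simp: r_def comb_model_space geo_in)
  ultimately show ?thesis by (intro bexI[of _ r]) (simp_all add: D_def q0_def r_def q algebra_simps)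
qed

text \<open>The Svarc--Milnor argument: a path from \<open>q0\<close> to the target is cut into
  steps of length at most 1 and followed by nearby orbit points; consecutive group elements differ
  by an element of the finite set \<open>S\<close>.\<close>

lemma words: "\<exists>S. finite S \<and> S \<subseteq> carrier L \<and>
  (\<forall>g\<in>carrier L. \<exists>ws. set ws \<subseteq> S \<and> real (length ws) \<le> D q0 (\<alpha> g q0) + 2 \<and> g = foldl (\<lambda>a b. a \<otimes>\<^bsub>L\<^esub> b) \<one>\<^bsub>L\<^esub> ws)"
proof -
  obtain R where R: "R \<ge> 0" "\<And>q. q \<in> W \<Longrightarrow> \<exists>g\<in>carrier L. D q (\<alpha> g q0) \<le> R" using dense by blast
  \<comment> \<open>A step of length 1 and an error \<open>R\<close> at either end.\<close>
  define S where "S = {g\<in>carrier L. D q0 (\<alpha> g q0) \<le> 2 * R + 1}"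
  let ?w = "foldl (\<lambda>a b. a \<otimes>\<^bsub>L\<^esub> b) \<one>\<^bsub>L\<^esub>"
  have "\<forall>q\<in>W. D q0 q \<le> real k \<longrightarrow> (\<forall>g\<in>carrier L. D q (\<alpha> g q0) \<le> R \<longrightarrow> (\<exists>ws. set ws \<subseteq> S \<and> length ws = Suc k \<and> g = ?w ws))" for k
  proof (induction k)
    case 0
    show ?case
    proof (intro ballI impI)
      fix q g assume q: "q \<in> W" "D q0 q \<le> real 0" and g: "g \<in> carrier L" "D q (\<alpha> g q0) \<le> R"
      have "D q0 (\<alpha> g q0) \<le> R" using D_triangle[OF q0_in q(1) \<alpha>_in[OF g(1) q0_in]] q(2) g(2) by simp
      then have "g \<in> S" using g(1) R(1) by (simp add: S_def)
      then show "\<exists>ws. set ws \<subseteq> S \<and> length ws = Suc 0 \<and> g = ?w ws" using g(1) by (intro exI[of _ "[g]"]) simp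
    qed
  next
    case (Suc k)
    show ?case
    proof (intro ballI impI)
      fix q g assume q: "q \<in> W" "D q0 q \<le> real (Suc k)" and g: "g \<in> carrier L" "D q (\<alpha> g q0) \<le> R"
      \<comment> \<open>Going back by the fraction \<open>1 / (k + 1)\<close> leaves a last step of
        length at most 1.\<close>
      have "real k / (real k + 1) \<in> {0..1}" by simp
      then obtain r where r: "r \<in> W" "D q0 r = real k / (real k + 1) * D q0 q" "D r q = (1 - real k / (real k + 1)) * D q0 q"
        using halfway[OF q(1)] by blast
      have "D q0 r \<le> real k / (real k + 1) * (real k + 1)" unfolding r(2) using q(2) by (intro mult_left_mono) auto
      then have 1: "D q0 r \<le> real k" by simp
      have "D r q \<le> (1 - real k / (real k + 1)) * (real k + 1)" unfolding r(3) using q(2) by (intro mult_left_mono) auto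
      then have 2: "D r q \<le> 1" by (simp add: field_simps)
      obtain h where h: "h \<in> carrier L" "D r (\<alpha> h q0) \<le> R" using R(2) r(1) by blast
      then obtain ws where ws: "set ws \<subseteq> S" "length ws = Suc k" "h = ?w ws" using Suc r(1) 1 by blast
      have "D (\<alpha> h q0) (\<alpha> g q0) \<le> D (\<alpha> h q0) r + (D r q + D q (\<alpha> g q0))"
        using D_triangle[OF \<alpha>_in[OF h(1) q0_in] r(1) \<alpha>_in[OF g(1) q0_in]] D_triangle[OF r(1) q(1) \<alpha>_in[OF g(1) q0_in]] by simp
      then have "inv\<^bsub>L\<^esub> h \<otimes>\<^bsub>L\<^esub> g \<in> S" using 2 h g D_sym[of r] by (simp add: S_def D_move)
      moreover have "g = h \<otimes>\<^bsub>L\<^esub> (inv\<^bsub>L\<^esub> h \<otimes>\<^bsub>L\<^esub> g)" using h(1) g(1) by (simp flip: m_assoc)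
      ultimately show "\<exists>ws. set ws \<subseteq> S \<and> length ws = Suc (Suc k) \<and> g = ?w ws"
        using ws by (intro exI[of _ "ws @ [inv\<^bsub>L\<^esub> h \<otimes>\<^bsub>L\<^esub> g]"]) simp
    qed
  qed
  note * = this
  \<comment> \<open>The 2 stands for rounding the distance up and for the first letter, which is
    present even at distance 0.\<close>
  have "\<exists>ws. set ws \<subseteq> S \<and> real (length ws) \<le> D q0 (\<alpha> g q0) + 2 \<and> g = ?w ws" if g: "g \<in> carrier L" for g
  proof -
    let ?k = "nat \<lceil>D q0 (\<alpha> g q0)\<rceil>"
    have k: "D q0 (\<alpha> g q0) \<le> real ?k" "real ?k \<le> D q0 (\<alpha> g q0) + 1" using D_nonneg[of q0 "\<alpha> g q0"] by linarith+
    obtain ws where "set ws \<subseteq> S" "length ws = Suc ?k" "g = ?w ws"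
      using * k(1) \<alpha>_in[OF g q0_in] g D_self[OF \<alpha>_in[OF g q0_in]] R(1) by (metis (no_types, lifting))
    then show ?thesis using k(2) by auto
  qed
  moreover have "finite S" unfolding S_def by (rule finite_ball)
  ultimately show ?thesis by (intro exI[of _ S]) (auto simp: S_def)
qed

lemma finitely_generated: "\<exists>S. finite S \<and> S \<subseteq> carrier L \<and>
  (\<forall>c\<in>carrier L. (\<forall>s\<in>S. c \<otimes>\<^bsub>L\<^esub> s = s \<otimes>\<^bsub>L\<^esub> c) \<longrightarrow> (\<forall>g\<in>carrier L. c \<otimes>\<^bsub>L\<^esub> g = g \<otimes>\<^bsub>L\<^esub> c))"
proof -
  obtain S where S: "finite S" "S \<subseteq> carrier L" "\<forall>g\<in>carrier L. \<exists>ws. set ws \<subseteq> S \<and> real (length ws) \<le> D q0 (\<alpha> g q0) + 2 \<and> g = foldl (\<lambda>a b. a \<otimes>\<^bsub>L\<^esub> b) \<one>\<^bsub>L\<^esub> ws"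
    using words by blast
  have "c \<otimes>\<^bsub>L\<^esub> g = g \<otimes>\<^bsub>L\<^esub> c" if c: "c \<in> carrier L" "\<forall>s\<in>S. c \<otimes>\<^bsub>L\<^esub> s = s \<otimes>\<^bsub>L\<^esub> c" and g: "g \<in> carrier L" for c g
  proof -
    have "set ws \<subseteq> S \<Longrightarrow> foldl (\<lambda>a b. a \<otimes>\<^bsub>L\<^esub> b) \<one>\<^bsub>L\<^esub> ws \<in> carrier L \<and>
      c \<otimes>\<^bsub>L\<^esub> foldl (\<lambda>a b. a \<otimes>\<^bsub>L\<^esub> b) \<one>\<^bsub>L\<^esub> ws = foldl (\<lambda>a b. a \<otimes>\<^bsub>L\<^esub> b) \<one>\<^bsub>L\<^esub> ws \<otimes>\<^bsub>L\<^esub> c" for ws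
    proof (induction ws rule: rev_induct)
      case (snoc s ws)
      define w where "w = foldl (\<lambda>a b. a \<otimes>\<^bsub>L\<^esub> b) \<one>\<^bsub>L\<^esub> ws"
      have w: "w \<in> carrier L" "c \<otimes>\<^bsub>L\<^esub> w = w \<otimes>\<^bsub>L\<^esub> c" using snoc by (auto simp: w_def)
      have s: "s \<in> carrier L" "c \<otimes>\<^bsub>L\<^esub> s = s \<otimes>\<^bsub>L\<^esub> c" using snoc.prems S(2) c(2) by auto
      have "c \<otimes>\<^bsub>L\<^esub> (w \<otimes>\<^bsub>L\<^esub> s) = (c \<otimes>\<^bsub>L\<^esub> w) \<otimes>\<^bsub>L\<^esub> s" using c(1) w(1) s(1) by (simp add: m_assoc)
      also have "\<dots> = w \<otimes>\<^bsub>L\<^esub> (c \<otimes>\<^bsub>L\<^esub> s)" unfolding w(2) using c(1) w(1) s(1) by (simp add: m_assoc)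
      also have "\<dots> = (w \<otimes>\<^bsub>L\<^esub> s) \<otimes>\<^bsub>L\<^esub> c" unfolding s(2) using c(1) w(1) s(1) by (simp add: m_assoc)
      finally show ?case using w s by (simp add: w_def)
    qed (use c in simp)
    then show ?thesis using S(3) g by metis
  qed
  then show ?thesis using S by blast
qed

text \<open>A homomorphism grows at most linearly in the word length, which \<open>words\<close>
  bounds by the displacement of \<open>q0\<close>.\<close>

lemma hom_bound: assumes "\<phi> \<in> hom L integer_group"
  shows "\<exists>B\<ge>0. \<forall>g\<in>carrier L. \<bar>real_of_int (\<phi> g)\<bar> \<le> B * (D q0 (\<alpha> g q0) + 2)"
proof -
  interpret h: group_hom L integer_group \<phi> by (intro group_hom.intro group_hom_axioms.intro assms is_group group_integer_group)
  obtain S where S: "finite S" "S \<subseteq> carrier L" "\<forall>g\<in>carrier L. \<exists>ws. set ws \<subseteq> S \<and> real (length ws) \<le> D q0 (\<alpha> g q0) + 2 \<and> g = foldl (\<lambda>a b. a \<otimes>\<^bsub>L\<^esub> b) \<one>\<^bsub>L\<^esub> ws"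
    using words by blast
  define B where "B = (\<Sum>s\<in>S. \<bar>real_of_int (\<phi> s)\<bar>)"
  have B: "B \<ge> 0" by (simp add: B_def sum_nonneg)
  have s: "\<bar>real_of_int (\<phi> s)\<bar> \<le> B" if "s \<in> S" for s unfolding B_def using that S(1) by (intro member_le_sum) auto
  have *: "set ws \<subseteq> S \<Longrightarrow> foldl (\<lambda>a b. a \<otimes>\<^bsub>L\<^esub> b) \<one>\<^bsub>L\<^esub> ws \<in> carrier L \<and> \<bar>real_of_int (\<phi> (foldl (\<lambda>a b. a \<otimes>\<^bsub>L\<^esub> b) \<one>\<^bsub>L\<^esub> ws))\<bar> \<le> B * length ws" for ws
  proof (induction ws rule: rev_induct)
    case (snoc t ws)
    have "t \<in> carrier L" "\<bar>real_of_int (\<phi> t)\<bar> \<le> B" using snoc.prems S(2) s by auto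
    then show ?case using snoc h.hom_mult by (auto simp: algebra_simps)
  qed (use h.hom_one in simp)
  have "\<bar>real_of_int (\<phi> g)\<bar> \<le> B * (D q0 (\<alpha> g q0) + 2)" if g: "g \<in> carrier L" for g
  proof -
    obtain ws where ws: "set ws \<subseteq> S" "real (length ws) \<le> D q0 (\<alpha> g q0) + 2" "g = foldl (\<lambda>a b. a \<otimes>\<^bsub>L\<^esub> b) \<one>\<^bsub>L\<^esub> ws" using S(3) g by blast
    have "\<bar>real_of_int (\<phi> g)\<bar> \<le> B * length ws" using *[OF ws(1)] ws(3) by simp
    also have "\<dots> \<le> B * (D q0 (\<alpha> g q0) + 2)" using ws(2) B by (rule mult_left_mono)
    finally show ?thesis .
  qed
  then show ?thesis using B by blast
qed

end

section \<open>Lipschitz equivariant functions and their regularisation\<close>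

context product_action
begin

definition lipschitz :: "real \<Rightarrow> ((nat \<Rightarrow> real) \<times> 'a \<Rightarrow> real) \<Rightarrow> bool" where
  "lipschitz C F \<longleftrightarrow> C > 0 \<and> (\<forall>q\<in>W. \<forall>r\<in>W. F q \<le> F r + C * D q r)"

definition equivar :: "('g \<Rightarrow> real) \<Rightarrow> ((nat \<Rightarrow> real) \<times> 'a \<Rightarrow> real) \<Rightarrow> bool" where
  "equivar \<psi> F \<longleftrightarrow> (\<forall>g\<in>carrier L. \<forall>q\<in>W. F (\<alpha> g q) = F q + \<psi> g)"

lemma lipschitz_uminus: "lipschitz C F \<Longrightarrow> lipschitz C (\<lambda>q. - F q)"
  unfolding lipschitz_def using D_sym by (smt (verit, best))

lemma equivar_uminus: "equivar \<psi> F \<Longrightarrow> equivar (\<lambda>g. - \<psi> g) (\<lambda>q. - F q)"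
  by (simp add: equivar_def)

lemma equivar_inv: assumes "equivar \<psi> F" "g \<in> carrier L" shows "\<psi> (inv\<^bsub>L\<^esub> g) = - \<psi> g"
proof -
  have "F (\<alpha> (inv\<^bsub>L\<^esub> g) (\<alpha> g q0)) = F q0 + \<psi> g + \<psi> (inv\<^bsub>L\<^esub> g)"
    using assms q0_in \<alpha>_in unfolding equivar_def by (metis inv_closed)
  then show ?thesis using \<alpha>_inv(1)[OF assms(2) q0_in] by simp
qed

text \<open>An infimum of McShane type: cones of slope \<open>C\<close> are placed at the orbit
  points at heights given by \<open>\<phi>\<close>. The slope is at least the growth rate of
  \<open>\<phi>\<close>, so the infimum is finite, and left translation permutes the cones.\<close>

lemma Lipschitz_equivariant_exists: assumes \<phi>: "\<phi> \<in> hom L integer_group"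
  shows "\<exists>C f. lipschitz C f \<and> equivar (\<lambda>g. real_of_int (\<phi> g)) f"
proof -
  obtain B where B: "B \<ge> 0" "\<And>g. g \<in> carrier L \<Longrightarrow> \<bar>real_of_int (\<phi> g)\<bar> \<le> B * (D q0 (\<alpha> g q0) + 2)"
    using hom_bound[OF \<phi>] by blast
  \<comment> \<open>The 1 makes \<open>C\<close> positive even if \<open>B\<close> is 0.\<close>
  define C where "C = B + 1"
  have C: "C > 0" using B(1) by (simp add: C_def)
  define h where "h q g = real_of_int (\<phi> g) + C * D (\<alpha> g q0) q" for q g
  define f where "f q = (INF g\<in>carrier L. h q g)" for q
  have bdd: "bdd_below (h q ` carrier L)" if q: "q \<in> W" for q
  proof (rule bdd_belowI2)
    fix g assume g: "g \<in> carrier L"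
    have 1: "D q0 (\<alpha> g q0) \<le> D q0 q + D (\<alpha> g q0) q" using D_triangle[OF q0_in q \<alpha>_in[OF g q0_in]] D_sym by simp
    have "\<bar>real_of_int (\<phi> g)\<bar> \<le> B * (D q0 q + D (\<alpha> g q0) q + 2)"
      using B(2)[OF g] mult_left_mono[OF 1 B(1)] by (simp add: algebra_simps)
    moreover have "B * D (\<alpha> g q0) q \<le> C * D (\<alpha> g q0) q" using D_nonneg by (simp add: C_def mult_right_mono)
    ultimately show "- (B * (D q0 q + 2)) \<le> h q g" unfolding h_def by (simp add: algebra_simps)
  qed
  have ne: "carrier L \<noteq> {}" by blast
  have le: "f q \<le> h q g" if "q \<in> W" "g \<in> carrier L" for q g unfolding f_def using bdd[OF that(1)] that(2) by (rule cINF_lower)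
  have "lipschitz C f" unfolding lipschitz_def
  proof (intro conjI ballI C)
    fix q r assume q: "q \<in> W" and r: "r \<in> W"
    have "f q - C * D q r \<le> f r" unfolding f_def[of r]
    proof (rule cINF_greatest[OF ne])
      fix g assume g: "g \<in> carrier L"
      have "D (\<alpha> g q0) q \<le> D (\<alpha> g q0) r + D q r" using D_triangle[OF \<alpha>_in[OF g q0_in] r q] D_sym by simp
      then have "C * D (\<alpha> g q0) q \<le> C * (D (\<alpha> g q0) r + D q r)" using C by (intro mult_left_mono) auto
      then show "f q - C * D q r \<le> h r g" using le[OF q g] by (simp add: h_def algebra_simps)
    qed
    then show "f q \<le> f r + C * D q r" by simp
  qed
  moreover have "f (\<alpha> a q) = f q + real_of_int (\<phi> a)" if a: "a \<in> carrier L" and q: "q \<in> W" for a q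
  proof -
    interpret i: group_hom L integer_group \<phi> by (intro group_hom.intro group_hom_axioms.intro \<phi> is_group group_integer_group)
    have *: "h (\<alpha> b r) (b \<otimes>\<^bsub>L\<^esub> g) = h r g + real_of_int (\<phi> b)" if "b \<in> carrier L" "g \<in> carrier L" "r \<in> W" for b g r
      using that q0_in i.hom_mult[of b g] by (simp add: h_def \<alpha>_mult \<alpha>_in \<alpha>_iso del: mem_Times_iff)
    have up: "f (\<alpha> b r) \<le> f r + real_of_int (\<phi> b)" if b: "b \<in> carrier L" and r: "r \<in> W" for b r
    proof -
      have "f (\<alpha> b r) - real_of_int (\<phi> b) \<le> f r" unfolding f_def[of r]
      proof (rule cINF_greatest[OF ne])
        fix g assume g: "g \<in> carrier L"
        show "f (\<alpha> b r) - real_of_int (\<phi> b) \<le> h r g"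
          using le[OF \<alpha>_in[OF b r] m_closed[OF b g]] unfolding *[OF b g r] by simp
      qed
      then show ?thesis by simp
    qed
    have "f (\<alpha> (inv\<^bsub>L\<^esub> a) (\<alpha> a q)) \<le> f (\<alpha> a q) + real_of_int (\<phi> (inv\<^bsub>L\<^esub> a))" using up[of "inv\<^bsub>L\<^esub> a"] a q \<alpha>_in by simp
    then have "f q \<le> f (\<alpha> a q) - real_of_int (\<phi> a)" using \<alpha>_inv(1)[OF a q] i.hom_inv[OF a] by simp
    then show ?thesis using up[OF a q] by simp
  qed
  ultimately show ?thesis unfolding equivar_def by blast
qed

text \<open>The Moreau envelope in the Euclidean variable alone.\<close>

definition infconv :: "real \<Rightarrow> ((nat \<Rightarrow> real) \<times> 'a \<Rightarrow> real) \<Rightarrow> (nat \<Rightarrow> real) \<times> 'a \<Rightarrow> real" where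
  "infconv c F q = (INF v\<in>V. F (comb 1 (fst q) 1 v, snd q) + c * nsq n v)"

lemma shift_in: "q \<in> W \<Longrightarrow> v \<in> V \<Longrightarrow> (comb 1 (fst q) 1 v, snd q) \<in> W"
  by (auto intro: comb_model_space)

lemma D_shift: "q \<in> W \<Longrightarrow> D q (comb 1 (fst q) 1 v, snd q) = sqrt (nsq n v)"
  by (auto simp: D_def model_dist_def nsq_def comb_def)

text \<open>A Lipschitz function decreases at most linearly; completing the square gives the
  explicit lower bound.\<close>

lemma infconv_bdd: assumes F: "lipschitz C F" and c: "c > 0" and q: "q \<in> W"
  shows "bdd_below ((\<lambda>v. F (comb 1 (fst q) 1 v, snd q) + c * nsq n v) ` V)"
proof (rule bdd_belowI2)
  fix v assume v: "v \<in> V"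
  define r where "r = sqrt (nsq n v)"
  have 1: "F q \<le> F (comb 1 (fst q) 1 v, snd q) + C * r"
    using F q shift_in[OF q v] D_shift[OF q] r_def unfolding lipschitz_def by metis
  have 2: "nsq n v = r\<^sup>2" by (simp add: r_def nsq_nonneg)
  have "0 \<le> c * (r - C / (2 * c))\<^sup>2" using c by simp
  also have "\<dots> = c * nsq n v - C * r + C\<^sup>2 / (4 * c)"
    unfolding 2 using c by (simp add: power2_eq_square field_simps)
  finally show "F q - C\<^sup>2 / (4 * c) \<le> F (comb 1 (fst q) 1 v, snd q) + c * nsq n v" using 1 by simp
qed

lemma infconv_le: assumes "lipschitz C F" "c > 0" "q \<in> W" "v \<in> V"
  shows "infconv c F q \<le> F (comb 1 (fst q) 1 v, snd q) + c * nsq n v"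
  unfolding infconv_def using infconv_bdd[OF assms(1-3)] assms(4) by (rule cINF_lower)

lemma infconv_greatest: assumes "\<And>v. v \<in> V \<Longrightarrow> m \<le> F (comb 1 (fst q) 1 v, snd q) + c * nsq n v" shows "m \<le> infconv c F q"
  unfolding infconv_def using o0_in assms by (intro cINF_greatest) auto

lemma infconv_lipschitz: assumes F: "lipschitz C F" and c: "c > 0" shows "lipschitz C (infconv c F)"
  unfolding lipschitz_def
proof (intro conjI ballI)
  show "C > 0" using F by (simp add: lipschitz_def)
  fix q r assume q: "q \<in> W" and r: "r \<in> W"
  have "infconv c F q - C * D q r \<le> infconv c F r"
  proof (rule infconv_greatest)
    fix v assume v: "v \<in> V"
    have "D (comb 1 (fst q) 1 v, snd q) (comb 1 (fst r) 1 v, snd r) = D q r"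
      by (simp add: D_def model_dist_def comb_def)
    then have "F (comb 1 (fst q) 1 v, snd q) \<le> F (comb 1 (fst r) 1 v, snd r) + C * D q r"
      using F shift_in[OF q v] shift_in[OF r v] unfolding lipschitz_def by metis
    then show "infconv c F q - C * D q r \<le> F (comb 1 (fst r) 1 v, snd r) + c * nsq n v"
      using infconv_le[OF F c q v] by simp
  qed
  then show "infconv c F q \<le> infconv c F r + C * D q r" by simp
qed

text \<open>An isometry carries the displacement \<open>v\<close> at \<open>q\<close> to a
  displacement of the same length at the image point, so it matches the competitors of the two
  infima. The inverse element gives the reverse inequality.\<close>

lemma infconv_equivar: assumes F: "lipschitz C F" and c: "c > 0" and e: "equivar \<psi> F" shows "equivar \<psi> (infconv c F)"
  unfolding equivar_def
proof (intro ballI)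
  have up: "infconv c F (\<alpha> g q) \<le> infconv c F q + \<psi> g" if g: "g \<in> carrier L" and q: "q \<in> W" for g q
  proof -
    have "infconv c F (\<alpha> g q) - \<psi> g \<le> infconv c F q"
    proof (rule infconv_greatest)
      fix v assume v: "v \<in> V"
      define p where "p = comb 1 (fst q) 1 v"
      define v' where "v' = comb 1 (rot g p) (-1) (rot g (fst q))"
      have p: "p \<in> V" "fst q \<in> V" using q v by (auto simp: p_def comb_model_space)
      have v': "v' \<in> V" unfolding v'_def using p g by (intro comb_model_space rot_in) auto
      have "sqrt (nsq n v') = model_dist 0 n (rot g p) (rot g (fst q))" by (simp add: v'_def model_dist_nsq)
      also have "\<dots> = model_dist 0 n p (fst q)" using rot_iso g p by simp
      also have "\<dots> = sqrt (nsq n v)" by (simp add: model_dist_nsq p_def nsq_def comb_def)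
      finally have n: "nsq n v' = nsq n v" by simp
      have eq: "(comb 1 (fst (\<alpha> g q)) 1 v', snd (\<alpha> g q)) = \<alpha> g (p, snd q)"
        by (simp add: \<alpha>_def v'_def comb_def)
      have "infconv c F (\<alpha> g q) \<le> F (\<alpha> g (p, snd q)) + c * nsq n v"
        using infconv_le[OF F c \<alpha>_in[OF g q] v'] unfolding eq n .
      also have "F (\<alpha> g (p, snd q)) = F (p, snd q) + \<psi> g" using e g p q by (auto simp: equivar_def)
      finally show "infconv c F (\<alpha> g q) - \<psi> g \<le> F (comb 1 (fst q) 1 v, snd q) + c * nsq n v" by (simp add: p_def)
    qed
    then show ?thesis by simp
  qed
  fix g q assume g: "g \<in> carrier L" and q: "q \<in> W"
  have "infconv c F q \<le> infconv c F (\<alpha> g q) + \<psi> (inv\<^bsub>L\<^esub> g)" using up[OF inv_closed[OF g] \<alpha>_in[OF g q]] \<alpha>_inv(1)[OF g q] by simp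
  then show "infconv c F (\<alpha> g q) = infconv c F q + \<psi> g" using up[OF g q] equivar_inv[OF e g] by simp
qed

text \<open>One competitor point \<open>p + v\<close> serves both shifted points, with displacements
  \<open>v - h\<close> and \<open>v + h\<close>; by the parallelogram law the extra cost is
  \<open>2 * c * nsq n h\<close>.\<close>

lemma infconv_semiconcave: assumes F: "lipschitz C F" and c: "c > 0" and p: "p \<in> V" and h: "h \<in> V" and x: "x \<in> M"
  shows "infconv c F (comb 1 p 1 h, x) + infconv c F (comb 1 p (-1) h, x) \<le> 2 * infconv c F (p, x) + 2 * c * nsq n h"
proof -
  have "(infconv c F (comb 1 p 1 h, x) + infconv c F (comb 1 p (-1) h, x) - 2 * c * nsq n h) / 2 \<le> infconv c F (p, x)"
  proof (rule infconv_greatest)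
    fix v assume v: "v \<in> V"
    have in1: "comb 1 p a h \<in> V" "comb 1 v a h \<in> V" for a using p h v by (simp_all add: comb_model_space)
    have eq: "comb 1 (comb 1 p 1 h) 1 (comb 1 v (-1) h) = comb 1 p 1 v" "comb 1 (comb 1 p (-1) h) 1 (comb 1 v 1 h) = comb 1 p 1 v"
      by (auto simp: comb_def)
    have "infconv c F (comb 1 p 1 h, x) \<le> F (comb 1 p 1 v, x) + c * nsq n (comb 1 v (-1) h)"
      using infconv_le[OF F c, of "(comb 1 p 1 h, x)" "comb 1 v (-1) h"] in1 p x unfolding fst_conv snd_conv eq by simp
    moreover have "infconv c F (comb 1 p (-1) h, x) \<le> F (comb 1 p 1 v, x) + c * nsq n (comb 1 v 1 h)"
      using infconv_le[OF F c, of "(comb 1 p (-1) h, x)" "comb 1 v 1 h"] in1 p x unfolding fst_conv snd_conv eq by simp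
    ultimately show "(infconv c F (comb 1 p 1 h, x) + infconv c F (comb 1 p (-1) h, x) - 2 * c * nsq n h) / 2
        \<le> F (comb 1 (fst (p, x)) 1 v, snd (p, x)) + c * nsq n v"
      by (simp add: nsq_comb algebra_simps)
  qed
  then show ?thesis by simp
qed

text \<open>The Lasry--Lions regularisation: a sup-convolution followed by an inf-convolution of half its
  width makes the second differences in the Euclidean directions small on both sides.\<close>

lemma regularisation: assumes f: "lipschitz C f" and s: "s > 0" and e: "equivar \<psi> f"
  shows "\<exists>u. lipschitz C u \<and> equivar \<psi> u \<and>
    (\<forall>p\<in>V. \<forall>h\<in>V. \<forall>x\<in>M. \<bar>u (comb 1 p 1 h, x) + u (comb 1 p (-1) h, x) - 2 * u (p, x)\<bar> \<le> nsq n h / s)"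
proof -
  \<comment> \<open>A sup-convolution, written through negatives. Its coefficient is half that of
    the second convolution, so that in the lower bound the parallelogram law absorbs the term in
    \<open>j\<close>.\<close>
  define F where "F = (\<lambda>q. - infconv (1 / (4 * s)) (\<lambda>q. - f q) q)"
  have c: "1 / (4 * s) > 0" "1 / (2 * s) > 0" using s by simp_all
  have "lipschitz C (infconv (1 / (4 * s)) (\<lambda>q. - f q))" using infconv_lipschitz[OF lipschitz_uminus[OF f] c(1)] .
  then have F: "lipschitz C F" unfolding F_def by (rule lipschitz_uminus)
  have "equivar (\<lambda>g. - \<psi> g) (infconv (1 / (4 * s)) (\<lambda>q. - f q))" using infconv_equivar[OF lipschitz_uminus[OF f] c(1) equivar_uminus[OF e]] .
  then have "equivar (\<lambda>g. - (- \<psi> g)) F" unfolding F_def by (rule equivar_uminus)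
  then have Fe: "equivar \<psi> F" by simp
  let ?u = "infconv (1 / (2 * s)) F"
  have "\<bar>?u (comb 1 p 1 h, x) + ?u (comb 1 p (-1) h, x) - 2 * ?u (p, x)\<bar> \<le> nsq n h / s" if p: "p \<in> V" and h: "h \<in> V" and x: "x \<in> M" for p h x
  proof -
    have 1: "?u (comb 1 p 1 h, x) + ?u (comb 1 p (-1) h, x) \<le> 2 * ?u (p, x) + nsq n h / s"
      using infconv_semiconcave[OF F c(2) p h x] by simp
    have *: "2 * ?u (p, x) - nsq n h / s \<le> (F (comb 1 (comb 1 p 1 h) 1 v, x) + 1 / (2 * s) * nsq n v) + (F (comb 1 (comb 1 p (-1) h) 1 w, x) + 1 / (2 * s) * nsq n w)"
      if v: "v \<in> V" and w: "w \<in> V" for v w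
    proof -
      \<comment> \<open>\<open>m\<close> is the midpoint of the two competitor points and
        \<open>l\<close> is half their difference, which brings in the semiconvexity of
        \<open>F\<close> at \<open>m\<close>.\<close>
      define k where "k = comb (1/2) v (1/2) w"
      define j where "j = comb (1/2) v (-1/2) w"
      define m where "m = comb 1 p 1 k"
      define l where "l = comb 1 h 1 j"
      have V: "k \<in> V" "j \<in> V" "m \<in> V" "l \<in> V" using p h v w by (auto simp: k_def j_def m_def l_def comb_model_space)
      have 2: "comb 1 (comb 1 p 1 h) 1 v = comb 1 m 1 l" "comb 1 (comb 1 p (-1) h) 1 w = comb 1 m (-1) l"
        by (auto simp: k_def j_def m_def l_def comb_def field_simps)
      have 3: "2 * F (m, x) \<le> F (comb 1 m 1 l, x) + F (comb 1 m (-1) l, x) + nsq n l / (2 * s)"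
        using infconv_semiconcave[OF lipschitz_uminus[OF f] c(1) V(3,4) x] by (simp add: F_def)
      have 4: "?u (p, x) \<le> F (m, x) + 1 / (2 * s) * nsq n k" using infconv_le[OF F c(2), of "(p, x)" k] p x V(1) by (simp add: m_def)
      have 5: "nsq n v + nsq n w = 2 * nsq n k + 2 * nsq n j" by (simp add: k_def j_def nsq_comb power2_eq_square field_simps)
      have "0 \<le> nsq n (comb 1 j (-1) h)" by (rule nsq_nonneg)
      then have 6: "nsq n l \<le> 2 * nsq n j + 2 * nsq n h" unfolding l_def nsq_comb by (simp add: mult.commute[of "h _"])
      have "nsq n l / (2 * s) \<le> (2 * nsq n j + 2 * nsq n h) / (2 * s)" using 6 s by (intro divide_right_mono) auto
      moreover have "1 / (2 * s) * nsq n v + 1 / (2 * s) * nsq n w = (2 * nsq n k + 2 * nsq n j) / (2 * s)"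
        unfolding 5[symmetric] by (simp add: add_divide_distrib)
      ultimately show ?thesis unfolding 2 using 3 4 by (simp add: add_divide_distrib)
    qed
    have px: "2 * ?u (p, x) - nsq n h / s - (F (comb 1 (comb 1 p 1 h) 1 v, x) + 1 / (2 * s) * nsq n v) \<le> ?u (comb 1 p (-1) h, x)" if v: "v \<in> V" for v
    proof (rule infconv_greatest)
      fix w assume w: "w \<in> V"
      show "2 * ?u (p, x) - nsq n h / s - (F (comb 1 (comb 1 p 1 h) 1 v, x) + 1 / (2 * s) * nsq n v)
        \<le> F (comb 1 (fst (comb 1 p (-1) h, x)) 1 w, snd (comb 1 p (-1) h, x)) + 1 / (2 * s) * nsq n w"
        using *[OF v w] by simp
    qed
    have "2 * ?u (p, x) - nsq n h / s - ?u (comb 1 p (-1) h, x) \<le> ?u (comb 1 p 1 h, x)"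
    proof (rule infconv_greatest)
      fix v assume v: "v \<in> V"
      show "2 * ?u (p, x) - nsq n h / s - ?u (comb 1 p (-1) h, x)
        \<le> F (comb 1 (fst (comb 1 p 1 h, x)) 1 v, snd (comb 1 p 1 h, x)) + 1 / (2 * s) * nsq n v"
        using px[OF v] by simp
    qed
    then show ?thesis using 1 by simp
  qed
  moreover have "lipschitz C ?u" using infconv_lipschitz[OF F c(2)] .
  moreover have "equivar \<psi> ?u" using infconv_equivar[OF F c(2) Fe] .
  ultimately show ?thesis by blast
qed

text \<open>Normalised at \<open>q0\<close>, the regularised functions lie in a product of compact
  intervals. The conditions for growing scales are closed and nested, so by compactness of the
  product they have a common solution.\<close>

lemma midpoint_affine_exists: assumes f: "lipschitz C f" and e: "equivar \<psi> f"
  shows "\<exists>u. lipschitz C u \<and> equivar \<psi> u \<and> (\<forall>p\<in>V. \<forall>h\<in>V. \<forall>x\<in>M. u (comb 1 p 1 h, x) + u (comb 1 p (-1) h, x) = 2 * u (p, x))"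
proof -
  have C: "C > 0" using f by (simp add: lipschitz_def)
  \<comment> \<open>Off \<open>W\<close> the interval shrinks to 0, so that the product over the
    whole type is compact.\<close>
  define P where "P = PiE UNIV (\<lambda>q. {- (if q \<in> W then C * D q q0 else 0) .. (if q \<in> W then C * D q q0 else 0)})"
  have "compactin (product_topology (\<lambda>_. euclideanreal) UNIV) P" unfolding P_def by (rule compactin_PiE[THEN iffD2]) (simp add: compactin_euclidean_iff)
  then have P: "compact P" unfolding euclidean_product_topology compactin_euclidean_iff .
  define T where "T s = {u. (\<forall>q\<in>W. \<forall>r\<in>W. u q \<le> u r + C * D q r) \<and> (\<forall>g\<in>carrier L. \<forall>q\<in>W. u (\<alpha> g q) = u q + \<psi> g) \<and>
    (\<forall>p\<in>V. \<forall>h\<in>V. \<forall>x\<in>M. \<bar>u (comb 1 p 1 h, x) + u (comb 1 p (-1) h, x) - 2 * u (p, x)\<bar> \<le> nsq n h / real (Suc s))}" for s :: nat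
  have cl: "closed (T s)" for s unfolding T_def Ball_def
    by (intro closed_Collect_conj closed_Collect_all closed_Collect_imp open_Collect_const closed_Collect_le closed_Collect_eq
        continuous_intros continuous_on_product_coordinates)
  have mono: "T t \<subseteq> T s" if "s \<le> t" for s t
  proof -
    have "nsq n h / real (Suc t) \<le> nsq n h / real (Suc s)" for h using that by (intro divide_left_mono nsq_nonneg) auto
    then show ?thesis unfolding T_def by (blast intro: order_trans)
  qed
  have ne: "P \<inter> T s \<noteq> {}" for s
  proof -
    obtain u where u: "lipschitz C u" "equivar \<psi> u"
      "\<And>p h x. p \<in> V \<Longrightarrow> h \<in> V \<Longrightarrow> x \<in> M \<Longrightarrow> \<bar>u (comb 1 p 1 h, x) + u (comb 1 p (-1) h, x) - 2 * u (p, x)\<bar> \<le> nsq n h / real (Suc s)"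
      using regularisation[OF f _ e, of "real (Suc s)"] by auto
    define v where "v q = (if q \<in> W then u q - u q0 else 0)" for q
    have "v \<in> T s" unfolding T_def
    proof (intro CollectI conjI ballI)
      show "v q \<le> v r + C * D q r" if "q \<in> W" "r \<in> W" for q r
      proof -
        have "u q \<le> u r + C * D q r" using u(1) that unfolding lipschitz_def by blast
        then show ?thesis using that by (simp add: v_def)
      qed
      show "v (\<alpha> g q) = v q + \<psi> g" if "g \<in> carrier L" "q \<in> W" for g q
      proof -
        have "u (\<alpha> g q) = u q + \<psi> g" using u(2) that unfolding equivar_def by blast
        then show ?thesis using that(2) \<alpha>_in[OF that] by (simp add: v_def)
      qed
      show "\<bar>v (comb 1 p 1 h, x) + v (comb 1 p (-1) h, x) - 2 * v (p, x)\<bar> \<le> nsq n h / real (Suc s)" if "p \<in> V" "h \<in> V" "x \<in> M" for p h x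
        using u(3)[OF that] that by (simp add: v_def comb_model_space)
    qed
    moreover have "v q \<in> {- (C * D q q0) .. C * D q q0}" if "q \<in> W" for q
    proof -
      have "u q \<le> u q0 + C * D q q0" "u q0 \<le> u q + C * D q0 q" using u(1) that q0_in by (auto simp: lipschitz_def)
      then show ?thesis using that D_sym[of q0 q] by (simp add: v_def)
    qed
    then have "v \<in> P" unfolding P_def by (auto simp: v_def)
    ultimately show ?thesis by blast
  qed
  have "P \<inter> \<Inter>(range T) \<noteq> {}"
  proof (rule compact_imp_fip[OF P])
    fix \<F> assume "finite \<F>" "\<F> \<subseteq> range T"
    then obtain I where I: "finite I" "\<F> = T ` I" using finite_subset_image[of \<F> T UNIV] by blast
    have "T (Max (insert 0 I)) \<subseteq> T s" if "s \<in> I" for s using that I(1) by (intro mono Max_ge) auto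
    then have "P \<inter> T (Max (insert 0 I)) \<subseteq> P \<inter> \<Inter>\<F>" unfolding I(2) by blast
    then show "P \<inter> \<Inter>\<F> \<noteq> {}" using ne by blast
  qed (use cl in auto)
  then obtain u where u: "\<And>s. u \<in> T s" by blast
  have "u (comb 1 p 1 h, x) + u (comb 1 p (-1) h, x) = 2 * u (p, x)" if "p \<in> V" "h \<in> V" "x \<in> M" for p h x
  proof -
    have "\<bar>u (comb 1 p 1 h, x) + u (comb 1 p (-1) h, x) - 2 * u (p, x)\<bar> \<le> nsq n h / real (Suc s)" for s using u[of s] that by (simp add: T_def)
    moreover have "(\<lambda>s. nsq n h / real (Suc s)) \<longlonglongrightarrow> 0" using tendsto_mult_right_zero[OF LIMSEQ_inverse_real_of_nat, of "nsq n h"] by (simp add: divide_inverse)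
    ultimately have "\<bar>u (comb 1 p 1 h, x) + u (comb 1 p (-1) h, x) - 2 * u (p, x)\<bar> \<le> 0" by (intro LIMSEQ_le_const) auto
    then show ?thesis by simp
  qed
  moreover have "lipschitz C u" "equivar \<psi> u" using u[of 0] C by (auto simp: T_def lipschitz_def equivar_def)
  ultimately show ?thesis by blast
qed

end

section \<open>Central elements\<close>

text \<open>Integer multiples are exact by additivity. Rounding \<open>m * t\<close> to an integer
  bounds \<open>m\<close> times the defect at \<open>t\<close> independently of
  \<open>m\<close>.\<close>

lemma additive_bounded_imp_linear: fixes f :: "real \<Rightarrow> real"
  assumes add: "\<And>s t. f (s + t) = f s + f t" and bd: "\<And>t. \<bar>f t\<bar> \<le> C * \<bar>t\<bar>"
  shows "f t = t * f 1"
proof -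
  have f0: "f 0 = 0" using bd[of 0] by simp
  have neg: "f (- s) = - f s" for s using add[of s "- s"] f0 by simp
  have nat: "f (real m * s) = real m * f s" for m s
    by (induction m) (simp_all add: f0 add algebra_simps)
  have int: "f (of_int j) = of_int j * f 1" for j
    using nat[of "nat j" 1] nat[of "nat (- j)" 1] neg[of "of_int (- j)"] by (cases "j \<ge> 0") auto
  have C: "C \<ge> 0" using bd[of 1] by simp
  have "\<bar>f t - t * f 1\<bar> = 0"
  proof (rule real_archimedian_rdiv_eq_0[of _ "C + \<bar>f 1\<bar>"])
    fix m :: nat
    define j where "j = \<lfloor>real m * t\<rfloor>"
    define r where "r = real m * t - of_int j"
    have r: "\<bar>r\<bar> \<le> 1" unfolding r_def j_def by linarith
    have "real m * f t = of_int j * f 1 + f r" using add[of "of_int j" r] nat[of m t] int[of j] by (simp add: r_def)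
    then have "real m * (f t - t * f 1) = f r - r * f 1" by (simp add: r_def algebra_simps)
    moreover have "\<bar>f r\<bar> \<le> C" using bd[of r] mult_left_mono[OF r C] by simp
    moreover have "\<bar>r * f 1\<bar> \<le> \<bar>f 1\<bar>" unfolding abs_mult using mult_right_mono[OF r, of "\<bar>f 1\<bar>"] by simp
    ultimately have "\<bar>real m * (f t - t * f 1)\<bar> \<le> C + \<bar>f 1\<bar>" by linarith
    then show "real m * \<bar>f t - t * f 1\<bar> \<le> C + \<bar>f 1\<bar>" by (simp add: abs_mult)
  qed (use C in auto)
  then show ?thesis by simp
qed

lemma nsq_zero_iff: "nsq n v = 0 \<longleftrightarrow> (\<forall>i<n. v i = 0)"
  by (auto simp: nsq_def sum_nonneg_eq_0_iff)

context group
begin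

text \<open>The subgroup is the preimage of the multiples of \<open>\<phi> c\<close>: dividing by a
  power of \<open>c\<close> lands in the kernel, and \<open>\<phi>\<close> modulo
  \<open>\<phi> c\<close> takes finitely many values and determines the coset.\<close>

lemma virtually_splits_central:
  assumes \<phi>: "\<phi> \<in> hom G integer_group" and c: "c \<in> carrier G" "\<And>g. g \<in> carrier G \<Longrightarrow> c \<otimes> g = g \<otimes> c" "\<phi> c \<noteq> 0"
    and inf: "infinite (kernel G integer_group \<phi>)"
  shows "virtually_splits G"
proof -
  interpret h: group_hom G integer_group \<phi> by (intro group_hom.intro group_hom_axioms.intro \<phi> is_group group_integer_group)
  define N where "N = kernel G integer_group \<phi>"
  define P where "P = range (\<lambda>k::int. c [^] k)"
  define H where "H = {g\<in>carrier G. \<phi> c dvd \<phi> g}"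
  have N: "subgroup N G" unfolding N_def by (rule h.subgroup_kernel)
  have pow: "\<phi> (c [^] k) = k * \<phi> c" for k :: int using h.hom_int_pow[OF c(1)] by simp
  have inj: "inj (\<lambda>k::int. c [^] k)" by (rule injI) (metis pow c(3) mult_right_cancel)
  have comm: "c [^] k \<otimes> g = g \<otimes> c [^] k" if g: "g \<in> carrier G" for g and k :: int
  proof -
    have nat: "c [^] m \<otimes> g = g \<otimes> c [^] m" for m :: nat
    proof (induction m)
      case (Suc m)
      have "c [^] Suc m \<otimes> g = c [^] m \<otimes> (c \<otimes> g)" using c(1) g by (simp add: m_assoc)
      also have "\<dots> = c [^] m \<otimes> (g \<otimes> c)" using c(2)[OF g] by simp
      also have "\<dots> = (c [^] m \<otimes> g) \<otimes> c" using c(1) g by (simp add: m_assoc)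
      finally show ?case unfolding Suc using c(1) g by (simp add: m_assoc)
    qed (use g in simp)
    have inv: "inv y \<otimes> g = g \<otimes> inv y" if y: "y \<in> carrier G" "y \<otimes> g = g \<otimes> y" for y
    proof -
      have "inv y \<otimes> (g \<otimes> y) \<otimes> inv y = inv y \<otimes> g" using y(1) g by (simp add: m_assoc)
      moreover have "inv y \<otimes> (y \<otimes> g) = g" using y(1) g by (simp flip: m_assoc)
      ultimately show ?thesis unfolding y(2) by simp
    qed
    show ?thesis
    proof (cases "k < 0")
      case True then show ?thesis using inv[OF nat_pow_closed[OF c(1)] nat, of "nat (- k)"] by (simp only: int_pow_def2 if_True)
    next
      case False then show ?thesis using nat[of "nat k"] by (simp only: int_pow_def2 if_False)
    qed
  qed
  have P: "subgroup P G"
  proof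
    show "x \<otimes> y \<in> P" if "x \<in> P" "y \<in> P" for x y using that c(1) by (auto simp: P_def simp flip: int_pow_mult)
    show "inv x \<in> P" if "x \<in> P" for x using that c(1) by (auto simp: P_def simp flip: int_pow_neg)
    show "\<one> \<in> P" unfolding P_def by (rule range_eqI[of _ _ 0]) simp
  qed (use c in \<open>auto simp: P_def\<close>)
  have H: "subgroup H G"
  proof
    show "inv x \<in> H" if "x \<in> H" for x using that by (auto simp: H_def h.hom_inv)
  qed (auto simp: H_def h.hom_mult)
  have "infinite P" unfolding P_def using finite_imageD[OF _ inj] infinite_UNIV_int by blast
  moreover have "finite (rcosets H)"
  proof -
    let ?r = "\<lambda>a. \<phi> a mod \<phi> c"
    have eq: "H #> a = H #> b" if "a \<in> carrier G" "b \<in> carrier G" "?r a = ?r b" for a b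
    proof -
      have "\<phi> c dvd \<phi> a - \<phi> b" using that(3) by (simp add: mod_eq_dvd_iff)
      then have "a \<otimes> inv b \<in> H" using that(1,2) by (simp add: H_def h.hom_mult h.hom_inv)
      then have "(a \<otimes> inv b) \<otimes> b \<in> H #> b" by (auto simp: r_coset_def)
      then have "a \<in> H #> b" using that(1,2) by (simp add: m_assoc)
      then show ?thesis using repr_independence[OF _ that(2) H] by simp
    qed
    have "rcosets H \<subseteq> (\<lambda>r. H #> (SOME a. a \<in> carrier G \<and> ?r a = r)) ` ?r ` carrier G"
    proof
      fix A assume "A \<in> rcosets H"
      then obtain a where a: "a \<in> carrier G" "A = H #> a" by (auto simp: RCOSETS_def)
      define b where "b = (SOME b. b \<in> carrier G \<and> ?r b = ?r a)"
      have b: "b \<in> carrier G \<and> ?r b = ?r a" unfolding b_def by (rule someI[of _ a]) (simp add: a)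
      have "A = H #> b" unfolding a(2) using a(1) b by (intro eq) simp_all
      then show "A \<in> (\<lambda>r. H #> (SOME a. a \<in> carrier G \<and> ?r a = r)) ` ?r ` carrier G"
        unfolding b_def
      proof (rule image_eqI)
        show "?r a \<in> ?r ` carrier G" using a(1) by (rule imageI)
      qed
    qed
    moreover have "?r ` carrier G \<subseteq> {- \<bar>\<phi> c\<bar>..\<bar>\<phi> c\<bar>}"
    proof (rule image_subsetI)
      show "?r a \<in> {- \<bar>\<phi> c\<bar>..\<bar>\<phi> c\<bar>}" for a using abs_mod_less[OF c(3), of "\<phi> a"] unfolding atLeastAtMost_iff by linarith
    qed
    then have "finite (?r ` carrier G)" by (rule finite_subset) simp
    ultimately show ?thesis by (meson finite_imageI finite_subset)
  qed
  moreover have "(\<lambda>(x, y). x \<otimes> y) \<in> iso (G\<lparr>carrier := N\<rparr> \<times>\<times> G\<lparr>carrier := P\<rparr>) (G\<lparr>carrier := H\<rparr>)"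
  proof (rule isoI)
    have NC: "\<And>x. x \<in> N \<Longrightarrow> x \<in> carrier G \<and> \<phi> x = 0" by (auto simp: N_def kernel_def)
    show "(\<lambda>(x, y). x \<otimes> y) \<in> hom (G\<lparr>carrier := N\<rparr> \<times>\<times> G\<lparr>carrier := P\<rparr>) (G\<lparr>carrier := H\<rparr>)"
    proof (rule homI)
      show "(case z of (x, y) \<Rightarrow> x \<otimes> y) \<in> carrier (G\<lparr>carrier := H\<rparr>)" if "z \<in> carrier (G\<lparr>carrier := N\<rparr> \<times>\<times> G\<lparr>carrier := P\<rparr>)" for z
        using that NC c(1) by (auto simp: DirProd_def P_def H_def h.hom_mult pow)
      fix z z' assume "z \<in> carrier (G\<lparr>carrier := N\<rparr> \<times>\<times> G\<lparr>carrier := P\<rparr>)" "z' \<in> carrier (G\<lparr>carrier := N\<rparr> \<times>\<times> G\<lparr>carrier := P\<rparr>)"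
      then obtain x x' and k k' :: int where z: "z = (x, c [^] k)" "x \<in> N" "z' = (x', c [^] k')" "x' \<in> N" by (auto simp: DirProd_def P_def)
      have C: "x \<in> carrier G" "x' \<in> carrier G" using NC z by auto
      have "(x \<otimes> x') \<otimes> (c [^] k \<otimes> c [^] k') = x \<otimes> (x' \<otimes> c [^] k) \<otimes> c [^] k'" using C c(1) by (simp add: m_assoc)
      also have "\<dots> = (x \<otimes> c [^] k) \<otimes> (x' \<otimes> c [^] k')" unfolding comm[OF C(2), of k, symmetric] using C c(1) by (simp add: m_assoc)
      finally show "(case z \<otimes>\<^bsub>G\<lparr>carrier := N\<rparr> \<times>\<times> G\<lparr>carrier := P\<rparr>\<^esub> z' of (x, y) \<Rightarrow> x \<otimes> y) =
        (case z of (x, y) \<Rightarrow> x \<otimes> y) \<otimes>\<^bsub>G\<lparr>carrier := H\<rparr>\<^esub> (case z' of (x, y) \<Rightarrow> x \<otimes> y)" by (simp add: z)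
    qed
    have "inj_on (\<lambda>(x, y). x \<otimes> y) (N \<times> P)"
    proof (rule inj_onI)
      fix z z' assume "z \<in> N \<times> P" "z' \<in> N \<times> P" and e: "(case z of (x, y) \<Rightarrow> x \<otimes> y) = (case z' of (x, y) \<Rightarrow> x \<otimes> y)"
      then obtain x x' and k k' :: int where z: "z = (x, c [^] k)" "x \<in> N" "z' = (x', c [^] k')" "x' \<in> N" by (auto simp: P_def)
      have e: "x \<otimes> c [^] k = x' \<otimes> c [^] k'" using e by (simp add: z)
      have "\<phi> (x \<otimes> c [^] k) = k * \<phi> c" "\<phi> (x' \<otimes> c [^] k') = k' * \<phi> c" using NC z c(1) by (simp_all add: h.hom_mult pow)
      then have "k = k'" using e c(3) by simp
      then show "z = z'" using e NC z c(1) by simp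
    qed
    moreover have "(\<lambda>(x, y). x \<otimes> y) ` (N \<times> P) = H"
    proof
      show "(\<lambda>(x, y). x \<otimes> y) ` (N \<times> P) \<subseteq> H" using NC c(1) by (auto simp: P_def H_def h.hom_mult pow)
      show "H \<subseteq> (\<lambda>(x, y). x \<otimes> y) ` (N \<times> P)"
      proof
        fix a assume "a \<in> H"
        then obtain k where a: "a \<in> carrier G" "\<phi> a = k * \<phi> c" by (auto simp: H_def dvd_def mult.commute)
        define x where "x = a \<otimes> inv (c [^] k)"
        have "x \<in> N" using a c(1) by (simp add: x_def N_def kernel_def h.hom_mult h.hom_inv pow)
        moreover have "a = x \<otimes> c [^] k" using a(1) c(1) by (simp add: x_def m_assoc)
        ultimately show "a \<in> (\<lambda>(x, y). x \<otimes> y) ` (N \<times> P)" by (intro image_eqI[of _ _ "(x, c [^] k)"]) (auto simp: P_def)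
      qed
    qed
    ultimately show "bij_betw (\<lambda>(x, y). x \<otimes> y) (carrier (G\<lparr>carrier := N\<rparr> \<times>\<times> G\<lparr>carrier := P\<rparr>)) (carrier (G\<lparr>carrier := H\<rparr>))"
      by (simp add: bij_betw_def DirProd_def)
  qed
  ultimately show ?thesis unfolding virtually_splits_def using H N P inf[folded N_def] by blast
qed

end

section \<open>The gradient and the central element\<close>

context product_action
begin

text \<open>Midpoint affinity makes \<open>u\<close> additive in \<open>p\<close> after subtracting
  its value at the origin. If the linear parts at \<open>x\<close> and \<open>y\<close> differed,
  the difference of \<open>u\<close> would grow along multiples of \<open>p\<close>, while the
  Lipschitz bound \<open>C * d x y\<close> is constant.\<close>

lemma midpoint_affine_split:
  assumes u: "lipschitz C u" and mid: "\<And>p h x. p \<in> V \<Longrightarrow> h \<in> V \<Longrightarrow> x \<in> M \<Longrightarrow> u (comb 1 p 1 h, x) + u (comb 1 p (-1) h, x) = 2 * u (p, x)"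
  shows "\<exists>w\<in>V. \<exists>g. \<forall>p\<in>V. \<forall>x\<in>M. u (p, x) = (\<Sum>i<n. w i * p i) + g x"
proof -
  define l where "l x p = u (p, x) - u (o0, x)" for x p
  have add: "l x (comb 1 a 1 b) = l x a + l x b" if "x \<in> M" "a \<in> V" "b \<in> V" for x a b
  proof -
    define p where "p = comb (1/2) a (1/2) b"
    define h where "h = comb (1/2) a (-1/2) b"
    have V: "p \<in> V" "h \<in> V" using that by (simp_all add: p_def h_def comb_model_space)
    have "comb 1 p 1 h = a" "comb 1 p (-1) h = b" "comb 1 p 1 p = comb 1 a 1 b" "comb 1 p (-1) p = o0"
      by (auto simp: p_def h_def comb_def field_simps)
    then show ?thesis using mid[OF V that(1)] mid[OF V(1) V(1) that(1)] by (simp add: l_def)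
  qed
  have l0: "l x o0 = 0" for x by (simp add: l_def)
  have mult: "l x (comb (real k) a 0 a) = real k * l x a" if "x \<in> M" "a \<in> V" for x a k
  proof (induction k)
    case (Suc k)
    have "comb (real (Suc k)) a 0 a = comb 1 (comb (real k) a 0 a) 1 a" by (auto simp: comb_def algebra_simps)
    then show ?case using Suc add[OF that(1) comb_model_space[OF that(2,2)] that(2)] by (simp add: algebra_simps)
  qed (simp add: comb_def l0)
  have lip: "\<bar>u (p, x) - u (q, y)\<bar> \<le> C * D (p, x) (q, y)" if "p \<in> V" "x \<in> M" "q \<in> V" "y \<in> M" for p x q y
  proof -
    have "u (p, x) \<le> u (q, y) + C * D (p, x) (q, y)" "u (q, y) \<le> u (p, x) + C * D (q, y) (p, x)"
      using u that unfolding lipschitz_def by blast+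
    then show ?thesis using D_sym[of "(q, y)"] by simp
  qed
  have indep: "l x p = l y p" if "x \<in> M" "y \<in> M" "p \<in> V" for x y p
  proof -
    have D: "D (q, x) (q, y) = d x y" if "q \<in> V" for q using that by (simp add: D_def model_dist_self)
    have "\<bar>l x p - l y p\<bar> = 0"
    proof (rule real_archimedian_rdiv_eq_0[of _ "2 * (C * d x y)"])
      fix k :: nat
      let ?q = "comb (real k) p 0 p"
      have q: "?q \<in> V" using that by (simp add: comb_model_space)
      have "real k * \<bar>l x p - l y p\<bar> = \<bar>l x ?q - l y ?q\<bar>" using mult that by (simp add: abs_mult flip: right_diff_distrib)
      also have "\<dots> \<le> \<bar>u (?q, x) - u (?q, y)\<bar> + \<bar>u (o0, x) - u (o0, y)\<bar>" unfolding l_def by linarith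
      also have "\<dots> \<le> 2 * (C * d x y)" using lip[OF q that(1) q that(2)] lip[OF o0_in that(1) o0_in that(2)] D[OF q] D[OF o0_in] by simp
      finally show "real k * \<bar>l x p - l y p\<bar> \<le> 2 * (C * d x y)" .
    qed (use u in \<open>simp_all add: lipschitz_def\<close>)
    then show ?thesis by simp
  qed
  define E where "E i t = (\<lambda>j. if j = i then t else 0 :: real)" for i :: nat and t
  have E: "E i t \<in> V" if "i < n" for i t using that by (auto simp: E_def model_zero)
  have lin: "l x0 (E i t) = t * l x0 (E i 1)" if i: "i < n" for i t
  proof (rule additive_bounded_imp_linear)
    show "l x0 (E i (s + t)) = l x0 (E i s) + l x0 (E i t)" for s t
    proof -
      have "E i (s + t) = comb 1 (E i s) 1 (E i t)" by (auto simp: E_def comb_def)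
      then show ?thesis using add[OF base E[OF i] E[OF i]] by simp
    qed
    show "\<bar>l x0 (E i t)\<bar> \<le> C * \<bar>t\<bar>" for t
    proof -
      have "(E i t j - 0)\<^sup>2 = (if j = i then t\<^sup>2 else 0)" for j by (simp add: E_def)
      then have "D (E i t, x0) (o0, x0) = \<bar>t\<bar>" using base i by (simp add: D_def model_dist_def sum.delta del: diff_0_right)
      then show ?thesis using lip[OF E[OF i] base o0_in base, of t] by (simp add: l_def)
    qed
  qed
  define w where "w = (\<lambda>i. if i < n then l x0 (E i 1) else 0)"
  have sum: "l x0 p = (\<Sum>i<n. w i * p i)" if p: "p \<in> V" for p
  proof -
    have "k \<le> n \<Longrightarrow> l x0 (\<lambda>i. if i < k then p i else 0) = (\<Sum>i<k. w i * p i)" for k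
    proof (induction k)
      case (Suc k)
      have "(\<lambda>i. if i < Suc k then p i else 0) = comb 1 (\<lambda>i. if i < k then p i else 0) 1 (E k (p k))"
        by (auto simp: comb_def E_def)
      moreover have "(\<lambda>i. if i < k then p i else 0) \<in> V" using p by (simp add: model_zero)
      ultimately show ?case using Suc add[OF base _ E] lin[of k "p k"] by (simp add: w_def)
    qed (simp add: l0)
    moreover have "(\<lambda>i. if i < n then p i else 0) = p" using p by (auto simp: model_zero)
    ultimately show ?thesis by (metis order_refl)
  qed
  have "u (p, x) = (\<Sum>i<n. w i * p i) + u (o0, x)" if "p \<in> V" "x \<in> M" for p x
    using sum[OF that(1)] indep[OF base that(2,1)] by (simp add: l_def)
  moreover have "w \<in> V" by (simp add: w_def model_zero)
  ultimately show ?thesis by (intro bexI[of _ w] exI[of _ "\<lambda>x. u (o0, x)"]) auto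
qed

text \<open>Equality in the Cauchy--Schwarz inequality.\<close>

lemma gradient_translation:
  assumes e: "equivar \<psi> u" and w: "w \<in> V" and u: "\<And>p x. p \<in> V \<Longrightarrow> x \<in> M \<Longrightarrow> u (p, x) = (\<Sum>i<n. w i * p i) + g x"
    and \<gamma>: "\<gamma> \<in> carrier L" and p: "p \<in> V"
  shows "rot \<gamma> (comb 1 p t w) = comb 1 (rot \<gamma> p) t w"
proof -
  define a where "a = rot \<gamma> (comb 1 p t w)"
  define b where "b = rot \<gamma> p"
  \<comment> \<open>The displacement of the images has the length of \<open>t * w\<close> because
    \<open>rot\<close> is isometric, and the same pairing with \<open>w\<close> because
    \<open>u\<close> is equivariant.\<close>
  define c where "c = comb 1 a (-1) b"
  have V: "comb 1 p t w \<in> V" "a \<in> V" "b \<in> V" using p w \<gamma> by (simp_all add: a_def b_def comb_model_space rot_in)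
  have "sqrt (nsq n c) = model_dist 0 n (comb 1 p t w) p" unfolding c_def model_dist_nsq[symmetric] a_def b_def using rot_iso[OF \<gamma> V(1) p] .
  also have "\<dots> = sqrt (nsq n (comb t w 0 w))" by (simp add: model_dist_nsq nsq_def comb_def)
  finally have 1: "nsq n c = t\<^sup>2 * nsq n w" by (simp add: nsq_comb)
  have "u (a, act \<gamma> x0) - u (b, act \<gamma> x0) = u (comb 1 p t w, x0) - u (p, x0)"
    using e \<gamma> V(1) p base unfolding equivar_def a_def b_def \<alpha>_def by force
  then have "(\<Sum>i<n. w i * a i) - (\<Sum>i<n. w i * b i) = (\<Sum>i<n. w i * (p i + t * w i)) - (\<Sum>i<n. w i * p i)"
    using u V p base act_in[OF \<gamma> base] by (simp add: comb_def)
  then have 2: "(\<Sum>i<n. c i * w i) = t * nsq n w"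
    by (simp add: c_def comb_def nsq_def power2_eq_square sum.distrib sum_subtractf sum_distrib_left algebra_simps)
  have "nsq n (comb 1 c (- t) w) = 0" unfolding nsq_comb 1 2 by (simp add: power2_eq_square algebra_simps)
  then have "a i - b i - t * w i = 0" if "i < n" for i using that by (simp add: nsq_zero_iff c_def comb_def)
  moreover have "a i - b i - t * w i = 0" if "i \<ge> n" for i using that V w by (simp add: model_zero)
  ultimately have "a i = b i + t * w i" for i using leI by (smt (verit))
  then show ?thesis by (auto simp: a_def b_def comb_def)
qed

lemma hom_value: assumes "equivar (\<lambda>g. real_of_int (\<phi> g)) u" "lipschitz C u" "g \<in> carrier L" "q \<in> W" "D q (\<alpha> g q0) \<le> R"
  shows "\<bar>real_of_int (\<phi> g) - (u q - u q0)\<bar> \<le> C * R"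
proof -
  have "u (\<alpha> g q0) = u q0 + real_of_int (\<phi> g)" using assms(1,3) q0_in unfolding equivar_def by metis
  moreover have "u (\<alpha> g q0) \<le> u q + C * D (\<alpha> g q0) q" "u q \<le> u (\<alpha> g q0) + C * D q (\<alpha> g q0)"
    using assms(2,4) \<alpha>_in[OF assms(3) q0_in] unfolding lipschitz_def by metis+
  moreover have "C * D q (\<alpha> g q0) \<le> C * R" using assms(2,5) by (intro mult_left_mono) (auto simp: lipschitz_def)
  ultimately show ?thesis using D_sym[of q] by simp
qed

text \<open>Elements of \<open>L\<close> that move \<open>q0\<close> roughly like the translations by multiples of \<open>w\<close> conjugate each
  generator to boundedly many elements, so two of these conjugations agree.\<close>

lemma central_element:
  assumes u: "lipschitz C u" and e: "equivar (\<lambda>g. real_of_int (\<phi> g)) u" and w: "w \<in> V" "nsq n w \<noteq> 0"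
    and uw: "\<And>p x. p \<in> V \<Longrightarrow> x \<in> M \<Longrightarrow> u (p, x) = (\<Sum>i<n. w i * p i) + g x" and \<phi>: "\<phi> \<in> hom L integer_group"
  shows "\<exists>c\<in>carrier L. \<phi> c \<noteq> 0 \<and> (\<forall>g\<in>carrier L. c \<otimes>\<^bsub>L\<^esub> g = g \<otimes>\<^bsub>L\<^esub> c)"
proof -
  interpret i: group_hom L integer_group \<phi> by (intro group_hom.intro group_hom_axioms.intro \<phi> is_group group_integer_group)
  obtain R where R: "R \<ge> 0" "\<And>q. q \<in> W \<Longrightarrow> \<exists>g\<in>carrier L. D q (\<alpha> g q0) \<le> R" using dense by blast
  obtain S where S: "finite S" "S \<subseteq> carrier L"
    "\<And>c. c \<in> carrier L \<Longrightarrow> \<forall>s\<in>S. c \<otimes>\<^bsub>L\<^esub> s = s \<otimes>\<^bsub>L\<^esub> c \<Longrightarrow> \<forall>g\<in>carrier L. c \<otimes>\<^bsub>L\<^esub> g = g \<otimes>\<^bsub>L\<^esub> c"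
    using finitely_generated by blast
  \<comment> \<open>The scaling by \<open>nsq n w\<close> makes \<open>u\<close> grow by exactly
    \<open>k\<close>.\<close>
  define \<tau> where "\<tau> k = (comb 1 o0 (real k / nsq n w) w, x0)" for k :: nat
  have \<tau>: "\<tau> k \<in> W" for k using w base o0_in by (simp add: \<tau>_def comb_model_space)
  have u\<tau>: "u (\<tau> k) - u q0 = real k" for k
  proof -
    have "(\<Sum>i<n. w i * comb 1 o0 (real k / nsq n w) w i) = (real k / nsq n w) * nsq n w"
      by (simp add: comb_def nsq_def power2_eq_square sum_distrib_left sum_divide_distrib mult_ac)
    then show ?thesis using uw[of "comb 1 o0 (real k / nsq n w) w" x0] uw[of o0 x0] \<tau>[of k] w(2) base o0_in by (simp add: \<tau>_def q0_def)
  qed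
  obtain \<gamma> where \<gamma>: "\<And>k. \<gamma> k \<in> carrier L" "\<And>k. D (\<tau> k) (\<alpha> (\<gamma> k) q0) \<le> R" using R(2)[OF \<tau>] by metis
  define F where "F s = {g\<in>carrier L. D q0 (\<alpha> g q0) \<le> 2 * R + D q0 (\<alpha> s q0)}" for s
  define c where "c k = (\<lambda>s\<in>S. inv\<^bsub>L\<^esub> \<gamma> k \<otimes>\<^bsub>L\<^esub> (s \<otimes>\<^bsub>L\<^esub> \<gamma> k))" for k
  have "inv\<^bsub>L\<^esub> \<gamma> k \<otimes>\<^bsub>L\<^esub> (s \<otimes>\<^bsub>L\<^esub> \<gamma> k) \<in> F s" if s: "s \<in> S" for k s
  proof -
    have sL: "s \<in> carrier L" using s S(2) by blast
    note in1 = \<alpha>_in[OF \<gamma>(1) q0_in, of k] \<alpha>_in[OF sL \<tau>, of k]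
    \<comment> \<open>Translations along \<open>w\<close> commute with \<open>s\<close>, so
      \<open>s\<close> displaces all \<open>\<tau> k\<close> by the same amount.\<close>
    have D: "D (\<tau> k) (\<alpha> s (\<tau> k)) = D q0 (\<alpha> s q0)"
    proof -
      have "rot s (comb 1 o0 (real k / nsq n w) w) = comb 1 (rot s o0) (real k / nsq n w) w"
        by (rule gradient_translation[OF e w(1) uw sL o0_in])
      then show ?thesis by (simp add: D_def \<alpha>_def \<tau>_def q0_def model_dist_def comb_def)
    qed
    have "D q0 (\<alpha> (inv\<^bsub>L\<^esub> \<gamma> k \<otimes>\<^bsub>L\<^esub> (s \<otimes>\<^bsub>L\<^esub> \<gamma> k)) q0) = D (\<alpha> (\<gamma> k) q0) (\<alpha> s (\<alpha> (\<gamma> k) q0))"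
      using D_move[OF \<gamma>(1) m_closed[OF sL \<gamma>(1)], of k k] \<alpha>_mult[OF sL \<gamma>(1) q0_in] by simp
    also have "\<dots> \<le> D (\<alpha> (\<gamma> k) q0) (\<tau> k) + (D (\<tau> k) (\<alpha> s (\<tau> k)) + D (\<alpha> s (\<tau> k)) (\<alpha> s (\<alpha> (\<gamma> k) q0)))"
      using D_triangle[OF in1(1) \<tau> \<alpha>_in[OF sL in1(1)], of k] D_triangle[OF \<tau>[of k] in1(2) \<alpha>_in[OF sL in1(1)]] by simp
    also have "\<dots> \<le> 2 * R + D q0 (\<alpha> s q0)"
      unfolding \<alpha>_iso[OF sL \<tau> in1(1)] D using \<gamma>(2)[of k] D_sym[of "\<tau> k"] by simp
    finally show ?thesis using \<gamma>(1) sL by (simp add: F_def)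
  qed
  then have "range c \<subseteq> PiE S F" unfolding c_def by auto
  moreover have "finite (PiE S F)" using S(1) by (intro finite_PiE) (simp_all add: F_def finite_ball)
  ultimately have "finite (range c)" by (rule finite_subset)
  then obtain k0 where k0: "infinite {k\<in>UNIV. c k = c k0}" using pigeonhole_infinite[of UNIV c] by auto
  \<comment> \<open>The values of \<open>\<phi>\<close> at \<open>\<gamma> k\<close> and
    \<open>\<gamma> k0\<close> are known up to \<open>C * R\<close>; a gap of more than
    \<open>2 * (C * R)\<close> between the indices separates them.\<close>
  then obtain k where k: "c k = c k0" "k > nat \<lceil>real k0 + 2 * (C * R)\<rceil>"
    using infinite_nat_iff_unbounded[of "{k\<in>UNIV. c k = c k0}"] by auto
  have "real k > real k0 + 2 * (C * R)" using k(2) by linarith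
  moreover have "\<bar>real_of_int (\<phi> (\<gamma> j)) - real j\<bar> \<le> C * R" for j
    using hom_value[OF e u \<gamma>(1) \<tau> \<gamma>(2), of j] u\<tau> by simp
  ultimately have ne: "\<phi> (\<gamma> k) \<noteq> \<phi> (\<gamma> k0)" by (smt (verit))
  \<comment> \<open>Elements that conjugate every \<open>s\<close> in the same way have a quotient
    that commutes with every \<open>s\<close>.\<close>
  define z where "z = \<gamma> k \<otimes>\<^bsub>L\<^esub> inv\<^bsub>L\<^esub> \<gamma> k0"
  have z: "z \<in> carrier L" using \<gamma>(1) by (simp add: z_def)
  have "z \<otimes>\<^bsub>L\<^esub> s = s \<otimes>\<^bsub>L\<^esub> z" if s: "s \<in> S" for s
  proof -
    have sL: "s \<in> carrier L" using s S(2) by blast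
    let ?a = "\<gamma> k" and ?b = "\<gamma> k0"
    have ab: "?a \<in> carrier L" "?b \<in> carrier L" using \<gamma>(1) by auto
    have eq: "inv\<^bsub>L\<^esub> ?a \<otimes>\<^bsub>L\<^esub> (s \<otimes>\<^bsub>L\<^esub> ?a) = inv\<^bsub>L\<^esub> ?b \<otimes>\<^bsub>L\<^esub> (s \<otimes>\<^bsub>L\<^esub> ?b)" using fun_cong[OF k(1), of s] s by (simp add: c_def)
    have "?a \<otimes>\<^bsub>L\<^esub> (inv\<^bsub>L\<^esub> ?a \<otimes>\<^bsub>L\<^esub> (s \<otimes>\<^bsub>L\<^esub> ?a)) = s \<otimes>\<^bsub>L\<^esub> ?a" using ab sL by (simp flip: m_assoc)
    then have "(?a \<otimes>\<^bsub>L\<^esub> (inv\<^bsub>L\<^esub> ?b \<otimes>\<^bsub>L\<^esub> (s \<otimes>\<^bsub>L\<^esub> ?b))) \<otimes>\<^bsub>L\<^esub> inv\<^bsub>L\<^esub> ?b = (s \<otimes>\<^bsub>L\<^esub> ?a) \<otimes>\<^bsub>L\<^esub> inv\<^bsub>L\<^esub> ?b" unfolding eq by simp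
    then show ?thesis using ab sL by (simp add: z_def m_assoc)
  qed
  then have "\<forall>g\<in>carrier L. z \<otimes>\<^bsub>L\<^esub> g = g \<otimes>\<^bsub>L\<^esub> z" using S(3)[OF z] by blast
  moreover have "\<phi> z \<noteq> 0" using ne \<gamma>(1) by (simp add: z_def i.hom_mult i.hom_inv)
  ultimately show ?thesis using z by blast
qed

text \<open>Along a direction \<open>v\<close> perpendicular to \<open>w\<close> the function
  \<open>u\<close> is constant, so elements whose orbit points follow the multiples of
  \<open>v\<close> have boundedly many values of \<open>\<phi>\<close>. Infinitely many share one
  value; their quotients lie in the kernel and are too spread out to be finite in number.\<close>

lemma infinite_kernel:
  assumes u: "lipschitz C u" and e: "equivar (\<lambda>g. real_of_int (\<phi> g)) u" and n: "n \<ge> 2"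
    and uw: "\<And>p x. p \<in> V \<Longrightarrow> x \<in> M \<Longrightarrow> u (p, x) = (\<Sum>i<n. w i * p i) + g x" and \<phi>: "\<phi> \<in> hom L integer_group"
  shows "infinite (kernel L integer_group \<phi>)"
proof
  interpret i: group_hom L integer_group \<phi> by (intro group_hom.intro group_hom_axioms.intro \<phi> is_group group_integer_group)
  assume fin: "finite (kernel L integer_group \<phi>)"
  obtain R where R: "R \<ge> 0" "\<And>q. q \<in> W \<Longrightarrow> \<exists>g\<in>carrier L. D q (\<alpha> g q0) \<le> R" using dense by blast
  \<comment> \<open>The first two coordinates of \<open>w\<close> rotated by a right angle; if both
    vanish, the first unit vector is perpendicular to \<open>w\<close>.\<close>
  define v where "v = (if w 0 = 0 \<and> w 1 = 0 then (\<lambda>i::nat. if i = 0 then 1 else 0) else (\<lambda>i. if i = 0 then w 1 else if i = 1 then - w 0 else 0))"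
  have v: "v \<in> V" using n by (auto simp: v_def model_zero)
  obtain m where m: "n = Suc (Suc m)" using n by (metis add_2_eq_Suc le_Suc_ex)
  have wv: "(\<Sum>i<n. w i * v i) = 0" unfolding m by (simp add: v_def sum.lessThan_Suc_shift del: sum.lessThan_Suc)
  have "v 0 \<noteq> 0 \<or> v 1 \<noteq> 0" by (auto simp: v_def)
  then have v0: "nsq n v > 0" using n nsq_nonneg[of n v] nsq_zero_iff[of n v] by (smt (verit) One_nat_def Suc_1 Suc_le_lessD less_Suc_eq less_le_trans zero_less_Suc)
  define q where "q j = (comb (real j) v 0 v, x0)" for j :: nat
  have q: "q j \<in> W" for j using v base by (simp add: q_def comb_model_space)
  have "u (q j) = u q0" for j
  proof -
    have "(\<Sum>i<n. w i * comb (real j) v 0 v i) = real j * (\<Sum>i<n. w i * v i)" by (simp add: comb_def sum_distrib_left mult_ac)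
    then show ?thesis using uw[of "comb (real j) v 0 v" x0] uw[of o0 x0] q[of j] base o0_in wv by (simp add: q_def q0_def)
  qed
  note uq = this
  obtain \<gamma> where \<gamma>: "\<And>j. \<gamma> j \<in> carrier L" "\<And>j. D (q j) (\<alpha> (\<gamma> j) q0) \<le> R" using R(2)[OF q] by metis
  have "\<bar>real_of_int (\<phi> (\<gamma> j))\<bar> \<le> C * R" for j using hom_value[OF e u \<gamma>(1) q \<gamma>(2), of j] uq by simp
  then have "\<phi> (\<gamma> j) \<in> {- \<lceil>C * R\<rceil>..\<lceil>C * R\<rceil>}" for j by (smt (verit) atLeastAtMost_iff le_of_int_ceiling of_int_le_iff of_int_minus abs_le_iff)
  then have "finite (range (\<lambda>j. \<phi> (\<gamma> j)))" by (intro finite_subset[of "range (\<lambda>j. \<phi> (\<gamma> j))" "{- \<lceil>C * R\<rceil>..\<lceil>C * R\<rceil>}"]) auto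
  then obtain k where k: "infinite {j\<in>UNIV. \<phi> (\<gamma> j) = \<phi> (\<gamma> k)}" using pigeonhole_infinite[of UNIV "\<lambda>j. \<phi> (\<gamma> j)"] by auto
  let ?T = "(\<lambda>a. D q0 (\<alpha> (a \<otimes>\<^bsub>L\<^esub> \<gamma> k) q0)) ` kernel L integer_group \<phi>"
  define K where "K = Max ?T"
  obtain j where j: "\<phi> (\<gamma> j) = \<phi> (\<gamma> k)" "j > nat \<lceil>(K + R) / sqrt (nsq n v)\<rceil>"
    using k infinite_nat_iff_unbounded[of "{j\<in>UNIV. \<phi> (\<gamma> j) = \<phi> (\<gamma> k)}"] by auto
  have "\<gamma> j \<otimes>\<^bsub>L\<^esub> inv\<^bsub>L\<^esub> \<gamma> k \<in> kernel L integer_group \<phi>" using \<gamma>(1) j(1) by (simp add: kernel_def i.hom_mult i.hom_inv)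
  moreover have "\<gamma> j = (\<gamma> j \<otimes>\<^bsub>L\<^esub> inv\<^bsub>L\<^esub> \<gamma> k) \<otimes>\<^bsub>L\<^esub> \<gamma> k" using \<gamma>(1) by (simp add: m_assoc)
  ultimately have "D q0 (\<alpha> (\<gamma> j) q0) \<in> ?T" by (intro image_eqI) auto
  then have "D q0 (\<alpha> (\<gamma> j) q0) \<le> K" unfolding K_def using fin by (intro Max_ge) auto
  moreover have "D q0 (q j) = real j * sqrt (nsq n v)"
    using base by (simp add: D_def q0_def q_def model_dist_def nsq_def comb_def power_mult_distrib real_sqrt_mult flip: sum_distrib_left)
  moreover have "D q0 (q j) \<le> D q0 (\<alpha> (\<gamma> j) q0) + D (q j) (\<alpha> (\<gamma> j) q0)" using D_triangle[OF q0_in \<alpha>_in[OF \<gamma>(1) q0_in] q, of j j] D_sym[of "q j"] by simp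
  ultimately have "real j * sqrt (nsq n v) \<le> K + R" using \<gamma>(2)[of j] by linarith
  then have "real j \<le> (K + R) / sqrt (nsq n v)" using v0 by (simp add: field_simps)
  then show False using j(2) by linarith
qed

theorem equivariant_function: assumes \<phi>: "\<phi> \<in> hom L integer_group" and n: "n \<noteq> 1" and irr: "\<not> virtually_splits L"
  shows "\<exists>C g. (\<forall>x\<in>M. \<forall>y\<in>M. \<bar>g x - g y\<bar> \<le> C * d x y) \<and> (\<forall>\<gamma>\<in>carrier L. \<forall>x\<in>M. g (act \<gamma> x) = g x + real_of_int (\<phi> \<gamma>))"
proof -
  obtain C f where f: "lipschitz C f" "equivar (\<lambda>g. real_of_int (\<phi> g)) f" using Lipschitz_equivariant_exists[OF \<phi>] by blast
  obtain u where u: "lipschitz C u" "equivar (\<lambda>g. real_of_int (\<phi> g)) u"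
    "\<And>p h x. p \<in> V \<Longrightarrow> h \<in> V \<Longrightarrow> x \<in> M \<Longrightarrow> u (comb 1 p 1 h, x) + u (comb 1 p (-1) h, x) = 2 * u (p, x)"
    using midpoint_affine_exists[OF f] by blast
  obtain w g where w: "w \<in> V" and g: "\<And>p x. p \<in> V \<Longrightarrow> x \<in> M \<Longrightarrow> u (p, x) = (\<Sum>i<n. w i * p i) + g x"
    using midpoint_affine_split[OF u(1,3)] by blast
  have "nsq n w = 0"
  proof (rule ccontr)
    assume nz: "nsq n w \<noteq> 0"
    \<comment> \<open>For \<open>n = 0\<close> the squared norm of \<open>w\<close> is an empty
      sum.\<close>
    then have "n \<ge> 2" using n by (cases "n = 0") (auto simp: nsq_def)
    then have "infinite (kernel L integer_group \<phi>)" using infinite_kernel[OF u(1,2) _ g \<phi>] by blast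
    moreover obtain c where "c \<in> carrier L" "\<phi> c \<noteq> 0" "\<And>g. g \<in> carrier L \<Longrightarrow> c \<otimes>\<^bsub>L\<^esub> g = g \<otimes>\<^bsub>L\<^esub> c"
      using central_element[OF u(1,2) w nz g \<phi>] by blast
    ultimately show False using virtually_splits_central[OF \<phi>] irr by blast
  qed
  then have ug: "u (p, x) = g x" if "p \<in> V" "x \<in> M" for p x using g[OF that] by (simp add: nsq_zero_iff)
  have "\<bar>g x - g y\<bar> \<le> C * d x y" if "x \<in> M" "y \<in> M" for x y
  proof -
    have "u (o0, x) \<le> u (o0, y) + C * D (o0, x) (o0, y)" "u (o0, y) \<le> u (o0, x) + C * D (o0, y) (o0, x)"
      using u(1) o0_in that unfolding lipschitz_def by blast+
    then show ?thesis using ug o0_in that commute[of y x] by (simp add: D_def model_dist_self)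
  qed
  moreover have "g (act \<gamma> x) = g x + real_of_int (\<phi> \<gamma>)" if "\<gamma> \<in> carrier L" "x \<in> M" for \<gamma> x
  proof -
    have "u (\<alpha> \<gamma> (o0, x)) = u (o0, x) + real_of_int (\<phi> \<gamma>)" using u(2) o0_in that unfolding equivar_def by blast
    then show ?thesis using ug o0_in that by (simp add: \<alpha>_def rot_in act_in)
  qed
  ultimately show ?thesis by blast
qed

end

section \<open>Uniform lattices\<close>

context Metric_space
begin

text \<open>Total boundedness at the single scale \<open>e\<close>, with centres that may lie
  outside the set.\<close>

definition covered :: "'a set \<Rightarrow> real \<Rightarrow> bool" where
  "covered S e \<longleftrightarrow> (\<exists>K. finite K \<and> K \<subseteq> M \<and> (\<forall>y\<in>S. \<exists>k\<in>K. d k y < e))"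

definition isometries_near :: "'a \<Rightarrow> real \<Rightarrow> ('a \<Rightarrow> 'a) set" where
  "isometries_near x0 R = {f. (\<forall>x\<in>M. f x \<in> M) \<and> (\<forall>x\<in>M. \<forall>y\<in>M. d (f x) (f y) = d x y) \<and> d x0 (f x0) \<le> R}"

text \<open>The finite core of the Arzela--Ascoli theorem: an isometry is encoded by points of a net
  near its values on a finite net of \<open>C\<close>. Equal codes leave four errors of size
  \<open>e / 4\<close>.\<close>

lemma isometries_near_finite:
  assumes x0: "x0 \<in> M" and cov: "\<And>r e. e > 0 \<Longrightarrow> covered {y\<in>M. d x0 y \<le> r} e" and C: "compactin mtopology C" and e: "e > 0"
  shows "\<exists>\<kappa> :: ('a \<Rightarrow> 'a) \<Rightarrow> 'a \<Rightarrow> 'a. finite (\<kappa> ` isometries_near x0 R) \<and>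
    (\<forall>f\<in>isometries_near x0 R. \<forall>g\<in>isometries_near x0 R. \<kappa> f = \<kappa> g \<longrightarrow> (\<forall>x\<in>C. d (f x) (g x) < e))"
proof -
  have "mtotally_bounded C" using C by (rule compactin_imp_mtotally_bounded)
  then obtain N where N: "finite N" "N \<subseteq> C" "C \<subseteq> (\<Union>x\<in>N. mball x (e / 4))" unfolding mtotally_bounded_def using e by (metis zero_less_divide_iff zero_less_numeral)
  have NM: "N \<subseteq> M" using N(2) compactin_subspace[of mtopology C] C by auto
  \<comment> \<open>A net point is mapped at most \<open>R\<close> plus its distance from
    \<open>x0\<close> away from \<open>x0\<close>; the sum bounds these distances for all net points
    at once.\<close>
  define r where "r = R + (\<Sum>y\<in>N. d x0 y)"
  obtain K where K: "finite K" "K \<subseteq> M" "\<And>y. y \<in> M \<Longrightarrow> d x0 y \<le> r \<Longrightarrow> \<exists>k\<in>K. d k y < e / 4"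
    using cov[of "e / 4" r] e unfolding covered_def by auto
  define \<kappa> where "\<kappa> f = (\<lambda>y\<in>N. SOME k. k \<in> K \<and> d k (f y) < e / 4)" for f :: "'a \<Rightarrow> 'a"
  have \<kappa>: "\<kappa> f y \<in> K \<and> d (\<kappa> f y) (f y) < e / 4" if f: "f \<in> isometries_near x0 R" and y: "y \<in> N" for f y
  proof -
    have yM: "y \<in> M" "f y \<in> M" "f x0 \<in> M" using y NM f x0 by (auto simp: isometries_near_def)
    have "d x0 (f y) \<le> d x0 (f x0) + d (f x0) (f y)" using x0 yM by (simp add: triangle)
    also have "\<dots> \<le> R + d x0 y" using f x0 yM by (simp add: isometries_near_def)
    also have "d x0 y \<le> (\<Sum>y\<in>N. d x0 y)" using y N(1) by (intro member_le_sum) auto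
    finally have "\<exists>k. k \<in> K \<and> d k (f y) < e / 4" using K(3) yM(2) by (auto simp: r_def)
    then show ?thesis unfolding \<kappa>_def using y by (simp del: split_paired_Ex) (rule someI_ex)
  qed
  have "\<kappa> ` isometries_near x0 R \<subseteq> PiE N (\<lambda>_. K)"
  proof (intro image_subsetI PiE_I)
    show "\<kappa> f y \<in> K" if "f \<in> isometries_near x0 R" "y \<in> N" for f y using \<kappa>[OF that] by simp
  qed (simp add: \<kappa>_def)
  then have "finite (\<kappa> ` isometries_near x0 R)" using finite_PiE[OF N(1)] K(1) by (metis finite_subset)
  moreover have "d (f x) (g x) < e" if f: "f \<in> isometries_near x0 R" and g: "g \<in> isometries_near x0 R" and eq: "\<kappa> f = \<kappa> g" and x: "x \<in> C" for f g x
  proof -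
    obtain y where y: "y \<in> N" "x \<in> M" "d y x < e / 4" using N(3) x by auto
    have M: "y \<in> M" "f y \<in> M" "g y \<in> M" "f x \<in> M" "g x \<in> M" using y NM f g by (auto simp: isometries_near_def)
    have k: "\<kappa> f y \<in> M" using \<kappa>[OF f y(1)] K(2) by blast
    have "d (f x) (f y) = d x y" "d (g y) (g x) = d y x" using f g y(2) M by (auto simp: isometries_near_def)
    moreover have "d (f y) (g y) \<le> d (\<kappa> f y) (f y) + d (\<kappa> f y) (g y)" using triangle[OF M(2) k M(3)] by (simp add: commute)
    moreover have "d (\<kappa> f y) (f y) < e / 4" "d (\<kappa> f y) (g y) < e / 4" using \<kappa>[OF f y(1)] \<kappa>[OF g y(1)] eq by auto
    moreover have "d (f x) (g x) \<le> d (f x) (f y) + (d (f y) (g y) + d (g y) (g x))"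
      using triangle[OF M(4,2,5)] triangle[OF M(2,3,5)] by simp
    ultimately show ?thesis using y(3) commute[of x y] by simp
  qed
  ultimately show ?thesis by blast
qed

lemma openin_evaluation: assumes A: "\<And>f x. f \<in> A \<Longrightarrow> x \<in> M \<Longrightarrow> f x \<in> M" and x: "x \<in> M" "y \<in> M"
  shows "openin (uniform_compacta_topology M d A) {f\<in>A. d y (f x) < r}"
  unfolding openin_uniform_compacta_topology
proof (intro conjI ballI)
  fix f assume f: "f \<in> {f\<in>A. d y (f x) < r}"
  have "g \<in> {f\<in>A. d y (f x) < r}" if "g \<in> A" "d (f x) (g x) < r - d y (f x)" for g
    using triangle[OF x(2) A[of f x] A[of g x]] that f x(1) by simp
  then show "\<exists>C e. compactin mtopology C \<and> e > 0 \<and> {g\<in>A. \<forall>x\<in>C. d (f x) (g x) < e} \<subseteq> {f\<in>A. d y (f x) < r}"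
    using f x(1) by (intro exI[of _ "{x}"] exI[of _ "r - d y (f x)"]) auto
qed blast

end

lemma topspace_uniform_compacta: "topspace (uniform_compacta_topology M d A) = A"
proof
  show "topspace (uniform_compacta_topology M d A) \<subseteq> A"
    using openin_topspace[of "uniform_compacta_topology M d A"] unfolding openin_uniform_compacta_topology by blast
  have "openin (uniform_compacta_topology M d A) A" unfolding openin_uniform_compacta_topology
    by (auto intro!: exI[of _ "{}"] exI[of _ "1::real"])
  then show "A \<subseteq> topspace (uniform_compacta_topology M d A)" by (rule openin_subset)
qed

lemma euclidean_covered: assumes e: "e > 0"
  shows "Metric_space.covered (model_space 0 n) (model_dist 0 n) {y\<in>model_space 0 n. model_dist 0 n (\<lambda>_. 0) y \<le> r} e"
  unfolding Metric_space.covered_def[OF Metric_space_model]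
proof -
  \<comment> \<open>A grid of this mesh has errors that add up to at most
    \<open>n * \<delta>\<close>, which is strictly below \<open>e\<close>, also for
    \<open>n = 0\<close>.\<close>
  define \<delta> where "\<delta> = e / (real n + 1)"
  have \<delta>: "\<delta> > 0" using e by (simp add: \<delta>_def)
  define m where "m = \<lceil>r / \<delta>\<rceil> + 1"
  define K where "K = (\<lambda>j i. if i < n then \<delta> * of_int (j i) else 0) ` PiE {..<n} (\<lambda>_. {- m..m})"
  have "finite K" unfolding K_def by (intro finite_imageI finite_PiE) auto
  moreover have "K \<subseteq> model_space 0 n" unfolding K_def by (rule image_subsetI) (simp add: model_zero)
  moreover have "\<exists>k\<in>K. model_dist 0 n k y < e" if y: "y \<in> model_space 0 n" "model_dist 0 n (\<lambda>_. 0) y \<le> r" for y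
  proof -
    define j where "j = (\<lambda>i\<in>{..<n}. \<lfloor>y i / \<delta>\<rfloor>)"
    have "j i \<in> {- m..m}" if i: "i < n" for i
    proof -
      have "\<bar>y i\<bar> \<le> L2_set y {..<n}" using member_le_L2_set[of "{..<n}" i "\<lambda>i. \<bar>y i\<bar>"] i by (simp add: L2_set_def)
      then have "\<bar>y i\<bar> \<le> r" using y(2) by (simp add: model_dist_zero L2_set_def)
      then have "\<bar>y i / \<delta>\<bar> \<le> r / \<delta>" using \<delta> by (simp add: abs_divide divide_right_mono)
      then have "- m \<le> \<lfloor>y i / \<delta>\<rfloor>" "\<lfloor>y i / \<delta>\<rfloor> \<le> m" unfolding m_def by linarith+
      then show ?thesis using i by (simp add: j_def)
    qed
    then have "j \<in> PiE {..<n} (\<lambda>_. {- m..m})" by (auto simp: j_def)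
    then have K: "(\<lambda>i. if i < n then \<delta> * of_int (j i) else 0) \<in> K" unfolding K_def by (rule imageI)
    have "model_dist 0 n (\<lambda>i. if i < n then \<delta> * of_int (j i) else 0) y \<le> (\<Sum>i<n. \<bar>(if i < n then \<delta> * of_int (j i) else 0) - y i\<bar>)"
      unfolding model_dist_zero by (rule L2_set_le_sum_abs)
    also have "\<dots> \<le> (\<Sum>i<n. \<delta>)"
    proof (rule sum_mono)
      fix i assume i: "i \<in> {..<n}"
      have "\<bar>of_int \<lfloor>y i / \<delta>\<rfloor> - y i / \<delta>\<bar> \<le> 1" by linarith
      then have "\<delta> * \<bar>of_int \<lfloor>y i / \<delta>\<rfloor> - y i / \<delta>\<bar> \<le> \<delta>" using \<delta> by simp
      moreover have "\<delta> * \<bar>of_int \<lfloor>y i / \<delta>\<rfloor> - y i / \<delta>\<bar> = \<bar>\<delta> * of_int \<lfloor>y i / \<delta>\<rfloor> - y i\<bar>"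
        using abs_mult[of \<delta> "of_int \<lfloor>y i / \<delta>\<rfloor> - y i / \<delta>"] \<delta> by (simp add: right_diff_distrib)
      ultimately show "\<bar>(if i < n then \<delta> * of_int (j i) else 0) - y i\<bar> \<le> \<delta>" using i by (simp add: j_def)
    qed
    also have "\<dots> < e" using e by (simp add: \<delta>_def field_simps)
    finally show ?thesis using K by blast
  qed
  ultimately show "\<exists>K. finite K \<and> K \<subseteq> model_space 0 n \<and> (\<forall>y\<in>{y\<in>model_space 0 n. model_dist 0 n (\<lambda>_. 0) y \<le> r}. \<exists>k\<in>K. model_dist 0 n k y < e)"
    by blast
qed

lemma subgroup_isometries: "subgroup (carrier (isometry_group M d)) (BijGroup M)"
proof (rule group.subgroupI[OF group_BijGroup])
  show "carrier (isometry_group M d) \<subseteq> carrier (BijGroup M)" by (auto simp: isometry_group_def BijGroup_def)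
  show "carrier (isometry_group M d) \<noteq> {}" using id_Bij[of M] by (auto simp: isometry_group_def intro!: exI[of _ "\<lambda>x\<in>M. x"])
  fix f assume f: "f \<in> carrier (isometry_group M d)"
  then have B: "f \<in> Bij M" and i: "\<And>x y. x \<in> M \<Longrightarrow> y \<in> M \<Longrightarrow> d (f x) (f y) = d x y" by (auto simp: isometry_group_def)
  have "f (inv_into M f x) = x" if "x \<in> M" for x using B that by (auto simp: Bij_def bij_betw_def f_inv_into_f)
  then have "d (inv_into M f x) (inv_into M f y) = d x y" if "x \<in> M" "y \<in> M" for x y using i[OF Bij_inv_into_mem[OF B that(1)] Bij_inv_into_mem[OF B that(2)]] that by simp
  then show "inv\<^bsub>BijGroup M\<^esub> f \<in> carrier (isometry_group M d)" using B by (simp add: inv_BijGroup isometry_group_def restrict_inv_into_Bij)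
  fix g assume g: "g \<in> carrier (isometry_group M d)"
  then have "g \<in> Bij M" "\<And>x. x \<in> M \<Longrightarrow> g x \<in> M" using Bij_imp_funcset by (auto simp: isometry_group_def)
  then show "f \<otimes>\<^bsub>BijGroup M\<^esub> g \<in> carrier (isometry_group M d)"
    using f g by (simp add: isometry_group_def BijGroup_def compose_Bij) (simp add: compose_def)
qed

lemma group_isometry_group: "group (isometry_group M d)"
  using group.subgroup_imp_group[OF group_BijGroup subgroup_isometries] by (simp add: isometry_group_def)

lemma isometry_groupD: assumes "f \<in> carrier (isometry_group M d)"
  shows "f \<in> Bij M" "\<And>x. x \<in> M \<Longrightarrow> f x \<in> M" "\<And>x y. x \<in> M \<Longrightarrow> y \<in> M \<Longrightarrow> d (f x) (f y) = d x y"
  using assms Bij_imp_funcset[of f M] by (auto simp: isometry_group_def)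

section \<open>Properness and coboundedness of a uniform lattice\<close>

locale uniform_lattice = metric_complex K for K :: "('i, 'a) cell_complex" +
  fixes n :: nat and \<Gamma> :: "(((nat \<Rightarrow> real) \<Rightarrow> nat \<Rightarrow> real) \<times> ('a \<Rightarrow> 'a)) set"
  assumes cat: "cat0_space X D" and cocompact: "acts_cocompactly (complex_aut K) X D"
    and lattice: "uniform_lattice_in (ambient_group n K) (ambient_topology n K) \<Gamma>"
begin

abbreviation "E \<equiv> model_space 0 n"
abbreviation "eD \<equiv> model_dist 0 n"
abbreviation "G \<equiv> ambient_group n K"
abbreviation "L \<equiv> G\<lparr>carrier := \<Gamma>\<rparr>"
abbreviation "z0 \<equiv> (\<lambda>_. 0) :: nat \<Rightarrow> real"

sublocale C: cat0 X D by unfold_locales (rule cat)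

lemma automorphism_cong: assumes "\<And>x. x \<in> X \<Longrightarrow> a x = b x" "complex_automorphism K b" shows "complex_automorphism K a"
proof -
  have eq: "a ` c = b ` c" if "c \<in> cells K" for c using assms(1) cells_sub[OF that] by (intro image_cong) auto
  have "(`) a ` cells K = (`) b ` cells K" by (rule image_cong[OF HOL.refl]) (rule eq)
  then show ?thesis using assms bij_betw_cong[of X a b X] by (simp add: complex_automorphism_def)
qed

lemma complex_aut_iff: "a \<in> carrier (complex_aut K) \<longleftrightarrow> a \<in> extensional X \<and> complex_automorphism K a"
  by (auto simp: complex_aut_def isometry_group_def complex_automorphism_def Bij_def)

lemma group_complex_aut: "group (complex_aut K)"
proof -
  have "subgroup (carrier (complex_aut K)) (BijGroup X)"
  proof (rule group.subgroupI[OF group_BijGroup])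
    show "carrier (complex_aut K) \<subseteq> carrier (BijGroup X)" by (auto simp: complex_aut_def isometry_group_def BijGroup_def)
    have "complex_automorphism K (\<lambda>x\<in>X. x)"
      by (rule automorphism_cong[of _ id]) (auto simp: complex_automorphism_def)
    then show "carrier (complex_aut K) \<noteq> {}" using complex_aut_iff by (metis emptyE restrict_extensional)
    fix a assume a: "a \<in> carrier (complex_aut K)"
    then have B: "a \<in> Bij X" by (simp add: complex_aut_iff complex_automorphism_def Bij_def)
    have "complex_automorphism K (restrict (inv_into X a) X)"
      by (rule automorphism_cong[OF _ automorphism_inverse]) (use a in \<open>auto simp: complex_aut_iff\<close>)
    then show "inv\<^bsub>BijGroup X\<^esub> a \<in> carrier (complex_aut K)" by (simp add: inv_BijGroup[OF B] complex_aut_iff)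
    fix b assume b: "b \<in> carrier (complex_aut K)"
    then have B': "b \<in> Bij X" by (simp add: complex_aut_iff complex_automorphism_def Bij_def)
    have "complex_automorphism K (compose X a b)"
      by (rule automorphism_cong[OF _ automorphism_comp[of a b]]) (use a b in \<open>auto simp: complex_aut_iff compose_def\<close>)
    then show "a \<otimes>\<^bsub>BijGroup X\<^esub> b \<in> carrier (complex_aut K)" using B B' by (simp add: BijGroup_def complex_aut_iff)
  qed
  from group.subgroup_imp_group[OF group_BijGroup this] show ?thesis by (simp add: complex_aut_def isometry_group_def)
qed

lemma ambient_carrier: "g \<in> carrier G \<longleftrightarrow> fst g \<in> carrier (euclidean_isometries n) \<and> snd g \<in> carrier (complex_aut K)"
  by (cases g) (simp add: ambient_group_def DirProd_def)

lemma ambient_mult: assumes "g \<in> carrier G" "h \<in> carrier G"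
  shows "p \<in> E \<Longrightarrow> fst (g \<otimes>\<^bsub>G\<^esub> h) p = fst g (fst h p)" "x \<in> X \<Longrightarrow> snd (g \<otimes>\<^bsub>G\<^esub> h) x = snd g (snd h x)"
proof -
  have "fst g \<in> Bij E" "fst h \<in> Bij E" "snd g \<in> Bij X" "snd h \<in> Bij X"
    using assms by (auto simp: ambient_carrier isometry_group_def complex_aut_iff complex_automorphism_def Bij_def)
  then show "p \<in> E \<Longrightarrow> fst (g \<otimes>\<^bsub>G\<^esub> h) p = fst g (fst h p)" "x \<in> X \<Longrightarrow> snd (g \<otimes>\<^bsub>G\<^esub> h) x = snd g (snd h x)"
    by (cases g; cases h; simp add: ambient_group_def isometry_group_def complex_aut_def BijGroup_def compose_def)+
qed

lemma ambient_one: "p \<in> E \<Longrightarrow> fst \<one>\<^bsub>G\<^esub> p = p" "x \<in> X \<Longrightarrow> snd \<one>\<^bsub>G\<^esub> x = x"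
  by (simp_all add: ambient_group_def isometry_group_def complex_aut_def BijGroup_def)

lemma group_ambient: "group G" unfolding ambient_group_def by (intro DirProd_group group_isometry_group group_complex_aut)

lemma \<Gamma>_subgroup: "subgroup \<Gamma> G" using lattice by (simp add: uniform_lattice_in_def lattice_in_def)

lemma \<Gamma>_sub: "g \<in> \<Gamma> \<Longrightarrow> g \<in> carrier G" using subgroup.subset[OF \<Gamma>_subgroup] by blast

lemma group_L: "group L" using group.subgroup_imp_group[OF group_ambient \<Gamma>_subgroup] .

lemma ambientD: assumes "g \<in> carrier G"
  shows "p \<in> E \<Longrightarrow> fst g p \<in> E" "p \<in> E \<Longrightarrow> q \<in> E \<Longrightarrow> eD (fst g p) (fst g q) = eD p q"
    "x \<in> X \<Longrightarrow> snd g x \<in> X" "x \<in> X \<Longrightarrow> y \<in> X \<Longrightarrow> D (snd g x) (snd g y) = D x y"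
  using assms isometry_groupD[of "fst g" E eD] automorphismD(4,5)[of "snd g"] by (auto simp: ambient_carrier complex_aut_iff)

text \<open>Local total boundedness gives a radius at each point, a finite subcover of
  \<open>C\<close> makes it uniform there, and automorphisms transport it to all of
  \<open>X\<close>.\<close>

lemma balls_covered_uniformly: "\<exists>r>0. \<forall>z\<in>X. \<forall>e>0. X.covered (X.mball z r) e"
proof -
  obtain C where C: "compactin X.mtopology C" "(\<Union>a\<in>carrier (complex_aut K). a ` C) = X" using cocompact unfolding acts_cocompactly_def by blast
  have CX: "C \<subseteq> X" using compactin_subspace[of X.mtopology C] C(1) by simp
  obtain r where r: "\<And>x. x \<in> X \<Longrightarrow> r x > 0 \<and> X.mtotally_bounded (X.mball x (r x))" using locally_totally_bounded by metis
  have "\<exists>\<F>. finite \<F> \<and> \<F> \<subseteq> (\<lambda>x. X.mball x (r x / 2)) ` C \<and> C \<subseteq> \<Union>\<F>"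
  proof (rule compactinD[OF C(1)])
    show "C \<subseteq> \<Union>((\<lambda>x. X.mball x (r x / 2)) ` C)" using r CX by force
  qed auto
  then obtain \<F> where F: "finite \<F>" "\<F> \<subseteq> (\<lambda>x. X.mball x (r x / 2)) ` C" "C \<subseteq> \<Union>\<F>" by (elim exE conjE)
  obtain T where T': "T \<subseteq> C" "finite T" "\<F> = (\<lambda>x. X.mball x (r x / 2)) ` T" using finite_subset_image[OF F(1,2)] by blast
  have T: "finite T" "T \<subseteq> C" "C \<subseteq> (\<Union>x\<in>T. X.mball x (r x / 2))" using T' F(3) by simp_all
  \<comment> \<open>Half radii leave room: a ball of radius \<open>r0\<close> about a point of
    \<open>C\<close> stays in one of the chosen balls of full radius.\<close>
  define r0 where "r0 = Min (insert 1 ((\<lambda>x. r x / 2) ` T))"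
  have "r0 > 0" using T(1,2) CX r by (auto simp: r0_def)
  moreover have "r0 \<le> r x / 2" if "x \<in> T" for x unfolding r0_def using T(1) that by (intro Min_le) auto
  ultimately have r0: "r0 > 0" "\<And>x. x \<in> T \<Longrightarrow> r0 \<le> r x / 2" by blast+
  have "X.covered (X.mball z r0) e" if z: "z \<in> X" and e: "e > 0" for z e
  proof -
    obtain a c where a: "a \<in> carrier (complex_aut K)" "c \<in> C" "z = a c" using z C(2) by blast
    have A: "complex_automorphism K a" using a(1) complex_aut_iff by blast
    obtain x where x: "x \<in> T" "D x c < r x / 2" using T(3) a(2) by auto
    have xX: "x \<in> X" "c \<in> X" using x(1) T(2) CX a(2) by auto
    obtain N where N: "finite N" "N \<subseteq> X.mball x (r x)" "X.mball x (r x) \<subseteq> (\<Union>k\<in>N. X.mball k e)"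
      using r[OF xX(1)] e unfolding X.mtotally_bounded_def by blast
    have NX: "N \<subseteq> X" using N(2) by auto
    have "\<exists>k\<in>a ` N. D k y < e" if y: "y \<in> X.mball z r0" for y
    proof -
      have "y \<in> a ` X" using y automorphismD(3)[OF A] by simp
      then obtain v where v: "v \<in> X" "y = a v" by blast
      have "D c v < r0" using y automorphismD(5)[OF A xX(2) v(1)] a(3) v(2) by simp
      then have "D x v < r x" using X.triangle[OF xX v(1)] x(2) r0(2)[OF x(1)] by simp
      then obtain k where "k \<in> N" "D k v < e" using N(3) v(1) xX(1) by auto
      then show ?thesis using automorphismD(5)[OF A _ v(1)] NX v(2) by force
    qed
    moreover have "a ` N \<subseteq> X" using NX automorphismD(4)[OF A] by blast
    ultimately show ?thesis unfolding X.covered_def using N(1) by blast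
  qed
  then show ?thesis using r0(1) by blast
qed

text \<open>Induction on the radius in steps of \<open>r / 2\<close>: going back along a geodesic by
  at most \<open>r / 2\<close> reaches the smaller ball, so the given point lies within
  \<open>r\<close> of a net point of that ball.\<close>

lemma balls_covered: assumes x0: "x0 \<in> X" and e: "e > 0" shows "X.covered {y\<in>X. D x0 y \<le> R} e"
proof -
  obtain r where r: "r > 0" "\<And>z e. z \<in> X \<Longrightarrow> e > 0 \<Longrightarrow> X.covered (X.mball z r) e" using balls_covered_uniformly by blast
  have "\<forall>e>0. X.covered {y\<in>X. D x0 y \<le> real k * (r / 2)} e" for k
  proof (induction k)
    case 0
    show ?case unfolding X.covered_def by (intro allI impI exI[of _ "{x0}"]) (use x0 in auto)
  next
    case (Suc k)
    show ?case
    proof (intro allI impI)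
      fix e :: real assume e: "e > 0"
      obtain N where N: "finite N" "N \<subseteq> X" "\<And>y. y \<in> X \<Longrightarrow> D x0 y \<le> real k * (r / 2) \<Longrightarrow> \<exists>z\<in>N. D z y < r / 4"
        using Suc r(1) unfolding X.covered_def by (metis (mono_tags, lifting) divide_pos_pos mem_Collect_eq zero_less_numeral)
      have "X.covered (X.mball z r) e" if "z \<in> N" for z using r(2) e N(2) that by blast
      then have "\<forall>z\<in>N. \<exists>F. finite F \<and> F \<subseteq> X \<and> (\<forall>y\<in>X.mball z r. \<exists>k\<in>F. D k y < e)" unfolding X.covered_def by (intro ballI)
      then obtain F where "\<forall>z\<in>N. finite (F z) \<and> F z \<subseteq> X \<and> (\<forall>y\<in>X.mball z r. \<exists>k\<in>F z. D k y < e)" by (rule bchoice[THEN exE])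
      then have F: "\<And>z. z \<in> N \<Longrightarrow> finite (F z) \<and> F z \<subseteq> X \<and> (\<forall>y\<in>X.mball z r. \<exists>k\<in>F z. D k y < e)" by blast
      have "\<exists>z\<in>\<Union>(F ` N). D z y < e" if y: "y \<in> X" "D x0 y \<le> real (Suc k) * (r / 2)" for y
      proof -
        define t where "t = real k / (real k + 1)"
        have t: "t \<in> {0..1}" "1 - t = 1 / (real k + 1)" by (simp_all add: t_def field_simps)
        define v where "v = C.geo x0 y t"
        have v: "v \<in> X" unfolding v_def using x0 y(1) t(1) by (rule C.geo_in)
        have "D x0 v = t * D x0 y" unfolding v_def using C.geo_dist_start[OF x0 y(1) t(1)] .
        also have "\<dots> \<le> t * (real (Suc k) * (r / 2))" using y(2) t(1) by (intro mult_left_mono) auto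
        also have "\<dots> = real k * (r / 2)" by (simp add: t_def field_simps)
        finally obtain z where z: "z \<in> N" "D z v < r / 4" using N(3)[OF v] by blast
        have zX: "z \<in> X" using z(1) N(2) by blast
        have "D v y = (1 - t) * D x0 y" unfolding v_def using C.geo_speed[OF x0 y(1) t(1), of 1] C.geo_ends[OF x0 y(1)] t(1) by simp
        also have "\<dots> \<le> (1 - t) * (real (Suc k) * (r / 2))" using y(2) t(1) by (intro mult_left_mono) auto
        also have "\<dots> = r / 2" unfolding t(2) by (simp add: field_simps)
        finally have "D z y < r" using X.triangle[OF zX v y(1)] z(2) r(1) by simp
        then have "y \<in> X.mball z r" using zX y(1) by simp
        then show ?thesis using F[OF z(1)] z(1) by blast
      qed
      moreover have "finite (\<Union>(F ` N))" "\<Union>(F ` N) \<subseteq> X" using F N(1) by auto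
      ultimately show "X.covered {y\<in>X. D x0 y \<le> real (Suc k) * (r / 2)} e" unfolding X.covered_def by blast
    qed
  qed
  moreover obtain k where "R / (r / 2) \<le> real k" using real_arch_simple by blast
  then have "R \<le> real k * (r / 2)" using r(1) by (simp add: field_simps)
  ultimately show ?thesis using e unfolding X.covered_def by (smt (verit, best) mem_Collect_eq)
qed

text \<open>Discreteness provides a neighbourhood of the identity that meets \<Gamma> only there,
  described by compact sets and tolerances. Two elements with the same finite code have a quotient
  in it, so the code is injective.\<close>

lemma proper: assumes x0: "x0 \<in> X" shows "finite {g\<in>\<Gamma>. eD z0 (fst g z0) \<le> R \<and> D x0 (snd g x0) \<le> R}"
proof -
  interpret E: Metric_space E eD by (rule Metric_space_model)
  interpret L: group L by (rule group_L)
  let ?T1 = "uniform_compacta_topology E eD (carrier (euclidean_isometries n))"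
  let ?T2 = "uniform_compacta_topology X D (carrier (complex_aut K))"
  have disc: "subtopology (ambient_topology n K) \<Gamma> = discrete_topology \<Gamma>" using lattice by (simp add: uniform_lattice_in_def lattice_in_def)
  have one: "\<one>\<^bsub>G\<^esub> \<in> \<Gamma>" using subgroup.one_closed[OF \<Gamma>_subgroup] .
  then have "openin (subtopology (ambient_topology n K) \<Gamma>) {\<one>\<^bsub>G\<^esub>}" unfolding disc by simp
  then obtain U where U: "openin (ambient_topology n K) U" "{\<one>\<^bsub>G\<^esub>} = U \<inter> \<Gamma>" by (auto simp: openin_subtopology)
  define u1 where "u1 = fst \<one>\<^bsub>G\<^esub>"
  define u2 where "u2 = snd \<one>\<^bsub>G\<^esub>"
  have u: "\<one>\<^bsub>G\<^esub> = (u1, u2)" by (simp add: u1_def u2_def)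
  have "(u1, u2) \<in> U" using U(2) unfolding u by blast
  then have "\<exists>U1 U2. openin ?T1 U1 \<and> openin ?T2 U2 \<and> u1 \<in> U1 \<and> u2 \<in> U2 \<and> U1 \<times> U2 \<subseteq> U"
    using iffD1[OF openin_prod_topology_alt U(1)[unfolded ambient_topology_def]] by (elim allE impE)
  then obtain U1 U2 where U12: "openin ?T1 U1" "openin ?T2 U2" "u1 \<in> U1" "u2 \<in> U2" "U1 \<times> U2 \<subseteq> U" by (elim exE conjE)
  obtain C1 e1 where C1: "compactin E.mtopology C1" "e1 > 0" "{g\<in>carrier (euclidean_isometries n). \<forall>x\<in>C1. eD (u1 x) (g x) < e1} \<subseteq> U1"
    using bspec[OF conjunct2[OF iffD1[OF openin_uniform_compacta_topology U12(1)]] U12(3)] by (elim exE conjE)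
  obtain C2 e2 where C2: "compactin X.mtopology C2" "e2 > 0" "{g\<in>carrier (complex_aut K). \<forall>x\<in>C2. D (u2 x) (g x) < e2} \<subseteq> U2"
    using bspec[OF conjunct2[OF iffD1[OF openin_uniform_compacta_topology U12(2)]] U12(4)] by (elim exE conjE)
  note C = C1 C2
  have CE: "C1 \<subseteq> E" "C2 \<subseteq> X" using compactin_subspace[of E.mtopology C1] compactin_subspace[of X.mtopology C2] C(1,4) by auto
  have trivial: "g = \<one>\<^bsub>G\<^esub>" if g: "g \<in> \<Gamma>" "\<And>p. p \<in> C1 \<Longrightarrow> eD p (fst g p) < e1" "\<And>x. x \<in> C2 \<Longrightarrow> D x (snd g x) < e2" for g
  proof -
    have gc: "fst g \<in> carrier (euclidean_isometries n)" "snd g \<in> carrier (complex_aut K)" using \<Gamma>_sub[OF g(1)] by (simp_all add: ambient_carrier)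
    have "\<forall>x\<in>C1. eD (u1 x) (fst g x) < e1" using g(2) CE(1) ambient_one(1) unfolding u1_def by (metis subsetD)
    then have 1: "fst g \<in> U1" using C(3) gc(1) by blast
    have "\<forall>x\<in>C2. D (u2 x) (snd g x) < e2" using g(3) CE(2) ambient_one(2) unfolding u2_def by (metis subsetD)
    then have 2: "snd g \<in> U2" using C(6) gc(2) by blast
    have "g \<in> U1 \<times> U2" using 1 2 by (cases g) simp
    then have "g \<in> U \<inter> \<Gamma>" using U12(5) g(1) by blast
    then show ?thesis unfolding U(2)[symmetric] by simp
  qed
  have z: "z0 \<in> E" by (simp add: model_zero)
  obtain \<kappa>1 :: "((nat \<Rightarrow> real) \<Rightarrow> nat \<Rightarrow> real) \<Rightarrow> (nat \<Rightarrow> real) \<Rightarrow> nat \<Rightarrow> real" where \<kappa>1: "finite (\<kappa>1 ` E.isometries_near z0 R)"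
    "\<And>f g x. f \<in> E.isometries_near z0 R \<Longrightarrow> g \<in> E.isometries_near z0 R \<Longrightarrow> \<kappa>1 f = \<kappa>1 g \<Longrightarrow> x \<in> C1 \<Longrightarrow> eD (f x) (g x) < e1"
    using E.isometries_near_finite[OF z euclidean_covered C(1,2), of R] by blast
  obtain \<kappa>2 :: "('a \<Rightarrow> 'a) \<Rightarrow> 'a \<Rightarrow> 'a" where \<kappa>2: "finite (\<kappa>2 ` X.isometries_near x0 R)"
    "\<And>f g x. f \<in> X.isometries_near x0 R \<Longrightarrow> g \<in> X.isometries_near x0 R \<Longrightarrow> \<kappa>2 f = \<kappa>2 g \<Longrightarrow> x \<in> C2 \<Longrightarrow> D (f x) (g x) < e2"
    using X.isometries_near_finite[OF x0 balls_covered[OF x0] C(4,5), of R] by blast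
  let ?F = "{g\<in>\<Gamma>. eD z0 (fst g z0) \<le> R \<and> D x0 (snd g x0) \<le> R}"
  let ?k = "\<lambda>g. (\<kappa>1 (fst g), \<kappa>2 (snd g))"
  have near: "fst g \<in> E.isometries_near z0 R" "snd g \<in> X.isometries_near x0 R" if "g \<in> ?F" for g
    using that ambientD[OF \<Gamma>_sub, of g] by (auto simp: E.isometries_near_def X.isometries_near_def)
  have "finite (?k ` ?F)"
    by (rule finite_subset[OF _ finite_cartesian_product[OF \<kappa>1(1) \<kappa>2(1)]]) (use near in auto)
  moreover have "inj_on ?k ?F"
  proof (rule inj_onI)
    fix g h assume g: "g \<in> ?F" and h: "h \<in> ?F" and eq: "?k g = ?k h"
    define c where "c = inv\<^bsub>L\<^esub> g \<otimes>\<^bsub>L\<^esub> h"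
    have gL: "g \<in> carrier L" "h \<in> carrier L" using g h by simp_all
    have c: "c \<in> carrier L" unfolding c_def by (intro L.m_closed L.inv_closed gL)
    have gc: "g \<otimes>\<^bsub>L\<^esub> c = h" unfolding c_def by (metis L.m_assoc L.inv_closed L.r_inv L.l_one gL)
    have gG: "g \<in> carrier G" "c \<in> carrier G" using \<Gamma>_sub gL(1) c by simp_all
    have "c = \<one>\<^bsub>G\<^esub>"
    proof (rule trivial)
      show "c \<in> \<Gamma>" using c by simp
      show "eD p (fst c p) < e1" if p: "p \<in> C1" for p
      proof -
        have pE: "p \<in> E" using p CE by blast
        have "eD p (fst c p) = eD (fst g p) (fst h p)" using ambientD(2)[OF gG(1) pE ambientD(1)[OF gG(2) pE]] ambient_mult(1)[OF gG pE] gc by simp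
        then show ?thesis using \<kappa>1(2)[OF near(1)[OF g] near(1)[OF h] _ p] eq by simp
      qed
      show "D x (snd c x) < e2" if x: "x \<in> C2" for x
      proof -
        have xX: "x \<in> X" using x CE by blast
        have "D x (snd c x) = D (snd g x) (snd h x)" using ambientD(4)[OF gG(1) xX ambientD(3)[OF gG(2) xX]] ambient_mult(2)[OF gG xX] gc by simp
        then show ?thesis using \<kappa>2(2)[OF near(2)[OF g] near(2)[OF h] _ x] eq by simp
      qed
    qed
    then show "g = h" using gc L.r_one[OF gL(1)] by simp
  qed
  ultimately show ?thesis by (rule finite_imageD)
qed

lemma translation: assumes "p \<in> E" shows "(\<lambda>z\<in>E. comb 1 z (-1) p) \<in> carrier (euclidean_isometries n)"
proof -
  have "bij_betw (\<lambda>z. comb 1 z (-1) p) E E"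
    by (rule bij_betw_byWitness[where f' = "\<lambda>z. comb 1 z 1 p"]) (use assms in \<open>auto simp: comb_def model_zero\<close>)
  then have "(\<lambda>z\<in>E. comb 1 z (-1) p) \<in> Bij E" by (simp add: Bij_def)
  then show ?thesis by (simp add: isometry_group_def model_dist_def comb_def)
qed

text \<open>The cosets with a representative that moves both base points by less than
  \<open>k\<close> form an increasing open cover of the compact coset space. Here \<open>U k\<close>
  is the union of these cosets, and \<open>sat\<close> says that it is saturated.\<close>

lemma coset_representatives: assumes x0: "x0 \<in> X"
  shows "\<exists>k::nat. \<forall>g\<in>carrier G. \<exists>\<gamma>\<in>\<Gamma>. eD z0 (fst g (fst \<gamma> z0)) < k \<and> D x0 (snd g (snd \<gamma> x0)) < k"
proof -
  interpret E: Metric_space E eD by (rule Metric_space_model)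
  interpret G: group G by (rule group_ambient)
  let ?T = "ambient_topology n K"
  let ?Q = "coset_topology G ?T \<Gamma>"
  let ?p = "\<lambda>g. g <#\<^bsub>G\<^esub> \<Gamma>"
  define B where "B k \<gamma> = {g\<in>carrier G. eD z0 (fst g (fst \<gamma> z0)) < real k \<and> D x0 (snd g (snd \<gamma> x0)) < real k}" for k :: nat and \<gamma>
  define U where "U k = (\<Union>\<gamma>\<in>\<Gamma>. B k \<gamma>)" for k
  have z: "z0 \<in> E" by (simp add: model_zero)
  have T: "topspace ?T = carrier G" unfolding ambient_topology_def ambient_group_def by (simp add: topspace_uniform_compacta)
  have opB: "openin ?T (B k \<gamma>)" if \<gamma>: "\<gamma> \<in> \<Gamma>" for k \<gamma>
  proof -
    note g = ambientD[OF \<Gamma>_sub[OF \<gamma>]]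
    have "B k \<gamma> = {f\<in>carrier (euclidean_isometries n). eD z0 (f (fst \<gamma> z0)) < real k} \<times> {f\<in>carrier (complex_aut K). D x0 (f (snd \<gamma> x0)) < real k}"
      by (auto simp: B_def ambient_carrier)
    moreover have "openin (uniform_compacta_topology E eD (carrier (euclidean_isometries n))) {f\<in>carrier (euclidean_isometries n). eD z0 (f (fst \<gamma> z0)) < real k}"
    proof (rule E.openin_evaluation[OF _ g(1)[OF z] z])
      show "f p \<in> E" if "f \<in> carrier (euclidean_isometries n)" "p \<in> E" for f p using that by (rule isometry_groupD(2))
    qed
    moreover have "openin (uniform_compacta_topology X D (carrier (complex_aut K))) {f\<in>carrier (complex_aut K). D x0 (f (snd \<gamma> x0)) < real k}"
    proof (rule X.openin_evaluation[OF _ g(3)[OF x0] x0])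
      show "f x \<in> X" if "f \<in> carrier (complex_aut K)" "x \<in> X" for f x using that automorphismD(4)[of f] by (simp add: complex_aut_iff)
    qed
    ultimately show ?thesis unfolding ambient_topology_def by (simp add: openin_prod_Times_iff)
  qed
  then have opU: "openin ?T (U k)" for k unfolding U_def by blast
  have sat: "h \<in> U k" if g: "g \<in> U k" and h: "h \<in> carrier G" "?p g = ?p h" for g h k
  proof -
    obtain \<gamma> where \<gamma>: "\<gamma> \<in> \<Gamma>" "g \<in> B k \<gamma>" using g by (auto simp: U_def)
    have gG: "g \<in> carrier G" using \<gamma>(2) by (simp add: B_def)
    have "g \<otimes>\<^bsub>G\<^esub> \<one>\<^bsub>G\<^esub> \<in> ?p g" using subgroup.one_closed[OF \<Gamma>_subgroup] by (auto simp: l_coset_def)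
    then have "g \<in> ?p h" using gG h(2) by simp
    then obtain \<delta> where \<delta>: "\<delta> \<in> \<Gamma>" "g = h \<otimes>\<^bsub>G\<^esub> \<delta>" by (auto simp: l_coset_def)
    have \<delta>\<gamma>: "\<delta> \<otimes>\<^bsub>G\<^esub> \<gamma> \<in> \<Gamma>" using subgroup.m_closed[OF \<Gamma>_subgroup \<delta>(1) \<gamma>(1)] .
    note s = \<Gamma>_sub[OF \<delta>(1)] \<Gamma>_sub[OF \<gamma>(1)]
    have "fst h (fst (\<delta> \<otimes>\<^bsub>G\<^esub> \<gamma>) z0) = fst g (fst \<gamma> z0)"
      unfolding \<delta>(2) using ambient_mult(1)[OF s z] ambient_mult(1)[OF h(1) s(1) ambientD(1)[OF s(2) z]] by simp
    moreover have "snd h (snd (\<delta> \<otimes>\<^bsub>G\<^esub> \<gamma>) x0) = snd g (snd \<gamma> x0)"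
      unfolding \<delta>(2) using ambient_mult(2)[OF s x0] ambient_mult(2)[OF h(1) s(1) ambientD(3)[OF s(2) x0]] by simp
    ultimately have "h \<in> B k (\<delta> \<otimes>\<^bsub>G\<^esub> \<gamma>)" using \<gamma>(2) h(1) by (simp add: B_def)
    then show ?thesis using \<delta>\<gamma> by (auto simp: U_def)
  qed
  have UG: "U k \<subseteq> carrier G" for k by (auto simp: U_def B_def)
  have opP: "openin ?Q (?p ` U k)" for k
  proof -
    have "{g\<in>topspace ?T. ?p g \<in> ?p ` U k} = U k" unfolding T
    proof
      show "{g\<in>carrier G. ?p g \<in> ?p ` U k} \<subseteq> U k"
      proof
        fix h assume "h \<in> {g\<in>carrier G. ?p g \<in> ?p ` U k}"
        then obtain g where "g \<in> U k" "h \<in> carrier G" "?p g = ?p h" by auto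
        then show "h \<in> U k" by (rule sat)
      qed
    qed (use UG in blast)
    then show ?thesis unfolding coset_topology_def openin_quotient_topology using opU UG T by (simp add: image_mono)
  qed
  have topQ: "topspace ?Q = ?p ` carrier G"
    using quotient_map_quotient_topology[of ?T ?p] unfolding coset_topology_def quotient_map_def T by simp
  have mono: "U k \<subseteq> U l" if "k \<le> l" for k l
  proof -
    have "B k \<gamma> \<subseteq> B l \<gamma>" for \<gamma> using of_nat_mono[OF that, where 'a = real] by (auto simp: B_def)
    then show ?thesis unfolding U_def by blast
  qed
  have cov: "carrier G \<subseteq> (\<Union>k. U k)"
  proof
    fix g assume g: "g \<in> carrier G"
    obtain k :: nat where "max (eD z0 (fst g (fst \<one>\<^bsub>G\<^esub> z0))) (D x0 (snd g (snd \<one>\<^bsub>G\<^esub> x0))) < k" using reals_Archimedean2 by blast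
    then have "g \<in> B k \<one>\<^bsub>G\<^esub>" using g by (simp add: B_def)
    then show "g \<in> (\<Union>k. U k)" using subgroup.one_closed[OF \<Gamma>_subgroup] by (auto simp: U_def)
  qed
  have "compactin ?Q (topspace ?Q)" using lattice by (simp add: uniform_lattice_in_def compact_space_def)
  then have "\<exists>\<F>. finite \<F> \<and> \<F> \<subseteq> range (\<lambda>k. ?p ` U k) \<and> topspace ?Q \<subseteq> \<Union>\<F>"
  proof (rule compactinD)
    show "topspace ?Q \<subseteq> \<Union>(range (\<lambda>k. ?p ` U k))" unfolding topQ
    proof (rule image_subsetI)
      fix g assume "g \<in> carrier G"
      then obtain k where "g \<in> U k" using cov by blast
      then show "?p g \<in> \<Union>(range (\<lambda>k. ?p ` U k))" by blast
    qed
  qed (use opP in blast)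
  then obtain \<F> where F: "finite \<F>" "\<F> \<subseteq> range (\<lambda>k. ?p ` U k)" "topspace ?Q \<subseteq> \<Union>\<F>" by (elim exE conjE)
  obtain I where I': "finite I" "\<F> = (\<lambda>k. ?p ` U k) ` I" using finite_subset_image[OF F(1,2)] by blast
  have I: "finite I" "topspace ?Q \<subseteq> (\<Union>k\<in>I. ?p ` U k)" using I' F(3) by simp_all
  define k where "k = Max (insert 0 I)"
  have "g \<in> U k" if g: "g \<in> carrier G" for g
  proof -
    have "?p g \<in> topspace ?Q" unfolding topQ using g by (rule imageI)
    then have "?p g \<in> (\<Union>k\<in>I. ?p ` U k)" using I(2) by (rule rev_subsetD)
    then obtain j h where h: "j \<in> I" "h \<in> U j" "?p g = ?p h" by auto
    have "j \<le> k" unfolding k_def using I(1) h(1) by simp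
    then have "h \<in> U k" using mono h(2) by blast
    then show ?thesis using sat[of h k g] g h(3) by simp
  qed
  then have "\<exists>\<gamma>\<in>\<Gamma>. eD z0 (fst g (fst \<gamma> z0)) < k \<and> D x0 (snd g (snd \<gamma> x0)) < k" if "g \<in> carrier G" for g
    using that by (auto simp: U_def B_def)
  then show ?thesis by blast
qed

text \<open>Apply \<open>coset_representatives\<close> to the ambient isometry that translates
  \<open>p\<close> to the origin and moves \<open>x\<close> into the compact set
  \<open>C\<close>.\<close>

lemma cobounded: assumes x0: "x0 \<in> X"
  shows "\<exists>R. \<forall>p\<in>E. \<forall>x\<in>X. \<exists>g\<in>\<Gamma>. eD p (fst g z0) + D x (snd g x0) \<le> R"
proof -
  interpret A: group "complex_aut K" by (rule group_complex_aut)
  obtain k :: nat where k: "\<And>g. g \<in> carrier G \<Longrightarrow> \<exists>\<gamma>\<in>\<Gamma>. eD z0 (fst g (fst \<gamma> z0)) < k \<and> D x0 (snd g (snd \<gamma> x0)) < k"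
    using coset_representatives[OF x0] by blast
  obtain C where C: "compactin X.mtopology C" "(\<Union>a\<in>carrier (complex_aut K). a ` C) = X" using cocompact unfolding acts_cocompactly_def by blast
  have "X.mbounded C" using C(1) by (rule X.compactin_imp_mbounded)
  then obtain y b where y: "C \<subseteq> X.mcball y b" unfolding X.mbounded_def by blast
  define r where "r = D x0 y + b"
  have r: "D x0 c \<le> r" if "c \<in> C" for c using X.triangle[of x0 y c] y that x0 by (force simp: r_def)
  \<comment> \<open>One \<open>k\<close> for each factor, and \<open>r\<close> for the distance from
    \<open>x0\<close> to the points of \<open>C\<close>.\<close>
  have "\<exists>g\<in>\<Gamma>. eD p (fst g z0) + D x (snd g x0) \<le> 2 * real k + r" if p: "p \<in> E" and x: "x \<in> X" for p x
  proof -
    obtain b c where b: "b \<in> carrier (complex_aut K)" "c \<in> C" "x = b c" using x C(2) by blast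
    have cX: "c \<in> X" using compactin_subspace[of X.mtopology C] C(1) b(2) by auto
    define a where "a = restrict (inv_into X b) X"
    have B: "complex_automorphism K b" using b(1) complex_aut_iff by blast
    have "complex_automorphism K a" unfolding a_def by (rule automorphism_cong[OF _ automorphism_inverse[OF B]]) simp
    then have a: "a \<in> carrier (complex_aut K)" by (simp add: complex_aut_iff a_def)
    define g where "g = ((\<lambda>z\<in>E. comb 1 z (-1) p), a)"
    have g: "g \<in> carrier G" using translation[OF p] a by (simp add: g_def ambient_carrier)
    obtain \<gamma> where \<gamma>: "\<gamma> \<in> \<Gamma>" "eD z0 (fst g (fst \<gamma> z0)) < k" "D x0 (snd g (snd \<gamma> x0)) < k" using k[OF g] by blast
    have z: "fst \<gamma> z0 \<in> E" using ambientD(1)[OF \<Gamma>_sub[OF \<gamma>(1)]] by (simp add: model_zero)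
    have y: "snd \<gamma> x0 \<in> X" using ambientD(3)[OF \<Gamma>_sub[OF \<gamma>(1)] x0] .
    have "eD z0 (fst g (fst \<gamma> z0)) = eD p (fst \<gamma> z0)" using z by (simp add: g_def model_dist_def comb_def power2_commute)
    moreover have "D x0 (a (snd \<gamma> x0)) = D (b x0) (snd \<gamma> x0)"
    proof -
      have i: "a (snd \<gamma> x0) \<in> X" "b (a (snd \<gamma> x0)) = snd \<gamma> x0"
        using y automorphismD(3)[OF B] by (auto simp: a_def f_inv_into_f inv_into_into)
      show ?thesis using automorphismD(5)[OF B x0 i(1)] i(2) by simp
    qed
    moreover have "D x (b x0) \<le> r" using automorphismD(5)[OF B cX x0] b(3) r[OF b(2)] X.commute[of c x0] by simp
    moreover have "D x (snd \<gamma> x0) \<le> D x (b x0) + D (b x0) (snd \<gamma> x0)" using X.triangle[OF x automorphismD(4)[OF B x0] y] .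
    ultimately show ?thesis using \<gamma> by (intro bexI[of _ \<gamma>]) (simp_all add: g_def)
  qed
  then show ?thesis by blast
qed

end

section \<open>Combination of the geometric and topological parts\<close>

context uniform_lattice
begin

lemma product_action: assumes x0: "x0 \<in> X" shows "product_action X D L n fst snd x0"
proof -
  interpret L: group L by (rule group_L)
  show ?thesis
  proof (intro product_action.intro product_action_axioms.intro)
    show "cat0 X D" by (rule C.cat0_axioms)
    show "group L" by (rule group_L)
    show "finite {g\<in>carrier L. eD z0 (fst g z0) \<le> R \<and> D x0 (snd g x0) \<le> R}" for R using proper[OF x0] by simp
    show "\<exists>R. \<forall>p\<in>E. \<forall>x\<in>X. \<exists>g\<in>carrier L. eD p (fst g z0) + D x (snd g x0) \<le> R" using cobounded[OF x0] by simp
  qed (use x0 \<Gamma>_sub ambientD ambient_mult ambient_one in simp_all)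
qed

text \<open>Discreteness of orbits is inherited from the full automorphism group, and the Lipschitz
  property of the equivariant function gives its continuity.\<close>

lemma orbit_setting: assumes irr: "irreducible_lattice n L" shows "orbit_setting X D L snd"
proof -
  obtain x0 where x0: "x0 \<in> X" using cat by (auto simp: cat0_space_def)
  interpret P: product_action X D L n fst snd x0 by (rule product_action[OF x0])
  show ?thesis
  proof (intro orbit_setting.intro orbit_setting_axioms.intro)
    show "\<exists>e>0. \<forall>g\<in>carrier L. D (snd g x) x < e \<longrightarrow> snd g x = x" if x: "x \<in> X" for x
    proof -
      obtain e where e: "e > 0" "\<And>a. complex_automorphism K a \<Longrightarrow> D (a x) x < e \<Longrightarrow> a x = x" using automorphism_orbit_discrete[OF x] by blast
      have "complex_automorphism K (snd g)" if "g \<in> carrier L" for g using \<Gamma>_sub[of g] that by (simp add: ambient_carrier complex_aut_iff)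
      then show ?thesis using e by blast
    qed
    show "\<exists>f. continuous_map X.mtopology euclideanreal f \<and> (\<forall>g\<in>carrier L. \<forall>x\<in>X. f (snd g x) = f x + real_of_int (\<phi> g))"
      if \<phi>: "\<phi> \<in> hom L integer_group" for \<phi>
    proof -
      obtain C f where f: "\<And>x y. x \<in> X \<Longrightarrow> y \<in> X \<Longrightarrow> \<bar>f x - f y\<bar> \<le> C * D x y"
        "\<And>g x. g \<in> carrier L \<Longrightarrow> x \<in> X \<Longrightarrow> f (snd g x) = f x + real_of_int (\<phi> g)"
        using P.equivariant_function[OF \<phi>] irr unfolding irreducible_lattice_def by blast
      have "continuous_map X.mtopology Met_TC.mtopology f" unfolding Met_TC.continuous_map_to_metric
      proof (intro ballI allI impI)
        fix x and e :: real assume x: "x \<in> topspace X.mtopology" and e: "e > 0"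
        \<comment> \<open>The sign of \<open>C\<close> is not known here;
          \<open>\<bar>C\<bar> + 1\<close> is a positive Lipschitz constant.\<close>
        define r where "r = e / (\<bar>C\<bar> + 1)"
        have r: "r > 0" using e by (simp add: r_def add_nonneg_pos)
        have "f y \<in> Met_TC.mball (f x) e" if y: "y \<in> X.mball x r" for y
        proof -
          have yX: "x \<in> X" "y \<in> X" "D x y < r" using y by auto
          have "\<bar>f x - f y\<bar> \<le> C * D x y" using f(1) yX by blast
          also have "\<dots> \<le> (\<bar>C\<bar> + 1) * D x y" by (intro mult_right_mono) auto
          also have "\<dots> < (\<bar>C\<bar> + 1) * r" using yX(3) by (intro mult_strict_left_mono) auto
          also have "\<dots> = e" by (simp add: r_def add_nonneg_pos[THEN less_imp_neq, symmetric])
          finally show ?thesis by (simp add: dist_real_def)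
        qed
        then show "\<exists>U. openin X.mtopology U \<and> x \<in> U \<and> (\<forall>y\<in>U. f y \<in> Met_TC.mball (f x) e)"
          using x r by (intro exI[of _ "X.mball x r"]) auto
      qed
      then show ?thesis using f(2) unfolding mtopology_is_euclidean by blast
    qed
  qed (use C.cat0_axioms group_L P.act_in P.act_iso P.act_mult P.act_one in simp_all)
qed

end

theorem proposition3p1:
  fixes K :: "('i, 'a) cell_complex" and n :: nat
    and \<Gamma> :: "(((nat \<Rightarrow> real) \<Rightarrow> nat \<Rightarrow> real) \<times> ('a \<Rightarrow> 'a)) set"
  assumes "polyhedral_complex K"
    and "locally_finite_complex K"
    and "cat0_space (points K) (path_dist K)"
    and "irreducible_space (points K) (path_dist K)"
    and "acts_cocompactly (complex_aut K) (points K) (path_dist K)"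
    and "acts_minimally (complex_aut K) (points K) (path_dist K)"
    and "uniform_lattice_in (ambient_group n K) (ambient_topology n K) \<Gamma>"
    and "irreducible_lattice n ((ambient_group n K)\<lparr>carrier := \<Gamma>\<rparr>)"
  shows "group_cohomology 1 ((ambient_group n K)\<lparr>carrier := \<Gamma>\<rparr>)
         \<cong> singular_cohomology 1 (orbit_space K ((ambient_group n K)\<lparr>carrier := \<Gamma>\<rparr>))"
proof -
  interpret uniform_lattice K n \<Gamma>
    using assms by (intro uniform_lattice.intro uniform_lattice_axioms.intro metric_complex.intro metric_complex_axioms.intro)
      (simp_all add: cat0_space_def)
  interpret O: orbit_setting X D L snd by (rule orbit_setting[OF assms(8)])
  show ?thesis using O.cohomology_iso by (simp add: orbit_space_def)
qed

end
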